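(* Let $m\ge 0$, let $\mathfrak{B}_{m+1}$ be the $(m+1)$-strand braid group, let $\sigma\in\mathfrak{B}_{m+1}$, and let $m(\widehat{\sigma})\subset A\times I$ be the mirror of the annular closure $\widehat\sigma$ of $\sigma$. Let $\mathcal{M}_\sigma$ be the Khovanov-Seidel dg bimodule of $\sigma$ over the Khovanov-Seidel algebra $A_m$. Then $$\mathrm{SKh}\left(m(\widehat{\sigma});\,m-1\right)\;\cong\; HH\left(A_m,\mathcal{M}_\sigma\right)[n_-]\{(m-1)+n_+-2n_-\}$$ as bigraded vector spaces over $\mathbb{F}=\mathbb{Z}/2\mathbb{Z}$, where $\mathrm{SKh}(m(\widehat\sigma);m-1)$ is the sutured annular Khovanov homology in filtration grading $f=m-1$, and $n_+$ (resp. $n_-$) is the number of positive (resp. negative) crossings of the diagram of $m(\widehat{\sigma})$ coming from a factorization of $\sigma$ into Artin generators, the same factorization being used to define $\mathcal{M}_\sigma$.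
   Context: Everything is over $\mathbb{F}=\mathbb{Z}/2\mathbb{Z}$. For a bigraded vector space $V=\bigoplus V_{(i,j)}$ (first grading homological, second internal/quantum), $V[k_1]\{k_2\}$ is defined by $(V[k_1]\{k_2\})_{(i-k_1,j+k_2)}=V_{(i,j)}$. Differentials raise the homological grading by $1$ and preserve the second grading. **Braids.** $\mathfrak{B}_{m+1}$ is the braid group on $m+1$ strands (numbered $0,\dots,m$) with Artin generators $\sigma_1,\dots,\sigma_m$, $\sigma_i$ crossing strands $i-1$ and $i$; words read left to right are stacked bottom to top. Fix a factorization $\sigma=\sigma_{i_1}^{\epsilon_1}\cdots\sigma_{i_k}^{\epsilon_k}$, $\epsilon_j\in\{\pm1\}$. The annular closure $\widehat\sigma\subset A\times I$ ($A$ an annulus, $I=[0,1]$) is the closed-up braid, given the braid orientation; the mirror $m(\widehat\sigma)$ is obtained by reversing all crossings, so it is the annular closure of $\sigma_{i_1}^{-\epsilon_1}\cdots\sigma_{i_k}^{-\epsilon_k}$. A letter $\sigma_i^{+1}$ (resp. $\sigma_i^{-1}$) gives a positive (resp. negative) crossing. **Sutured annular Khovanov homology.** Let $L$ be the annular closure of $\sigma_{i_1}^{\delta_1}\cdots\sigma_{i_k}^{\delta_k}$, with $n_\pm$ the number of $\pm$ crossings. To a vertex $\vec v\in\{-1,1\}^k$ associate the annular closure of the Temperley-Lieb diagram $N_{i_1}\cdots N_{i_k}$ (stacked bottom to top), where $N_{i_j}=U_{i_j}$ (the elementary cup-cap diagram joining strands $i_j-1$ and $i_j$) if $v_j\delta_j=1$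 and $N_{i_j}=\mathrm{Id}$ (the identity diagram) if $v_j\delta_j=-1$. This is a collection of disjoint circles in $A$; a circle is trivial or nontrivial according to its class in $H_1(A;\mathbb{Z}/2)$. Generators of the complex at $\vec v$ are labelings of each nontrivial circle by $v_+$ or $v_-$ and each trivial circle by $w_+$ or $w_-$. Put $\vec v_h=\sum_j\frac12(1+v_j)$. A generator has gradings: $h=-n_-+\vec v_h$; $q=(n_+-2n_-)+\vec v_h+(\#\text{plus labels}-\#\text{minus labels})$; $f=\#v_+-\#v_-$. For each edge from $\vec v$ to $\vec w$ with $v_j=-1$, $w_j=+1$ and other entries equal, the edge map is the following merge or split map (identity on uninvolved circles): merges: $w_+w_+\mapsto w_+$, $w_+w_-,w_-w_+\mapsto w_-$, $w_-w_-\mapsto0$; $v_\pm w_+\mapsto v_\pm$, $v_\pm w_-\mapsto 0$; $v_+v_-,v_-v_+\mapsto w_-$, $v_+v_+,v_-v_-\mapsto0$ (two nontrivial circles merging to a trivial one); splits: $w_+\mapsto w_+w_-+w_-w_+$, $w_-\mapsto w_-w_-$ (trivial to two trivial); $v_\pm\mapsto v_\pm w_-$ (nontrivial to nontrivial plus trivial); $w_+\mapsto v_+v_-+v_-v_+$, $w_-\mapsto0$ (trivial to two nontrivial). This is the associated graded, with respect to the $f$-filtration, of the Khovanov complex. $\mathrm{SKh}(L;n)$ is the homology of the part with $f=n$, bigraded by $(h,q)$. **The algebra $A_m$.** Let $\Gamma_m$ be the quiver with vertices $0,\dots,m$ and a pair of oppositely oriented edges between each pair of adjacent vertices $i,i+1$.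 A path is written as the tuple of vertices traversed, e.g. $(i|i+1|i)$; $(i)$ is the constant path. $A_m$ is the path algebra over $\mathbb{F}$ (product = concatenation, zero for non-composable paths) modulo $(i-1|i|i+1)=(i+1|i|i-1)=0$, $(i|i+1|i)=(i|i-1|i)$ for $1\le i\le m-1$, and $(0|1|0)=0$. The internal grading is negative path length; $A_m$ is in homological degree $0$. $P_i=A_m(i)$ (paths ending at $i$) and ${}_iP=(i)A_m$ (paths beginning at $i$). Unadorned $\otimes$ is over $\mathbb{F}$. **Khovanov-Seidel bimodules.** For $1\le i\le m$, $\mathcal{M}_{\sigma_i^{+}}=\big(P_i\otimes{}_iP\{1\}\xrightarrow{\beta_i}A_m\{1\}\big)$ and $\mathcal{M}_{\sigma_i^-}=\big(A_m\xrightarrow{\gamma_i}P_i\otimes{}_iP\{2\}\big)$, two-term complexes in homological degrees $0,1$, with $A_m$-bimodule maps determined by $\beta_i((i)\otimes(i))=(i)$ and $\gamma_i(1)=(i-1|i)\otimes(i|i-1)+(i+1|i)\otimes(i|i+1)+(i)\otimes(i|i-1|i)+(i|i-1|i)\otimes(i)$ (terms involving vertex $m+1$ omitted). Then $\mathcal{M}_\sigma=\mathcal{M}_{\sigma_{i_1}^{\epsilon_1}}\otimes_{A_m}\cdots\otimes_{A_m}\mathcal{M}_{\sigma_{i_k}^{\epsilon_k}}$ (and $\mathcal{M}_\sigma=A_m$ for the empty word); up to homotopy equivalence it depends only on $\sigma$. **Hochschild homology.** $HH(A,\mathcal{M})$, for an associative algebra $A$ and dg $A$-bimodule $\mathcal{M}$,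 is the homology of $\mathcal{R}(A)\otimes_{A^e}\mathcal{M}$ (total complex), where $A^e=A\otimes A^{op}$ and $\mathcal{R}(A)\to A$ is any projective resolution of $A$ by right $A^e$-modules; e.g. the total complex of $\bigoplus_{k\ge0}A^{\otimes k}\otimes\mathcal{M}$ with differential $a_1\otimes\cdots\otimes a_k\otimes x\mapsto a_1\otimes\cdots\otimes a_k\otimes\partial x+\sum_{j<k}a_1\otimes\cdots\otimes a_ja_{j+1}\otimes\cdots\otimes x+a_1\otimes\cdots\otimes a_{k-1}\otimes a_kx+a_2\otimes\cdots\otimes a_k\otimes xa_1$ (for $k=0$ only the term $\partial x$). The bigrading: $A^{\otimes k}\otimes\mathcal{M}_n$ lies in homological degree $n-k$, and internal gradings add. *)

theory Defs
  imports "HOL-Algebra.QuotRing" "HOL-Algebra.Module" "HOL-Library.Z2" "HOL-Library.Poly_Mapping"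
begin

section \<open>Vector spaces over \<open>\<int>/2\<int>\<close>\<close>

definition F2 :: "bit ring" where
  "F2 = \<lparr>carrier = UNIV, mult = (*), one = 1, zero = 0, add = (+)\<rparr>"

type_synonym 'v f2_space = "(bit, 'v) module"

text \<open>
  A group of exponent 2 has exactly one structure of vector space over \<^const>\<open>F2\<close>, so carrier, addition
  and zero determine the scalar multiplication. The ring fields \<open>mult\<close> and \<open>one\<close> of the record
  type are not part of the structure. For the same reason additive maps between such spaces are
  linear, and the relations imposed below on tensor products need only express additivity.
\<close>

definition f2_space :: "'v set \<Rightarrow> ('v \<Rightarrow> 'v \<Rightarrow> 'v) \<Rightarrow> 'v \<Rightarrow> 'v f2_space" where
  "f2_space C p z =
    \<lparr>carrier = C, mult = undefined, one = undefined, zero = z, add = p,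
     smult = (\<lambda>c x. if c = 0 then z else x)\<rparr>"

definition f2_iso :: "'v f2_space \<Rightarrow> 'w f2_space \<Rightarrow> bool" where
  "f2_iso V W \<longleftrightarrow> (\<exists>\<phi>. bij_betw \<phi> (carrier V) (carrier W) \<and>
     (\<forall>x\<in>carrier V. \<forall>y\<in>carrier V. \<phi> (x \<oplus>\<^bsub>V\<^esub> y) = \<phi> x \<oplus>\<^bsub>W\<^esub> \<phi> y) \<and>
     (\<forall>c\<in>carrier F2. \<forall>x\<in>carrier V. \<phi> (c \<odot>\<^bsub>V\<^esub> x) = c \<odot>\<^bsub>W\<^esub> \<phi> x))"

definition quotient_space :: "'v f2_space \<Rightarrow> 'v set \<Rightarrow> 'v set f2_space" where
  "quotient_space V W = f2_space (a_rcosets\<^bsub>V\<^esub> W) (set_add V) W"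

definition free_space :: "'g set \<Rightarrow> ('g \<Rightarrow>\<^sub>0 bit) f2_space" where
  "free_space G = f2_space {x. Poly_Mapping.keys x \<subseteq> G} (+) 0"

abbreviation elt :: "'g \<Rightarrow> ('g \<Rightarrow>\<^sub>0 bit)" where
  "elt g \<equiv> Poly_Mapping.single g 1"

definition f2_span :: "('g \<Rightarrow>\<^sub>0 bit) set \<Rightarrow> ('g \<Rightarrow>\<^sub>0 bit) set" where
  "f2_span S = {\<Sum>T | T. finite T \<and> T \<subseteq> S}"

definition presented_space :: "'g set \<Rightarrow> ('g \<Rightarrow>\<^sub>0 bit) set \<Rightarrow> ('g \<Rightarrow>\<^sub>0 bit) set f2_space" where
  "presented_space G R = quotient_space (free_space G) (f2_span R)"

definition presented_class ::
  "'g set \<Rightarrow> ('g \<Rightarrow>\<^sub>0 bit) set \<Rightarrow> ('g \<Rightarrow>\<^sub>0 bit) \<Rightarrow> ('g \<Rightarrow>\<^sub>0 bit) set" where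
  "presented_class G R x = f2_span R +>\<^bsub>free_space G\<^esub> x"

text \<open>
  The linear map to \<open>V\<close> from a quotient of a free space that sends the class of each generator
  \<open>g\<close> to \<open>f g\<close>: the value of the linear extension of \<open>f\<close> on any representative. It is only applied
  to \<open>f\<close> whose extension kills the relations, so that the set of values is a singleton.
\<close>

definition extend_linear :: "'v f2_space \<Rightarrow> ('g \<Rightarrow> 'v) \<Rightarrow> ('g \<Rightarrow>\<^sub>0 bit) set \<Rightarrow> 'v" where
  "extend_linear V f X = the_elem ((\<lambda>x. \<Oplus>\<^bsub>V\<^esub>g\<in>Poly_Mapping.keys x. f g) ` X)"


section \<open>Bigraded complexes and dg bimodules\<close>

text \<open>
  \<open>piece C i j\<close> is the part of homological degree \<open>i\<close> and internal degree \<open>j\<close>.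
\<close>

record 'v dg_space =
  space :: "'v f2_space"
  diff :: "'v \<Rightarrow> 'v"
  piece :: "int \<Rightarrow> int \<Rightarrow> 'v set"

record ('v, 'a) dg_bimodule = "'v dg_space" +
  lact :: "'a \<Rightarrow> 'v \<Rightarrow> 'v"
  ract :: "'v \<Rightarrow> 'a \<Rightarrow> 'v"

definition homology :: "('v, 'z) dg_space_scheme \<Rightarrow> int \<Rightarrow> int \<Rightarrow> 'v set f2_space" where
  "homology C i j =
    quotient_space
      ((space C)\<lparr>carrier := {x \<in> piece C i j. diff C x = \<zero>\<^bsub>space C\<^esub>}\<rparr>)
      (diff C ` piece C (i - 1) j)"

text \<open>The shift \<open>V[k\<^sub>1]{k\<^sub>2}\<close>, with \<open>(V[k\<^sub>1]{k\<^sub>2})\<close> in degree \<open>(i - k\<^sub>1, j + k\<^sub>2)\<close> equal to \<open>V\<close> in degree \<open>(i, j)\<close>.\<close>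

definition gshift :: "int \<Rightarrow> int \<Rightarrow> (int \<Rightarrow> int \<Rightarrow> 'x) \<Rightarrow> int \<Rightarrow> int \<Rightarrow> 'x" where
  "gshift k1 k2 V = (\<lambda>i j. V (i + k1) (j - k2))"

definition dg_shift :: "int \<Rightarrow> int \<Rightarrow> ('v, 'a) dg_bimodule \<Rightarrow> ('v, 'a) dg_bimodule" where
  "dg_shift k1 k2 M = M\<lparr>piece := gshift k1 k2 (piece M)\<rparr>"

definition bigraded_iso ::
  "(int \<Rightarrow> int \<Rightarrow> 'v f2_space) \<Rightarrow> (int \<Rightarrow> int \<Rightarrow> 'w f2_space) \<Rightarrow> bool" where
  "bigraded_iso V W \<longleftrightarrow> (\<forall>i j. f2_iso (V i j) (W i j))"

text \<open>The direct sum of the underlying bigraded bimodules, with \<open>d\<close> as differential.\<close>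

definition dg_sum ::
  "('v, 'a) dg_bimodule \<Rightarrow> ('w, 'a) dg_bimodule \<Rightarrow> ('v \<times> 'w \<Rightarrow> 'v \<times> 'w) \<Rightarrow> ('v \<times> 'w, 'a) dg_bimodule" where
  "dg_sum X Y d =
    \<lparr>space = f2_space (carrier (space X) \<times> carrier (space Y))
       (\<lambda>(x, y) (x', y'). (x \<oplus>\<^bsub>space X\<^esub> x', y \<oplus>\<^bsub>space Y\<^esub> y')) (\<zero>\<^bsub>space X\<^esub>, \<zero>\<^bsub>space Y\<^esub>),
     diff = d,
     piece = (\<lambda>i j. piece X i j \<times> piece Y i j),
     lact = (\<lambda>a (x, y). (lact X a x, lact Y a y)),
     ract = (\<lambda>(x, y) a. (ract X x a, ract Y y a))\<rparr>"

definition zero_part :: "('v, 'a) dg_bimodule \<Rightarrow> ('v, 'a) dg_bimodule" where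
  "zero_part X = X\<lparr>space := (space X)\<lparr>carrier := {\<zero>\<^bsub>space X\<^esub>}\<rparr>, piece := (\<lambda>i j. {\<zero>\<^bsub>space X\<^esub>})\<rparr>"


subsection \<open>Tensor products over a ring\<close>

text \<open>
  \<open>M\<^sub>1 \<otimes>\<^sub>A \<dots> \<otimes>\<^sub>A M\<^sub>n\<close> for \<open>n \<ge> 1\<close>, formed in one step: the free space on the tuples
  \<open>(x\<^sub>1, \<dots>, x\<^sub>n)\<close> modulo additivity in every entry and the relations moving an element of \<open>A\<close>
  across each tensor sign.
\<close>

definition tensor_gens :: "('v, 'a) dg_bimodule list \<Rightarrow> 'v list set" where
  "tensor_gens Ms =
    {xs. length xs = length Ms \<and> (\<forall>j<length Ms. xs ! j \<in> carrier (space (Ms ! j)))}"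

definition tensor_rels :: "'a ring \<Rightarrow> ('v, 'a) dg_bimodule list \<Rightarrow> ('v list \<Rightarrow>\<^sub>0 bit) set" where
  "tensor_rels A Ms =
    {elt (xs[j := x \<oplus>\<^bsub>space (Ms ! j)\<^esub> y]) - (elt (xs[j := x]) + elt (xs[j := y])) | xs j x y.
       xs \<in> tensor_gens Ms \<and> j < length Ms \<and>
       x \<in> carrier (space (Ms ! j)) \<and> y \<in> carrier (space (Ms ! j))} \<union>
    {elt (xs[j := ract (Ms ! j) (xs ! j) a]) - elt (xs[Suc j := lact (Ms ! Suc j) a (xs ! Suc j)]) | xs j a.
       xs \<in> tensor_gens Ms \<and> Suc j < length Ms \<and> a \<in> carrier A}"

definition tensor_space :: "'a ring \<Rightarrow> ('v, 'a) dg_bimodule list \<Rightarrow> ('v list \<Rightarrow>\<^sub>0 bit) set f2_space" where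
  "tensor_space A Ms = presented_space (tensor_gens Ms) (tensor_rels A Ms)"

definition tensor_class ::
  "'a ring \<Rightarrow> ('v, 'a) dg_bimodule list \<Rightarrow> ('v list \<Rightarrow>\<^sub>0 bit) \<Rightarrow> ('v list \<Rightarrow>\<^sub>0 bit) set" where
  "tensor_class A Ms = presented_class (tensor_gens Ms) (tensor_rels A Ms)"

definition tensor_homogeneous :: "('v, 'a) dg_bimodule list \<Rightarrow> int \<Rightarrow> int \<Rightarrow> 'v list set" where
  "tensor_homogeneous Ms h q =
    {xs \<in> tensor_gens Ms. \<exists>hs qs. length hs = length Ms \<and> length qs = length Ms \<and>
       sum_list hs = h \<and> sum_list qs = q \<and>
       (\<forall>j<length Ms. xs ! j \<in> piece (Ms ! j) (hs ! j) (qs ! j))}"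

definition tensor_over ::
  "'a ring \<Rightarrow> ('v, 'a) dg_bimodule list \<Rightarrow> (('v list \<Rightarrow>\<^sub>0 bit) set, 'a) dg_bimodule" where
  "tensor_over A Ms = (let l = length Ms - 1; T = tensor_space A Ms; cl = tensor_class A Ms in
    \<lparr>space = T,
     diff = extend_linear T (\<lambda>xs. cl (\<Sum>j<length Ms. elt (xs[j := diff (Ms ! j) (xs ! j)]))),
     piece = (\<lambda>h q. {cl x | x. Poly_Mapping.keys x \<subseteq> tensor_homogeneous Ms h q}),
     lact = (\<lambda>a. extend_linear T (\<lambda>xs. cl (elt (xs[0 := lact (Ms ! 0) a (xs ! 0)])))),
     ract = (\<lambda>X a. extend_linear T (\<lambda>xs. cl (elt (xs[l := ract (Ms ! l) (xs ! l) a]))) X)\<rparr>)"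


subsection \<open>Hochschild homology\<close>

text \<open>
  The complex \<open>\<Oplus>\<^sub>k A\<^bsup>\<otimes>k\<^esup> \<otimes> M\<close>. The generator \<open>(as, x)\<close> stands for \<open>a\<^sub>1 \<otimes> \<dots> \<otimes> a\<^sub>k \<otimes> x\<close>;
  since lists of all lengths occur and the relations preserve the length, the quotient is the
  direct sum over \<open>k\<close>. The grading of \<open>A\<close> is given by its homogeneous parts \<open>gr j\<close>.
\<close>

definition hoch_gens :: "'a ring \<Rightarrow> ('v, 'a) dg_bimodule \<Rightarrow> ('a list \<times> 'v) set" where
  "hoch_gens A M = {(as, x). set as \<subseteq> carrier A \<and> x \<in> carrier (space M)}"

definition hoch_rels :: "'a ring \<Rightarrow> ('v, 'a) dg_bimodule \<Rightarrow> ('a list \<times> 'v \<Rightarrow>\<^sub>0 bit) set" where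
  "hoch_rels A M =
    {elt (as[j := a \<oplus>\<^bsub>A\<^esub> b], x) - (elt (as[j := a], x) + elt (as[j := b], x)) | as j a b x.
       (as, x) \<in> hoch_gens A M \<and> j < length as \<and> a \<in> carrier A \<and> b \<in> carrier A} \<union>
    {elt (as, x \<oplus>\<^bsub>space M\<^esub> y) - (elt (as, x) + elt (as, y)) | as x y.
       (as, x) \<in> hoch_gens A M \<and> y \<in> carrier (space M)}"

definition hoch_boundary ::
  "'a ring \<Rightarrow> ('v, 'a) dg_bimodule \<Rightarrow> 'a list \<times> 'v \<Rightarrow> ('a list \<times> 'v \<Rightarrow>\<^sub>0 bit)" where
  "hoch_boundary A M = (\<lambda>(as, x).
     elt (as, diff M x) +
     (if as = [] then 0 else
        (\<Sum>j<length as - 1. elt (take j as @ (as ! j \<otimes>\<^bsub>A\<^esub> as ! Suc j) # drop (Suc (Suc j)) as, x)) +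
        elt (butlast as, lact M (last as) x) +
        elt (tl as, ract M x (hd as))))"

definition hoch_homogeneous ::
  "'a ring \<Rightarrow> (int \<Rightarrow> 'a set) \<Rightarrow> ('v, 'a) dg_bimodule \<Rightarrow> int \<Rightarrow> int \<Rightarrow> ('a list \<times> 'v) set" where
  "hoch_homogeneous A gr M i j =
    {(as, x) \<in> hoch_gens A M. \<exists>js j'. length js = length as \<and>
       (\<forall>l<length as. as ! l \<in> gr (js ! l)) \<and> x \<in> piece M (i + int (length as)) j' \<and>
       sum_list js + j' = j}"

definition hoch_complex ::
  "'a ring \<Rightarrow> (int \<Rightarrow> 'a set) \<Rightarrow> ('v, 'a) dg_bimodule \<Rightarrow> ('a list \<times> 'v \<Rightarrow>\<^sub>0 bit) set dg_space" where
  "hoch_complex A gr M =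
    (let G = hoch_gens A M; R = hoch_rels A M; T = presented_space G R; cl = presented_class G R in
    \<lparr>space = T,
     diff = extend_linear T (\<lambda>g. cl (hoch_boundary A M g)),
     piece = (\<lambda>i j. {cl x | x. Poly_Mapping.keys x \<subseteq> hoch_homogeneous A gr M i j})\<rparr>)"

definition HH ::
  "'a ring \<Rightarrow> (int \<Rightarrow> 'a set) \<Rightarrow> ('v, 'a) dg_bimodule \<Rightarrow>
   int \<Rightarrow> int \<Rightarrow> ('a list \<times> 'v \<Rightarrow>\<^sub>0 bit) set set f2_space" where
  "HH A gr M = homology (hoch_complex A gr M)"


section \<open>Braids\<close>

text \<open>The letter \<open>(i, \<epsilon>)\<close> stands for \<open>\<sigma>\<^sub>i\<^sup>\<epsilon>\<close>, with \<open>i \<ge> 1\<close> and \<open>\<epsilon> = \<plusminus>1\<close>.\<close>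

type_synonym braid_word = "(nat \<times> int) list"

definition braid_words :: "nat \<Rightarrow> braid_word set" where
  "braid_words n = {w. set w \<subseteq> {1..<n} \<times> {-1, 1}}"

inductive braid_step :: "braid_word \<Rightarrow> braid_word \<Rightarrow> bool" where
  cancel: "braid_step (u @ [(i, e), (i, - e)] @ v) (u @ v)"
| far: "Suc i < j \<Longrightarrow> braid_step (u @ [(i, 1), (j, 1)] @ v) (u @ [(j, 1), (i, 1)] @ v)"
| braid: "braid_step (u @ [(i, 1), (Suc i, 1), (i, 1)] @ v) (u @ [(Suc i, 1), (i, 1), (Suc i, 1)] @ v)"

definition braid_rel :: "nat \<Rightarrow> (braid_word \<times> braid_word) set" where
  "braid_rel n = (let S = {(u, v). u \<in> braid_words n \<and> v \<in> braid_words n \<and> braid_step u v}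
     in Restr ((S \<union> S\<inverse>)\<^sup>*) (braid_words n))"

text \<open>
  The braid group on \<open>n\<close> strands; an element is the set of all words in the Artin generators
  (with inverses) that represent it.
\<close>

definition braid_group :: "nat \<Rightarrow> braid_word set monoid" where
  "braid_group n =
    \<lparr>carrier = braid_words n // braid_rel n,
     mult = (\<lambda>X Y. \<Union>x\<in>X. \<Union>y\<in>Y. braid_rel n `` {x @ y}),
     one = braid_rel n `` {[]}\<rparr>"

definition mirror :: "braid_word \<Rightarrow> braid_word" where
  "mirror w = map (\<lambda>(i, e). (i, - e)) w"

definition n_plus :: "braid_word \<Rightarrow> int" where
  "n_plus w = int (length (filter (\<lambda>(i, e). e = 1) w))"

definition n_minus :: "braid_word \<Rightarrow> int" where
  "n_minus w = int (length (filter (\<lambda>(i, e). e = -1) w))"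


section \<open>Sutured annular Khovanov homology of closed braids\<close>

text \<open>
  The point \<open>(l, s)\<close> is strand \<open>s \<in> {0..m}\<close> at level \<open>l \<in> {0..k}\<close>, where \<open>k\<close> is the length of the
  word. The diagram of the \<open>j\<close>-th letter lies between the levels \<open>j\<close> and \<open>j + 1\<close> (counting letters
  from 0), and closing up joins \<open>(k, s)\<close> to \<open>(0, s)\<close> by an arc around the annulus.
\<close>

type_synonym circle = "(nat \<times> nat) set"

definition id_arcs :: "nat \<Rightarrow> nat \<Rightarrow> ((nat \<times> nat) \<times> (nat \<times> nat)) set" where
  "id_arcs m j = {((j, s), (Suc j, s)) | s. s \<le> m}"

definition cup_cap_arcs :: "nat \<Rightarrow> nat \<Rightarrow> nat \<Rightarrow> ((nat \<times> nat) \<times> (nat \<times> nat)) set" where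
  "cup_cap_arcs m i j =
    {((j, s), (Suc j, s)) | s. s \<le> m \<and> s \<noteq> i - 1 \<and> s \<noteq> i} \<union>
    {((j, i - 1), (j, i)), ((Suc j, i - 1), (Suc j, i))}"

definition resolution_arcs ::
  "nat \<Rightarrow> braid_word \<Rightarrow> int list \<Rightarrow> ((nat \<times> nat) \<times> (nat \<times> nat)) set" where
  "resolution_arcs m w v =
    (\<Union>j<length w. case w ! j of (i, \<delta>) \<Rightarrow>
       if v ! j * \<delta> = 1 then cup_cap_arcs m i j else id_arcs m j) \<union>
    {((length w, s), (0, s)) | s. s \<le> m}"

definition circles :: "nat \<Rightarrow> braid_word \<Rightarrow> int list \<Rightarrow> circle set" where
  "circles m w v =
    ({0..length w} \<times> {0..m}) //
      ((resolution_arcs m w v \<union> (resolution_arcs m w v)\<inverse>)\<^sup>*)"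

text \<open>
  The class of a circle in \<open>H\<^sub>1\<close> of the annulus with \<open>\<int>/2\<int>\<close> coefficients is its intersection number
  mod 2 with a radial arc crossing exactly the closing arcs.
\<close>

definition nontrivial :: "circle \<Rightarrow> bool" where
  "nontrivial C \<longleftrightarrow> odd (card {s. (0, s) \<in> C})"

text \<open>A generator \<open>(v, P)\<close>: a vertex \<open>v\<close> of the cube and the set \<open>P\<close> of circles with a plus label.\<close>

type_synonym skh_gen = "int list \<times> circle set"

definition cube :: "nat \<Rightarrow> int list set" where
  "cube k = {v. length v = k \<and> set v \<subseteq> {-1, 1}}"

definition height :: "int list \<Rightarrow> int" where
  "height v = (\<Sum>x\<leftarrow>v. (1 + x) div 2)"

definition deg_h :: "braid_word \<Rightarrow> skh_gen \<Rightarrow> int" where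
  "deg_h w = (\<lambda>(v, P). - n_minus w + height v)"

definition deg_q :: "nat \<Rightarrow> braid_word \<Rightarrow> skh_gen \<Rightarrow> int" where
  "deg_q m w = (\<lambda>(v, P). (n_plus w - 2 * n_minus w) + height v +
     (int (card P) - int (card (circles m w v - P))))"

definition deg_f :: "nat \<Rightarrow> braid_word \<Rightarrow> skh_gen \<Rightarrow> int" where
  "deg_f m w = (\<lambda>(v, P).
     int (card {C \<in> P. nontrivial C}) - int (card {C \<in> circles m w v - P. nontrivial C}))"

definition skh_gens :: "nat \<Rightarrow> braid_word \<Rightarrow> int \<Rightarrow> skh_gen set" where
  "skh_gens m w n = {(v, P). v \<in> cube (length w) \<and> P \<subseteq> circles m w v \<and> deg_f m w (v, P) = n}"

datatype label = V_plus | V_minus | W_plus | W_minus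

definition label_of :: "circle set \<Rightarrow> circle \<Rightarrow> label" where
  "label_of P C =
    (if nontrivial C then (if C \<in> P then V_plus else V_minus)
     else (if C \<in> P then W_plus else W_minus))"

text \<open>
  \<open>(a, b, c) \<in> merge_terms\<close> iff \<open>c\<close> occurs in the merge of \<open>a\<close> and \<open>b\<close>; \<open>(a, b, c) \<in> split_terms\<close> iff
  \<open>b \<otimes> c\<close> occurs in the split of \<open>a\<close>. The letters \<open>V\<close>, \<open>W\<close> also record the types of the circles.
\<close>

definition merge_terms :: "(label \<times> label \<times> label) set" where
  "merge_terms =
    {(W_plus, W_plus, W_plus), (W_plus, W_minus, W_minus), (W_minus, W_plus, W_minus),
     (V_plus, W_plus, V_plus), (W_plus, V_plus, V_plus),
     (V_minus, W_plus, V_minus), (W_plus, V_minus, V_minus),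
     (V_plus, V_minus, W_minus), (V_minus, V_plus, W_minus)}"

definition split_terms :: "(label \<times> label \<times> label) set" where
  "split_terms =
    {(W_plus, W_plus, W_minus), (W_plus, W_minus, W_plus), (W_minus, W_minus, W_minus),
     (V_plus, V_plus, W_minus), (V_plus, W_minus, V_plus),
     (V_minus, V_minus, W_minus), (V_minus, W_minus, V_minus),
     (W_plus, V_plus, V_minus), (W_plus, V_minus, V_plus)}"

text \<open>
  Circles are point sets, so the circles not involved in a merge or split are exactly those
  common to both resolutions.
\<close>

definition edge_term :: "nat \<Rightarrow> braid_word \<Rightarrow> skh_gen \<Rightarrow> skh_gen \<Rightarrow> bool" where
  "edge_term m w = (\<lambda>(v, P) (v', P').
     let S = circles m w v; S' = circles m w v' in
     (\<exists>j<length w. v ! j = -1 \<and> v' = v[j := 1]) \<and>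
     P \<inter> (S \<inter> S') = P' \<inter> (S \<inter> S') \<and>
     ((\<exists>C\<^sub>1 C\<^sub>2 C. C\<^sub>1 \<noteq> C\<^sub>2 \<and> S - S' = {C\<^sub>1, C\<^sub>2} \<and> S' - S = {C} \<and>
         (label_of P C\<^sub>1, label_of P C\<^sub>2, label_of P' C) \<in> merge_terms) \<or>
      (\<exists>C C\<^sub>1 C\<^sub>2. C\<^sub>1 \<noteq> C\<^sub>2 \<and> S - S' = {C} \<and> S' - S = {C\<^sub>1, C\<^sub>2} \<and>
         (label_of P C, label_of P' C\<^sub>1, label_of P' C\<^sub>2) \<in> split_terms)))"

definition skh_complex :: "nat \<Rightarrow> braid_word \<Rightarrow> int \<Rightarrow> (skh_gen \<Rightarrow>\<^sub>0 bit) dg_space" where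
  "skh_complex m w n =
    \<lparr>space = free_space (skh_gens m w n),
     diff = (\<lambda>x. \<Sum>g\<in>Poly_Mapping.keys x. \<Sum>g' | g' \<in> skh_gens m w n \<and> edge_term m w g g'. elt g'),
     piece = (\<lambda>h q. {x. Poly_Mapping.keys x \<subseteq> {g \<in> skh_gens m w n. deg_h w g = h \<and> deg_q m w g = q}})\<rparr>"

text \<open>
  \<open>SKh m w n\<close> is the sutured annular Khovanov homology, in filtration grading \<open>n\<close>, of the annular
  closure of the word \<open>w\<close> on the \<open>m + 1\<close> strands \<open>0, \<dots>, m\<close>.
\<close>

definition SKh :: "nat \<Rightarrow> braid_word \<Rightarrow> int \<Rightarrow> int \<Rightarrow> int \<Rightarrow> (skh_gen \<Rightarrow>\<^sub>0 bit) set f2_space" where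
  "SKh m w n = homology (skh_complex m w n)"


section \<open>The Khovanov-Seidel algebra\<close>

definition paths :: "nat \<Rightarrow> nat list set" where
  "paths m = {p. p \<noteq> [] \<and> set p \<subseteq> {0..m} \<and>
     (\<forall>j. Suc j < length p \<longrightarrow> p ! Suc j = Suc (p ! j) \<or> p ! j = Suc (p ! Suc j))}"

definition path_mult :: "(nat list \<Rightarrow>\<^sub>0 bit) \<Rightarrow> (nat list \<Rightarrow>\<^sub>0 bit) \<Rightarrow> (nat list \<Rightarrow>\<^sub>0 bit)" where
  "path_mult x y = (\<Sum>p\<in>Poly_Mapping.keys x. \<Sum>q\<in>Poly_Mapping.keys y.
     if last p = hd q then elt (p @ tl q) else 0)"

definition path_algebra :: "nat \<Rightarrow> (nat list \<Rightarrow>\<^sub>0 bit) ring" where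
  "path_algebra m =
    \<lparr>carrier = {x. Poly_Mapping.keys x \<subseteq> paths m}, mult = path_mult,
     one = (\<Sum>i\<le>m. elt [i]), zero = 0, add = (+)\<rparr>"

definition KS_relations :: "nat \<Rightarrow> (nat list \<Rightarrow>\<^sub>0 bit) set" where
  "KS_relations m =
    {elt [i - 1, i, i + 1] | i. 1 \<le> i \<and> i < m} \<union>
    {elt [i + 1, i, i - 1] | i. 1 \<le> i \<and> i < m} \<union>
    {elt [i, i + 1, i] - elt [i, i - 1, i] | i. 1 \<le> i \<and> i < m} \<union>
    (if 1 \<le> m then {elt [0, 1, 0]} else {})"

definition KS_ideal :: "nat \<Rightarrow> (nat list \<Rightarrow>\<^sub>0 bit) set" where
  "KS_ideal m = Idl\<^bsub>path_algebra m\<^esub> (KS_relations m)"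

type_synonym ks = "(nat list \<Rightarrow>\<^sub>0 bit) set"

definition KS_algebra :: "nat \<Rightarrow> ks ring" where
  "KS_algebra m = path_algebra m Quot KS_ideal m"

definition ks_class :: "nat \<Rightarrow> (nat list \<Rightarrow>\<^sub>0 bit) \<Rightarrow> ks" where
  "ks_class m x = KS_ideal m +>\<^bsub>path_algebra m\<^esub> x"

abbreviation ks_path :: "nat \<Rightarrow> nat list \<Rightarrow> ks" where
  "ks_path m p \<equiv> ks_class m (elt p)"

definition KS_grading :: "nat \<Rightarrow> int \<Rightarrow> ks set" where
  "KS_grading m j =
    {ks_class m x | x. Poly_Mapping.keys x \<subseteq> {p \<in> paths m. - int (length p - 1) = j}}"


section \<open>The Khovanov-Seidel bimodules\<close>

definition KS_regular :: "nat \<Rightarrow> (ks, ks) dg_bimodule" where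
  "KS_regular m = (let A = KS_algebra m in
    \<lparr>space = f2_space (carrier A) (add A) (zero A),
     diff = (\<lambda>x. zero A),
     piece = (\<lambda>h q. if h = 0 then KS_grading m q else {zero A}),
     lact = mult A,
     ract = mult A\<rparr>)"

definition P_left :: "nat \<Rightarrow> nat \<Rightarrow> ks set" where
  "P_left m i = {a \<otimes>\<^bsub>KS_algebra m\<^esub> ks_path m [i] | a. a \<in> carrier (KS_algebra m)}"

definition P_right :: "nat \<Rightarrow> nat \<Rightarrow> ks set" where
  "P_right m i = {ks_path m [i] \<otimes>\<^bsub>KS_algebra m\<^esub> a | a. a \<in> carrier (KS_algebra m)}"

text \<open>\<open>P\<^sub>i \<otimes> \<^sub>iP\<close>, the tensor product being over \<open>\<int>/2\<int>\<close>.\<close>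

type_synonym ks2 = "(ks \<times> ks \<Rightarrow>\<^sub>0 bit) set"

definition PP_gens :: "nat \<Rightarrow> nat \<Rightarrow> (ks \<times> ks) set" where
  "PP_gens m i = P_left m i \<times> P_right m i"

definition PP_rels :: "nat \<Rightarrow> nat \<Rightarrow> (ks \<times> ks \<Rightarrow>\<^sub>0 bit) set" where
  "PP_rels m i = (let A = KS_algebra m in
    {elt (x \<oplus>\<^bsub>A\<^esub> x', y) - (elt (x, y) + elt (x', y)) | x x' y.
       x \<in> P_left m i \<and> x' \<in> P_left m i \<and> y \<in> P_right m i} \<union>
    {elt (x, y \<oplus>\<^bsub>A\<^esub> y') - (elt (x, y) + elt (x, y')) | x y y'.
       x \<in> P_left m i \<and> y \<in> P_right m i \<and> y' \<in> P_right m i})"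

definition PP_class :: "nat \<Rightarrow> nat \<Rightarrow> (ks \<times> ks \<Rightarrow>\<^sub>0 bit) \<Rightarrow> ks2" where
  "PP_class m i = presented_class (PP_gens m i) (PP_rels m i)"

definition PP :: "nat \<Rightarrow> nat \<Rightarrow> (ks2, ks) dg_bimodule" where
  "PP m i =
    (let A = KS_algebra m; T = presented_space (PP_gens m i) (PP_rels m i); cl = PP_class m i in
    \<lparr>space = T,
     diff = (\<lambda>t. zero T),
     piece = (\<lambda>h q. if h = 0 then
         {cl x | x. Poly_Mapping.keys x \<subseteq>
            {(a, b) \<in> PP_gens m i. \<exists>j j'. a \<in> KS_grading m j \<and> b \<in> KS_grading m j' \<and> j + j' = q}}
       else {zero T}),
     lact = (\<lambda>a. extend_linear T (\<lambda>(x, y). cl (elt (a \<otimes>\<^bsub>A\<^esub> x, y)))),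
     ract = (\<lambda>t a. extend_linear T (\<lambda>(x, y). cl (elt (x, y \<otimes>\<^bsub>A\<^esub> a))) t)\<rparr>)"

definition KS_beta :: "nat \<Rightarrow> nat \<Rightarrow> ks2 \<Rightarrow> ks" where
  "KS_beta m i = extend_linear (space (KS_regular m)) (\<lambda>(x, y). x \<otimes>\<^bsub>KS_algebra m\<^esub> y)"

definition KS_gamma_one :: "nat \<Rightarrow> nat \<Rightarrow> ks2" where
  "KS_gamma_one m i = PP_class m i
     (elt (ks_path m [i - 1, i], ks_path m [i, i - 1]) +
      (if i < m then elt (ks_path m [i + 1, i], ks_path m [i, i + 1]) else 0) +
      elt (ks_path m [i], ks_path m [i, i - 1, i]) +
      elt (ks_path m [i, i - 1, i], ks_path m [i]))"

definition KS_gamma :: "nat \<Rightarrow> nat \<Rightarrow> ks \<Rightarrow> ks2" where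
  "KS_gamma m i a = lact (PP m i) a (KS_gamma_one m i)"

text \<open>
  The two-term complexes of the generators. So that all of them have the same type, \<open>P\<^sub>i \<otimes> \<^sub>iP\<close> is the
  first summand and \<open>A\<^sub>m\<close> the second whatever the direction of the differential; the shift by
  \<open>[-1]\<close> places a summand in homological degree 1.
\<close>

type_synonym ks_cpx = "ks2 \<times> ks"

definition KS_letter :: "nat \<Rightarrow> nat \<times> int \<Rightarrow> (ks_cpx, ks) dg_bimodule" where
  "KS_letter m = (\<lambda>(i, e).
     if e = 1 then
       dg_sum (dg_shift 0 1 (PP m i)) (dg_shift (-1) 1 (KS_regular m))
         (\<lambda>(t, a). (\<zero>\<^bsub>space (PP m i)\<^esub>, KS_beta m i t))
     else
       dg_sum (dg_shift (-1) 2 (PP m i)) (KS_regular m)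
         (\<lambda>(t, a). (KS_gamma m i a, \<zero>\<^bsub>KS_algebra m\<^esub>)))"

text \<open>\<open>A\<^sub>m\<close> itself in that type, the first summand being zero; it is the value on the empty word.\<close>

definition KS_unit :: "nat \<Rightarrow> (ks_cpx, ks) dg_bimodule" where
  "KS_unit m = dg_sum (zero_part (PP m 0)) (KS_regular m)
     (\<lambda>(t, a). (\<zero>\<^bsub>space (PP m 0)\<^esub>, \<zero>\<^bsub>KS_algebra m\<^esub>))"

definition KS_bimodule :: "nat \<Rightarrow> braid_word \<Rightarrow> ((ks_cpx list \<Rightarrow>\<^sub>0 bit) set, ks) dg_bimodule" where
  "KS_bimodule m w =
    tensor_over (KS_algebra m) (if w = [] then [KS_unit m] else map (KS_letter m) w)"

end

theory Submission
 imports Defs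
begin

text \<open>
  Both sides are homologies of complexes spread over the cube of resolutions of the braid word: the
  mirror diagram has the cup-cap diagram \<open>U\<^sub>i\<close> exactly where \<open>P\<^sub>i \<otimes> \<^sub>iP\<close> is chosen in the bimodule, in
  the same height. So Hochschild homology is computed vertex by vertex and compared with the circles
  of the resolution, compatibly with the edge maps.

  Bases make everything explicit. A product of two of the paths \<open>(i)\<close>, \<open>(i|i\<plusminus>1)\<close>, \<open>(i|i-1|i)\<close>, a basis
  of \<open>A\<^sub>m\<close>, is zero or one of them. Hence words, with one path in front of each \<open>P\<^sub>i \<otimes> \<^sub>iP\<close> and one at the
  end, form a basis of the tensor product of the letters (\<open>M_coords\<close>).

  A vertex with some \<open>P\<^sub>i \<otimes> \<^sub>iP\<close> is projective, so there the Hochschild complex contracts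
  (\<open>peel_contracts\<close>) to degree 0: closed words, that is, cyclic sequences of paths from one cup-cap diagram
  to the next. At the vertex without them stands the Hochschild complex of \<open>A\<^sub>m\<close>, of which only the
  \<open>m + 1\<close> constant paths remain (\<open>cyc_acyclic\<close>, \<open>cyc_trivial\<close>).

  On the other side, let \<open>x\<close> and \<open>y\<close> be the indices of consecutive cup-cap diagrams. If they differ by
  two or more, there is no path from \<open>x\<close> to \<open>y\<close>, and too few circles are nontrivial to reach the filtration
  grading \<open>m - 1\<close> (\<open>few_nontrivial\<close>). Otherwise there are \<open>m - 1\<close> nontrivial circles, all labelled
  \<open>v\<^sub>+\<close>, and a trivial circle in each slab with \<open>x = y\<close>, whose labels \<open>w\<^sub>+\<close>, \<open>w\<^sub>-\<close> stand for the paths \<open>(x)\<close>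
  and \<open>(x|x-1|x)\<close> (\<open>conn_iff\<close>). Without cup-cap diagrams all \<open>m + 1\<close> strands are nontrivial circles, one of
  them labelled \<open>v\<^sub>-\<close>.

  Closing up words is a trace \<open>tr\<close>; it takes products of paths to merges and splits (\<open>remove_cup\<close>, \<open>insert_cup\<close>,
  \<open>tr_chain\<close>) and is bijective on \<open>HH\<^sub>0\<close> (\<open>tr_inject\<close>, \<open>tr_onto\<close>). Such a map induces an isomorphism of
  homologies, since its kernel is exact, column by column (\<open>Hochschild_homology_iso\<close>).
\<close>

abbreviation (input) iff_ascii (infixr "<->" 25) where
"P <-> Q == (P :: bool) = Q"

type_synonym 'g fvec = "'g \<Rightarrow>\<^sub>0 bit"

section \<open>Vectors over the field with two elements\<close>

definition lin :: "('a => 'b fvec) => 'a fvec => 'b fvec" where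
 "lin f x = (SUM g:Poly_Mapping.keys x. f g)"

definition vec :: "'a set => 'a fvec set" where
 "vec H = {x. Poly_Mapping.keys x <= H}"

lemma bit_add_self: "(b::bit) + b = 0" by(cases b) simp_all

lemma vec_add_self [simp]: "(x::'a \<Rightarrow>\<^sub>0 bit) + x = 0" by(rule poly_mapping_eqI) (simp add: lookup_add bit_add_self)

lemma vec_minus [simp]: "- (x::'a \<Rightarrow>\<^sub>0 bit) = x" by(metis vec_add_self add_eq_0_iff)

lemma vec_diff: "(x::'a \<Rightarrow>\<^sub>0 bit) - y = x + y" by(metis diff_conv_add_uminus vec_minus)

lemma vec_add_cancel [simp]: "(x::'a \<Rightarrow>\<^sub>0 bit) + (x + y) = y" "x + y + y = x"
 by(simp add: add.assoc[symmetric], simp add: add.assoc)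

lemma vec_add_eq_0_iff: "(x::'a \<Rightarrow>\<^sub>0 bit) + y = 0 <-> x = y" by(metis add_eq_0_iff vec_minus)

lemma keys_elt [simp]: "Poly_Mapping.keys (elt g) = {g}" by simp

lemma keys_add_F2:
 "Poly_Mapping.keys (x + y :: 'a \<Rightarrow>\<^sub>0 bit) =
  (Poly_Mapping.keys x - Poly_Mapping.keys y) Un (Poly_Mapping.keys y - Poly_Mapping.keys x)"
proof -
 have "(a::bit) + b ~= 0 <-> (a ~= 0) ~= (b ~= 0)" for a b by(cases a; cases b) simp_all
 thus ?thesis by(auto simp: in_keys_iff lookup_add)
qed

lemma lin_zero [simp]: "lin f 0 = 0" by(simp add: lin_def)

lemma lin_elt [simp]: "lin f (elt g) = f g" by(simp add: lin_def)

lemma lin_add: "lin f (x + y) = lin f x + lin f y"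
proof -
 let ?A = "Poly_Mapping.keys x" and ?B = "Poly_Mapping.keys y"
 have A: "sum f ?A = sum f (?A Int ?B) + sum f (?A - ?B)" by(rule sum.Int_Diff) simp
 have B: "sum f ?B = sum f (?A Int ?B) + sum f (?B - ?A)" using sum.Int_Diff[of ?B f ?A] by(simp add: Int_commute)
 have "sum f (?A - ?B Un (?B - ?A)) = sum f (?A - ?B) + sum f (?B - ?A)" by(rule sum.union_disjoint) auto
 also have "... = sum f ?A + sum f ?B" unfolding A B by(simp add: ac_simps)
 finally show ?thesis by(simp add: lin_def keys_add_F2)
qed

lemma lin_sum: "lin f (sum g A) = (SUM a:A. lin f (g a))" by(induction A rule: infinite_finite_induct) (simp_all add: lin_add)

lemma lin_lin: "lin f (lin g x) = lin (%a. lin f (g a)) x" by(simp add: lin_def[of g] lin_sum) (simp add: lin_def)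

lemma lin_cong: "(!!g. g : Poly_Mapping.keys x ==> f g = f' g) ==> lin f x = lin f' x" by(simp add: lin_def)

lemma lin_fun_add: "lin (%g. f g + f' g) x = lin f x + lin f' x" by(simp add: lin_def sum.distrib)

lemma lin_fun_zero [simp]: "lin (%g. 0) x = 0" by(simp add: lin_def)

lemma lin_fun_sum: "lin (%g. SUM a:A. f a g) x = (SUM a:A. lin (f a) x)" unfolding lin_def by(rule sum.swap)

lemma lin_swap: "lin (%a. lin (f a) y) x = lin (%b. lin (%a. f a b) x) y" unfolding lin_def by(rule sum.swap)

lemma lin_elt_id [simp]: "lin elt x = x"
proof(rule poly_mapping_eqI)
 fix k
 have "Poly_Mapping.lookup (lin elt x) k = (SUM g:Poly_Mapping.keys x. if g = k then 1 else 0)"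
  unfolding lin_def lookup_sum by(rule sum.cong) (auto simp: lookup_single when_def)
 also have "... = (if k : Poly_Mapping.keys x then 1 else 0)" by(simp add: sum.delta)
 also have "... = Poly_Mapping.lookup x k" by(cases "Poly_Mapping.lookup x k") (auto simp: in_keys_iff)
 finally show "Poly_Mapping.lookup (lin elt x) k = Poly_Mapping.lookup x k" .
qed

lemma vec_zero [simp]: "0 : vec H" by(simp add: vec_def)

lemma vec_elt [simp]: "elt h : vec H <-> h : H" by(simp add: vec_def)

lemma vec_add [intro]: "x : vec H ==> y : vec H ==> x + y : vec H" by(auto simp: vec_def keys_add_F2)

lemma vec_sum: "(!!a. a : A ==> f a : vec H) ==> sum f A : vec H" by(induction A rule: infinite_finite_induct) (auto intro: vec_add)

lemma vec_lin: "x : vec G ==> (!!g. g : G ==> f g : vec H) ==> lin f x : vec H" unfolding lin_def by(rule vec_sum) (auto simp: vec_def)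

lemma vec_mono: "x : vec G ==> G <= H ==> x : vec H" by(auto simp: vec_def)

lemma lin_cong_vec: "x : vec G ==> (!!g. g : G ==> f g = f' g) ==> lin f x = lin f' x" by(rule lin_cong) (auto simp: vec_def)

lemma vec_induct [consumes 1, case_names zero elt add]:
 assumes "x : vec H" "P 0" "!!h. h : H ==> P (elt h)"
  and "!!x y. x : vec H ==> y : vec H ==> P x ==> P y ==> P (x + y)"
 shows "P x"
proof -
 have "A <= H ==> sum elt A : vec H & P (sum elt A)" for A
 proof(induction A rule: infinite_finite_induct)
  case (insert a A)
  thus ?case using assms(4)[of "elt a" "sum elt A"] assms(3)[of a] by(auto intro!: vec_add)
 qed(use assms in auto)
 moreover have "sum elt (Poly_Mapping.keys x) = x" using lin_elt_id[of x] by(simp only: lin_def)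
 ultimately show ?thesis using assms(1) by(metis mem_Collect_eq vec_def)
qed

lemma lin_image_vec:
 assumes "!!a. a : G ==> f a : vec H" "!!h. h : H ==> EX x:vec G. lin f x = elt h"
 shows "lin f ` vec G = vec H"
proof
 show "lin f ` vec G <= vec H" using assms(1) by(auto intro: vec_lin)
 show "vec H <= lin f ` vec G"
 proof
  fix y assume "y : vec H"
  thus "y : lin f ` vec G"
  proof(induction rule: vec_induct)
  case zero
  thus ?case by(rule image_eqI[of _ _ 0]) auto
  next
  case (elt h)
  thus ?case using assms(2)[of h] by force
  next
  case (add x y)
  thus ?case by(auto simp flip: lin_add)
  qed
 qed
qed

lemma f2_span_zero: "0 : f2_span S" unfolding f2_span_def by(auto intro!: exI[of _ "{}"])

lemma f2_span_base: "s : S ==> s : f2_span S" unfolding f2_span_def by(auto intro!: exI[of _ "{s}"])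

lemma f2_span_add: "x : f2_span S ==> y : f2_span S ==> x + y : f2_span S"
proof -
 assume "x : f2_span S" "y : f2_span S"
 then obtain A B where *: "x = \<Sum>A" "finite A" "A <= S" "y = \<Sum>B" "finite B" "B <= S" unfolding f2_span_def by auto
 have A: "\<Sum>A = \<Sum>(A Int B) + \<Sum>(A - B)" using * by(intro sum.Int_Diff) simp
 have B: "\<Sum>B = \<Sum>(A Int B) + \<Sum>(B - A)" using sum.Int_Diff[of B "%x. x" A] * by(simp add: Int_commute)
 have "\<Sum>(A - B Un (B - A)) = \<Sum>(A - B) + \<Sum>(B - A)" using * by(intro sum.union_disjoint) auto
 also have "... = x + y" unfolding * A B by(simp add: ac_simps)
 finally show ?thesis unfolding f2_span_def using * by(auto intro!: exI[of _ "A - B Un (B - A)"])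
qed

lemma f2_span_sum: "(!!a. a : A ==> f a : f2_span S) ==> sum f A : f2_span S"
 by(induction A rule: infinite_finite_induct) (auto intro: f2_span_zero f2_span_add)

lemma f2_span_trans: "x + y : f2_span S ==> y + z : f2_span S ==> x + z : f2_span S" using f2_span_add[of "x + y" S "y + z"] by(simp add: add.assoc)

section \<open>Coordinates on quotients of free spaces\<close>

text \<open>
  Every space in sight gets coordinates: an additive bijection onto the vectors supported on an
  explicit set of basis elements. All later arguments are about such vectors.
\<close>

definition coords :: "('v, 'z) ring_scheme => 'h set => ('v => 'h fvec) => bool" where
 "coords V H Phi <-> bij_betw Phi (carrier V) (vec H) & (zero V) : carrier V & Phi (zero V) = 0 &
  (ALL x:carrier V. ALL y:carrier V. x \<oplus>\<^bsub>V\<^esub> y : carrier V & Phi (x \<oplus>\<^bsub>V\<^esub> y) = Phi x + Phi y)"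

definition point :: "('v, 'z) ring_scheme => ('v => 'h fvec) => 'h fvec => 'v" where
 "point V Phi = inv_into (carrier V) Phi"

lemma coords_vec: "coords V H Phi ==> x : carrier V ==> Phi x : vec H"
 and coords_zero: "coords V H Phi ==> (zero V) : carrier V" "coords V H Phi ==> Phi (zero V) = 0"
 and coords_add_closed: "coords V H Phi ==> x : carrier V ==> y : carrier V ==> x \<oplus>\<^bsub>V\<^esub> y : carrier V"
 and coords_add: "coords V H Phi ==> x : carrier V ==> y : carrier V ==> Phi (x \<oplus>\<^bsub>V\<^esub> y) = Phi x + Phi y"
 by(auto simp: coords_def bij_betw_def)

lemma coords_inject: "coords V H Phi ==> x : carrier V ==> y : carrier V ==> Phi x = Phi y ==> x = y"
 by(auto simp: coords_def bij_betw_def inj_on_def)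

lemma point_closed: "coords V H Phi ==> v : vec H ==> point V Phi v : carrier V"
 and coords_point: "coords V H Phi ==> v : vec H ==> Phi (point V Phi v) = v"
 unfolding coords_def bij_betw_def point_def by(auto intro: inv_into_into f_inv_into_f)

lemma point_coords: "coords V H Phi ==> x : carrier V ==> point V Phi (Phi x) = x" by(meson coords_inject coords_point coords_vec point_closed)

lemma coords_comm_monoid:
 assumes "coords V H Phi"
 shows "comm_monoid (add_monoid V)"
proof(rule comm_monoidI)
 fix x y z
 assume "x : carrier (add_monoid V)" "y : carrier (add_monoid V)" "z : carrier (add_monoid V)"
 hence *: "x : carrier V" "y : carrier V" "z : carrier V" by simp_all
 note c = coords_add_closed[OF assms] coords_add[OF assms] coords_zero[OF assms] *
 show "x \<otimes>\<^bsub>add_monoid V\<^esub> y : carrier (add_monoid V)" using c by simp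
 show "x \<otimes>\<^bsub>add_monoid V\<^esub> y \<otimes>\<^bsub>add_monoid V\<^esub> z = x \<otimes>\<^bsub>add_monoid V\<^esub> (y \<otimes>\<^bsub>add_monoid V\<^esub> z)"
  by(simp, rule coords_inject[OF assms]) (simp_all add: c add.assoc)
 show "x \<otimes>\<^bsub>add_monoid V\<^esub> y = y \<otimes>\<^bsub>add_monoid V\<^esub> x"
  by(simp, rule coords_inject[OF assms]) (simp_all add: c add.commute)
 show "\<one>\<^bsub>add_monoid V\<^esub> \<otimes>\<^bsub>add_monoid V\<^esub> x = x" by(simp, rule coords_inject[OF assms]) (simp_all add: c)
qed(use coords_zero[OF assms] in simp)

lemma coords_finsum:
 assumes "coords V H Phi" "finite A" "!!a. a : A ==> f a : carrier V"
 shows "finsum V f A : carrier V & Phi (finsum V f A) = (SUM a:A. Phi (f a))"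
proof -
 interpret comm_monoid "add_monoid V" by(rule coords_comm_monoid[OF assms(1)])
 show ?thesis using assms(2,3)
 proof(induction A rule: finite_induct)
  case empty
  thus ?case using coords_zero[OF assms(1)] by(simp add: finsum_def)
 next
  case (insert a A)
  hence "finsum V f (insert a A) = f a \<oplus>\<^bsub>V\<^esub> finsum V f A" unfolding finsum_def by(subst finprod_insert) auto
  with insert show ?case using coords_add_closed[OF assms(1)] coords_add[OF assms(1)] by auto
 qed
qed

lemma coords_induct [consumes 4, case_names zero elt add]:
 assumes "coords V H Phi" "x : carrier V" "Phi x : vec H'"
  and "H' <= H" "P (zero V)" "!!h. h : H' ==> P (point V Phi (elt h))"
  and "!!x y. x : carrier V ==> y : carrier V ==> Phi x : vec H' ==> Phi y : vec H' ==> P x ==> P y ==> P (x \<oplus>\<^bsub>V\<^esub> y)"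
 shows "P x"
proof -
 have "v : vec H' ==> P (point V Phi v)" for v
 proof(induction rule: vec_induct)
  case zero
  thus ?case using assms(5) coords_zero[OF assms(1)] point_coords[OF assms(1)] by metis
 next
  case (add u v)
  hence m: "u : vec H" "v : vec H" using assms(4) by(auto simp: vec_def)
  have "point V Phi (u + v) = point V Phi u \<oplus>\<^bsub>V\<^esub> point V Phi v" by(rule coords_inject[OF assms(1)])
  (use m in "simp_all add: vec_add point_closed[OF assms(1)] coords_point[OF assms(1)]
  coords_add_closed[OF assms(1)] coords_add[OF assms(1)]")
  with add m show ?case using assms(7) by(simp add: point_closed[OF assms(1)] coords_point[OF assms(1)])
 qed(rule assms(6))
 from this[OF assms(3)] show ?thesis by(simp add: point_coords[OF assms(1,2)])
qed

text \<open>
  When the subspace that is divided out is the kernel of \<open>lin f\<close>, its cosets are the fibres of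
  \<open>lin f\<close>, and reading off the common value gives coordinates.
\<close>

definition fibre :: "('a => 'b fvec) => 'a set => 'b fvec => 'a fvec set" where
 "fibre f G v = {z : vec G. lin f z = v}"

definition value_on :: "('a => 'b fvec) => 'a fvec set => 'b fvec" where
 "value_on f X = lin f (SOME x. x : X)"

lemma value_on_fibre: "z : fibre f G v ==> value_on f (fibre f G v) = v"
 unfolding value_on_def by(metis (mono_tags, lifting) fibre_def mem_Collect_eq someI)

locale kernel_quotient =
 fixes R :: "('a \<Rightarrow>\<^sub>0 bit, 'z) ring_scheme" and G W and f :: "'a => 'b fvec" and H
 assumes carrier: "carrier R = vec G" and add: "add R = (+)" and zero: "zero R = 0"
  and kernel: "W = {x : vec G. lin f x = 0}" and onto: "lin f ` vec G = vec H"
begin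

lemma coset: "x : vec G ==> W +>\<^bsub>R\<^esub> x = fibre f G (lin f x)"
proof -
 assume x: "x : vec G"
 have "z : W +>\<^bsub>R\<^esub> x" if "z : fibre f G (lin f x)" for z
 proof -
  have "z + x : W" using that x by(auto simp: kernel fibre_def lin_add vec_add)
  moreover have "z = (z + x) + x" by simp
  ultimately show ?thesis unfolding a_r_coset_def' add by blast
 qed
 moreover have "z : fibre f G (lin f x)" if z: "z : W +>\<^bsub>R\<^esub> x" for z
 proof -
  obtain h where "h : W" "z = h + x" using z unfolding a_r_coset_def' add by blast
  thus ?thesis using x by(simp add: kernel fibre_def lin_add vec_add)
 qed
 ultimately show ?thesis by blast
qed

lemma cosets: "a_rcosets\<^bsub>R\<^esub> W = fibre f G ` vec H"
proof -
 have "a_rcosets\<^bsub>R\<^esub> W = (%x. fibre f G (lin f x)) ` vec G" by(auto simp: A_RCOSETS_def' carrier coset)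
 also have "... = fibre f G ` vec H" unfolding onto[symmetric] by auto
 finally show ?thesis .
qed

lemma fibre_inhabited: "v : vec H ==> EX z. z : fibre f G v" using onto by(force simp: fibre_def)

lemma value_on [simp]: "v : vec H ==> value_on f (fibre f G v) = v" using fibre_inhabited value_on_fibre by metis

lemma set_add_fibre:
 assumes "u : vec H" "v : vec H"
 shows "set_add R (fibre f G u) (fibre f G v) = fibre f G (u + v)"
proof -
 obtain z where z: "z : fibre f G u" using fibre_inhabited[OF assms(1)] by blast
 have "x : set_add R (fibre f G u) (fibre f G v)" if "x : fibre f G (u + v)" for x
 proof -
  have "x + z : fibre f G v" using that z by(auto simp: fibre_def vec_add lin_add)
  moreover have "x = z + (x + z)" by(simp add: add.commute)
  ultimately show ?thesis using z unfolding set_add_def' add by blast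
 qed
 moreover have "x : fibre f G (u + v)" if x: "x : set_add R (fibre f G u) (fibre f G v)" for x
 proof -
  obtain h k where "h : fibre f G u" "k : fibre f G v" "x = h + k" using x unfolding set_add_def' add by blast
  thus ?thesis by(simp add: fibre_def lin_add vec_add)
 qed
 ultimately show ?thesis by blast
qed

lemma zero_fibre: "W = fibre f G 0" by(simp add: kernel fibre_def)

lemma coset_value: "x : vec G ==> value_on f (W +>\<^bsub>R\<^esub> x) = lin f x" using coset onto value_on by(metis image_eqI)

lemma quotient_coords:
 assumes "carrier V = a_rcosets\<^bsub>R\<^esub> W" "add V = set_add R" "zero V = W"
 shows "coords V H (value_on f)" unfolding coords_def bij_betw_def
proof(intro conjI ballI)
 show "inj_on (value_on f) (carrier V)" by(auto simp: assms cosets inj_on_def)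
 show "value_on f ` carrier V = vec H" by(auto simp: assms cosets image_image)
 have "W : fibre f G ` vec H" "value_on f W = 0" using zero_fibre value_on[of 0] by auto
 thus "(zero V) : carrier V" "value_on f (zero V) = 0" by(simp_all add: assms cosets)
 fix x y assume "x : carrier V" "y : carrier V"
 thus "x \<oplus>\<^bsub>V\<^esub> y : carrier V" "value_on f (x \<oplus>\<^bsub>V\<^esub> y) = value_on f x + value_on f y"
  by(auto simp: assms cosets set_add_fibre vec_add)
qed

end

lemma f2_space_simps [simp]:
 "carrier (f2_space C p z) = C" "add (f2_space C p z) = p" "zero (f2_space C p z) = z" by(simp_all add: f2_space_def)

lemma free_space_simps [simp]:
 "carrier (free_space G) = vec G" "add (free_space G) = (+)" "zero (free_space G) = 0" by(simp_all add: free_space_def vec_def)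

definition presents :: "'g set => 'g fvec set => ('g => 'h fvec) => 'h set => bool" where
 "presents G R f H <-> f2_span R = {x : vec G. lin f x = 0} & lin f ` vec G = vec H"

text \<open>
  A family of representatives \<open>g\<close> of the basis elements, to which every generator can be reduced
  modulo the relations, shows that the relations span the whole kernel of \<open>lin f\<close>.
\<close>

lemma presentsI:
 assumes f: "!!a. a : G ==> f a : vec H"
  and R: "!!r. r : R ==> r : vec G & lin f r = 0"
  and g: "!!h. h : H ==> g h : vec G & lin f (g h) = elt h"
  and reduce: "!!a. a : G ==> elt a + lin g (f a) : f2_span R"
 shows "presents G R f H"
proof -
 have "r : vec G & lin f r = 0" if r: "r : f2_span R" for r
 proof -
  obtain T where T: "r = \<Sum>T" "T <= R" using r unfolding f2_span_def by blast
  hence "ALL t:T. t : vec G & lin f t = 0" using R by blast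
  thus ?thesis unfolding T(1) lin_sum by(auto intro: vec_sum)
 qed
 moreover have "x + lin g (lin f x) : f2_span R" if "x : vec G" for x using that
 proof(induction rule: vec_induct)
  case (add x y)
  hence "(x + lin g (lin f x)) + (y + lin g (lin f y)) : f2_span R" by(rule_tac f2_span_add)
  thus ?case by(simp add: lin_add ac_simps)
 qed(auto intro: f2_span_zero reduce)
 hence "x : f2_span R" if "x : vec G" "lin f x = 0" for x using that by fastforce
 moreover have "lin f ` vec G = vec H" using f g by(intro lin_image_vec) blast+
 ultimately show ?thesis unfolding presents_def by blast
qed

lemma presents_quotient: "presents G R f H ==> kernel_quotient (free_space G) G (f2_span R) f H" by unfold_locales (auto simp: presents_def)

lemma presented_coords:
 assumes "presents G R f H"
 shows "coords (presented_space G R) H (value_on f)"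
proof -
 interpret kernel_quotient "free_space G" G "f2_span R" f H by(rule presents_quotient[OF assms])
 show ?thesis by(rule quotient_coords) (simp_all add: presented_space_def quotient_space_def)
qed

lemma presented_class:
 assumes "presents G R f H" "x : vec G"
 shows "presented_class G R x : carrier (presented_space G R)" (is ?g1)
  and "value_on f (presented_class G R x) = lin f x" (is ?g2)
proof -
 interpret kernel_quotient "free_space G" G "f2_span R" f H by(rule presents_quotient[OF assms(1)])
 show ?g2 unfolding presented_class_def by(rule coset_value[OF assms(2)])
 show ?g1 using onto assms(2)
  by(auto simp: presented_class_def presented_space_def quotient_space_def coset cosets)
qed

lemma extend_linear_coords:
 assumes p: "presents G R f H" and W: "coords W H' Psi"
  and phi: "!!g. g : G ==> phi g : carrier W & Psi (phi g) = lin \<delta> (f g)"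
  and X: "X : carrier (presented_space G R)"
 shows "extend_linear W phi X : carrier W" "Psi (extend_linear W phi X) = lin \<delta> (value_on f X)"
proof -
 interpret kernel_quotient "free_space G" G "f2_span R" f H by(rule presents_quotient[OF p])
 let ?\<sigma> = "%x. \<Oplus>\<^bsub>W\<^esub>g\<in>Poly_Mapping.keys x. phi g"
 obtain v where v: "v : vec H" "X = fibre f G v" using X cosets by(auto simp: presented_space_def quotient_space_def)
 have *: "?\<sigma> x : carrier W & Psi (?\<sigma> x) = lin \<delta> v" if "x : X" for x
 proof -
  have x: "x : vec G" "lin f x = v" using that v by(auto simp: fibre_def)
  hence k: "g : G" if "g : Poly_Mapping.keys x" for g using that by(auto simp: vec_def)
  hence "?\<sigma> x : carrier W & Psi (?\<sigma> x) = (SUM g:Poly_Mapping.keys x. Psi (phi g))" using phi by(intro coords_finsum[OF W]) auto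
  moreover have "(SUM g:Poly_Mapping.keys x. Psi (phi g)) = lin (%g. lin \<delta> (f g)) x"
  using phi k by(auto simp: lin_def[of "%g. lin \<delta> (f g)"] intro!: sum.cong)
  ultimately show ?thesis using x by(simp flip: lin_lin)
 qed
 obtain z where z: "z : X" using fibre_inhabited[OF v(1)] v(2) by blast
 have "?\<sigma> ` X = {?\<sigma> z}" using z * coords_inject[OF W] by(auto simp: image_iff)
 hence e: "extend_linear W phi X = ?\<sigma> z" by(simp add: extend_linear_def)
 show "extend_linear W phi X : carrier W" "Psi (extend_linear W phi X) = lin \<delta> (value_on f X)" unfolding e using *[OF z] v by simp_all
qed

lemma presented_pieces:
 assumes p: "presents G R f H" and "G' <= G" "!!a. a : G' ==> f a : vec H'"
  and "!!h. h : H' ==> EX x:vec G'. lin f x = elt h"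
 shows "{presented_class G R x | x. Poly_Mapping.keys x <= G'} <= carrier (presented_space G R)" (is ?g1)
  and "value_on f ` {presented_class G R x | x. Poly_Mapping.keys x <= G'} = vec H'" (is ?g2)
proof -
 have v: "{presented_class G R x | x. Poly_Mapping.keys x <= G'} = presented_class G R ` vec G'" by(auto simp: vec_def)
 have s: "x : vec G" if "x : vec G'" for x using that assms(2) by(rule vec_mono)
 show ?g1 unfolding v using presented_class[OF p] s by auto
 have "value_on f ` presented_class G R ` vec G' = lin f ` vec G'" using presented_class[OF p] s by(force simp: image_image)
 also have "... = vec H'" using assms(3,4) by(rule lin_image_vec)
 finally show ?g2 unfolding v .
qed

section \<open>Bilinear maps\<close>

definition bil :: "('a => 'b => 'c fvec) => 'a fvec => 'b fvec => 'c fvec" where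
 "bil f x y = lin (%a. lin (f a) y) x"

lemma bil_zero [simp]: "bil f 0 y = 0" "bil f x 0 = 0" by(simp_all add: bil_def)

lemma bil_elt [simp]: "bil f (elt a) (elt b) = f a b" by(simp add: bil_def)

lemma bil_add_left: "bil f (x + x') y = bil f x y + bil f x' y" by(simp add: bil_def lin_add)

lemma bil_add_right: "bil f x (y + y') = bil f x y + bil f x y'" by(simp add: bil_def lin_add lin_fun_add)

lemma lin_bil: "lin h (bil f x y) = bil (%a b. lin h (f a b)) x y" by(simp add: bil_def lin_lin)

lemma bil_lin_left: "bil f (lin g x) y = lin (%a. bil f (g a) y) x" by(simp add: bil_def lin_lin)

lemma bil_lin_right: "bil f x (lin g y) = lin (%b. bil f x (g b)) y" unfolding bil_def by(simp add: lin_lin) (rule lin_swap)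

lemma bil_lin_right': "bil f x (lin g y) = bil (%a b. lin (f a) (g b)) x y" unfolding bil_def by(simp add: lin_lin)

lemma bil_lin_left': "bil f (lin g x) y = bil (%a b. lin (%c. f c b) (g a)) x y"
 unfolding bil_def by(simp add: lin_lin) (rule lin_cong, rule lin_swap)

lemma bil_elt_left: "bil f (elt a) y = lin (f a) y" by(simp add: bil_def)

lemma bil_elt_right: "bil f x (elt b) = lin (%a. f a b) x" by(simp add: bil_def)

lemma bil_sum_left: "bil f (SUM i:I. x i) y = (SUM i:I. bil f (x i) y)" by(simp add: bil_def lin_sum)

lemma bil_sum_right: "bil f x (SUM i:I. y i) = (SUM i:I. bil f x (y i))" by(simp add: bil_def lin_sum lin_fun_sum)

lemma vec_bil: "x : vec G ==> y : vec H ==> (!!a b. a : G ==> b : H ==> f a b : vec K) ==> bil f x y : vec K"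
 unfolding bil_def by(blast intro: vec_lin)

definition elto :: "'a option => 'a fvec" where
 "elto a = (case a of None => 0 | Some b => elt b)"

lemma elto_simps [simp]: "elto None = 0" "elto (Some a) = elt a" by(simp_all add: elto_def)

lemma elto_vec: "elto a : vec H <-> (ALL b. a = Some b --> b : H)" by(cases a) auto

section \<open>A multiplicative basis of the Khovanov-Seidel algebra\<close>

text \<open>
  \<open>Step i j\<close> is the path \<open>(i|j)\<close> and \<open>Loop i\<close> the path \<open>(i|i-1|i)\<close>, \<open>i \<ge> 1\<close>. The product of two basis
  elements is again one of them or zero.
\<close>

datatype kb = Vertex nat | Step nat nat | Loop nat

fun src :: "kb => nat" where
 "src (Vertex i) = i" | "src (Step i j) = i" | "src (Loop i) = i"

fun tgt :: "kb => nat" where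
 "tgt (Vertex i) = i" | "tgt (Step i j) = j" | "tgt (Loop i) = i"

fun len :: "kb => nat" where
 "len (Vertex i) = 0" | "len (Step i j) = 1" | "len (Loop i) = 2"

fun mul :: "kb => kb => kb option" where
 "mul (Vertex i) b = (if src b = i then Some b else None)"
| "mul (Step i j) (Vertex k) = (if j = k then Some (Step i j) else None)"
| "mul (Loop i) (Vertex k) = (if i = k then Some (Loop i) else None)"
| "mul (Step i j) (Step k l) = (if j = k & l = i & i ~= 0 then Some (Loop i) else None)"
| "mul (Step i j) (Loop k) = None"
| "mul (Loop i) (Step j k) = None"
| "mul (Loop i) (Loop j) = None"

fun basic :: "nat => kb => bool" where
 "basic m (Vertex i) = (i <= m)"
| "basic m (Step i j) = (i <= m & j <= m & (j = Suc i | i = Suc j))"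
| "basic m (Loop i) = (1 <= i & i <= m)"

definition KB :: "nat => kb set" where
 "KB m = {b. basic m b}"

lemma KB_simps [simp]:
 "Vertex i : KB m <-> i <= m" "Step i j : KB m <-> i <= m & j <= m & (j = Suc i | i = Suc j)"
 "Loop i : KB m <-> 1 <= i & i <= m" by(auto simp: KB_def)

lemma mul_Vertex_right: "mul b (Vertex j) = (if tgt b = j then Some b else None)" by(cases b) auto

lemma mul_assoc: "Option.bind (mul a b) (%x. mul x c) = Option.bind (mul b c) (mul a)" by(cases a; cases b; cases c) auto

lemma mul_Some:
 assumes "mul a b = Some c"
 shows "tgt a = src b" "src c = src a" "tgt c = tgt b" "len c = len a + len b" using assms by(cases a; cases b; auto split: if_splits)+

lemma mul_KB: "a : KB m ==> b : KB m ==> mul a b = Some c ==> c : KB m" by(cases a; cases b; auto split: if_splits)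

lemma src_KB: "b : KB m ==> src b <= m" and tgt_KB: "b : KB m ==> tgt b <= m" by(cases b; auto)+

definition mulv :: "kb fvec => kb fvec => kb fvec" where
 "mulv = bil (%a b. elto (mul a b))"

definition onev :: "nat => kb fvec" where
 "onev m = (SUM i<=m. elt (Vertex i))"

fun nf :: "nat list => kb option" where
 "nf [] = None"
| "nf [v] = Some (Vertex v)"
| "nf (v # w # p) = Option.bind (nf (w # p)) (mul (Step v w))"

abbreviation nfe :: "nat list => kb fvec" where
 "nfe p == elto (nf p)"

lemma nf_Some: "nf p = Some b ==> src b = hd p & tgt b = last p & len b = length p - 1"
proof(induction p arbitrary: b rule: nf.induct)
 case (3 v w p)
 then obtain c where c: "nf (w # p) = Some c" "mul (Step v w) c = Some b" by(auto simp: Option.bind_eq_Some_conv)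
 with 3 mul_Some[OF c(2)] show ?case by simp
qed auto

lemma nf_append:
 "p ~= [] ==> q ~= [] ==> last p = hd q ==>
  nf (p @ tl q) = Option.bind (nf p) (%a. Option.bind (nf q) (mul a))"
proof(induction p rule: nf.induct)
 case (2 v)
 hence e: "[v] @ tl q = q" by(cases q) auto
 show ?case unfolding e using nf_Some[of q] 2 by(cases "nf q") auto
next
 case (3 v w p)
 thus ?case by(cases "nf (w # p)"; cases "nf q") (auto simp: mul_assoc bind_rzero)
qed auto

fun rep :: "kb => nat list" where
 "rep (Vertex i) = [i]" | "rep (Step i j) = [i, j]" | "rep (Loop i) = [i, i - 1, i]"

lemma nf_rep: "b : KB m ==> nf (rep b) = Some b" by(cases b) auto

lemma paths_single [simp]: "[v] : paths m <-> v <= m" by(auto simp: paths_def)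

lemma paths_Cons [simp]:
 "v # w # p : paths m <-> v <= m & (w = Suc v | v = Suc w) & w # p : paths m"
proof -
 have split: "(ALL j. Q j) <-> Q 0 & (ALL j. Q (Suc j))" for Q :: "nat => bool" by(metis nat.exhaust)
 show ?thesis unfolding paths_def by(subst (1) split) auto
qed

lemma nf_KB: "p : paths m ==> nf p = Some b ==> b : KB m"
proof(induction p arbitrary: b rule: nf.induct)
 case (3 v w p)
 then obtain c where c: "nf (w # p) = Some c" "mul (Step v w) c = Some b" by(auto simp: Option.bind_eq_Some_conv)
 moreover have "w <= m" using 3 by(simp add: paths_def)
 ultimately show ?case using 3 by(intro mul_KB[OF _ _ c(2)]) auto
qed auto

lemma rep_paths: "b : KB m ==> rep b : paths m" by(cases b) auto

lemma paths_ends: "p : paths m ==> p ~= [] & hd p <= m & last p <= m" using hd_in_set[of p] last_in_set[of p] by(auto simp: paths_def subset_iff)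

lemma paths_append:
 "p : paths m ==> q : paths m ==> last p = hd q ==> p @ tl q : paths m"
proof(induction p rule: nf.induct)
 case (2 v)
 hence "[v] @ tl q = q" by(cases q) (auto simp: paths_def)
 with 2 show ?case by simp
next
 case 1
 thus ?case by(simp add: paths_def)
qed simp

lemma path_mult_bil:
 "path_mult x y = bil (%p q. if last p = hd q then elt (p @ tl q) else 0) x y" by(simp add: path_mult_def bil_def lin_def)

lemma path_mult_elt [simp]:
 "path_mult (elt p) (elt q) = (if last p = hd q then elt (p @ tl q) else 0)" by(simp add: path_mult_bil)

lemma path_mult_add:
 "path_mult (x + x') y = path_mult x y + path_mult x' y"
 "path_mult x (y + y') = path_mult x y + path_mult x y'"
 and path_mult_zero [simp]: "path_mult 0 y = 0" "path_mult x 0 = 0" by(simp_all add: path_mult_bil bil_add_left bil_add_right)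

lemma path_mult_closed: "x : vec (paths m) ==> y : vec (paths m) ==> path_mult x y : vec (paths m)"
 unfolding path_mult_bil by(erule vec_bil) (auto intro: paths_append)

lemma nfe_path_mult:
 assumes "x : vec (paths m)" "y : vec (paths m)"
 shows "lin nfe (path_mult x y) = mulv (lin nfe x) (lin nfe y)"
proof -
 have *: "lin nfe (if last p = hd q then elt (p @ tl q) else 0) = bil (%a b. elto (mul a b)) (nfe p) (nfe q)"
  if "p : paths m" "q : paths m" for p q
 proof(cases "last p = hd q")
  case True
  have "p ~= []" "q ~= []" using that by(auto simp: paths_def)
  with True nf_append[of p q] show ?thesis by(cases "nf p"; cases "nf q") simp_all
 next
  case False
  thus ?thesis using nf_Some[of p] nf_Some[of q] mul_Some(1) by(cases "nf p"; cases "nf q") (auto simp: elto_def split: option.splits)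
 qed
 show ?thesis using assms(1)
 proof(induction rule: vec_induct)
  case (elt p)
  show ?case using assms(2) by(induction rule: vec_induct)
  (use elt * in "simp_all add: path_mult_add lin_add mulv_def bil_add_right")
 qed(simp_all add: path_mult_add lin_add mulv_def bil_add_left)
qed

lemma path_algebra_simps [simp]:
 "carrier (path_algebra m) = vec (paths m)" "mult (path_algebra m) = path_mult"
 "add (path_algebra m) = (+)" "zero (path_algebra m) = 0" "one (path_algebra m) = (SUM i<=m. elt [i])" by(simp_all add: path_algebra_def vec_def)

lemma ring_path_algebra: "ring (path_algebra m)"
proof(rule ringI)
 show "abelian_group (path_algebra m)"
 proof(rule abelian_groupI)
  fix x assume "x : carrier (path_algebra m)"
  thus "EX y:carrier (path_algebra m). y \<oplus>\<^bsub>path_algebra m\<^esub> x = \<zero>\<^bsub>path_algebra m\<^esub>"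
  by(intro bexI[of _ x]) simp_all
 qed(auto simp: ac_simps)
 have one: "path_mult (SUM i<=m. elt [i]) x = x & path_mult x (SUM i<=m. elt [i]) = x"
  if "x : vec (paths m)" for x using that
 proof(induction rule: vec_induct)
  case (elt p)
  hence p: "p ~= []" "hd p <= m" "last p <= m" using paths_ends by auto
  have "path_mult (SUM i<=m. elt [i]) (elt p) = (SUM i<=m. if i = hd p then elt p else 0)"
  unfolding path_mult_bil bil_sum_left using p by(intro sum.cong) auto
  moreover have "path_mult (elt p) (SUM i<=m. elt [i]) = (SUM i<=m. if i = last p then elt p else 0)"
  unfolding path_mult_bil bil_sum_right using p by(intro sum.cong) auto
  ultimately show ?case using p by simp
 qed(simp_all add: path_mult_add)
 have assoc: "path_mult (path_mult x y) z = path_mult x (path_mult y z)"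
  if x: "x : vec (paths m)" and y: "y : vec (paths m)" and z: "z : vec (paths m)" for x y z using x
 proof(induction rule: vec_induct)
  case (elt p)
  show ?case using y
  proof(induction rule: vec_induct)
  case e: (elt q)
  show ?case using z
  proof(induction rule: vec_induct)
  case (elt r)
  hence n: "p ~= []" "q ~= []" "r ~= []" using e `p : paths m` by(auto simp: paths_def)
  thus ?case by(cases "tl q = []") (auto simp: last_tl hd_append, (cases q; auto)+)
  qed(simp_all add: path_mult_add)
  qed(simp_all add: path_mult_add)
 qed(simp_all add: path_mult_add)
 show "Group.monoid (path_algebra m)" by(rule monoidI) (auto simp: path_mult_closed one assoc intro!: vec_sum)
qed(simp_all add: path_mult_add)

lemma KS_relations_paths: "KS_relations m <= vec (paths m)" unfolding KS_relations_def by(auto simp: vec_diff intro!: vec_add)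

lemma ideal_KS_ideal: "ideal (KS_ideal m) (path_algebra m)" unfolding KS_ideal_def
 using ring.genideal_ideal[OF ring_path_algebra] KS_relations_paths by simp

lemma KS_ideal_base: "r : KS_relations m ==> r : KS_ideal m" unfolding KS_ideal_def
 using ring.genideal_self[OF ring_path_algebra, of "KS_relations m" m] KS_relations_paths by auto

lemma KS_ideal_closed:
 "x : KS_ideal m ==> y : KS_ideal m ==> x + y : KS_ideal m"
 "0 : KS_ideal m"
 "x : KS_ideal m ==> a : vec (paths m) ==> path_mult a x : KS_ideal m"
 "x : KS_ideal m ==> a : vec (paths m) ==> path_mult x a : KS_ideal m"
proof -
 interpret ideal "KS_ideal m" "path_algebra m" by(rule ideal_KS_ideal)
 show "x : KS_ideal m ==> y : KS_ideal m ==> x + y : KS_ideal m" using additive_subgroup.a_closed[OF ideal.axioms(1)[OF ideal_KS_ideal], of x m y] by simp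
 show "0 : KS_ideal m" using additive_subgroup.zero_closed[OF ideal.axioms(1)[OF ideal_KS_ideal], of m] by simp
 show "x : KS_ideal m ==> a : vec (paths m) ==> path_mult a x : KS_ideal m" using I_l_closed[of x a] by simp
 show "x : KS_ideal m ==> a : vec (paths m) ==> path_mult x a : KS_ideal m" using I_r_closed[of x a] by simp
qed

lemma KS_ideal_trans: "x + y : KS_ideal m ==> y + z : KS_ideal m ==> x + z : KS_ideal m"
 using KS_ideal_closed(1)[of "x + y" m "y + z"] by(simp add: add.assoc)

lemma KS_relation_instances:
 "Suc (Suc i) <= m ==> elt [i, Suc i, Suc (Suc i)] : KS_ideal m"
 "Suc (Suc i) <= m ==> elt [Suc (Suc i), Suc i, i] : KS_ideal m"
 "Suc (Suc i) <= m ==> elt [Suc i, Suc (Suc i), Suc i] + elt [Suc i, i, Suc i] : KS_ideal m"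
 "1 <= m ==> elt [0, Suc 0, 0] : KS_ideal m"
proof -
 have 1: "elt [Suc i - 1, Suc i, Suc i + 1] : KS_relations m"
  "elt [Suc i + 1, Suc i, Suc i - 1] : KS_relations m"
  "elt [Suc i, Suc i + 1, Suc i] - elt [Suc i, Suc i - 1, Suc i] : KS_relations m"
  if "1 <= Suc i" "Suc i < m" unfolding KS_relations_def using that by blast+
 have 2: "1 <= m ==> elt [0, 1, 0] : KS_relations m" by(simp add: KS_relations_def)
 show "Suc (Suc i) <= m ==> elt [i, Suc i, Suc (Suc i)] : KS_ideal m"
  "Suc (Suc i) <= m ==> elt [Suc (Suc i), Suc i, i] : KS_ideal m"
  "Suc (Suc i) <= m ==> elt [Suc i, Suc (Suc i), Suc i] + elt [Suc i, i, Suc i] : KS_ideal m"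
  "1 <= m ==> elt [0, Suc 0, 0] : KS_ideal m" using 1[THEN KS_ideal_base] 2[THEN KS_ideal_base] by(simp_all add: vec_diff)
qed

lemma path_reduces_step:
 assumes v: "v <= m" "w = Suc v | v = Suc w" and b: "b : KB m" "src b = w"
 shows "elt (v # rep b) + lin (%b. elt (rep b)) (elto (mul (Step v w) b)) : KS_ideal m"
proof(cases b)
 case (Vertex i)
 thus ?thesis using b by(simp add: KS_ideal_closed)
next
 case (Step w' u)
 hence *: "w' = w" "u <= m" "w <= m" "u = Suc w | w = Suc u" using b by auto
 show ?thesis
 proof(cases "u = v")
  case True
  show ?thesis
  proof(cases v)
  case 0
  thus ?thesis using * Step v True KS_relation_instances(4) by simp
  next
  case (Suc v')
  show ?thesis using * Step v True Suc KS_relation_instances(3)[of v' m] by(auto simp: KS_ideal_closed)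
  qed
 next
  case False
  thus ?thesis using * Step v KS_relation_instances(1)[of v m] KS_relation_instances(2)[of u m] by auto
 qed
next
 case (Loop i)
 hence i: "i = w" "1 <= w" "w <= m" using b by auto
 have "elt [v, w, w - 1, w] : KS_ideal m"
 proof(cases "v = Suc w")
  case True
  have "path_mult (elt [Suc w, w, w - 1]) (elt [w - 1, w]) : KS_ideal m"
  using i v True KS_relation_instances(2)[of "w - 1" m] by(intro KS_ideal_closed(4)) auto
  thus ?thesis using True by simp
 next
  case False
  hence w: "w = Suc v" using v by auto
  show ?thesis
  proof(cases v)
  case 0
  have "path_mult (elt [0, Suc 0, 0]) (elt [0, Suc 0]) : KS_ideal m" using i w 0 KS_relation_instances(4)[of m] by(intro KS_ideal_closed(4)) auto
  thus ?thesis using 0 w by simp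
  next
  case (Suc u)
  have "path_mult (elt [v, w, v] + elt [v, u, v]) (elt [v, w]) : KS_ideal m"
  using i w Suc KS_relation_instances(3)[of u m] by(intro KS_ideal_closed(4)) auto
  hence 1: "elt [v, w, v, w] + elt [v, u, v, w] : KS_ideal m" by(simp add: path_mult_add)
  have "path_mult (elt [v, u]) (elt [u, v, w]) : KS_ideal m" using i w Suc v KS_relation_instances(1)[of u m] by(intro KS_ideal_closed(3)) auto
  hence "elt [v, u, v, w] : KS_ideal m" by simp
  from KS_ideal_closed(1)[OF 1 this] show ?thesis using w by(simp add: add.assoc)
  qed
 qed
 thus ?thesis using Loop i by simp
qed

lemma path_reduces:
 "p : paths m ==> elt p + lin (%b. elt (rep b)) (nfe p) : KS_ideal m"
proof(induction p rule: nf.induct)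
 case 1
 thus ?case by(simp add: paths_def)
next
 case (2 v)
 thus ?case by(simp add: KS_ideal_closed)
next
 case (3 v w p)
 hence v: "v <= m" "w = Suc v | v = Suc w" "w # p : paths m" by auto
 hence vw: "elt [v, w] : vec (paths m)" by(auto simp: paths_def)
 have "path_mult (elt [v, w]) (elt (w # p) + lin (%b. elt (rep b)) (nfe (w # p))) : KS_ideal m" using 3 v vw by(intro KS_ideal_closed(3)) auto
 hence 1: "elt (v # w # p) + path_mult (elt [v, w]) (lin (%b. elt (rep b)) (nfe (w # p))) : KS_ideal m" by(simp add: path_mult_add)
 show ?case
 proof(cases "nf (w # p)")
  case None
  thus ?thesis using 1 by simp
 next
  case (Some b)
  hence b: "b : KB m" "src b = w" using nf_KB v(3) nf_Some by fastforce+
  hence "path_mult (elt [v, w]) (elt (rep b)) = elt (v # rep b)" by(cases b) auto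
  with 1 Some have "elt (v # w # p) + elt (v # rep b) : KS_ideal m" by simp
  from KS_ideal_trans[OF this path_reduces_step[OF v(1,2) b]] show ?thesis using Some by simp
 qed
qed

lemma KS_quotient: "kernel_quotient (path_algebra m) (paths m) (KS_ideal m) nfe (KB m)"
proof
 let ?K = "{x : vec (paths m). lin nfe x = 0}"
 have "ideal ?K (path_algebra m)"
 proof(rule idealI[OF ring_path_algebra])
  interpret ring "path_algebra m" by(rule ring_path_algebra)
  show "subgroup ?K (add_monoid (path_algebra m))"
  proof
  fix x assume x: "x : ?K"
  hence "\<ominus>\<^bsub>path_algebra m\<^esub> x = x" by(intro minus_equality) auto
  thus "inv\<^bsub>add_monoid (path_algebra m)\<^esub> x : ?K" using x by(simp add: a_inv_def)
  qed(auto simp: lin_add)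
 qed(auto simp: path_mult_closed nfe_path_mult mulv_def)
 moreover have "KS_relations m <= ?K" unfolding KS_relations_def by(auto simp: vec_diff lin_add intro!: vec_add)
 ultimately have "KS_ideal m <= ?K" unfolding KS_ideal_def by(rule ring.genideal_minimal[OF ring_path_algebra])
 moreover have "x + lin (%b. elt (rep b)) (lin nfe x) : KS_ideal m" if "x : vec (paths m)" for x using that
 proof(induction rule: vec_induct)
  case (add x y)
  let ?r = "%x. lin (%b. elt (rep b)) (lin nfe x)"
  have "(x + ?r x) + (y + ?r y) : KS_ideal m" by(rule KS_ideal_closed) (rule add)+
  thus ?case by(simp add: lin_add ac_simps)
 qed(auto simp: KS_ideal_closed path_reduces)
 ultimately show "KS_ideal m = ?K" by fastforce
 show "lin nfe ` vec (paths m) = vec (KB m)"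
 proof(rule lin_image_vec)
  show "nfe p : vec (KB m)" if "p : paths m" for p using nf_KB that by(auto simp: elto_vec)
  show "EX x:vec (paths m). lin nfe x = elt b" if "b : KB m" for b using that nf_rep rep_paths by(intro bexI[of _ "elt (rep b)"]) auto
 qed
qed simp_all

abbreviation KS :: "nat => ks set" where
 "KS m == carrier (KS_algebra m)"

definition kc :: "ks => kb fvec" where
 "kc = value_on nfe"

lemma KS_algebra_simps:
 "KS m = a_rcosets\<^bsub>path_algebra m\<^esub> (KS_ideal m)"
 "add (KS_algebra m) = set_add (path_algebra m)" "zero (KS_algebra m) = KS_ideal m"
 "one (KS_algebra m) = ks_class m (SUM i<=m. elt [i])"
 "mult (KS_algebra m) = rcoset_mult (path_algebra m) (KS_ideal m)" by(simp_all add: KS_algebra_def FactRing_def ks_class_def)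

lemma ks_coords: "coords (KS_algebra m) (KB m) kc"
 unfolding kc_def by(rule kernel_quotient.quotient_coords[OF KS_quotient]) (simp_all add: KS_algebra_simps)

lemma ks_class:
 assumes "x : vec (paths m)"
 shows "ks_class m x : KS m" "kc (ks_class m x) = lin nfe x"
proof -
 interpret kernel_quotient "path_algebra m" "paths m" "KS_ideal m" nfe "KB m" by(rule KS_quotient)
 show "ks_class m x : KS m" using assms by(auto simp: KS_algebra_simps ks_class_def A_RCOSETS_def')
 show "kc (ks_class m x) = lin nfe x" unfolding kc_def ks_class_def by(rule coset_value[OF assms])
qed

lemma ks_carrierE:
 assumes "x : KS m"
 obtains u where "u : vec (paths m)" "x = ks_class m u" using assms by(auto simp: KS_algebra_simps ks_class_def A_RCOSETS_def')

lemma ks_mult: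
 assumes "x : KS m" "y : KS m"
 shows "x \<otimes>\<^bsub>KS_algebra m\<^esub> y : KS m"
  "kc (x \<otimes>\<^bsub>KS_algebra m\<^esub> y) = mulv (kc x) (kc y)"
proof -
 obtain u v where uv: "u : vec (paths m)" "x = ks_class m u" "v : vec (paths m)" "y = ks_class m v" using assms ks_carrierE by metis
 hence "x \<otimes>\<^bsub>KS_algebra m\<^esub> y = ks_class m (path_mult u v)" using ideal.rcoset_mult_add[OF ideal_KS_ideal, of u m v]
  by(simp add: KS_algebra_simps ks_class_def)
 thus "x \<otimes>\<^bsub>KS_algebra m\<^esub> y : KS m"
  "kc (x \<otimes>\<^bsub>KS_algebra m\<^esub> y) = mulv (kc x) (kc y)" using uv by(simp_all add: ks_class path_mult_closed nfe_path_mult)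
qed

lemma ks_one: "\<one>\<^bsub>KS_algebra m\<^esub> : KS m" "kc \<one>\<^bsub>KS_algebra m\<^esub> = onev m"
proof -
 have "(SUM i<=m. elt [i]) : vec (paths m)" by(auto intro: vec_sum)
 from ks_class[OF this] show "\<one>\<^bsub>KS_algebra m\<^esub> : KS m" "kc \<one>\<^bsub>KS_algebra m\<^esub> = onev m"
  by(simp_all add: KS_algebra_simps lin_sum onev_def)
qed

lemma ks_path_coords: "p : paths m ==> ks_path m p : KS m & kc (ks_path m p) = nfe p" using ks_class[of "elt p" m] by simp

lemma ks_grading:
 "KS_grading m j <= KS m"
 "kc ` KS_grading m j = vec {b : KB m. - int (len b) = j}"
proof -
 let ?G = "{p : paths m. - int (length p - 1) = j}"
 have g: "KS_grading m j = ks_class m ` vec ?G" by(auto simp: KS_grading_def vec_def)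
 have v: "x : vec (paths m)" if "x : vec ?G" for x using that by(rule vec_mono) auto
 show "KS_grading m j <= KS m" unfolding g using ks_class v by auto
 have "kc ` ks_class m ` vec ?G = lin nfe ` vec ?G" using ks_class v by(force simp: image_image)
 also have "... = vec {b : KB m. - int (len b) = j}"
 proof(rule lin_image_vec)
  show "nfe p : vec {b : KB m. - int (len b) = j}" if "p : ?G" for p using that nf_KB nf_Some by(auto simp: elto_vec)
  show "EX x:vec ?G. lin nfe x = elt b" if "b : {b : KB m. - int (len b) = j}" for b
  proof(rule bexI[of _ "elt (rep b)"])
  show "lin nfe (elt (rep b)) = elt b" using that nf_rep by auto
  have "length (rep b) - 1 = len b" by(cases b) auto
  thus "elt (rep b) : vec ?G" using that rep_paths by auto
  qed
 qed
 finally show "kc ` KS_grading m j = vec {b : KB m. - int (len b) = j}" unfolding g .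
qed

section \<open>Coordinates on the bimodules of the letters\<close>

lemma f2_induct [case_names zero elt add]:
 assumes "P 0" "!!a. P (elt a)" "!!x y. P x ==> P y ==> P (x + y)"
 shows "P (x :: 'a \<Rightarrow>\<^sub>0 bit)" by(rule vec_induct[of x UNIV]) (auto simp: vec_def intro: assms)

lemma f2_induct2 [case_names zero1 zero2 elt add1 add2]:
 assumes "!!y. P 0 y" "!!x. P x 0" "!!a b. P (elt a) (elt b)"
  "!!x x' y. P x y ==> P x' y ==> P (x + x') y" "!!x y y'. P x y ==> P x y' ==> P x (y + y')"
 shows "P (x :: 'a \<Rightarrow>\<^sub>0 bit) (y :: 'b \<Rightarrow>\<^sub>0 bit)"
proof(induction x rule: f2_induct)
 case (elt a)
 show ?case by(induction y rule: f2_induct) (auto intro: assms)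
qed(auto intro: assms)

lemma f2_induct3 [case_names zero1 zero2 zero3 elt add1 add2 add3]:
 assumes "!!y z. P 0 y z" "!!x z. P x 0 z" "!!x y. P x y 0" "!!a b c. P (elt a) (elt b) (elt c)"
  "!!x x' y z. P x y z ==> P x' y z ==> P (x + x') y z"
  "!!x y y' z. P x y z ==> P x y' z ==> P x (y + y') z"
  "!!x y z z'. P x y z ==> P x y z' ==> P x y (z + z')"
 shows "P (x :: 'a \<Rightarrow>\<^sub>0 bit) (y :: 'b \<Rightarrow>\<^sub>0 bit) (z :: 'c \<Rightarrow>\<^sub>0 bit)"
proof(induction x rule: f2_induct)
 case (elt a)
 show ?case by(induction y z rule: f2_induct2) (auto intro: assms)
qed(auto intro: assms)

lemma piece_iff:
 assumes "coords V H Phi" "P <= carrier V" "Phi ` P = vec H'"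
 shows "x : P <-> x : carrier V & Phi x : vec H'"
proof
 show "x : P" if "x : carrier V & Phi x : vec H'"
 proof -
  have "Phi x : Phi ` P" using that assms(3) by simp
  then obtain y where y: "Phi x = Phi y" "y : P" by(rule imageE)
  hence "x = y" using that assms(2) coords_inject[OF assms(1), of x y] by blast
  thus ?thesis using y by simp
 qed
 show "x : carrier V & Phi x : vec H'" if "x : P" using that assms(2,3) by blast
qed

lemma reduce_coords:
 assumes V: "coords V H Phi" and x: "x : carrier V" "Phi x : vec H'" "H' <= H"
  and rel: "!!x y. x : carrier V ==> y : carrier V ==> Phi x : vec H' ==> Phi y : vec H' ==>
  elt (c (x \<oplus>\<^bsub>V\<^esub> y)) - (elt (c x) + elt (c y)) : R"
  and basis: "!!h. h : H' ==> elt (c (point V Phi (elt h))) + D h : f2_span R"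
 shows "elt (c x) + lin D (Phi x) : f2_span R" using V x
proof(induction rule: coords_induct)
 case zero
 have "(zero V) \<oplus>\<^bsub>V\<^esub> (zero V) = (zero V)"
  using coords_zero[OF V] coords_add[OF V] coords_add_closed[OF V] coords_inject[OF V] by simp
 thus ?case using rel[of "(zero V)" "(zero V)"] coords_zero[OF V] by(auto simp: vec_diff intro: f2_span_base)
next
 case (elt h)
 hence "elt h : vec H" using x(3) by auto
 thus ?case using basis[OF elt] by(simp add: coords_point[OF V])
next
 case (add x y)
 have "(elt (c (x \<oplus>\<^bsub>V\<^esub> y)) + (elt (c x) + elt (c y))) +
  ((elt (c x) + lin D (Phi x)) + (elt (c y) + lin D (Phi y))) : f2_span R"
 proof(rule f2_span_add)
  show "elt (c (x \<oplus>\<^bsub>V\<^esub> y)) + (elt (c x) + elt (c y)) : f2_span R"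
  using rel[of x y] add by(intro f2_span_base) (simp add: vec_diff)
  show "(elt (c x) + lin D (Phi x)) + (elt (c y) + lin D (Phi y)) : f2_span R" by(rule f2_span_add) (rule add)+
 qed
 thus ?case using add by(simp add: coords_add[OF V] lin_add ac_simps)
qed

abbreviation kb_point :: "nat => kb => ks" where
 "kb_point m b == point (KS_algebra m) kc (elt b)"

lemma kb_point: "b : KB m ==> kb_point m b : KS m & kc (kb_point m b) = elt b" using point_closed[OF ks_coords] coords_point[OF ks_coords] by simp

lemmas KS_grading_iff = piece_iff[OF ks_coords ks_grading]

definition PL :: "nat => nat => kb set" where
 "PL m i = {b : KB m. tgt b = i}"

definition PR :: "nat => nat => kb set" where
 "PR m i = {b : KB m. src b = i}"

lemma P_left_iff:
 assumes "i <= m"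
 shows "x : P_left m i <-> x : KS m & kc x : vec (PL m i)"
proof
 have i: "ks_path m [i] : KS m" "kc (ks_path m [i]) = elt (Vertex i)" using ks_path_coords[of "[i]" m] assms by auto
 show "x : KS m & kc x : vec (PL m i)" if x: "x : P_left m i"
 proof -
  obtain a where a: "a : KS m" "x = a \<otimes>\<^bsub>KS_algebra m\<^esub> ks_path m [i]" using x by(auto simp: P_left_def)
  have "lin (%a. elto (mul a (Vertex i))) (kc a) : vec (PL m i)"
  by(rule vec_lin[OF coords_vec[OF ks_coords a(1)]]) (auto simp: elto_vec mul_Vertex_right PL_def split: if_splits)
  thus ?thesis using a i by(simp add: ks_mult mulv_def bil_elt_right)
 qed
 show "x : P_left m i" if x: "x : KS m & kc x : vec (PL m i)"
 proof -
  have "lin (%a. elto (mul a (Vertex i))) (kc x) = lin elt (kc x)" using x by(intro lin_cong_vec[of _ "PL m i"]) (auto simp: mul_Vertex_right PL_def)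
  hence "x = x \<otimes>\<^bsub>KS_algebra m\<^esub> ks_path m [i]"
  using x i by(intro coords_inject[OF ks_coords[of m]]) (simp_all add: ks_mult mulv_def bil_elt_right)
  thus ?thesis unfolding P_left_def using x by blast
 qed
qed

lemma P_right_iff:
 assumes "i <= m"
 shows "x : P_right m i <-> x : KS m & kc x : vec (PR m i)"
proof
 have i: "ks_path m [i] : KS m" "kc (ks_path m [i]) = elt (Vertex i)" using ks_path_coords[of "[i]" m] assms by auto
 show "x : KS m & kc x : vec (PR m i)" if x: "x : P_right m i"
 proof -
  obtain a where a: "a : KS m" "x = ks_path m [i] \<otimes>\<^bsub>KS_algebra m\<^esub> a" using x by(auto simp: P_right_def)
  have "lin (%a. elto (mul (Vertex i) a)) (kc a) : vec (PR m i)"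
  by(rule vec_lin[OF coords_vec[OF ks_coords a(1)]]) (auto simp: elto_vec PR_def split: if_splits)
  thus ?thesis using a i by(simp add: ks_mult mulv_def bil_elt_left)
 qed
 show "x : P_right m i" if x: "x : KS m & kc x : vec (PR m i)"
 proof -
  have "lin (%a. elto (mul (Vertex i) a)) (kc x) = lin elt (kc x)" using x by(intro lin_cong_vec[of _ "PR m i"]) (auto simp: PR_def)
  hence "x = ks_path m [i] \<otimes>\<^bsub>KS_algebra m\<^esub> x"
  using x i by(intro coords_inject[OF ks_coords[of m]]) (simp_all add: ks_mult mulv_def bil_elt_left)
  thus ?thesis unfolding P_right_def using x by blast
 qed
qed

definition ppf :: "ks \<times> ks => (kb \<times> kb) fvec" where
 "ppf = (%(x, y). bil (%p q. elt (p, q)) (kc x) (kc y))"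

definition pc :: "ks2 => (kb \<times> kb) fvec" where
 "pc = value_on ppf"

lemma PL_KB: "PL m i <= KB m" and PR_KB: "PR m i <= KB m" by(auto simp: PL_def PR_def)

lemma mulv_PL: "x : vec (KB m) ==> y : vec (PL m i) ==> mulv x y : vec (PL m i)"
 unfolding mulv_def by(erule (1) vec_bil) (auto simp: elto_vec PL_def dest: mul_Some mul_KB)

lemma mulv_PR: "x : vec (PR m i) ==> y : vec (KB m) ==> mulv x y : vec (PR m i)"
 unfolding mulv_def by(erule (1) vec_bil) (auto simp: elto_vec PR_def dest: mul_Some mul_KB)

lemma PP_gens_point:
 assumes "i <= m" "p : PL m i" "q : PR m i"
 shows "(kb_point m p, kb_point m q) : PP_gens m i" "ppf (kb_point m p, kb_point m q) = elt (p, q)" using assms kb_point[of p m] kb_point[of q m]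
 by(auto simp: PP_gens_def P_left_iff P_right_iff ppf_def PL_def PR_def)

lemma PP_presents:
 assumes i: "i <= m"
 shows "presents (PP_gens m i) (PP_rels m i) ppf (PL m i \<times> PR m i)"
proof(rule presentsI[where g = "%(p, q). elt (kb_point m p, kb_point m q)"])
 note iff = P_left_iff[OF i] P_right_iff[OF i]
 note A = coords_add_closed[OF ks_coords] coords_add[OF ks_coords]
 show "ppf a : vec (PL m i \<times> PR m i)" if a: "a : PP_gens m i" for a
 proof -
  obtain x y where "a = (x, y)" "kc x : vec (PL m i)" "kc y : vec (PR m i)" using a by(auto simp: PP_gens_def iff)
  thus ?thesis by(simp add: ppf_def vec_bil[of _ "PL m i" _ "PR m i"])
 qed
 show "r : vec (PP_gens m i) & lin ppf r = 0" if "r : PP_rels m i" for r using that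
  by(auto simp: PP_rels_def Let_def vec_diff PP_gens_def iff A lin_add ppf_def bil_add_left bil_add_right
  intro!: vec_add)
 show "(case h of (p, q) => elt (kb_point m p, kb_point m q)) : vec (PP_gens m i) &
  lin ppf (case h of (p, q) => elt (kb_point m p, kb_point m q)) = elt h"
  if "h : PL m i \<times> PR m i" for h using that PP_gens_point[OF i] by auto
 show "elt a + lin (%(p, q). elt (kb_point m p, kb_point m q)) (ppf a) : f2_span (PP_rels m i)"
  if a: "a : PP_gens m i" for a
 proof -
  obtain x y where xy: "a = (x, y)" "x : P_left m i" "y : P_right m i" using a by(auto simp: PP_gens_def)
  let ?D = "%p. lin (%q. elt (kb_point m p, kb_point m q)) (kc y)"
  have "elt (x, y) + lin ?D (kc x) : f2_span (PP_rels m i)"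
  proof(rule reduce_coords[OF ks_coords, of x m "PL m i" "%x. (x, y)"])
  fix p assume p: "p : PL m i"
  show "elt (kb_point m p, y) + lin (%q. elt (kb_point m p, kb_point m q)) (kc y) : f2_span (PP_rels m i)"
  proof(rule reduce_coords[OF ks_coords, of y m "PR m i" "%y. (kb_point m p, y)"])
  show "elt (kb_point m p, x \<oplus>\<^bsub>KS_algebra m\<^esub> y) - (elt (kb_point m p, x) + elt (kb_point m p, y)) : PP_rels m i"
  if "x : KS m" "y : KS m" "kc x : vec (PR m i)" "kc y : vec (PR m i)" for x y
  proof -
  have "kb_point m p : P_left m i" using p kb_point[of p m] by(auto simp: iff PL_def)
  moreover have "x : P_right m i" "y : P_right m i" using that by(simp_all add: iff)
  ultimately show ?thesis unfolding PP_rels_def Let_def by blast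
  qed
  qed(use xy iff PR_KB in "auto intro: f2_span_zero")
  next
  show "elt (x \<oplus>\<^bsub>KS_algebra m\<^esub> x', y) - (elt (x, y) + elt (x', y)) : PP_rels m i"
  if "x : KS m" "x' : KS m" "kc x : vec (PL m i)" "kc x' : vec (PL m i)" for x x'
  proof -
  have "x : P_left m i" "x' : P_left m i" using that by(simp_all add: iff)
  thus ?thesis unfolding PP_rels_def Let_def using xy by blast
  qed
  qed(use xy iff PL_KB in auto)
  thus ?thesis unfolding xy ppf_def by(simp add: lin_bil) (simp add: bil_def)
 qed
qed

lemma PP_space: "space (PP m i) = presented_space (PP_gens m i) (PP_rels m i)" by(simp add: PP_def Let_def)

lemma pp_coords: "i <= m ==> coords (space (PP m i)) (PL m i \<times> PR m i) pc" unfolding pc_def PP_space by(rule presented_coords[OF PP_presents])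

lemma PP_class:
 assumes "i <= m" "x : vec (PP_gens m i)"
 shows "PP_class m i x : carrier (space (PP m i))" "pc (PP_class m i x) = lin ppf x"
 unfolding PP_class_def PP_space pc_def using presented_class[OF PP_presents] assms by auto

definition lpp :: "kb => kb \<times> kb => (kb \<times> kb) option" where
 "lpp a = (%(p, q). map_option (%p'. (p', q)) (mul a p))"

definition rpp :: "kb \<times> kb => kb => (kb \<times> kb) option" where
 "rpp = (%(p, q) a. map_option (Pair p) (mul q a))"

lemma bil_pair_mulv:
 "bil (%p q. elt (p, q)) (mulv a x) y = lin (%t. lin (%a. elto (lpp a t)) a) (bil (%p q. elt (p, q)) x y)"
 "bil (%p q. elt (p, q)) x (mulv y a) = lin (%t. lin (%a. elto (rpp t a)) a) (bil (%p q. elt (p, q)) x y)" unfolding mulv_def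
proof(induction a x y rule: f2_induct3)
 case (elt a p q)
 { case 1 show ?case by(cases "mul a p") (simp_all add: lpp_def) }
 { case 2 show ?case by(cases "mul q a") (simp_all add: rpp_def) }
qed(simp_all add: bil_add_left bil_add_right lin_add lin_fun_add)

lemma PP_lact:
 assumes i: "i <= m" and a: "a : KS m" and t: "t : carrier (space (PP m i))"
 shows "lact (PP m i) a t : carrier (space (PP m i))" (is ?g1)
  "pc (lact (PP m i) a t) = bil (%a t. elto (lpp a t)) (kc a) (pc t)" (is ?g2)
proof -
 let ?phi = "%(x, y). PP_class m i (elt (a \<otimes>\<^bsub>KS_algebra m\<^esub> x, y))"
 have e: "lact (PP m i) a t = extend_linear (space (PP m i)) ?phi t" by(simp add: PP_def Let_def)
 have *: "?phi g : carrier (space (PP m i)) & pc (?phi g) = lin (%t. lin (%a. elto (lpp a t)) (kc a)) (ppf g)"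
  if "g : PP_gens m i" for g
 proof -
  obtain x y where g: "g = (x, y)" "x : P_left m i" "y : P_right m i" using `g : PP_gens m i` by(auto simp: PP_gens_def)
  have "mulv (kc a) (kc x) : vec (PL m i)" using g coords_vec[OF ks_coords a] by(simp add: P_left_iff[OF i] mulv_PL)
  hence "elt (a \<otimes>\<^bsub>KS_algebra m\<^esub> x, y) : vec (PP_gens m i)" using g a by(auto simp: PP_gens_def P_left_iff[OF i] ks_mult)
  from PP_class[OF i this] show ?thesis using g a by(auto simp: ppf_def ks_mult bil_pair_mulv P_left_iff[OF i])
 qed
 note l = extend_linear_coords[OF PP_presents[OF i] pp_coords[OF i] * t[unfolded PP_space]]
 show ?g1 unfolding e by(rule l(1))
 show ?g2
  unfolding e bil_def pc_def using l(2)[unfolded pc_def] lin_swap[of "%a t. elto (lpp a t)" "value_on ppf t" "kc a"] by simp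
qed

lemma PP_ract:
 assumes i: "i <= m" and a: "a : KS m" and t: "t : carrier (space (PP m i))"
 shows "ract (PP m i) t a : carrier (space (PP m i))" (is ?g1)
  "pc (ract (PP m i) t a) = bil (%t a. elto (rpp t a)) (pc t) (kc a)" (is ?g2)
proof -
 let ?phi = "%(x, y). PP_class m i (elt (x, y \<otimes>\<^bsub>KS_algebra m\<^esub> a))"
 have e: "ract (PP m i) t a = extend_linear (space (PP m i)) ?phi t" by(simp add: PP_def Let_def)
 have *: "?phi g : carrier (space (PP m i)) & pc (?phi g) = lin (%t. lin (%a. elto (rpp t a)) (kc a)) (ppf g)"
  if "g : PP_gens m i" for g
 proof -
  obtain x y where g: "g = (x, y)" "x : P_left m i" "y : P_right m i" using `g : PP_gens m i` by(auto simp: PP_gens_def)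
  have "mulv (kc y) (kc a) : vec (PR m i)" using g coords_vec[OF ks_coords a] by(simp add: P_right_iff[OF i] mulv_PR)
  hence "elt (x, y \<otimes>\<^bsub>KS_algebra m\<^esub> a) : vec (PP_gens m i)" using g a by(auto simp: PP_gens_def P_right_iff[OF i] ks_mult)
  from PP_class[OF i this] show ?thesis using g a by(auto simp: ppf_def ks_mult bil_pair_mulv P_right_iff[OF i])
 qed
 note l = extend_linear_coords[OF PP_presents[OF i] pp_coords[OF i] * t[unfolded PP_space]]
 show ?g1 unfolding e by(rule l(1))
 show ?g2 unfolding e bil_def pc_def using l(2)[unfolded pc_def] by simp
qed

lemma PP_piece:
 assumes i: "i <= m"
 shows "t : piece (PP m i) h q <-> t : carrier (space (PP m i)) &
  pc t : vec {x : PL m i \<times> PR m i. h = 0 & - int (len (fst x)) - int (len (snd x)) = q}"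
proof(rule piece_iff[OF pp_coords[OF i]])
 let ?G = "{(a, b) : PP_gens m i. EX j j'. a : KS_grading m j & b : KS_grading m j' & j + j' = q}"
 let ?H = "{x : PL m i \<times> PR m i. - int (len (fst x)) - int (len (snd x)) = q}"
 have 0: "piece (PP m i) h q = (if h = 0 then {PP_class m i x | x. Poly_Mapping.keys x <= ?G} else {\<zero>\<^bsub>space (PP m i)\<^esub>})"
  by(simp add: PP_def Let_def)
 have f: "ppf g : vec ?H" if g: "g : ?G" for g
 proof -
  obtain a b j j' where ab: "g = (a, b)" "(a, b) : PP_gens m i" "a : KS_grading m j" "b : KS_grading m j'" "j + j' = q" using g by blast
  have "vec (PL m i) Int vec {b : KB m. - int (len b) = j} <= vec {b : PL m i. - int (len b) = j}"
  "vec (PR m i) Int vec {b : KB m. - int (len b) = j'} <= vec {b : PR m i. - int (len b) = j'}" by(auto simp: vec_def)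
  hence "kc a : vec {b : PL m i. - int (len b) = j}" "kc b : vec {b : PR m i. - int (len b) = j'}"
  using ab by(auto simp: PP_gens_def KS_grading_iff P_left_iff[OF i] P_right_iff[OF i])
  thus ?thesis unfolding ab(1) ppf_def prod.case using ab(5) by(elim vec_bil) auto
 qed
 have s: "EX x:vec ?G. lin ppf x = elt g" if g: "g : ?H" for g
 proof -
  obtain p q' where pq: "g = (p, q')" "p : PL m i" "q' : PR m i" "- int (len p) - int (len q') = q" using g by(cases g) auto
  have "(kb_point m p, kb_point m q') : ?G" using pq PP_gens_point[OF i pq(2,3)] kb_point[of p m] kb_point[of q' m]
  by(intro CollectI case_prodI conjI exI[of _ "- int (len p)"] exI[of _ "- int (len q')"])
  (auto simp: KS_grading_iff PL_def PR_def)
  thus ?thesis using PP_gens_point[OF i pq(2,3)] pq(1) by(intro bexI[of _ "elt (kb_point m p, kb_point m q')"]) auto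
 qed
 note p = presented_pieces[OF PP_presents[OF i] _ f s, folded PP_class_def PP_space pc_def]
 show "piece (PP m i) h q <= carrier (space (PP m i))" unfolding 0 using p(1) coords_zero[OF pp_coords[OF i]] by auto
 have "{x : PL m i \<times> PR m i. h = 0 & - int (len (fst x)) - int (len (snd x)) = q} = (if h = 0 then ?H else {})" by auto
 thus "pc ` piece (PP m i) h q = vec {x : PL m i \<times> PR m i. h = 0 & - int (len (fst x)) - int (len (snd x)) = q}"
  unfolding 0 using p(2) coords_zero[OF pp_coords[OF i]] by(auto simp: vec_def)
qed

definition gamv :: "nat => nat => (kb \<times> kb) fvec" where
 "gamv m i = elt (Step (i - 1) i, Step i (i - 1)) +
  (if i < m then elt (Step (i + 1) i, Step i (i + 1)) else 0) +
  elt (Vertex i, Loop i) + elt (Loop i, Vertex i)"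

lemma KS_beta_coords:
 assumes i: "i <= m" and t: "t : carrier (space (PP m i))"
 shows "KS_beta m i t : KS m"
  "kc (KS_beta m i t) = lin (%(p, q). elto (mul p q)) (pc t)"
proof -
 let ?V = "space (KS_regular m)"
 have V: "coords ?V (KB m) kc" and c: "carrier ?V = KS m" using ks_coords[of m] by(simp_all add: coords_def KS_regular_def Let_def)
 have *: "(case g of (x, y) => x \<otimes>\<^bsub>KS_algebra m\<^esub> y) : carrier ?V &
  kc (case g of (x, y) => x \<otimes>\<^bsub>KS_algebra m\<^esub> y) = lin (%(p, q). elto (mul p q)) (ppf g)"
  if "g : PP_gens m i" for g using that by(auto simp: PP_gens_def P_left_iff[OF i] P_right_iff[OF i] c ks_mult mulv_def ppf_def lin_bil)
 note l = extend_linear_coords[OF PP_presents[OF i] V * t[unfolded PP_space], folded pc_def, unfolded c]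
 show "KS_beta m i t : KS m"
  "kc (KS_beta m i t) = lin (%(p, q). elto (mul p q)) (pc t)" unfolding KS_beta_def using l by simp_all
qed

lemma KS_gamma_coords:
 assumes i: "1 <= i" "i <= m" and a: "a : KS m"
 shows "KS_gamma m i a : carrier (space (PP m i))" (is ?g1)
  "pc (KS_gamma m i a) = bil (%a t. elto (lpp a t)) (kc a) (gamv m i)"
proof -
 have g: "(ks_path m p, ks_path m q) : PP_gens m i & ppf (ks_path m p, ks_path m q) = bil (%p q. elt (p, q)) (nfe p) (nfe q)"
  if "p : paths m" "q : paths m" "last p = i" "hd q = i" for p q using that ks_path_coords[OF that(1)] ks_path_coords[OF that(2)] nf_KB nf_Some
  by(auto simp: PP_gens_def P_left_iff[OF i(2)] P_right_iff[OF i(2)] ppf_def elto_vec PL_def PR_def)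
 have p: "[i - 1, i] : paths m" "[i, i - 1] : paths m" "[i] : paths m" "[i, i - 1, i] : paths m" using i by auto
 have p': "[i + 1, i] : paths m" "[i, i + 1] : paths m" if "i < m" using that by auto
 have n: "nf [i - 1, i] = Some (Step (i - 1) i)" "nf [i, i - 1] = Some (Step i (i - 1))"
  "nf [i, i - 1, i] = Some (Loop i)" using i by auto
 have n': "nf [Suc i, i] = Some (Step (Suc i) i)" "nf [i, Suc i] = Some (Step i (Suc i))" by auto
 have "(elt (ks_path m [i - 1, i], ks_path m [i, i - 1]) +
  (if i < m then elt (ks_path m [i + 1, i], ks_path m [i, i + 1]) else 0) +
  elt (ks_path m [i], ks_path m [i, i - 1, i]) +
  elt (ks_path m [i, i - 1, i], ks_path m [i])) : vec (PP_gens m i)" using g p p' by(intro vec_add) simp_all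
 from PP_class[OF i(2) this] have 1: "KS_gamma_one m i : carrier (space (PP m i))" "pc (KS_gamma_one m i) = gamv m i"
  using g p p' n n' by(simp_all add: KS_gamma_one_def gamv_def lin_add del: nf.simps(3))
 show ?g1
  "pc (KS_gamma m i a) = bil (%a t. elto (lpp a t)) (kc a) (gamv m i)" unfolding KS_gamma_def using PP_lact[OF i(2) a 1(1)] 1(2) by simp_all
qed

definition inl :: "'a fvec => ('a + 'b \<Rightarrow>\<^sub>0 bit)" where
 "inl = lin (%x. elt (Inl x))"

definition inr :: "'b fvec => ('a + 'b \<Rightarrow>\<^sub>0 bit)" where
 "inr = lin (%x. elt (Inr x))"

lemma inl_simps [simp]: "inl 0 = 0" "inl (elt x) = elt (Inl x)" "inl (u + u') = inl u + inl u'" by(simp_all add: inl_def lin_add)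

lemma inr_simps [simp]: "inr 0 = 0" "inr (elt z) = elt (Inr z)" "inr (v + v') = inr v + inr v'" by(simp_all add: inr_def lin_add)

lemma lin_inl: "lin f (inl u) = lin (%x. f (Inl x)) u" and lin_inr: "lin f (inr v) = lin (%x. f (Inr x)) v" by(simp_all add: inl_def inr_def lin_lin)

lemma inl_inr_parts:
 "lin (case_sum elt (%_. 0)) (inl u + inr v) = u" "lin (case_sum (%_. 0) elt) (inl u + inr v) = v" by(simp_all add: lin_add lin_inl lin_inr)

lemma vec_inl: "u : vec (Inl -` K) ==> inl u : vec K" and vec_inr: "v : vec (Inr -` K) ==> inr v : vec K"
 unfolding inl_def inr_def by(erule vec_lin; simp)+

lemma vec_inl_inr: "inl u + inr v : vec K <-> u : vec (Inl -` K) & v : vec (Inr -` K)"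
proof
 assume *: "inl u + inr v : vec K"
 have "lin (case_sum elt (%_. 0)) (inl u + inr v) : vec (Inl -` K)"
  "lin (case_sum (%_. 0) elt) (inl u + inr v) : vec (Inr -` K)" by(rule vec_lin[OF *], auto split: sum.splits)+
 thus "u : vec (Inl -` K) & v : vec (Inr -` K)" by(simp add: inl_inr_parts)
qed(auto intro: vec_add vec_inl vec_inr)

lemma inl_inr_decompose: "y = inl (lin (case_sum elt (%_. 0)) y) + inr (lin (case_sum (%_. 0) elt) y)"
proof(induction y rule: f2_induct)
 case (elt a)
 thus ?case by(cases a) simp_all
next
 case (add x y)
 have "x + y = (inl (lin (case_sum elt (%_. 0)) x) + inr (lin (case_sum (%_. 0) elt) x)) +
  (inl (lin (case_sum elt (%_. 0)) y) + inr (lin (case_sum (%_. 0) elt) y))" by(rule arg_cong2[where f = "(+)", OF add])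
 also have "... = inl (lin (case_sum elt (%_. 0)) (x + y)) + inr (lin (case_sum (%_. 0) elt) (x + y))" by(simp add: lin_add ac_simps)
 finally show ?case .
qed simp

lemma dg_sum_coords:
 assumes X: "coords (space X) H1 Phi1" and Y: "coords (space Y) H2 Phi2"
 shows "coords (space (dg_sum X Y d)) (Inl ` H1 Un Inr ` H2) (%(x, y). inl (Phi1 x) + inr (Phi2 y))"
proof -
 let ?S = "carrier (space X) \<times> carrier (space Y)" and ?Phi = "%(x, y). inl (Phi1 x) + inr (Phi2 y)"
 have v: "Inl -` (Inl ` H1 Un Inr ` H2) = H1" "Inr -` (Inl ` H1 Un Inr ` H2) = H2" by auto
 have "inj_on ?Phi ?S"
 proof(rule inj_onI)
  fix a b assume ab: "a : ?S" "b : ?S" "?Phi a = ?Phi b"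
  obtain x y x' y' where e: "a = (x, y)" "b = (x', y')" by(metis prod.exhaust)
  have "Phi1 x = Phi1 x'" "Phi2 y = Phi2 y'"
  using ab(3) inl_inr_parts[of "Phi1 x" "Phi2 y"] inl_inr_parts[of "Phi1 x'" "Phi2 y'"] by(simp_all add: e)
  thus "a = b" using ab(1,2) e coords_inject[OF X] coords_inject[OF Y] by auto
 qed
 moreover have "?Phi ` ?S = vec (Inl ` H1 Un Inr ` H2)"
 proof
  show "?Phi ` ?S <= vec (Inl ` H1 Un Inr ` H2)" using coords_vec[OF X] coords_vec[OF Y] by(auto simp: vec_inl_inr v simp del: vimage_Un)
  show "vec (Inl ` H1 Un Inr ` H2) <= ?Phi ` ?S"
  proof
  fix y assume y: "y : vec (Inl ` H1 Un Inr ` H2)"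
  let ?u = "lin (case_sum elt (%_. 0)) y" and ?v = "lin (case_sum (%_. 0) elt) y"
  have uv: "?u : vec H1" "?v : vec H2"
  using y inl_inr_decompose[of y] vec_inl_inr[of ?u ?v "Inl ` H1 Un Inr ` H2"] by(simp_all add: v del: vimage_Un)
  show "y : ?Phi ` ?S" by(rule image_eqI[of _ _ "(point (space X) Phi1 ?u, point (space Y) Phi2 ?v)"])
  (use uv inl_inr_decompose[of y] in
  "simp_all add: coords_point[OF X] coords_point[OF Y] point_closed[OF X] point_closed[OF Y]")
  qed
 qed
 ultimately show ?thesis unfolding coords_def bij_betw_def
  by(auto simp: dg_sum_def coords_zero[OF X] coords_zero[OF Y] coords_add_closed[OF X] coords_add_closed[OF Y]
  coords_add[OF X] coords_add[OF Y] ac_simps)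
qed

type_synonym lb = "kb \<times> kb + kb"

text \<open>
  The bimodule of the empty word is treated as that of an additional letter \<open>(0, 0)\<close>, without a
  first summand and with zero differential.
\<close>

definition letter :: "nat => nat \<times> int => (ks_cpx, ks) dg_bimodule" where
 "letter m l = (if snd l = 0 then KS_unit m else KS_letter m l)"

abbreviation LS :: "nat => nat \<times> int => ks_cpx set" where
 "LS m l == carrier (space (letter m l))"

fun good :: "nat => nat \<times> int => bool" where
 "good m (i, e) <-> (e = 0 & i = 0) | ((e = 1 | e = -1) & 1 <= i & i <= m)"

definition LB :: "nat => nat \<times> int => lb set" where
 "LB m l = Inl ` (if snd l = 0 then {} else PL m (fst l) \<times> PR m (fst l)) Un Inr ` KB m"

definition lc :: "ks_cpx => lb fvec" where
 "lc = (%(t, a). inl (pc t) + inr (kc a))"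

lemma KS_regular_coords: "coords (space (KS_regular m)) (KB m) kc" using ks_coords[of m] by(simp add: coords_def KS_regular_def Let_def)

lemma zero_part_coords: "coords (space X) H Phi ==> coords (space (zero_part X)) {} Phi"
 using coords_add_closed[of "space X" H Phi "\<zero>\<^bsub>space X\<^esub>" "\<zero>\<^bsub>space X\<^esub>"]
  coords_add[of "space X" H Phi "\<zero>\<^bsub>space X\<^esub>" "\<zero>\<^bsub>space X\<^esub>"]
  coords_inject[of "space X" H Phi "\<zero>\<^bsub>space X\<^esub> \<oplus>\<^bsub>space X\<^esub> \<zero>\<^bsub>space X\<^esub>" "\<zero>\<^bsub>space X\<^esub>"]
 by(auto simp: coords_def zero_part_def bij_betw_def vec_def)

lemma good_cases:
 assumes "good m l"
 obtains (empty) "l = (0, 0)" | (plus) i where "l = (i, 1)" "1 <= i" "i <= m" | (minus) i where "l = (i, -1)" "1 <= i" "i <= m"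
 using assms by(cases l) auto

lemma dg_sum_space_shift [simp]:
 "space (dg_sum (dg_shift k j X) Y d) = space (dg_sum X Y d)"
 "space (dg_sum X (dg_shift k j Y) d) = space (dg_sum X Y d)" by(simp_all add: dg_sum_def dg_shift_def)

lemma letter_coords:
 assumes "good m l"
 shows "coords (space (letter m l)) (LB m l) lc" using assms
proof(cases l rule: good_cases[of m])
 case empty
 thus ?thesis using dg_sum_coords[OF zero_part_coords[OF pp_coords[of 0 m]] KS_regular_coords[of m]]
  by(simp add: letter_def KS_unit_def lc_def LB_def)
next
 case (plus i)
 thus ?thesis using dg_sum_coords[OF pp_coords[of i m] KS_regular_coords[of m]] by(simp add: letter_def KS_letter_def lc_def LB_def)
next
 case (minus i)
 thus ?thesis using dg_sum_coords[OF pp_coords[of i m] KS_regular_coords[of m]] by(simp add: letter_def KS_letter_def lc_def LB_def)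
qed

lemma letter_carrier:
 assumes "good m l" "x : LS m l"
 obtains t a where "x = (t, a)" "t : carrier (space (PP m (fst l)))" "a : KS m"
  "fst l <= m" "snd l = 0 --> t = \<zero>\<^bsub>space (PP m (fst l))\<^esub>"
proof -
 obtain t a where x: "x = (t, a)" by(cases x)
 have "t : carrier (space (PP m (fst l))) & a : KS m &
  fst l <= m & (snd l = 0 --> t = \<zero>\<^bsub>space (PP m (fst l))\<^esub>)" using assms(1)
 proof(cases l rule: good_cases[of m])
  case empty
  thus ?thesis using assms(2) coords_zero[OF pp_coords[of 0 m]]
  by(auto simp: x letter_def KS_unit_def dg_sum_def zero_part_def KS_regular_def Let_def)
 qed(use assms(2) in "auto simp: x letter_def KS_letter_def dg_sum_def dg_shift_def KS_regular_def Let_def")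
 thus ?thesis using that x by blast
qed

lemma letter_carrierI:
 assumes "good m l" "t : carrier (space (PP m (fst l)))" "a : KS m"
  and "snd l = 0 ==> t = \<zero>\<^bsub>space (PP m (fst l))\<^esub>"
 shows "(t, a) : LS m l" using assms(1) by(cases l rule: good_cases[of m])
  (use assms in "auto simp: letter_def KS_unit_def KS_letter_def dg_sum_def dg_shift_def zero_part_def KS_regular_def Let_def")

lemma letter_actions:
 assumes "good m l"
 shows "lact (letter m l) a (t, b) = (lact (PP m (fst l)) a t, a \<otimes>\<^bsub>KS_algebra m\<^esub> b)"
  "ract (letter m l) (t, b) a = (ract (PP m (fst l)) t a, b \<otimes>\<^bsub>KS_algebra m\<^esub> a)" using assms by(cases l rule: good_cases[of m];
  auto simp: letter_def KS_unit_def KS_letter_def dg_sum_def dg_shift_def zero_part_def KS_regular_def Let_def)+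

definition lal :: "kb => lb => lb option" where
 "lal a x = (case x of Inl t => map_option Inl (lpp a t) | Inr b => map_option Inr (mul a b))"

definition lar :: "lb => kb => lb option" where
 "lar x a = (case x of Inl t => map_option Inl (rpp t a) | Inr b => map_option Inr (mul b a))"

lemma elto_map: "elto (map_option f a) = lin (%x. elt (f x)) (elto a)" by(cases a) simp_all

lemma bil_lal: "bil (%a x. elto (lal a x)) a (inl u + inr v) =
  inl (bil (%a t. elto (lpp a t)) a u) + inr (bil (%a b. elto (mul a b)) a v)"
proof -
 have "bil (%a x. elto (lal a x)) a (inl u) = inl (bil (%a t. elto (lpp a t)) a u)"
  "bil (%a x. elto (lal a x)) a (inr v) = inr (bil (%a b. elto (mul a b)) a v)"
  unfolding inl_def inr_def lin_bil bil_lin_right' by(simp_all add: lal_def elto_map)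
 thus ?thesis by(simp add: bil_add_right)
qed

lemma bil_lar: "bil (%x a. elto (lar x a)) (inl u + inr v) a =
  inl (bil (%t a. elto (rpp t a)) u a) + inr (bil (%b a. elto (mul b a)) v a)"
proof -
 have "bil (%x a. elto (lar x a)) (inl u) a = inl (bil (%t a. elto (rpp t a)) u a)"
  "bil (%x a. elto (lar x a)) (inr v) a = inr (bil (%b a. elto (mul b a)) v a)"
  unfolding inl_def inr_def lin_bil bil_lin_left' by(simp_all add: lar_def elto_map)
 thus ?thesis by(simp add: bil_add_left)
qed

lemma letter_lact:
 assumes l: "good m l" and a: "a : KS m" and x: "x : LS m l"
 shows "lact (letter m l) a x : LS m l"
  "lc (lact (letter m l) a x) = bil (%a x. elto (lal a x)) (kc a) (lc x)" (is ?g1)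
proof -
 obtain t b where tb: "x = (t, b)" "t : carrier (space (PP m (fst l)))" "b : KS m"
  "fst l <= m" "snd l = 0 --> t = \<zero>\<^bsub>space (PP m (fst l))\<^esub>" by(rule letter_carrier[OF l x])
 note p = PP_lact[OF tb(4) a tb(2)] and z = coords_zero[OF pp_coords[OF tb(4)]]
 have "snd l = 0 ==> lact (PP m (fst l)) a t = \<zero>\<^bsub>space (PP m (fst l))\<^esub>"
  using p z tb(5) by(intro coords_inject[OF pp_coords[OF tb(4)]]) simp_all
 thus "lact (letter m l) a x : LS m l" unfolding tb(1) letter_actions[OF l] using p ks_mult[OF a tb(3)] by(intro letter_carrierI[OF l])
 show ?g1
  unfolding tb(1) letter_actions[OF l] lc_def prod.case bil_lal p(2) ks_mult[OF a tb(3)] mulv_def ..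
qed

lemma letter_ract:
 assumes l: "good m l" and a: "a : KS m" and x: "x : LS m l"
 shows "ract (letter m l) x a : LS m l"
  "lc (ract (letter m l) x a) = bil (%x a. elto (lar x a)) (lc x) (kc a)" (is ?g1)
proof -
 obtain t b where tb: "x = (t, b)" "t : carrier (space (PP m (fst l)))" "b : KS m"
  "fst l <= m" "snd l = 0 --> t = \<zero>\<^bsub>space (PP m (fst l))\<^esub>" by(rule letter_carrier[OF l x])
 note p = PP_ract[OF tb(4) a tb(2)] and z = coords_zero[OF pp_coords[OF tb(4)]]
 have "snd l = 0 ==> ract (PP m (fst l)) t a = \<zero>\<^bsub>space (PP m (fst l))\<^esub>"
  using p z tb(5) by(intro coords_inject[OF pp_coords[OF tb(4)]]) simp_all
 thus "ract (letter m l) x a : LS m l" unfolding tb(1) letter_actions[OF l] using p ks_mult[OF tb(3) a] by(intro letter_carrierI[OF l])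
 show ?g1
  unfolding tb(1) letter_actions[OF l] lc_def prod.case bil_lar p(2) ks_mult[OF tb(3) a] mulv_def ..
qed

fun dlet :: "nat => nat \<times> int => lb => lb fvec" where
 "dlet m (i, e) (Inl (p, q)) = (if e = 1 then inr (elto (mul p q)) else 0)"
| "dlet m (i, e) (Inr b) = (if e = -1 then inl (lin (%t. elto (lpp b t)) (gamv m i)) else 0)"

lemma lin_dlet:
 "lin (dlet m (i, 1)) (inl u + inr v) = inr (lin (%(p, q). elto (mul p q)) u)"
 "lin (dlet m (i, -1)) (inl u + inr v) = inl (bil (%a t. elto (lpp a t)) v (gamv m i))"
 "lin (dlet m (i, 0)) (inl u + inr v) = 0"
proof -
 have "(%x. dlet m (i, e) (Inl x)) = (%x. if e = 1 then inr (elto (mul (fst x) (snd x))) else 0)" for e by(auto simp: fun_eq_iff)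
 thus "lin (dlet m (i, 1)) (inl u + inr v) = inr (lin (%(p, q). elto (mul p q)) u)"
  "lin (dlet m (i, -1)) (inl u + inr v) = inl (bil (%a t. elto (lpp a t)) v (gamv m i))"
  "lin (dlet m (i, 0)) (inl u + inr v) = 0" by(simp_all add: lin_add lin_inl lin_inr case_prod_unfold bil_def)
  (simp_all add: inr_def inl_def lin_lin)
qed

lemma letter_diff:
 assumes l: "good m l" and x: "x : LS m l"
 shows "diff (letter m l) x : LS m l" "lc (diff (letter m l) x) = lin (dlet m l) (lc x)"
proof -
 obtain t b where tb: "x = (t, b)" "t : carrier (space (PP m (fst l)))" "b : KS m"
  "fst l <= m" "snd l = 0 --> t = \<zero>\<^bsub>space (PP m (fst l))\<^esub>" by(rule letter_carrier[OF l x])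
 note z = coords_zero[OF pp_coords[OF tb(4)]] and z' = coords_zero[OF ks_coords[of m]]
 have "diff (letter m l) x : LS m l & lc (diff (letter m l) x) = lin (dlet m l) (lc x)" using l
 proof(cases l rule: good_cases[of m])
  case empty
  thus ?thesis using letter_carrierI[OF l z(1) z'(1)] z z' by(simp add: tb(1) letter_def KS_unit_def dg_sum_def lc_def lin_dlet)
 next
  case (plus i)
  thus ?thesis using letter_carrierI[OF l z(1), of "KS_beta m i t"] z z' KS_beta_coords[of i m t] tb
  by(simp add: letter_def KS_letter_def dg_sum_def lc_def lin_dlet)
 next
  case (minus i)
  thus ?thesis using letter_carrierI[OF l, of "KS_gamma m i b" "\<zero>\<^bsub>KS_algebra m\<^esub>"] z z' KS_gamma_coords[of i m b] tb
  by(simp add: letter_def KS_letter_def dg_sum_def lc_def lin_dlet)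
 qed
 thus "diff (letter m l) x : LS m l" "lc (diff (letter m l) x) = lin (dlet m l) (lc x)" by auto
qed

fun lh :: "nat \<times> int => lb => int" where
 "lh (i, e) (Inl t) = (if e = 1 then 0 else 1)"
| "lh (i, e) (Inr b) = (if e = 1 then 1 else 0)"

fun lq :: "nat \<times> int => lb => int" where
 "lq (i, e) (Inl (p, q)) = (if e = 1 then 1 else 2) - int (len p) - int (len q)"
| "lq (i, e) (Inr b) = (if e = 1 then 1 else 0) - int (len b)"

lemma regular_piece:
 "a : piece (KS_regular m) h q <-> a : KS m & kc a : vec {b : KB m. h = 0 & - int (len b) = q}"
proof(cases "h = 0")
 case True
 thus ?thesis by(simp add: KS_regular_def Let_def KS_grading_iff)
next
 case False
 have "a = \<zero>\<^bsub>KS_algebra m\<^esub> <-> a : KS m & kc a = 0"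
  using coords_zero[OF ks_coords[of m]] coords_inject[OF ks_coords[of m], of a "\<zero>\<^bsub>KS_algebra m\<^esub>"] by auto
 thus ?thesis using False by(simp add: KS_regular_def Let_def vec_def)
qed

lemma letter_piece:
 assumes l: "good m l"
 shows "x : piece (letter m l) h q <->
  x : LS m l & lc x : vec {y : LB m l. lh l y = h & lq l y = q}"
proof -
 obtain t a where x: "x = (t, a)" by(cases x)
 let ?K = "{y : LB m l. lh l y = h & lq l y = q}"
 have k: "lc x : vec ?K <-> pc t : vec (Inl -` ?K) & kc a : vec (Inr -` ?K)" by(simp add: x lc_def vec_inl_inr)
 show ?thesis using l
 proof(cases l rule: good_cases[of m])
  case empty
  have K: "Inl -` ?K = {}" "Inr -` ?K = {b : KB m. h = 0 & - int (len b) = q}" by(auto simp: LB_def empty)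
  have "pc \<zero>\<^bsub>space (PP m 0)\<^esub> = 0" using coords_zero[OF pp_coords[of 0 m]] by simp
  thus ?thesis unfolding k K by(auto simp: x empty letter_def KS_unit_def dg_sum_def zero_part_def regular_piece)
  (auto simp: KS_regular_def Let_def)
 next
  case (plus i)
  have K: "Inl -` ?K = {x : PL m i \<times> PR m i. h = 0 & - int (len (fst x)) - int (len (snd x)) = q - 1}"
  "Inr -` ?K = {b : KB m. h - 1 = 0 & - int (len b) = q - 1}" by(auto simp: LB_def plus)
  show ?thesis unfolding k K using plus by(auto simp: x letter_def KS_letter_def dg_sum_def dg_shift_def gshift_def regular_piece PP_piece)
  (auto simp: KS_regular_def Let_def)
 next
  case (minus i)
  have K: "Inl -` ?K = {x : PL m i \<times> PR m i. h - 1 = 0 & - int (len (fst x)) - int (len (snd x)) = q - 2}"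
  "Inr -` ?K = {b : KB m. h = 0 & - int (len b) = q}" by(auto simp: LB_def minus)
  show ?thesis unfolding k K using minus by(auto simp: x letter_def KS_letter_def dg_sum_def dg_shift_def gshift_def regular_piece PP_piece)
  (auto simp: KS_regular_def Let_def)
 qed
qed

section \<open>A basis of the tensor product of the letters\<close>

text \<open>
  In \<open>A \<otimes>\<^sub>A N = N\<close> and \<open>(P\<^sub>i \<otimes> \<^sub>iP) \<otimes>\<^sub>A N = P\<^sub>i \<otimes> (i)N\<close> all middle factors can be pushed to the right. So a
  basis element is a word: for each letter \<open>None\<close> if the summand \<open>A\<close> is chosen there and \<open>Some p\<close>, with
  \<open>p\<close> ending at \<open>i\<close>, if \<open>P\<^sub>i \<otimes> \<^sub>iP\<close> is, followed by a last basis element of \<open>A\<close>; the path after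
  \<open>Some p\<close> starts at \<open>i\<close>.
\<close>

type_synonym word = "kb option list \<times> kb"

definition consw :: "kb option => word => word" where
 "consw u = (%(us, b). (u # us, b))"

lemma consw_simp [simp]: "consw u (us, b) = (u # us, b)" by(simp add: consw_def)

fun srcw :: "word => nat" where
 "srcw ([], b) = src b"
| "srcw (None # us, b) = srcw (us, b)"
| "srcw (Some p # us, b) = src p"

fun lmw :: "kb => word => word option" where
 "lmw a ([], b) = map_option (Pair []) (mul a b)"
| "lmw a (None # us, b) = map_option (consw None) (lmw a (us, b))"
| "lmw a (Some p # us, b) = map_option (%p. (Some p # us, b)) (mul a p)"

definition rmw :: "word => kb => word option" where
 "rmw = (%(us, b) a. map_option (Pair us) (mul b a))"

fun okw :: "nat => braid_word => word => bool" where
 "okw m [] (us, b) <-> us = [] & b : KB m"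
| "okw m (l # ls) ([], b) <-> False"
| "okw m (l # ls) (None # us, b) <-> okw m ls (us, b)"
| "okw m (l # ls) (Some p # us, b) <-> snd l ~= 0 & p : PL m (fst l) & okw m ls (us, b) & srcw (us, b) = fst l"

definition NW :: "nat => braid_word => word set" where
 "NW m ls = {y. okw m ls y}"

lemma okw_length: "okw m ls (us, b) ==> length us = length ls" by(induction m ls "(us, b)" arbitrary: us rule: okw.induct) auto

lemma okw_last: "okw m ls (us, b) ==> b : KB m" by(induction m ls "(us, b)" arbitrary: us rule: okw.induct) auto

lemma lmw_Some:
 "lmw a y = Some z ==> srcw z = src a & tgt a = srcw y & length (fst z) = length (fst y)"
 by(induction a y arbitrary: z rule: lmw.induct) (auto dest: mul_Some)

lemma okw_lmw: "okw m ls y ==> a : KB m ==> lmw a y = Some z ==> okw m ls z"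
proof(induction m ls y arbitrary: z rule: okw.induct)
 case (4 m l ls p us b)
 then obtain q where "mul a p = Some q" "z = (Some q # us, b)" by auto
 thus ?case using 4 mul_KB[of a m p q] mul_Some[of a p q] by(auto simp: PL_def)
qed(auto intro: mul_KB)

lemma okw_rmw: "okw m ls y ==> a : KB m ==> rmw y a = Some z ==> okw m ls z & srcw z = srcw y"
proof(induction m ls y arbitrary: z rule: okw.induct)
 case (3 m l ls us b)
 thus ?case by(auto simp: rmw_def)
next
 case (4 m l ls p us b)
 thus ?case by(auto simp: rmw_def)
qed(auto simp: rmw_def intro: mul_KB dest: mul_Some)

lemma lmw_assoc: "Option.bind (mul a b) (%c. lmw c y) = Option.bind (lmw b y) (lmw a)"
proof(induction b y rule: lmw.induct)
 case (1 b c)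
 thus ?case using mul_assoc[of a b c] by(cases "mul a b"; cases "mul b c") (auto simp: Option.bind_eq_Some_conv)
next
 case (2 b us c)
 thus ?case by(cases "mul a b"; cases "lmw b (us, c)") auto
next
 case (3 b p us c)
 thus ?case using mul_assoc[of a b p] by(cases "mul a b"; cases "mul b p") auto
qed

lemma lmw_consw: "lmw a (consw None y) = map_option (consw None) (lmw a y)"
 "lmw a (consw (Some p) y) = map_option (%p. consw (Some p) y) (mul a p)" by(cases y; simp)+

lemma rmw_consw: "rmw (consw u y) a = map_option (consw u) (rmw y a)" by(cases y; cases "mul (snd y) a") (simp_all add: rmw_def)

lemma lmw_rmw: "Option.bind (lmw a y) (%z. rmw z c) = Option.bind (rmw y c) (lmw a)"
proof(induction a y rule: lmw.induct)
 case (1 a b)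
 thus ?case using mul_assoc[of a b c] by(cases "mul a b"; cases "mul b c") (auto simp: rmw_def)
next
 case (2 a us b)
 have "rmw (None # us, b) c = map_option (consw None) (rmw (us, b) c)" using rmw_consw[of None "(us, b)" c] by simp
 thus ?case using 2 by(cases "lmw a (us, b)"; cases "rmw (us, b) c") (auto simp: rmw_consw lmw_consw simp del: consw_simp)
next
 case (3 a p us b)
 thus ?case by(cases "mul a p"; cases "mul b c") (auto simp: rmw_def)
qed

lemma lmw_Vertex: "lmw (Vertex i) y = (if srcw y = i then Some y else None)"
proof(induction "Vertex i" y rule: lmw.induct)
 case (2 us b)
 thus ?case by simp
qed auto

fun cut :: "lb => kb option \<times> kb" where
 "cut (Inl (p, q)) = (Some p, q)" | "cut (Inr c) = (None, c)"

definition actw :: "lb => word => word option" where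
 "actw x y = map_option (consw (fst (cut x))) (lmw (snd (cut x)) y)"

lemma okw_consw: "okw m (l # ls) (consw None y) <-> okw m ls y"
 "okw m (l # ls) (consw (Some p) y) <-> snd l ~= 0 & p : PL m (fst l) & okw m ls y & srcw y = fst l" by(cases y; simp)+

lemma okw_actw: "x : LB m l ==> okw m ls y ==> actw x y = Some z ==> okw m (l # ls) z"
proof(cases x)
 case (Inl t)
 assume *: "x : LB m l" "okw m ls y" "actw x y = Some z"
 obtain p q where t: "t = (p, q)" by(cases t)
 with * Inl obtain y' where y': "lmw q y = Some y'" "z = consw (Some p) y'" by(auto simp: actw_def)
 have "snd l ~= 0 & p : PL m (fst l) & q : PR m (fst l)" using * by(auto simp: LB_def Inl t split: if_splits)
 thus ?thesis using y' okw_lmw[OF *(2) _ y'(1)] lmw_Some[OF y'(1)] by(auto simp: okw_consw PR_def)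
next
 case (Inr c)
 assume *: "x : LB m l" "okw m ls y" "actw x y = Some z"
 with Inr show ?thesis using okw_lmw[of m ls y c] by(auto simp: actw_def okw_consw LB_def)
qed

lemma actw_lal: "Option.bind (lal a x) (%x. actw x y) = Option.bind (actw x y) (lmw a)"
proof(cases x)
 case (Inl t)
 thus ?thesis by(cases t; cases "mul a (fst t)"; cases "lmw (snd t) y") (auto simp: lal_def lpp_def actw_def lmw_consw)
next
 case (Inr c)
 thus ?thesis using lmw_assoc[of a c y] by(cases "mul a c"; cases "lmw c y") (auto simp: lal_def actw_def lmw_consw)
qed

lemma actw_lar: "Option.bind (lar x a) (%x. actw x y) = Option.bind (lmw a y) (actw x)"
proof(cases x)
 case (Inl t)
 thus ?thesis using lmw_assoc[of "snd t" a y] by(cases t; cases "mul (snd t) a"; cases "lmw a y") (auto simp: lar_def rpp_def actw_def)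
next
 case (Inr c)
 thus ?thesis using lmw_assoc[of c a y] by(cases "mul c a"; cases "lmw a y") (auto simp: lar_def actw_def)
qed

lemma actw_rmw: "Option.bind (actw x y) (%z. rmw z c) = Option.bind (rmw y c) (actw x)" using lmw_rmw[of "snd (cut x)" y c]
 by(cases "lmw (snd (cut x)) y"; cases "rmw y c") (auto simp: actw_def rmw_consw)

definition lmv :: "kb fvec => word fvec => word fvec" where
 "lmv = bil (%a y. elto (lmw a y))"

definition rmv :: "word fvec => kb fvec => word fvec" where
 "rmv = bil (%y a. elto (rmw y a))"

definition actv :: "lb fvec => word fvec => word fvec" where
 "actv = bil (%x y. elto (actw x y))"

lemmas v_defs = lmv_def rmv_def actv_def

lemma v_add:
 "lmv (a + a') y = lmv a y + lmv a' y" "lmv a (y + y') = lmv a y + lmv a y'"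
 "rmv (y + y') a = rmv y a + rmv y' a" "rmv y (a + a') = rmv y a + rmv y a'"
 "actv (x + x') y = actv x y + actv x' y" "actv x (y + y') = actv x y + actv x y'" by(simp_all add: v_defs bil_add_left bil_add_right)

lemma v_zero [simp]: "lmv 0 y = 0" "lmv a 0 = 0" "rmv 0 a = 0" "rmv y 0 = 0" "actv 0 y = 0" "actv x 0 = 0" by(simp_all add: v_defs)

lemma v_elt: "lmv (elt a) (elt y) = elto (lmw a y)" "rmv (elt y) (elt a) = elto (rmw y a)"
 "actv (elt x) (elt y) = elto (actw x y)" by(simp_all add: v_defs)

lemma lmv_elto: "lmv (elto a) (elt y) = elto (Option.bind a (%a. lmw a y))" "lmv (elt b) (elto z) = elto (Option.bind z (lmw b))"
 by(cases a; simp add: v_elt) (cases z; simp add: v_elt)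

lemma rmv_elto: "rmv (elto z) (elt b) = elto (Option.bind z (%y. rmw y b))" "rmv (elt y) (elto a) = elto (Option.bind a (rmw y))"
 by(cases z; simp add: v_elt) (cases a; simp add: v_elt)

lemma actv_elto: "actv (elto x) (elt y) = elto (Option.bind x (%x. actw x y))" "actv (elt x') (elto z) = elto (Option.bind z (actw x'))"
 by(cases x; simp add: v_elt) (cases z; simp add: v_elt)

lemmas v_elto = lmv_elto rmv_elto actv_elto

lemma actv_lal: "actv (bil (%a x. elto (lal a x)) a x) y = lmv a (actv x y)" by(induction a x y rule: f2_induct3)
  (simp_all add: bil_add_left bil_add_right v_add v_elt v_elto actw_lal)

lemma actv_lar: "actv (bil (%x a. elto (lar x a)) x a) y = actv x (lmv a y)" by(induction x a y rule: f2_induct3)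
  (simp_all add: bil_add_left bil_add_right v_add v_elt v_elto actw_lar)

lemma actv_rmv: "actv x (rmv y c) = rmv (actv x y) c" by(induction x y c rule: f2_induct3) (simp_all add: v_add v_elt v_elto actw_rmw)

lemma lmv_rmv: "lmv a (rmv y c) = rmv (lmv a y) c" by(induction a y c rule: f2_induct3) (simp_all add: v_add v_elt v_elto lmw_rmw)

lemma lmv_mulv: "lmv (mulv a b) y = lmv a (lmv b y)" by(induction a b y rule: f2_induct3)
  (simp_all add: v_add v_elt v_elto lmw_assoc mulv_def bil_add_left bil_add_right)

lemma rmw_assoc: "Option.bind (mul a b) (rmw y) = Option.bind (rmw y a) (%z. rmw z b)" using mul_assoc[of "snd y" a b]
 by(cases y; cases "mul a b"; cases "mul (snd y) a") (auto simp: rmw_def)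

lemma rmv_mulv: "rmv y (mulv a b) = rmv (rmv y a) b" by(induction y a b rule: f2_induct3)
  (simp_all add: v_add v_elt v_elto rmw_assoc mulv_def bil_add_left bil_add_right)

definition onew :: "nat => word fvec" where
 "onew m = lin (%b. elt ([], b)) (onev m)"

lemma lmv_onew: "a : vec (KB m) ==> lmv a (onew m) = lin (%b. elt ([], b)) a"
 and rmv_onew: "a : vec (KB m) ==> rmv (onew m) a = lin (%b. elt ([], b)) a"
proof -
 have 1: "lmv (elt a) (onew m) = elt ([], a) & rmv (onew m) (elt a) = elt ([], a)" if "a : KB m" for a
 proof -
  have "lmv (elt a) (onew m) = (SUM i<=m. if i = tgt a then elt ([], a) else 0)" unfolding onew_def onev_def lin_sum lmv_def bil_sum_right
  by(intro sum.cong) (auto simp: mul_Vertex_right)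
  moreover have "rmv (onew m) (elt a) = (SUM i<=m. if i = src a then elt ([], a) else 0)" unfolding onew_def onev_def lin_sum rmv_def bil_sum_left
  by(intro sum.cong) (auto simp: rmw_def)
  ultimately show ?thesis using src_KB[OF that] tgt_KB[OF that] by simp
 qed
 show "a : vec (KB m) ==> lmv a (onew m) = lin (%b. elt ([], b)) a" by(induction rule: vec_induct) (simp_all add: 1 v_add lin_add)
 show "a : vec (KB m) ==> rmv (onew m) a = lin (%b. elt ([], b)) a" by(induction rule: vec_induct) (simp_all add: 1 v_add lin_add)
qed

subsection \<open>Coordinates of elementary tensors\<close>

fun tf :: "nat => ks_cpx list => word fvec" where
 "tf m [] = onew m" | "tf m (x # xs) = actv (lc x) (tf m xs)"

definition letters :: "nat => braid_word => (ks_cpx, ks) dg_bimodule list" where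
 "letters m ls = map (letter m) ls"

abbreviation tuples :: "nat => braid_word => ks_cpx list set" where
 "tuples m ls == tensor_gens (letters m ls)"

lemma tuples_Nil [simp]: "xs : tuples m [] <-> xs = []" by(auto simp: tensor_gens_def letters_def)

lemma tuples_Cons: "xs : tuples m (l # ls) <->
  (EX x ys. xs = x # ys & x : LS m l & ys : tuples m ls)"
proof -
 have split: "(ALL j<Suc n. Q j) <-> Q 0 & (ALL j<n. Q (Suc j))" for n and Q :: "nat => bool" using less_Suc_eq_0_disj by auto
 show ?thesis by(cases xs) (auto simp: tensor_gens_def letters_def split)
qed

lemma tuples_append: "length xs = length ls ==> xs @ ys : tuples m (ls @ ls') <-> xs : tuples m ls & ys : tuples m ls'"
 by(induction xs ls rule: list_induct2) (auto simp: tuples_Cons)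

lemma tuples_length: "xs : tuples m ls ==> length xs = length ls" by(simp add: tensor_gens_def letters_def)

lemma tuples_nth: "xs : tuples m ls ==> j < length ls ==> xs ! j : carrier (space (letter m (ls ! j)))" by(simp add: tensor_gens_def letters_def)

lemma tuples_update:
 "xs : tuples m ls ==> j < length ls ==> x : carrier (space (letter m (ls ! j))) ==> xs[j := x] : tuples m ls"
 by(auto simp: tensor_gens_def letters_def nth_list_update)

lemma onew_vec: "onew m : vec (NW m [])" unfolding onew_def onev_def lin_sum by(rule vec_sum) (simp add: NW_def)

lemma tf_vec: "ALL l:set ls. good m l ==> xs : tuples m ls ==> tf m xs : vec (NW m ls)"
proof(induction ls arbitrary: xs)
 case (Cons l ls)
 then obtain x ys where x: "xs = x # ys" "x : LS m l" "ys : tuples m ls" by(auto simp: tuples_Cons)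
 hence "lc x : vec (LB m l)" "tf m ys : vec (NW m ls)" using Cons coords_vec[OF letter_coords] by auto
 thus ?case unfolding x tf.simps actv_def by(rule vec_bil) (auto simp: elto_vec NW_def intro: okw_actw)
qed(simp add: onew_vec)

lemma tf_lact:
 assumes "good m l" "a : KS m" "x : LS m l"
 shows "tf m (lact (letter m l) a x # ys) = lmv (kc a) (tf m (x # ys))" using letter_lact[OF assms] by(simp add: actv_lal)

lemma tf_balanced:
 assumes "good m l" "good m l'" "a : KS m"
  "x : LS m l" "y : carrier (space (letter m l'))"
 shows "tf m (ract (letter m l) x a # y # ys) = tf m (x # lact (letter m l') a y # ys)"
 using letter_ract[OF assms(1,3,4)] letter_lact[OF assms(2,3,5)] by(simp add: actv_lar actv_lal)

lemma tf_update: "j < length xs ==> EX D. ALL x. tf m (xs[j := x]) = lin D (lc x)"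
proof(induction xs arbitrary: j)
 case (Cons x xs)
 show ?case
 proof(cases j)
  case 0
  thus ?thesis by(auto simp: actv_def bil_def intro!: exI[of _ "%a. lin (%b. elto (actw a b)) (tf m xs)"])
 next
  case (Suc i)
  then obtain D where "ALL x. tf m (xs[i := x]) = lin D (lc x)" using Cons.IH[of i] Cons.prems Suc by(metis Suc_less_eq length_Cons)
  thus ?thesis using Suc by(auto simp: actv_def bil_lin_right intro!: exI[of _ "%a. actv (lc x) (D a)"])
 qed
qed simp

lemma tf_shift_scalar:
 assumes "ALL l:set ls. good m l" "xs : tuples m ls" "Suc j < length ls" "a : KS m"
 shows "tf m (xs[j := ract (letter m (ls ! j)) (xs ! j) a]) =
  tf m (xs[Suc j := lact (letter m (ls ! Suc j)) a (xs ! Suc j)])" using assms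
proof(induction ls arbitrary: xs j)
 case (Cons l ls)
 then obtain x ys where x: "xs = x # ys" "x : LS m l" "ys : tuples m ls" by(auto simp: tuples_Cons)
 show ?case
 proof(cases j)
  case 0
  obtain l' ls' where l': "ls = l' # ls'" using Cons(4) 0 by(cases ls) auto
  then obtain y zs where "ys = y # zs" "y : carrier (space (letter m l'))" using x by(auto simp: tuples_Cons)
  thus ?thesis using 0 x l' Cons(2,5) tf_balanced[of m l l' a x y zs] by simp
 next
  case (Suc i)
  thus ?thesis using Cons x by simp
 qed
qed simp

text \<open>Representatives of the basis words; the last path is multiplied into the last letter.\<close>

definition rep_letter :: "nat => nat \<times> int => kb option => ks_cpx" where
 "rep_letter m l u = point (space (letter m l)) lc
  (case u of None => inr (onev m) | Some p => elt (Inl (p, Vertex (fst l))))"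

fun rep_tuple :: "nat => braid_word => word => ks_cpx list" where
 "rep_tuple m [] y = []"
| "rep_tuple m [l] (us, b) = [ract (letter m l) (rep_letter m l (hd us)) (kb_point m b)]"
| "rep_tuple m (l # ls) (us, b) = rep_letter m l (hd us) # rep_tuple m ls (tl us, b)"

lemma onev_vec: "onev m : vec (KB m)" unfolding onev_def by(rule vec_sum) auto

lemma rep_letter:
 assumes "good m l" "u = None | (EX p. u = Some p & snd l ~= 0 & p : PL m (fst l))"
 shows "rep_letter m l u : LS m l"
  "lc (rep_letter m l u) = (case u of None => inr (onev m) | Some p => elt (Inl (p, Vertex (fst l))))"
proof -
 have "fst l <= m" using assms(1) by(cases l) auto
 hence "(case u of None => inr (onev m) | Some p => elt (Inl (p, Vertex (fst l)))) : vec (LB m l)" using assms(2) onev_vec[of m]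
  by(auto simp: LB_def PR_def intro!: vec_inr elim!: vec_mono)
 thus "rep_letter m l u : LS m l"
  "lc (rep_letter m l u) = (case u of None => inr (onev m) | Some p => elt (Inl (p, Vertex (fst l))))" unfolding rep_letter_def
  by(rule point_closed[OF letter_coords[OF assms(1)]] coords_point[OF letter_coords[OF assms(1)]])+
qed

lemma cut_letter:
 assumes "good m l" "h : LB m l"
 shows "bil (%x a. elto (lar x a)) (lc (rep_letter m l (fst (cut h)))) (elt (snd (cut h))) = elt h" (is ?g1)
  and "fst (cut h) = None | (EX p. fst (cut h) = Some p & snd l ~= 0 & p : PL m (fst l))"
  and "snd (cut h) : KB m"
proof -
 show u: "fst (cut h) = None | (EX p. fst (cut h) = Some p & snd l ~= 0 & p : PL m (fst l))"
  and k: "snd (cut h) : KB m" using assms(2) by(auto simp: LB_def PR_def split: if_splits)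
 show ?g1
 proof(cases h)
  case (Inl t)
  obtain p q where t: "t = (p, q)" by(cases t)
  have "src q = fst l" using assms(2) by(auto simp: Inl t LB_def PR_def split: if_splits)
  thus ?thesis using rep_letter(2)[OF assms(1) u] by(simp add: Inl t lar_def rpp_def)
 next
  case (Inr b)
  have "src b <= m" using k src_KB by(simp add: Inr)
  hence "(SUM i<=m. elto (lar (Inr (Vertex i)) b)) = elt (Inr b)"
  by(subst sum.cong[OF refl, of _ _ "%i. if i = src b then elt (Inr b) else 0"]) (auto simp: lar_def)
  thus ?thesis using rep_letter(2)[OF assms(1) u] by(simp add: Inr bil_elt_right lin_inr onev_def lin_sum)
 qed
qed

lemma actv_rep_letter:
 assumes "good m l" "okw m (l # ls) (consw u y)"
 shows "actv (lc (rep_letter m l u)) (elt y) = elt (consw u y)"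
proof -
 obtain us b where y: "y = (us, b)" by(cases y)
 have u: "u = None | (EX p. u = Some p & snd l ~= 0 & p : PL m (fst l))" using assms(2) by(cases u) (auto simp: y)
 show ?thesis
 proof(cases u)
  case None
  have ok: "okw m ls y" using assms(2) by(simp add: None okw_consw)
  have "srcw y <= m" using ok unfolding y by(induction m ls "(us, b)" arbitrary: us rule: okw.induct) (auto simp: PL_def intro: src_KB)
  hence "(SUM i<=m. elto (actw (Inr (Vertex i)) y)) = elt (consw None y)"
  by(subst sum.cong[OF refl, of _ _ "%i. if i = srcw y then elt (consw None y) else 0"])
  (auto simp: actw_def lmw_Vertex)
  thus ?thesis using rep_letter(2)[OF assms(1) u] by(simp add: None actv_def bil_elt_right lin_inr onev_def lin_sum)
 next
  case (Some p)
  hence "srcw y = fst l" using assms(2) by(simp add: okw_consw)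
  thus ?thesis using rep_letter(2)[OF assms(1) u] by(simp add: Some v_elt actw_def lmw_Vertex)
 qed
qed

lemma rep_tuple:
 assumes "ls ~= []" "ALL l:set ls. good m l" "okw m ls y"
 shows "rep_tuple m ls y : tuples m ls & tf m (rep_tuple m ls y) = elt y" using assms
proof(induction m ls y rule: rep_tuple.induct)
 case (2 m l us b)
 then obtain u where us: "us = [u]" using okw_length[of m "[l]" us b] by(cases us) auto
 have b: "b : KB m" using okw_last[OF 2(3)] .
 have u: "u = None | (EX p. u = Some p & snd l ~= 0 & p : PL m (fst l))" using 2(3) by(cases u) (auto simp: us)
 have g: "good m l" using 2 by simp
 have ok: "okw m [l] (consw u ([], b))" using 2(3) us by simp
 note k = kb_point[OF b] and r = rep_letter[OF g u]
 show ?case using letter_ract[OF g conjunct1[OF k] r(1)] k actv_rep_letter[OF g ok] lmv_onew[of "elt b" m] b by(simp add: us tuples_Cons actv_lar)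
next
 case (3 m l l' ls us b)
 then obtain u us' where us: "us = u # us'" using okw_length[of m "l # l' # ls" us b] by(cases us) auto
 have u: "u = None | (EX p. u = Some p & snd l ~= 0 & p : PL m (fst l))" using 3(4) by(cases u) (auto simp: us)
 have g: "good m l" using 3 by simp
 have ok: "okw m (l # l' # ls) (consw u (us', b))" using 3(4) us by simp
 hence "okw m (l' # ls) (us', b)" by(cases u) simp_all
 with 3 have "rep_tuple m (l' # ls) (us', b) : tuples m (l' # ls) & tf m (rep_tuple m (l' # ls) (us', b)) = elt (us', b)" by(simp add: us)
 thus ?case using rep_letter(1)[OF g u] actv_rep_letter[OF g ok] by(simp add: us tuples_Cons[of _ m l])
qed simp

text \<open>
  Reduction to representatives, for the tail of a tuple behind an arbitrary beginning: the first
  entry of the tail is a representative times a path, and that path moves on to the next entry.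
\<close>

lemma reduce_tuple:
 assumes "ALL l:set lp. good m l" "ALL l:set ls. good m l" "ls ~= []" "pre : tuples m lp" "xs : tuples m ls"
 shows "elt (pre @ xs) + lin (%y. elt (pre @ rep_tuple m ls y)) (tf m xs) :
  f2_span (tensor_rels (KS_algebra m) (letters m (lp @ ls)))" using assms
proof(induction ls arbitrary: lp pre xs)
 case (Cons l ls)
 let ?R = "tensor_rels (KS_algebra m) (letters m (lp @ l # ls))"
 obtain x ys where x: "xs = x # ys" "x : LS m l" "ys : tuples m ls" using Cons by(auto simp: tuples_Cons)
 have g: "good m l" and gs: "ALL l:set ls. good m l" using Cons by auto
 have len: "length pre = length lp" using Cons tuples_length by blast
 have nth: "letters m (lp @ l # ls) ! length pre = letter m l" by(simp add: letters_def len nth_append)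
 have lenM: "length (letters m (lp @ l # ls)) = Suc (length pre + length ls)" by(simp add: letters_def len)
 have mem: "pre @ z # zs : tuples m (lp @ l # ls)" if "z : LS m l" "zs : tuples m ls" for z zs
  using Cons.prems(4) that by(auto simp: tuples_append[OF len] tuples_Cons)
 let ?D = "%h. lin (%y. elt (pre @ rep_tuple m (l # ls) y)) (lin (%b. elto (actw h b)) (tf m ys))"
 have "elt (pre @ x # ys) + lin ?D (lc x) : f2_span ?R"
 proof(rule reduce_coords[OF letter_coords[OF g], of x "LB m l" "%x. pre @ x # ys"])
  show "elt (pre @ (z \<oplus>\<^bsub>space (letter m l)\<^esub> z') # ys) - (elt (pre @ z # ys) + elt (pre @ z' # ys)) : ?R"
  if z: "z : LS m l" "z' : LS m l" for z z'
  proof -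
  have "elt ((pre @ z # ys)[length pre := z \<oplus>\<^bsub>space (letters m (lp @ l # ls) ! length pre)\<^esub> z']) -
  (elt ((pre @ z # ys)[length pre := z]) + elt ((pre @ z # ys)[length pre := z'])) : ?R" unfolding tensor_rels_def using mem[OF z(1) x(3)] z nth lenM
  by(intro UnI1 CollectI exI[of _ "pre @ z # ys"] exI[of _ "length pre"] exI[of _ z] exI[of _ z']) simp
  thus ?thesis by(simp add: nth)
  qed
 next
  fix h assume h: "h : LB m l"
  note c = cut_letter[OF g h]
  let ?u = "fst (cut h)" and ?b = "snd (cut h)"
  let ?r = "rep_letter m l ?u" and ?a = "kb_point m ?b"
  note r = rep_letter[OF g c(2)] and a = kb_point[OF c(3)]
  note ra = letter_ract[OF g conjunct1[OF a] r(1)]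
  have hv: "elt h : vec (LB m l)" using h by simp
  have p: "point (space (letter m l)) lc (elt h) = ract (letter m l) ?r ?a"
  using point_closed[OF letter_coords[OF g] hv] coords_point[OF letter_coords[OF g] hv] ra a c(1)
  by(intro coords_inject[OF letter_coords[OF g]]) simp_all
  show "elt (pre @ point (space (letter m l)) lc (elt h) # ys) + ?D h : f2_span ?R"
  proof(cases ls)
  case Nil
  hence "ys = []" using x by simp
  moreover have "lin (%b. elto (actw h b)) (onew m) = elt ([?u], ?b)"
  proof -
  have "lin (%b. elto (actw h b)) (onew m) = lin (%y. elt (consw ?u y)) (lmv (elt ?b) (onew m))"
  by(simp add: actw_def lmv_def bil_elt_left lin_lin elto_map)
  thus ?thesis using lmv_onew[of "elt ?b" m] c(3) by simp
  qed
  ultimately show ?thesis using Nil by(simp add: p f2_span_zero)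
  next
  case (Cons l' ls')
  then obtain y zs where y: "ys = y # zs" "y : carrier (space (letter m l'))" "zs : tuples m ls'" using x by(auto simp: tuples_Cons)
  have g': "good m l'" using gs Cons by simp
  let ?y = "lact (letter m l') ?a y"
  note la = letter_lact[OF g' conjunct1[OF a] y(2)]
  have ys': "?y # zs : tuples m ls" using y la by(simp add: Cons tuples_Cons)
  have nth': "letters m (lp @ l # ls) ! Suc (length pre) = letter m l'" by(simp add: letters_def len nth_append Cons)
  have "elt ((pre @ ?r # ys)[length pre := ract (letters m (lp @ l # ls) ! length pre) ((pre @ ?r # ys) ! length pre) ?a]) -
  elt ((pre @ ?r # ys)[Suc (length pre) := lact (letters m (lp @ l # ls) ! Suc (length pre)) ?a ((pre @ ?r # ys) ! Suc (length pre))]) : ?R"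
  unfolding tensor_rels_def using mem[OF r(1) x(3)] a lenM Cons
  by(intro UnI2 CollectI exI[of _ "pre @ ?r # ys"] exI[of _ "length pre"] exI[of _ ?a]) simp
  hence 1: "elt (pre @ ract (letter m l) ?r ?a # ys) + elt (pre @ ?r # ?y # zs) : f2_span ?R"
  by(intro f2_span_base) (simp add: nth nth' vec_diff y list_update_append nth_append)
  have "elt ((pre @ [?r]) @ ?y # zs) + lin (%z. elt ((pre @ [?r]) @ rep_tuple m ls z)) (tf m (?y # zs)) :
  f2_span (tensor_rels (KS_algebra m) (letters m ((lp @ [l]) @ ls)))" using Cons.prems(1,4) g gs r(1) ys' Cons
  by(intro Cons.IH) (auto simp: tuples_append[OF len] tuples_Cons)
  moreover have "tf m (?y # zs) = lmv (elt ?b) (tf m ys)" using tf_lact[OF g' conjunct1[OF a] y(2)] a by(simp add: y)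
  moreover have "?D h = lin (%z. elt ((pre @ [?r]) @ rep_tuple m ls z)) (lmv (elt ?b) (tf m ys))"
  proof -
  have "rep_tuple m (l # ls) (consw ?u z) = ?r # rep_tuple m ls z" for z by(cases z) (simp add: Cons)
  thus ?thesis by(simp add: actw_def elto_map lin_lin lmv_def bil_elt_left)
  qed
  ultimately have "elt (pre @ ?r # ?y # zs) + ?D h : f2_span ?R" by simp
  thus ?thesis unfolding p by(rule f2_span_trans[OF 1])
  qed
 qed(use x coords_vec[OF letter_coords[OF g]] in auto)
 thus ?case by(simp add: x actv_def bil_def lin_lin)
qed simp

subsection \<open>The bimodule structure in coordinates\<close>

lemma letters_simps [simp]: "length (letters m ls) = length ls" "j < length ls ==> letters m ls ! j = letter m (ls ! j)"
 by(simp_all add: letters_def)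

lemma tensor_presents:
 assumes ls: "ls ~= []" "ALL l:set ls. good m l"
 shows "presents (tuples m ls) (tensor_rels (KS_algebra m) (letters m ls)) (tf m) (NW m ls)"
proof(rule presentsI[where g = "%y. elt (rep_tuple m ls y)"])
 show "tf m xs : vec (NW m ls)" if "xs : tuples m ls" for xs using tf_vec[OF ls(2) that] .
 show "elt (rep_tuple m ls y) : vec (tuples m ls) & lin (tf m) (elt (rep_tuple m ls y)) = elt y"
  if "y : NW m ls" for y using rep_tuple[OF ls, of y] that by(simp add: NW_def)
 show "elt xs + lin (%y. elt (rep_tuple m ls y)) (tf m xs) : f2_span (tensor_rels (KS_algebra m) (letters m ls))"
  if "xs : tuples m ls" for xs using reduce_tuple[of "[]" m ls "[]" xs] ls that by simp
 fix r assume r: "r : tensor_rels (KS_algebra m) (letters m ls)"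
 have good: "good m (ls ! j)" if "j < length ls" for j using ls(2) that by simp
 consider (add) xs j x y where "r = elt (xs[j := x \<oplus>\<^bsub>space (letters m ls ! j)\<^esub> y]) - (elt (xs[j := x]) + elt (xs[j := y]))"
  "xs : tuples m ls" "j < length ls" "x : carrier (space (letters m ls ! j))" "y : carrier (space (letters m ls ! j))"
  | (scalar) xs j a where "r = elt (xs[j := ract (letters m ls ! j) (xs ! j) a]) - elt (xs[Suc j := lact (letters m ls ! Suc j) a (xs ! Suc j)])"
  "xs : tuples m ls" "Suc j < length ls" "a : KS m" using r unfolding tensor_rels_def letters_simps(1) by blast
 thus "r : vec (tuples m ls) & lin (tf m) r = 0"
 proof cases
  case add
  note c = letter_coords[OF good[OF add(3)]]
  obtain D where D: "ALL x. tf m (xs[j := x]) = lin D (lc x)" using tf_update[of j xs m] add tuples_length by metis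
  show ?thesis using add coords_add[OF c, of x y] coords_add_closed[OF c, of x y] by(auto simp: vec_diff lin_add D intro!: vec_add tuples_update)
 next
  case scalar
  have j: "j < length ls" using scalar by simp
  show ?thesis using scalar j tf_shift_scalar[OF ls(2) scalar(2,3,4)]
  letter_ract[OF good[OF j] scalar(4) tuples_nth[OF scalar(2) j]]
  letter_lact[OF good[OF scalar(3)] scalar(4) tuples_nth[OF scalar(2,3)]] by(auto simp: vec_diff lin_add intro!: vec_add tuples_update)
 qed
qed

definition cons1 :: "kb option => word fvec => word fvec" where
 "cons1 u = lin (%y. elt (consw u y))"

lemma cons1_simps [simp]: "cons1 u 0 = 0" "cons1 u (elt z) = elt (consw u z)" "cons1 u (x + y) = cons1 u x + cons1 u y"
 by(simp_all add: cons1_def lin_add)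

lemma cons1_lin: "cons1 u (lin f x) = lin (%a. cons1 u (f a)) x" by(simp add: cons1_def lin_lin)

lemma lmv_cons1: "lmv a (cons1 None y) = cons1 None (lmv a y)"
 "lmv (elt c) (cons1 (Some p) y) = lin (%p. cons1 (Some p) y) (elto (mul c p))"
proof -
 show "lmv a (cons1 None y) = cons1 None (lmv a y)"
 proof(induction a y rule: f2_induct2)
  case (elt a y)
  thus ?case by(cases "lmw a y") (simp_all add: v_elt lmw_consw)
 qed(simp_all add: v_add)
 show "lmv (elt c) (cons1 (Some p) y) = lin (%p. cons1 (Some p) y) (elto (mul c p))"
 proof(induction y rule: f2_induct)
  case (elt y)
  thus ?case by(cases "mul c p") (simp_all add: v_elt lmw_consw)
 qed(simp_all add: v_add lin_fun_add)
qed

lemma rmv_cons1: "rmv (cons1 u y) a = cons1 u (rmv y a)"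
proof(induction y a rule: f2_induct2)
 case (elt y a)
 thus ?case by(cases "rmw y a") (simp_all add: v_elt rmw_consw)
qed(simp_all add: v_add)

lemma actv_elt: "actv (elt h) y = cons1 (fst (cut h)) (lmv (elt (snd (cut h))) y)"
 by(simp add: actv_def lmv_def bil_elt_left cons1_def lin_lin actw_def elto_map)

definition dloc :: "nat => nat \<times> int => kb option => word fvec => word fvec" where
 "dloc m l u y = (case u of
  None => if snd l = -1 then lin (%t. cons1 (Some (fst t)) (lmv (elt (snd t)) y)) (gamv m (fst l)) else 0
 | Some p => if snd l = 1 then cons1 None (lmv (elt p) y) else 0)"

fun dnw :: "nat => braid_word => word => word fvec" where
 "dnw m [] y = 0"
| "dnw m (l # ls) ([], b) = 0"
| "dnw m (l # ls) (u # us, b) = cons1 u (dnw m ls (us, b)) + dloc m l u (elt (us, b))"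

lemma dloc_add [simp]: "dloc m l u (x + y) = dloc m l u x + dloc m l u y" "dloc m l u 0 = 0"
 by(auto simp: dloc_def v_add lin_fun_add split: option.splits)

lemma dnw_consw: "dnw m (l # ls) (consw u y) = cons1 u (dnw m ls y) + dloc m l u (elt y)" by(cases y) simp

lemma lin_dnw_cons1: "lin (dnw m (l # ls)) (cons1 u y) = cons1 u (lin (dnw m ls) y) + dloc m l u y"
 by(induction y rule: f2_induct) (simp_all add: lin_add dnw_consw ac_simps)

text \<open>This makes \<open>\<gamma>\<^sub>i\<close> a map of bimodules.\<close>

lemma gamv_central:
 assumes "c : KB m" "1 <= i" "i <= m"
 shows "lin (%t. elto (rpp t c)) (gamv m i) = lin (%t. elto (lpp c t)) (gamv m i)"
proof -
 obtain n where i: "i = Suc n" using assms(2) by(cases i) auto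
 show ?thesis using assms(1,3) unfolding i by(cases c) (auto simp: gamv_def lin_add rpp_def lpp_def mul_Vertex_right add.commute)
qed

lemma gamv_KB: "1 <= i ==> i <= m ==> gamv m i : vec (PL m i \<times> PR m i)" unfolding gamv_def by(auto simp: PL_def PR_def intro!: vec_add)

lemma dloc_slide:
 assumes "good m l" "c : KB m"
 shows "dloc m l None (lmv (elt c) y) =
  (if snd l = -1 then lin (%t. cons1 (Some (fst t)) (lmv (elt (snd t)) y)) (lin (%t. elto (lpp c t)) (gamv m (fst l))) else 0)"
proof(cases "snd l = -1")
 case True
 hence i: "1 <= fst l" "fst l <= m" using assms(1) by(cases l; auto)+
 let ?F = "%t. cons1 (Some (fst t)) (lmv (elt (snd t)) y)"
 have "cons1 (Some (fst t)) (lmv (elt (snd t)) (lmv (elt c) y)) = lin ?F (elto (rpp t c))" for t using lmv_mulv[of "elt (snd t)" "elt c" y]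
  by(cases t; cases "mul (snd t) c") (simp_all add: rpp_def mulv_def)
 thus ?thesis using True by(simp add: dloc_def lin_lin[symmetric] gamv_central[OF assms(2) i])
qed(simp add: dloc_def)

lemma dnw_lmv_elt:
 assumes "ALL l:set ls. good m l" "c : KB m"
 shows "lin (dnw m ls) (lmv (elt c) (elt y)) = lmv (elt c) (dnw m ls y)" using assms(1)
proof(induction ls arbitrary: y)
 case Nil
 have "dnw m [] = (%y. 0)" by(simp add: fun_eq_iff)
 thus ?case by simp
next
 case (Cons l ls)
 obtain us b where y: "y = (us, b)" by(cases y)
 show ?case
 proof(cases us)
  case Nil
  thus ?thesis unfolding y by(cases "mul c b") (simp_all add: v_elt)
 next
  case (Cons u us')
  let ?y = "elt (us', b)"
  have e: "elt y = cons1 u ?y" by(simp add: y Cons)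
  have IH: "lin (dnw m ls) (lmv (elt c) ?y) = lmv (elt c) (dnw m ls (us', b))" by(rule Cons.IH) (use Cons.prems in simp)
  have l: "good m l" using Cons.prems by simp
  have d: "dnw m (l # ls) y = cons1 u (dnw m ls (us', b)) + dloc m l u ?y" by(simp add: y Cons)
  show ?thesis
  proof(cases u)
  case None
  have "lmv (elt c) (dloc m l None ?y) = dloc m l None (lmv (elt c) ?y)"
  proof(cases "snd l = -1")
  case True
  have "lmv (elt c) (cons1 (Some (fst t)) (lmv (elt (snd t)) ?y)) =
  lin (%t. cons1 (Some (fst t)) (lmv (elt (snd t)) ?y)) (elto (lpp c t))" for t by(cases t; cases "mul c (fst t)") (simp_all add: lmv_cons1 lpp_def)
  thus ?thesis unfolding dloc_slide[OF l assms(2)] by(simp add: True dloc_def lmv_def bil_lin_right lin_lin)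
  qed(simp add: dloc_def)
  thus ?thesis unfolding e d unfolding None by(simp only: lmv_cons1 lin_dnw_cons1 IH v_add)
  next
  case (Some p)
  have "lin (dnw m (l # ls)) (lmv (elt c) (cons1 (Some p) ?y)) =
  lmv (elt c) (cons1 (Some p) (dnw m ls (us', b)) + dloc m l (Some p) ?y)"
  proof(cases "mul c p")
  case None
  hence "lmv (elt c) (lmv (elt p) ?y) = 0" using lmv_mulv[of "elt c" "elt p" ?y] by(simp add: mulv_def)
  thus ?thesis using None by(simp add: lmv_cons1 v_add dloc_def del: cons1_simps(2))
  next
  case (Some q)
  hence "lmv (elt c) (lmv (elt p) ?y) = lmv (elt q) ?y" using lmv_mulv[of "elt c" "elt p" ?y] by(simp add: mulv_def)
  thus ?thesis using Some by(simp add: lmv_cons1 v_add dloc_def lin_dnw_cons1 del: cons1_simps(2))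
  qed
  thus ?thesis unfolding e d unfolding Some .
  qed
 qed
qed

lemma dnw_lmv:
 assumes "ALL l:set ls. good m l" "a : vec (KB m)"
 shows "lin (dnw m ls) (lmv a y) = lmv a (lin (dnw m ls) y)" using assms(2)
proof(induction rule: vec_induct)
 case (elt c)
 show ?case by(induction y rule: f2_induct) (simp_all add: v_add lin_add dnw_lmv_elt[OF assms(1) elt])
qed(simp_all add: v_add lin_add)

lemma dloc_rmv: "dloc m l u (rmv y a) = rmv (dloc m l u y) a"
proof -
 have "rmv (lin f x) a = lin (%t. rmv (f t) a) x" for f :: "kb \<times> kb => word fvec" and x by(simp add: rmv_def bil_lin_left)
 thus ?thesis by(auto simp: dloc_def lmv_rmv rmv_cons1 split: option.splits)
qed

lemma dnw_rmv: "lin (dnw m ls) (rmv y a) = rmv (lin (dnw m ls) y) a"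
proof(induction y a rule: f2_induct2)
 case (elt y a)
 show ?case
 proof(induction ls arbitrary: y)
  case Nil
  have "dnw m [] = (%y. 0)" by(simp add: fun_eq_iff)
  thus ?case by simp
 next
  case (Cons l ls)
  obtain us b where y: "y = (us, b)" by(cases y)
  show ?case
  proof(cases us)
  case Nil
  thus ?thesis unfolding y by(cases "mul b a") (simp_all add: v_elt rmw_def)
  next
  case (Cons u us')
  hence "elt y = cons1 u (elt (us', b))" by(simp add: y)
  thus ?thesis using Cons.IH[of "(us', b)"] by(simp add: rmv_cons1 lin_dnw_cons1 v_add dloc_rmv del: cons1_simps(2))
  qed
 qed
qed(simp_all add: v_add lin_add)

lemma dnw_dloc:
 assumes "good m l" "ALL l:set ls. good m l" "u = None | (EX p:KB m. u = Some p)"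
 shows "lin (dnw m (l # ls)) (dloc m l u y) = dloc m l u (lin (dnw m ls) y)"
proof(cases u)
 case None
 show ?thesis
 proof(cases "snd l = -1")
  case True
  hence "1 <= fst l" "fst l <= m" using assms(1) by(cases l; auto)+
  from gamv_KB[OF this] have g: "gamv m (fst l) : vec (PL m (fst l) \<times> PR m (fst l))" .
  have "lin (%t. lin (dnw m (l # ls)) (cons1 (Some (fst t)) (lmv (elt (snd t)) y))) (gamv m (fst l)) =
  lin (%t. cons1 (Some (fst t)) (lmv (elt (snd t)) (lin (dnw m ls) y))) (gamv m (fst l))"
  proof(rule lin_cong_vec[OF g])
  fix t assume "t : PL m (fst l) \<times> PR m (fst l)"
  hence "elt (snd t) : vec (KB m)" by(auto simp: PR_def)
  thus "lin (dnw m (l # ls)) (cons1 (Some (fst t)) (lmv (elt (snd t)) y)) =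
  cons1 (Some (fst t)) (lmv (elt (snd t)) (lin (dnw m ls) y))" using True by(simp add: lin_dnw_cons1 dnw_lmv[OF assms(2)] dloc_def)
  qed
  thus ?thesis by(simp add: None True dloc_def lin_lin)
 qed(simp add: None dloc_def)
next
 case (Some p)
 hence "elt p : vec (KB m)" using assms(3) by auto
 thus ?thesis by(simp add: Some dloc_def lin_dnw_cons1 dnw_lmv[OF assms(2)])
qed

lemma dnw_dnw: "ALL l:set ls. good m l ==> okw m ls y ==> lin (dnw m ls) (dnw m ls y) = 0"
proof(induction ls arbitrary: y)
 case (Cons l ls)
 obtain us b where y: "y = (us, b)" by(cases y)
 with Cons.prems(2) obtain u us' where us: "us = u # us'" by(cases us) auto
 have ok: "okw m ls (us', b)" "u = None | (EX p:KB m. u = Some p)" using Cons.prems(2) by(cases u; auto simp: y us PL_def)+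
 show ?case using Cons.IH[OF _ ok(1)] dnw_dloc[OF _ _ ok(2), of l ls] Cons.prems(1) by(simp add: y us lin_add lin_dnw_cons1)
qed simp

lemma dnw_actv:
 assumes "good m l" "ALL l:set ls. good m l" "x : vec (LB m l)"
 shows "lin (dnw m (l # ls)) (actv x y) = actv (lin (dlet m l) x) y + actv x (lin (dnw m ls) y)" using assms(3)
proof(induction rule: vec_induct)
 case (elt h)
 let ?u = "fst (cut h)" and ?c = "snd (cut h)"
 have c: "?c : KB m" by(rule cut_letter(3)[OF assms(1) elt])
 have "actv (dlet m l h) y = dloc m l ?u (lmv (elt ?c) y)"
 proof(cases h)
  case (Inl t)
  obtain p q where t: "t = (p, q)" by(cases t)
  have "lmv (elto (mul p q)) y = lmv (elt p) (lmv (elt q) y)" using lmv_mulv[of "elt p" "elt q" y] by(simp add: mulv_def)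
  thus ?thesis by(cases l; cases "mul p q") (simp_all add: Inl t dloc_def actv_elt)
 next
  case (Inr b)
  have "actv (inl x) y = lin (%t. cons1 (Some (fst t)) (lmv (elt (snd t)) y)) x" for x
  proof(induction x rule: f2_induct)
  case (elt t)
  thus ?case by(cases t) (simp add: actv_elt)
  qed(simp_all add: v_add lin_add)
  thus ?thesis using c dloc_slide[OF assms(1), of b y] by(cases l) (simp add: Inr)
 qed
 thus ?case using c by(simp add: actv_elt lin_dnw_cons1 dnw_lmv[OF assms(2)] ac_simps)
qed(simp_all add: v_add lin_add ac_simps)

lemma tf_diff:
 assumes "ALL l:set ls. good m l" "xs : tuples m ls"
 shows "(SUM j<length ls. tf m (xs[j := diff (letter m (ls ! j)) (xs ! j)])) = lin (dnw m ls) (tf m xs)" using assms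
proof(induction ls arbitrary: xs)
 case Nil
 have "dnw m [] = (%y. 0)" by(simp add: fun_eq_iff)
 thus ?case by simp
next
 case (Cons l ls)
 then obtain x ys where x: "xs = x # ys" "x : LS m l" "ys : tuples m ls" by(auto simp: tuples_Cons)
 have l: "good m l" "ALL l:set ls. good m l" using Cons by auto
 have "(SUM j<length (l # ls). tf m (xs[j := diff (letter m ((l # ls) ! j)) (xs ! j)])) =
  tf m (diff (letter m l) x # ys) + (SUM j<length ls. tf m (x # ys[j := diff (letter m (ls ! j)) (ys ! j)]))"
  unfolding x length_Cons sum.lessThan_Suc_shift by(simp del: tf.simps)
 also have "... = actv (lin (dlet m l) (lc x)) (tf m ys) + actv (lc x) (lin (dnw m ls) (tf m ys))"
  using letter_diff[OF l(1) x(2)] Cons.IH[OF l(2) x(3), symmetric] by(simp add: actv_def bil_sum_right)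
 also have "... = lin (dnw m (l # ls)) (tf m xs)" unfolding x tf.simps by(rule dnw_actv[OF l coords_vec[OF letter_coords[OF l(1)] x(2)], symmetric])
 finally show ?case .
qed

lemma tf_ract:
 assumes "ls ~= []" "ALL l:set ls. good m l" "xs : tuples m ls" "a : KS m"
 shows "tf m (xs[length ls - 1 := ract (letter m (ls ! (length ls - 1))) (xs ! (length ls - 1)) a]) = rmv (tf m xs) (kc a)" using assms
proof(induction ls arbitrary: xs)
 case (Cons l ls)
 then obtain x ys where x: "xs = x # ys" "x : LS m l" "ys : tuples m ls" by(auto simp: tuples_Cons)
 have l: "good m l" "ALL l:set ls. good m l" using Cons by auto
 show ?case
 proof(cases ls)
  case Nil
  have "ys = []" using x Nil by simp
  moreover have "kc a : vec (KB m)" by(rule coords_vec[OF ks_coords Cons.prems(4)])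
  ultimately show ?thesis using letter_ract[OF l(1) Cons.prems(4) x(2)] Nil by(simp add: x actv_lar lmv_onew rmv_onew[symmetric] actv_rmv)
 next
  case (Cons l' ls')
  thus ?thesis using Cons.IH[OF _ l(2) x(3) Cons.prems(4)] by(simp add: x actv_rmv)
 qed
qed simp

definition tc :: "nat => ks_cpx list fvec set => word fvec" where
 "tc m = value_on (tf m)"

abbreviation M :: "nat => braid_word => (ks_cpx list fvec set, ks) dg_bimodule" where
 "M m ls == tensor_over (KS_algebra m) (letters m ls)"

lemma M_space: "space (M m ls) = presented_space (tuples m ls) (tensor_rels (KS_algebra m) (letters m ls))"
 by(simp add: tensor_over_def Let_def tensor_space_def)

context
 fixes m :: nat and ls :: braid_word
 assumes ls: "ls ~= []" "ALL l:set ls. good m l"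
begin

lemma good_nth: "j < length ls ==> good m (ls ! j)" using ls(2) by simp

lemma M_coords: "coords (space (M m ls)) (NW m ls) (tc m)" unfolding M_space tc_def by(rule presented_coords[OF tensor_presents[OF ls]])

lemma tensor_class_coords:
 assumes "x : vec (tuples m ls)"
 shows "tensor_class (KS_algebra m) (letters m ls) x : carrier (space (M m ls))"
  "tc m (tensor_class (KS_algebra m) (letters m ls) x) = lin (tf m) x"
 unfolding tensor_class_def M_space tc_def using presented_class[OF tensor_presents[OF ls] assms] by auto

lemmas M_extend = extend_linear_coords[OF tensor_presents[OF ls] M_coords, folded tc_def M_space]

lemma M_diff:
 assumes "X : carrier (space (M m ls))"
 shows "diff (M m ls) X : carrier (space (M m ls))" (is ?g1) "tc m (diff (M m ls) X) = lin (dnw m ls) (tc m X)"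
proof -
 let ?cl = "tensor_class (KS_algebra m) (letters m ls)"
 let ?phi = "%xs. ?cl (SUM j<length ls. elt (xs[j := diff (letters m ls ! j) (xs ! j)]))"
 have e: "diff (M m ls) = extend_linear (space (M m ls)) ?phi" by(simp add: tensor_over_def Let_def)
 have *: "?phi xs : carrier (space (M m ls)) & tc m (?phi xs) = lin (dnw m ls) (tf m xs)" if xs: "xs : tuples m ls" for xs
 proof -
  have "(SUM j<length ls. elt (xs[j := diff (letters m ls ! j) (xs ! j)])) : vec (tuples m ls)"
  using xs by(intro vec_sum) (auto intro!: tuples_update letter_diff good_nth tuples_nth)
  from tensor_class_coords[OF this] show ?thesis using tf_diff[OF ls(2) xs] by(simp add: lin_sum)
 qed
 show ?g1 "tc m (diff (M m ls) X) = lin (dnw m ls) (tc m X)"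
  unfolding e by(rule M_extend[OF * assms], assumption)+
qed

lemma M_lact:
 assumes a: "a : KS m" and X: "X : carrier (space (M m ls))"
 shows "lact (M m ls) a X : carrier (space (M m ls))" (is ?g1) "tc m (lact (M m ls) a X) = lmv (kc a) (tc m X)" (is ?g2)
proof -
 let ?cl = "tensor_class (KS_algebra m) (letters m ls)"
 let ?phi = "%xs. ?cl (elt (xs[0 := lact (letters m ls ! 0) a (xs ! 0)]))"
 have e: "lact (M m ls) a = extend_linear (space (M m ls)) ?phi" by(simp add: tensor_over_def Let_def)
 have *: "?phi xs : carrier (space (M m ls)) &
  tc m (?phi xs) = lin (%y. lin (%a. elto (lmw a y)) (kc a)) (tf m xs)" if xs: "xs : tuples m ls" for xs
 proof -
  have 0: "0 < length ls" using ls by simp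
  have "elt (xs[0 := lact (letters m ls ! 0) a (xs ! 0)]) : vec (tuples m ls)"
  using xs 0 a by(auto intro!: tuples_update letter_lact good_nth tuples_nth)
  moreover obtain x ys l ls' where "xs = x # ys" "ls = l # ls'" "x : LS m l" using xs 0 by(cases ls) (auto simp: tuples_Cons)
  ultimately show ?thesis using tensor_class_coords[of "elt (xs[0 := lact (letters m ls ! 0) a (xs ! 0)])"] tf_lact[of m l a x ys] a ls(2)
  by(simp add: lmv_def bil_def lin_swap[of _ "tf m xs"] del: tf.simps) (simp add: lin_swap[of _ _ "kc a"] del: tf.simps)
 qed
 show ?g1 unfolding e by(rule M_extend(1)[OF * X])
 show ?g2 unfolding e lmv_def bil_def by(rule trans[OF M_extend(2)[OF * X]]) (assumption, rule lin_swap)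
qed

lemma M_ract:
 assumes a: "a : KS m" and X: "X : carrier (space (M m ls))"
 shows "ract (M m ls) X a : carrier (space (M m ls))" (is ?g1) "tc m (ract (M m ls) X a) = rmv (tc m X) (kc a)" (is ?g2)
proof -
 let ?cl = "tensor_class (KS_algebra m) (letters m ls)" and ?l = "length ls - 1"
 let ?phi = "%xs. ?cl (elt (xs[?l := ract (letters m ls ! ?l) (xs ! ?l) a]))"
 have e: "ract (M m ls) X a = extend_linear (space (M m ls)) ?phi X" by(simp add: tensor_over_def Let_def)
 have *: "?phi xs : carrier (space (M m ls)) &
  tc m (?phi xs) = lin (%y. lin (%a. elto (rmw y a)) (kc a)) (tf m xs)" if xs: "xs : tuples m ls" for xs
 proof -
  have l: "?l < length ls" using ls by simp
  hence "elt (xs[?l := ract (letters m ls ! ?l) (xs ! ?l) a]) : vec (tuples m ls)"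
  using xs a by(auto intro!: tuples_update letter_ract good_nth tuples_nth)
  from tensor_class_coords[OF this] show ?thesis using tf_ract[OF ls xs a] l by(simp add: rmv_def bil_def)
 qed
 show ?g1 unfolding e by(rule M_extend(1)[OF * X])
 show ?g2 unfolding e rmv_def bil_def by(rule M_extend(2)[OF * X])
qed

end

subsection \<open>The bigrading in coordinates\<close>

definition uh :: "nat \<times> int => kb option => int" where
 "uh l u = (if (u = None) = (snd l = 1) then 1 else 0)"

definition uq :: "nat \<times> int => kb option => int" where
 "uq l u = (case u of None => if snd l = 1 then 1 else 0 | Some p => (if snd l = 1 then 1 else 2) - int (len p))"

fun wh :: "braid_word => word => int" where
 "wh (l # ls) (u # us, b) = uh l u + wh ls (us, b)" | "wh _ (us, b) = 0"

fun wq :: "braid_word => word => int" where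
 "wq (l # ls) (u # us, b) = uq l u + wq ls (us, b)" | "wq _ (us, b) = - int (len b)"

lemma letter_degrees: "lh l h = uh l (fst (cut h))" "lq l h = uq l (fst (cut h)) - int (len (snd (cut h)))"
 by(cases l; cases h rule: cut.cases; simp add: uh_def uq_def)+

lemma lmw_degrees: "lmw a y = Some z ==> length (fst y) = length ls ==> wh ls z = wh ls y & wq ls z = wq ls y - int (len a)"
proof(induction a y arbitrary: z ls rule: lmw.induct)
 case (1 a b)
 thus ?case by(auto dest: mul_Some(4))
next
 case (2 a us b)
 then obtain l ls' where ls: "ls = l # ls'" by(cases ls) auto
 obtain us' b' where "lmw a (us, b) = Some (us', b')" "z = (None # us', b')" using 2(2) by auto
 thus ?case using 2(1)[of "(us', b')" ls'] 2(3) by(simp add: ls)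
next
 case (3 a p us b)
 then obtain l ls' where ls: "ls = l # ls'" by(cases ls) auto
 thus ?case using 3 by(auto simp: uh_def uq_def dest: mul_Some(4))
qed

lemma rmw_degrees: "rmw y a = Some z ==> length (fst y) = length ls ==> wh ls z = wh ls y & wq ls z = wq ls y - int (len a)"
proof(induction ls arbitrary: y z)
 case Nil
 thus ?case by(cases y) (auto simp: rmw_def dest: mul_Some(4))
next
 case (Cons l ls)
 then obtain u us b where y: "y = (u # us, b)" by(cases y; cases "fst y") auto
 then obtain c where c: "mul b a = Some c" "z = (u # us, c)" using Cons.prems by(auto simp: rmw_def)
 thus ?case using Cons.IH[of "(us, b)" "(us, c)"] Cons.prems by(simp add: y rmw_def)
qed

lemma wh_consw: "wh (l # ls) (consw u y) = uh l u + wh ls y" "wq (l # ls) (consw u y) = uq l u + wq ls y" by(cases y; simp)+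

lemma actw_degrees:
 assumes "actw h y = Some z" "length (fst y) = length ls"
 shows "wh (l # ls) z = lh l h + wh ls y" "wq (l # ls) z = lq l h + wq ls y"
proof -
 obtain y' where y': "lmw (snd (cut h)) y = Some y'" "z = consw (fst (cut h)) y'" using assms(1) by(auto simp: actw_def)
 show "wh (l # ls) z = lh l h + wh ls y" "wq (l # ls) z = lq l h + wq ls y"
  using lmw_degrees[OF y'(1) assms(2)] by(simp_all add: y' wh_consw letter_degrees)
qed

definition NWd :: "nat => braid_word => int => int => word set" where
 "NWd m ls h q = {y : NW m ls. wh ls y = h & wq ls y = q}"

abbreviation homogeneous :: "nat => braid_word => int => int => ks_cpx list set" where
 "homogeneous m ls h q == tensor_homogeneous (letters m ls) h q"

lemma homogeneous_Nil: "xs : homogeneous m [] h q <-> xs = [] & h = 0 & q = 0" by(auto simp: tensor_homogeneous_def letters_def tensor_gens_def)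

lemma homogeneous_Cons:
 "xs : homogeneous m (l # ls) h q <-> (EX x ys h' q'. xs = x # ys & x : LS m l &
  x : piece (letter m l) h' q' & ys : homogeneous m ls (h - h') (q - q'))"
proof -
 have split: "(ALL j<Suc n. Q j) <-> Q 0 & (ALL j<n. Q (Suc j))" for n and Q :: "nat => bool" using less_Suc_eq_0_disj by auto
 show ?thesis
 proof
  assume "xs : homogeneous m (l # ls) h q"
  then obtain hs qs where *: "xs : tuples m (l # ls)" "length hs = Suc (length ls)" "length qs = Suc (length ls)"
  "sum_list hs = h" "sum_list qs = q" "ALL j<Suc (length ls). xs ! j : piece (letters m (l # ls) ! j) (hs ! j) (qs ! j)"
  by(auto simp: tensor_homogeneous_def)
  obtain h' hs' q' qs' where hq: "hs = h' # hs'" "qs = q' # qs'" using *(2,3) by(cases hs; cases qs) auto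
  obtain x ys where x: "xs = x # ys" "x : LS m l" "ys : tuples m ls" using *(1) by(auto simp: tuples_Cons)
  have "ys : homogeneous m ls (h - h') (q - q')" using * x hq unfolding split tensor_homogeneous_def
  by(intro CollectI conjI, simp, rule_tac exI[of _ hs'], rule_tac exI[of _ qs']) (auto simp: letters_def)
  thus "EX x ys h' q'. xs = x # ys & x : LS m l &
  x : piece (letter m l) h' q' & ys : homogeneous m ls (h - h') (q - q')" using * x hq unfolding split by(auto simp: letters_def)
 next
  assume "EX x ys h' q'. xs = x # ys & x : LS m l &
  x : piece (letter m l) h' q' & ys : homogeneous m ls (h - h') (q - q')"
  then obtain x ys h' q' hs qs where *: "xs = x # ys" "x : LS m l"
  "x : piece (letter m l) h' q'" "ys : tuples m ls" "length hs = length ls" "length qs = length ls"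
  "sum_list hs = h - h'" "sum_list qs = q - q'" "ALL j<length ls. ys ! j : piece (letters m ls ! j) (hs ! j) (qs ! j)"
  by(auto simp: tensor_homogeneous_def)
  have "ALL j<Suc (length ls). (x # ys) ! j : piece (letters m (l # ls) ! j) ((h' # hs) ! j) ((q' # qs) ! j)"
  unfolding split using * by(auto simp: letters_def)
  moreover have mem: "xs : tuples m (l # ls)" unfolding tuples_Cons using * by blast
  ultimately show "xs : homogeneous m (l # ls) h q" unfolding tensor_homogeneous_def using * mem
  by(intro CollectI conjI, simp, rule_tac exI[of _ "h' # hs"], rule_tac exI[of _ "q' # qs"]) auto
 qed
qed

lemma tf_homogeneous:
 assumes "ALL l:set ls. good m l" "xs : homogeneous m ls h q"
 shows "tf m xs : vec (NWd m ls h q)" using assms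
proof(induction ls arbitrary: xs h q)
 case Nil
 thus ?case unfolding homogeneous_Nil by(auto simp: onew_def onev_def lin_sum NWd_def NW_def intro!: vec_sum)
next
 case (Cons l ls)
 then obtain x ys h' q' where x: "xs = x # ys" "x : piece (letter m l) h' q'" "ys : homogeneous m ls (h - h') (q - q')"
  unfolding homogeneous_Cons by blast
 have l: "good m l" using Cons by simp
 have "lc x : vec {y : LB m l. lh l y = h' & lq l y = q'}" "tf m ys : vec (NWd m ls (h - h') (q - q'))" using letter_piece[OF l] x Cons by auto
 thus ?case unfolding x tf.simps actv_def
 proof(rule vec_bil)
  fix a b assume ab: "a : {y : LB m l. lh l y = h' & lq l y = q'}" "b : NWd m ls (h - h') (q - q')"
  hence "length (fst b) = length ls" using okw_length[of m ls "fst b" "snd b"] by(simp add: NWd_def NW_def)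
  thus "elto (actw a b) : vec (NWd m (l # ls) h q)"
  using ab okw_actw[of a m l ls b] actw_degrees[of a b _ ls l] by(auto simp: elto_vec NWd_def NW_def)
 qed
qed

lemma rep_letter_piece:
 assumes "good m l" "u = None | (EX p. u = Some p & snd l ~= 0 & p : PL m (fst l))"
 shows "rep_letter m l u : piece (letter m l) (uh l u) (uq l u)"
proof -
 let ?K = "{y : LB m l. lh l y = uh l u & lq l y = uq l u}"
 have "fst l <= m" using assms(1) by(cases l) auto
 hence "(case u of None => inr (onev m) | Some p => elt (Inl (p, Vertex (fst l)))) : vec ?K"
  using assms(2) by(auto simp: letter_degrees LB_def PR_def onev_def intro!: vec_inr vec_sum)
 thus ?thesis unfolding letter_piece[OF assms(1)] rep_letter(2)[OF assms] using rep_letter(1)[OF assms] by blast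
qed

lemma rep_tuple_homogeneous:
 assumes "ls ~= []" "ALL l:set ls. good m l" "okw m ls y"
 shows "rep_tuple m ls y : homogeneous m ls (wh ls y) (wq ls y)" using assms
proof(induction m ls y rule: rep_tuple.induct)
 case (2 m l us b)
 then obtain u where us: "us = [u]" using okw_length[of m "[l]" us b] by(cases us) auto
 have b: "b : KB m" using okw_last[OF 2(3)] .
 have u: "u = None | (EX p. u = Some p & snd l ~= 0 & p : PL m (fst l))" using 2(3) by(cases u) (auto simp: us)
 have g: "good m l" using 2 by simp
 note k = kb_point[OF b] and r = rep_letter[OF g u]
 note ra = letter_ract[OF g conjunct1[OF k] r(1)]
 let ?h = "case u of None => Inr b | Some p => Inl (p, b)"
 have h: "?h : LB m l" "cut ?h = (u, b)" using 2(3) b by(auto simp: us LB_def PR_def split: option.splits)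
 have "lc (ract (letter m l) (rep_letter m l u) (kb_point m b)) = elt ?h" using ra k cut_letter(1)[OF g h(1)] by(simp add: h(2))
 hence "ract (letter m l) (rep_letter m l u) (kb_point m b) : piece (letter m l) (uh l u) (uq l u - int (len b))"
  unfolding letter_piece[OF g] using ra h by(simp add: letter_degrees)
 thus ?case using ra(1) by(auto simp: us homogeneous_Cons homogeneous_Nil)
next
 case (3 m l l' ls us b)
 then obtain u us' where us: "us = u # us'" using okw_length[of m "l # l' # ls" us b] by(cases us) auto
 have u: "u = None | (EX p. u = Some p & snd l ~= 0 & p : PL m (fst l))" using 3(4) by(cases u) (auto simp: us)
 have g: "good m l" using 3 by simp
 have "okw m (l' # ls) (us', b)" using 3(4) us by(cases u) simp_all
 with 3 have "rep_tuple m (l' # ls) (us', b) : homogeneous m (l' # ls) (wh (l' # ls) (us', b)) (wq (l' # ls) (us', b))" by(simp add: us)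
 thus ?case using rep_letter(1)[OF g u] rep_letter_piece[OF g u]
  by(subst homogeneous_Cons, intro exI[of _ "rep_letter m l u"] exI[of _ "rep_tuple m (l' # ls) (us', b)"],
  rule_tac exI[of _ "uh l u"], rule_tac exI[of _ "uq l u"]) (simp add: us)
qed simp

lemma M_piece:
 assumes ls: "ls ~= []" "ALL l:set ls. good m l"
 shows "X : piece (M m ls) h q <-> X : carrier (space (M m ls)) & tc m X : vec (NWd m ls h q)"
proof(rule piece_iff[OF M_coords[OF ls]])
 have e: "piece (M m ls) h q = {tensor_class (KS_algebra m) (letters m ls) x | x. Poly_Mapping.keys x <= homogeneous m ls h q}"
  by(simp add: tensor_over_def Let_def)
 have s: "EX x:vec (homogeneous m ls h q). lin (tf m) x = elt y" if "y : NWd m ls h q" for y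
  using that rep_tuple[OF ls, of y] rep_tuple_homogeneous[OF ls, of y] by(intro bexI[of _ "elt (rep_tuple m ls y)"]) (auto simp: NWd_def NW_def)
 have sub: "homogeneous m ls h q <= tuples m ls" by(auto simp: tensor_homogeneous_def)
 note p = presented_pieces[OF tensor_presents[OF ls] sub tf_homogeneous[OF ls(2)] s, folded tensor_class_def M_space tc_def]
 show "piece (M m ls) h q <= carrier (space (M m ls))" unfolding e by(rule p(1))
 show "tc m ` piece (M m ls) h q = vec (NWd m ls h q)" unfolding e by(rule p(2))
qed

section \<open>The Hochschild complex in coordinates\<close>

type_synonym bar = "kb list \<times> word"

definition consb :: "kb => bar => bar" where
 "consb b = (%(bs, y). (b # bs, y))"

lemma consb_simp [simp]: "consb b (bs, y) = (b # bs, y)" by(simp add: consb_def)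

definition consbv :: "kb fvec => bar fvec => bar fvec" where
 "consbv = bil (%b z. elt (consb b z))"

definition pairb :: "kb list => word fvec => bar fvec" where
 "pairb bs = lin (%y. elt (bs, y))"

lemma pairb_simps [simp]: "pairb bs 0 = 0" "pairb bs (elt z) = elt (bs, z)" "pairb bs (x + y) = pairb bs x + pairb bs y"
 by(simp_all add: pairb_def lin_add)

lemma lin_pairb: "lin f (pairb bs y) = lin (%y. f (bs, y)) y" by(simp add: pairb_def lin_lin)

lemma consbv_add [simp]: "consbv (a + a') z = consbv a z + consbv a' z" "consbv a (z + z') = consbv a z + consbv a z'"
 "consbv 0 z = 0" "consbv a 0 = 0" by(simp_all add: consbv_def bil_add_left bil_add_right)

lemma consbv_elt [simp]: "consbv (elt b) (elt w) = elt (consb b w)" by(simp add: consbv_def)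

lemma consbv_pairb: "consbv (elt b) (pairb bs y) = pairb (b # bs) y" by(simp add: consbv_def bil_elt_left lin_pairb) (simp add: pairb_def)

fun hf :: "nat => ks list \<times> ks_cpx list fvec set => bar fvec" where
 "hf m ([], X) = pairb [] (tc m X)"
| "hf m (a # as, X) = consbv (kc a) (hf m (as, X))"

definition BG :: "nat => braid_word => bar set" where
 "BG m ls = {(bs, y). set bs <= KB m & y : NW m ls}"

text \<open>
  The Hochschild differential on basis elements. In \<open>bar_mult\<close> the module element is the last entry of
  the list of factors; \<open>bar_rot\<close> moves the first factor around to its other side.
\<close>

fun front :: "kb => bar => bar fvec" where
 "front b ([], y) = pairb [] (elto (lmw b y))"
| "front b (c # bs, y) = lin (%d. elt (d # bs, y)) (elto (mul b c))"

fun bar_mult :: "bar => bar fvec" where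
 "bar_mult ([], y) = 0"
| "bar_mult (b # bs, y) = front b (bs, y) + consbv (elt b) (bar_mult (bs, y))"

definition rbar :: "bar => kb => bar fvec" where
 "rbar = (%(bs, y) c. pairb bs (elto (rmw y c)))"

fun bar_rot :: "bar => bar fvec" where
 "bar_rot ([], y) = 0"
| "bar_rot (b # bs, y) = rbar (bs, y) b"

definition bar_int :: "nat => braid_word => bar => bar fvec" where
 "bar_int m ls = (%(bs, y). pairb bs (dnw m ls y))"

definition bar_ext :: "bar => bar fvec" where
 "bar_ext z = bar_mult z + bar_rot z"

definition dbar :: "nat => braid_word => bar => bar fvec" where
 "dbar m ls z = bar_int m ls z + bar_ext z"

lemma lin_bar_mult_consbv: "lin bar_mult (consbv a z) = bil front a z + consbv a (lin bar_mult z)"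
proof(induction a z rule: f2_induct2)
 case (elt a z)
 thus ?case by(cases z) simp
qed(simp_all add: lin_add bil_add_left bil_add_right ac_simps)

lemma front_consbv: "bil front a (consbv b z) = consbv (mulv a b) z"
proof(induction a b z rule: f2_induct3)
 case (elt a b z)
 thus ?case by(cases z; cases "mul a b") (simp_all add: mulv_def)
qed(simp_all add: bil_add_left bil_add_right mulv_def)

lemma front_pairb: "bil front a (pairb [] y) = pairb [] (lmv a y)"
 by(induction a y rule: f2_induct2) (simp_all add: bil_add_left bil_add_right v_add v_elt)

lemma lin_bar_rot_consbv: "lin bar_rot (consbv a z) = bil rbar z a"
proof(induction a z rule: f2_induct2)
 case (elt a z)
 thus ?case by(cases z) simp
qed(simp_all add: lin_add bil_add_left bil_add_right)

lemma lin_bar_int_consbv: "lin (bar_int m ls) (consbv a z) = consbv a (lin (bar_int m ls) z)"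
proof(induction a z rule: f2_induct2)
 case (elt a z)
 thus ?case by(cases z) (simp add: bar_int_def consbv_pairb)
qed(simp_all add: lin_add)

context
 fixes m :: nat and ls :: braid_word
 assumes ls: "ls ~= []" "ALL l:set ls. good m l"
begin

abbreviation "HGens == hoch_gens (KS_algebra m) (M m ls)"
abbreviation "HRels == hoch_rels (KS_algebra m) (M m ls)"

lemma hf_ract:
 assumes "set as <= KS m" "X : carrier (space (M m ls))" "a : KS m"
 shows "hf m (as, ract (M m ls) X a) = bil rbar (hf m (as, X)) (kc a)" using assms(1)
proof(induction as)
 case Nil
 have "pairb [] (rmv y c) = bil rbar (pairb [] y) c" for y c by(induction y c rule: f2_induct2)
  (simp_all add: v_add v_elt bil_add_left bil_add_right rbar_def)
 thus ?case using M_ract[OF ls assms(3,2)] by simp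
next
 case (Cons b as)
 have "consbv b (bil rbar z c) = bil rbar (consbv b z) c" for b z c
 proof(induction b z c rule: f2_induct3)
  case (elt b z c)
  thus ?case by(cases z) (simp add: rbar_def consbv_pairb)
 qed(simp_all add: bil_add_left bil_add_right)
 thus ?case using Cons by simp
qed

lemma hf_diff:
 assumes "X : carrier (space (M m ls))"
 shows "hf m (as, diff (M m ls) X) = lin (bar_int m ls) (hf m (as, X))"
proof(induction as)
 case Nil
 have "pairb [] (lin (dnw m ls) y) = lin (bar_int m ls) (pairb [] y)" for y by(induction y rule: f2_induct) (simp_all add: lin_add bar_int_def)
 thus ?case using M_diff[OF ls assms] by simp
qed(simp add: lin_bar_int_consbv)

lemma hf_mult:
 assumes "set as <= KS m" "X : carrier (space (M m ls))" "as ~= []"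
 shows "(SUM j<length as - 1. hf m (take j as @ (as ! j \<otimes>\<^bsub>KS_algebra m\<^esub> as ! Suc j) # drop (Suc (Suc j)) as, X)) +
  hf m (butlast as, lact (M m ls) (last as) X) = lin bar_mult (hf m (as, X))" using assms(1,3)
proof(induction as)
 case (Cons a as)
 have a: "a : KS m" using Cons by simp
 have 0: "lin bar_mult (pairb [] y) = 0" for y by(simp add: lin_pairb)
 show ?case
 proof(cases as)
  case Nil
  thus ?thesis using M_lact[OF ls a assms(2)] by(simp add: lin_bar_mult_consbv front_pairb 0)
 next
  case (Cons a' as')
  have "(SUM j<length (a # as) - 1. hf m (take j (a # as) @ ((a # as) ! j \<otimes>\<^bsub>KS_algebra m\<^esub> (a # as) ! Suc j) # drop (Suc (Suc j)) (a # as), X)) =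
  hf m ((a \<otimes>\<^bsub>KS_algebra m\<^esub> a') # as', X) +
  (SUM j<length as - 1. hf m (a # take j as @ (as ! j \<otimes>\<^bsub>KS_algebra m\<^esub> as ! Suc j) # drop (Suc (Suc j)) as, X))"
  unfolding Cons length_Cons diff_Suc_1 sum.lessThan_Suc_shift by simp
  also have "... = hf m ((a \<otimes>\<^bsub>KS_algebra m\<^esub> a') # as', X) +
  consbv (kc a) (SUM j<length as - 1. hf m (take j as @ (as ! j \<otimes>\<^bsub>KS_algebra m\<^esub> as ! Suc j) # drop (Suc (Suc j)) as, X))"
  by(simp add: consbv_def bil_sum_right)
  finally have "(SUM j<length (a # as) - 1. hf m (take j (a # as) @ ((a # as) ! j \<otimes>\<^bsub>KS_algebra m\<^esub> (a # as) ! Suc j) # drop (Suc (Suc j)) (a # as), X)) +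
  hf m (butlast (a # as), lact (M m ls) (last (a # as)) X) =
  hf m ((a \<otimes>\<^bsub>KS_algebra m\<^esub> a') # as', X) + consbv (kc a) (lin bar_mult (hf m (as, X)))"
  using Cons.IH Cons.prems Cons by(simp add: add.assoc flip: consbv_add(2))
  also have "... = lin bar_mult (hf m (a # as, X))" using Cons.prems a by(simp add: lin_bar_mult_consbv Cons front_consbv ks_mult)
  finally show ?thesis .
 qed
qed simp

lemma hf_boundary:
 assumes "g : HGens"
 shows "lin (hf m) (hoch_boundary (KS_algebra m) (M m ls) g) = lin (dbar m ls) (hf m g)"
proof -
 obtain as X where g: "g = (as, X)" "set as <= KS m" "X : carrier (space (M m ls))" using assms by(auto simp: hoch_gens_def)
 have d: "lin (dbar m ls) z = lin (bar_int m ls) z + (lin bar_mult z + lin bar_rot z)" for z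
 proof -
  have "dbar m ls = (%z. bar_int m ls z + (bar_mult z + bar_rot z))" by(simp add: fun_eq_iff dbar_def bar_ext_def)
  thus ?thesis by(simp add: lin_fun_add)
 qed
 show ?thesis
 proof(cases as)
  case Nil
  thus ?thesis unfolding d g(1) using hf_diff[OF g(3), of as] by(simp add: hoch_boundary_def lin_pairb)
 next
  case (Cons a as')
  have a: "a : KS m" and s: "set as' <= KS m" using g Cons by auto
  have r: "hf m (as', ract (M m ls) X a) = lin bar_rot (hf m (as, X))" using hf_ract[OF s g(3) a] by(simp add: Cons lin_bar_rot_consbv)
  have "as ~= []" using Cons by simp
  from hf_mult[OF g(2,3) this] show ?thesis unfolding d g(1) using hf_diff[OF g(3), of as] r by(simp add: hoch_boundary_def Cons lin_add lin_sum)
 qed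
qed

lemma hoch_boundary_gens:
 assumes "g : HGens"
 shows "hoch_boundary (KS_algebra m) (M m ls) g : vec HGens"
proof -
 obtain as X where g: "g = (as, X)" "set as <= KS m" "X : carrier (space (M m ls))" using assms by(auto simp: hoch_gens_def)
 have "set b <= KS m"
  if "j < length as - 1" "take j as @ (as ! j \<otimes>\<^bsub>KS_algebra m\<^esub> as ! Suc j) # drop (Suc (Suc j)) as = b" for j b
 proof -
  have "as ! j : KS m" "as ! Suc j : KS m" using g(2) that(1) by(auto simp: subset_iff)
  thus ?thesis using g(2) set_take_subset[of j as] set_drop_subset[of "Suc (Suc j)" as] ks_mult(1) unfolding that(2)[symmetric] by auto
 qed
 moreover have "set (butlast as) <= KS m" "set (tl as) <= KS m" using g(2) by(cases as; auto dest: in_set_butlastD split: if_splits)+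
 moreover have "as ~= [] ==> hd as : KS m & last as : KS m" using g(2) by auto
 ultimately have "(as, diff (M m ls) X) : HGens"
  "!!j. j < length as - 1 ==> (take j as @ (as ! j \<otimes>\<^bsub>KS_algebra m\<^esub> as ! Suc j) # drop (Suc (Suc j)) as, X) : HGens"
  "as ~= [] ==> (butlast as, lact (M m ls) (last as) X) : HGens"
  "as ~= [] ==> (tl as, ract (M m ls) X (hd as)) : HGens" using g M_diff(1)[OF ls g(3)] M_lact(1)[OF ls _ g(3)] M_ract(1)[OF ls _ g(3)]
  unfolding hoch_gens_def by blast+
 thus ?thesis unfolding hoch_boundary_def g(1) prod.case by(auto intro!: vec_add vec_sum)
qed

lemma hf_update: "j < length as ==> EX D. ALL a. hf m (as[j := a], X) = lin D (kc a)"
proof(induction as arbitrary: j)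
 case (Cons b as)
 show ?case
 proof(cases j)
  case 0
  thus ?thesis by(auto simp: consbv_def bil_def intro!: exI[of _ "%a. lin (%z. elt (consb a z)) (hf m (as, X))"])
 next
  case (Suc i)
  then obtain D where "ALL a. hf m (as[i := a], X) = lin D (kc a)" using Cons.IH[of i] Cons.prems by(metis Suc_less_eq length_Cons)
  thus ?thesis using Suc by(auto simp: consbv_def bil_lin_right intro!: exI[of _ "%a. consbv (kc b) (D a)"])
 qed
qed simp

lemma hf_module: "EX D. ALL X. hf m (as, X) = lin D (tc m X)"
proof(induction as)
 case Nil
 thus ?case by(auto simp: pairb_def)
next
 case (Cons b as)
 then obtain D where "ALL X. hf m (as, X) = lin D (tc m X)" by blast
 thus ?case by(auto simp: consbv_def bil_lin_right intro!: exI[of _ "%a. consbv (kc b) (D a)"])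
qed

definition rep_bar :: "bar => (ks list \<times> ks_cpx list fvec set)" where
 "rep_bar = (%(bs, y). (map (kb_point m) bs, point (space (M m ls)) (tc m) (elt y)))"

lemma hf_rep_bar:
 assumes "z : BG m ls"
 shows "rep_bar z : HGens" "hf m (rep_bar z) = elt z"
proof -
 obtain bs y where z: "z = (bs, y)" "set bs <= KB m" "y : NW m ls" using assms by(auto simp: BG_def)
 have y: "elt y : vec (NW m ls)" using z by simp
 note p = point_closed[OF M_coords[OF ls] y] coords_point[OF M_coords[OF ls] y]
 have "kb_point m b : KS m" if "b : set bs" for b using z kb_point that by blast
 thus "rep_bar z : HGens" using p by(auto simp: z rep_bar_def hoch_gens_def)
 have "hf m (map (kb_point m) bs, point (space (M m ls)) (tc m) (elt y)) = elt (bs, y)" using z(2) p kb_point by(induction bs) auto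
 thus "hf m (rep_bar z) = elt z" by(simp add: z rep_bar_def)
qed

lemma hf_vec: "g : HGens ==> hf m g : vec (BG m ls)"
proof -
 assume "g : HGens"
 then obtain as X where g: "g = (as, X)" "set as <= KS m" "X : carrier (space (M m ls))" by(auto simp: hoch_gens_def)
 have "hf m (as, X) : vec (BG m ls)" using g(2)
 proof(induction as)
  case Nil
  show ?case unfolding hf.simps pairb_def by(rule vec_lin[OF coords_vec[OF M_coords[OF ls] g(3)]]) (simp add: BG_def)
 next
  case (Cons a as)
  hence "kc a : vec (KB m)" "hf m (as, X) : vec (BG m ls)" using coords_vec[OF ks_coords] by auto
  thus ?case unfolding hf.simps consbv_def by(rule vec_bil) (auto simp: BG_def)
 qed
 thus ?thesis using g by simp
qed

lemma reduce_bar: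
 assumes "set pre <= KS m" "set as <= KS m" "X : carrier (space (M m ls))"
 shows "elt (pre @ as, X) + lin (%z. elt (pre @ fst (rep_bar z), snd (rep_bar z))) (hf m (as, X)) : f2_span HRels" using assms(1,2)
proof(induction as arbitrary: pre)
 case Nil
 have "elt (pre, X) + lin (%y. elt (pre, point (space (M m ls)) (tc m) (elt y))) (tc m X) : f2_span HRels"
 proof(rule reduce_coords[OF M_coords[OF ls], of X "NW m ls" "%X. (pre, X)"])
  show "elt (pre, x \<oplus>\<^bsub>space (M m ls)\<^esub> y) - (elt (pre, x) + elt (pre, y)) : HRels"
  if "x : carrier (space (M m ls))" "y : carrier (space (M m ls))" for x y using that Nil unfolding hoch_rels_def hoch_gens_def by blast
 qed(use assms(3) coords_vec[OF M_coords[OF ls]] in "auto intro: f2_span_zero")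
 thus ?case by(simp add: lin_pairb rep_bar_def)
next
 case (Cons a as)
 let ?D = "%b. lin (%z. elt (pre @ fst (rep_bar (consb b z)), snd (rep_bar (consb b z)))) (hf m (as, X))"
 have "elt (pre @ a # as, X) + lin ?D (kc a) : f2_span HRels"
 proof(rule reduce_coords[OF ks_coords[of m], of a "KB m" "%a. (pre @ a # as, X)"])
  fix x y assume xy: "x : KS m" "y : KS m"
  have "elt ((pre @ a # as)[length pre := x \<oplus>\<^bsub>KS_algebra m\<^esub> y], X) -
  (elt ((pre @ a # as)[length pre := x], X) + elt ((pre @ a # as)[length pre := y], X)) : HRels"
  unfolding hoch_rels_def hoch_gens_def using xy Cons.prems assms(3)
  by(intro UnI1 CollectI exI[of _ "pre @ a # as"] exI[of _ "length pre"] exI[of _ x] exI[of _ y] exI[of _ X]) auto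
  thus "elt (pre @ (x \<oplus>\<^bsub>KS_algebra m\<^esub> y) # as, X) - (elt (pre @ x # as, X) + elt (pre @ y # as, X)) : HRels" by simp
 next
  fix b assume b: "b : KB m"
  have "elt ((pre @ [kb_point m b]) @ as, X) +
  lin (%z. elt ((pre @ [kb_point m b]) @ fst (rep_bar z), snd (rep_bar z))) (hf m (as, X)) : f2_span HRels"
  using Cons.prems kb_point[OF b] by(intro Cons.IH) auto
  thus "elt (pre @ kb_point m b # as, X) + ?D b : f2_span HRels" by(simp add: rep_bar_def consb_def case_prod_beta)
 qed(use Cons.prems coords_vec[OF ks_coords] in auto)
 thus ?case by(simp add: consbv_def bil_def lin_lin)
qed

lemma hoch_presents: "presents HGens HRels (hf m) (BG m ls)"
proof(rule presentsI[where g = "%z. elt (rep_bar z)"])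
 show "hf m a : vec (BG m ls)" if "a : HGens" for a using hf_vec[OF that] .
 show "elt (rep_bar z) : vec HGens & lin (hf m) (elt (rep_bar z)) = elt z" if "z : BG m ls" for z using hf_rep_bar[OF that] by simp
 show "elt g + lin (%z. elt (rep_bar z)) (hf m g) : f2_span HRels" if "g : HGens" for g
  using that reduce_bar[of "[]" "fst g" "snd g"] by(auto simp: hoch_gens_def)
 fix r assume "r : HRels"
 then consider (alg) as j a b X where "r = elt (as[j := a \<oplus>\<^bsub>KS_algebra m\<^esub> b], X) - (elt (as[j := a], X) + elt (as[j := b], X))"
  "(as, X) : HGens" "j < length as" "a : KS m" "b : KS m"
  | (module) as x y where "r = elt (as, x \<oplus>\<^bsub>space (M m ls)\<^esub> y) - (elt (as, x) + elt (as, y))"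
  "(as, x) : HGens" "y : carrier (space (M m ls))" unfolding hoch_rels_def by blast
 thus "r : vec HGens & lin (hf m) r = 0"
 proof cases
  case alg
  obtain D where D: "ALL a. hf m (as[j := a], X) = lin D (kc a)" using hf_update[OF alg(3)] by blast
  have "set (as[j := c]) <= KS m" if "c : KS m" for c using alg(2) that set_update_subset_insert[of as j c] by(auto simp: hoch_gens_def)
  thus ?thesis using alg coords_add[OF ks_coords alg(4,5)] coords_add_closed[OF ks_coords alg(4,5)]
  by(auto simp: vec_diff lin_add D hoch_gens_def intro!: vec_add)
 next
  case module
  obtain D where D: "ALL X. hf m (as, X) = lin D (tc m X)" using hf_module by blast
  show ?thesis using module coords_add[OF M_coords[OF ls], of x y] coords_add_closed[OF M_coords[OF ls], of x y]
  by(auto simp: vec_diff lin_add D hoch_gens_def intro!: vec_add)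
 qed
qed

abbreviation "HC == hoch_complex (KS_algebra m) (KS_grading m) (M m ls)"

definition hc :: "(ks list \<times> ks_cpx list fvec set) fvec set => bar fvec" where
 "hc = value_on (hf m)"

lemma HC_space: "space HC = presented_space HGens HRels" by(simp add: hoch_complex_def Let_def)

lemma HC_coords: "coords (space HC) (BG m ls) hc" unfolding HC_space hc_def by(rule presented_coords[OF hoch_presents])

lemma HC_diff:
 assumes "X : carrier (space HC)"
 shows "diff HC X : carrier (space HC)" "hc (diff HC X) = lin (dbar m ls) (hc X)"
proof -
 let ?phi = "%g. presented_class HGens HRels (hoch_boundary (KS_algebra m) (M m ls) g)"
 have e: "diff HC = extend_linear (space HC) ?phi" by(simp add: hoch_complex_def Let_def)
 have *: "?phi g : carrier (space HC) & hc (?phi g) = lin (dbar m ls) (hf m g)" if "g : HGens" for g unfolding HC_space hc_def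
  using presented_class[OF hoch_presents hoch_boundary_gens[OF that]] hf_boundary[OF that] by simp
 note l = extend_linear_coords[OF hoch_presents HC_coords * assms[unfolded HC_space], folded hc_def]
 show "diff HC X : carrier (space HC)" unfolding e by(rule l(1))
 show "hc (diff HC X) = lin (dbar m ls) (hc X)" unfolding e by(rule l(2))
qed

end

definition BGd :: "nat => braid_word => int => int => bar set" where
 "BGd m ls i j = {(bs, y). set bs <= KB m & y : NW m ls & wh ls y - int (length bs) = i &
  wq ls y - int (sum_list (map len bs)) = j}"

lemma HC_piece:
 assumes ls: "ls ~= []" "ALL l:set ls. good m l"
 shows "X : piece (hoch_complex (KS_algebra m) (KS_grading m) (M m ls)) i j <->
  X : carrier (space (hoch_complex (KS_algebra m) (KS_grading m) (M m ls))) & hc m X : vec (BGd m ls i j)"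
proof(rule piece_iff[OF HC_coords[OF ls]])
 let ?G = "hoch_homogeneous (KS_algebra m) (KS_grading m) (M m ls) i j"
 let ?C = "hoch_complex (KS_algebra m) (KS_grading m) (M m ls)"
 let ?HG = "hoch_gens (KS_algebra m) (M m ls)" and ?HR = "hoch_rels (KS_algebra m) (M m ls)"
 have e: "piece ?C i j = {presented_class ?HG ?HR x | x. Poly_Mapping.keys x <= ?G}" by(simp add: hoch_complex_def Let_def)
 have f: "hf m g : vec (BGd m ls i j)" if g: "g : ?G" for g
 proof -
  obtain as x js j' where *: "g = (as, x)" "set as <= KS m" "length js = length as"
  "ALL l<length as. as ! l : KS_grading m (js ! l)" "x : piece (M m ls) (i + int (length as)) j'"
  "sum_list js + j' = j" using g by(auto simp: hoch_homogeneous_def hoch_gens_def)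
  have "hf m (as, x) : vec {(bs, y). set bs <= KB m & y : NWd m ls h j' &
  length bs = length as & - int (sum_list (map len bs)) = sum_list js}"
  if "x : piece (M m ls) h j'" for h using *(2,3,4)
  proof(induction as arbitrary: js)
  case Nil
  have "tc m x : vec (NWd m ls h j')" using that M_piece[OF ls] by blast
  thus ?case unfolding hf.simps pairb_def by(rule vec_lin) (use Nil in auto)
  next
  case (Cons a as)
  then obtain k js' where js: "js = k # js'" by(cases js) auto
  have "ALL l<length as. as ! l : KS_grading m (js' ! l)" "a : KS_grading m k"
  using Cons.prems(3) unfolding js by(auto dest: spec[of _ "Suc _"] spec[of _ 0])
  hence "kc a : vec {b : KB m. - int (len b) = k}"
  "hf m (as, x) : vec {(bs, y). set bs <= KB m & y : NWd m ls h j' &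
  length bs = length as & - int (sum_list (map len bs)) = sum_list js'}" using Cons js KS_grading_iff by auto
  thus ?case unfolding hf.simps consbv_def by(rule vec_bil) (auto simp: js subset_iff)
  qed
  from this[OF *(5)] show ?thesis unfolding *(1) by(rule vec_mono) (use *(6) in "auto simp: BGd_def NWd_def")
 qed
 have s: "EX x:vec ?G. lin (hf m) x = elt z" if z: "z : BGd m ls i j" for z
 proof(rule bexI[of _ "elt (rep_bar m ls z)"])
  obtain bs y where bs: "z = (bs, y)" "set bs <= KB m" "y : NW m ls" "wh ls y - int (length bs) = i"
  "wq ls y - int (sum_list (map len bs)) = j" using z by(auto simp: BGd_def)
  hence bg: "z : BG m ls" by(simp add: BG_def)
  show "lin (hf m) (elt (rep_bar m ls z)) = elt z" using hf_rep_bar[OF ls bg] by simp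
  have y: "elt y : vec (NW m ls)" using bs by simp
  note p = point_closed[OF M_coords[OF ls] y] coords_point[OF M_coords[OF ls] y]
  have "point (space (M m ls)) (tc m) (elt y) : piece (M m ls) (i + int (length bs)) (wq ls y)"
  unfolding M_piece[OF ls] using p bs by(auto simp: NWd_def)
  moreover have "ALL l<length bs. map (kb_point m) bs ! l : KS_grading m (map (%b. - int (len b)) bs ! l)"
  proof(intro allI impI)
  fix l assume l: "l < length bs"
  hence "bs ! l : KB m" using bs(2) by auto
  from kb_point[OF this] show "map (kb_point m) bs ! l : KS_grading m (map (%b. - int (len b)) bs ! l)"
  using l `bs ! l : KB m` by(auto simp: KS_grading_iff)
  qed
  moreover have "sum_list (map (%b. - int (len b)) bs) + wq ls y = j" using bs(5) by(induction bs arbitrary: j) auto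
  ultimately show "elt (rep_bar m ls z) : vec ?G" using hf_rep_bar(1)[OF ls bg]
  by(auto simp: hoch_homogeneous_def rep_bar_def[OF ls] bs(1) intro!: exI[of _ "map (%b. - int (len b)) bs"] exI[of _ "wq ls y"])
 qed
 have sub: "?G <= ?HG" by(auto simp: hoch_homogeneous_def)
 show "piece ?C i j <= carrier (space ?C)" unfolding e HC_space[OF ls] by(rule presented_pieces(1)[OF hoch_presents[OF ls] sub f s])
 show "hc m ` piece ?C i j = vec (BGd m ls i j)" unfolding e hc_def[OF ls] by(rule presented_pieces(2)[OF hoch_presents[OF ls] sub f s])
qed

section \<open>Acyclicity of the Hochschild direction\<close>

lemma add_swap4: "(a + b) + (c + d) = (a + c) + (b + (d :: 'a \<Rightarrow>\<^sub>0 bit))" by(simp only: ac_simps)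

lemma add_cancel4: "(a + b) + (a + c) = b + (c :: 'a \<Rightarrow>\<^sub>0 bit)" by(simp only: add_swap4[of a b a c] vec_add_self add_0_left)

definition bar_front :: "kb fvec => bar fvec => bar fvec" where
 "bar_front = bil front"

definition rbv :: "bar fvec => kb fvec => bar fvec" where
 "rbv = bil rbar"

lemma bar_add [simp]:
 "bar_front (a + a') z = bar_front a z + bar_front a' z" "bar_front a (z + z') = bar_front a z + bar_front a z'"
 "rbv (z + z') a = rbv z a + rbv z' a" "rbv z (a + a') = rbv z a + rbv z a'"
 "bar_front 0 z = 0" "bar_front a 0 = 0" "rbv 0 a = 0" "rbv z 0 = 0" by(simp_all add: bar_front_def rbv_def bil_add_left bil_add_right)

lemma bar_front_elt [simp]: "bar_front (elt a) (elt w) = front a w" and rbv_elt [simp]: "rbv (elt w) (elt a) = rbar w a"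
 by(simp_all add: bar_front_def rbv_def)

lemmas bar_front_consbv = front_consbv[folded bar_front_def]
lemmas bar_mult_consbv = lin_bar_mult_consbv[folded bar_front_def]
lemmas bar_rot_consbv = lin_bar_rot_consbv[folded rbv_def]

lemma bar_front_pairb: "bar_front a (pairb [] y) = pairb [] (lmv a y)" by(simp add: bar_front_def front_pairb)

lemma rbv_pairb: "rbv (pairb bs y) a = pairb bs (rmv y a)" by(induction y a rule: f2_induct2) (simp_all add: v_add v_elt rbar_def)

lemma rbv_consbv: "rbv (consbv b z) a = consbv b (rbv z a)"
proof(induction b z a rule: f2_induct3)
 case (elt b z a)
 thus ?case by(cases z) (simp add: rbar_def consbv_pairb)
qed simp_all

text \<open>Identities between the operators are proved by moving one algebra factor at a time to the front.\<close>

lemma bar_induct [case_names nil cons]: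
 assumes "!!y. P (elt ([], y))" "!!b bs y. P (elt (bs, y)) ==> P (consbv (elt b) (elt (bs, y)))"
 shows "P (elt (bs, y))"
proof(induction bs)
 case (Cons b bs)
 show ?case using assms(2)[OF Cons] by simp
qed(rule assms(1))

lemma elt_pairb: "elt ([], y) = pairb [] (elt y)" by simp

lemma bar_mult_pairb: "lin bar_mult (pairb [] y) = 0" "lin bar_rot (pairb [] y) = 0" by(simp_all add: lin_pairb)

lemma bar_front_mulv: "bar_front (mulv a b) z = bar_front a (bar_front b z)"
proof(induction z rule: f2_induct)
 case (elt w)
 obtain bs y where w: "w = (bs, y)" by(cases w)
 show ?case
 proof(cases bs)
  case Nil
  show ?thesis unfolding w Nil elt_pairb bar_front_pairb lmv_mulv ..
 next
  case (Cons c cs)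
  have e: "elt w = consbv (elt c) (elt (cs, y))" by(simp add: w Cons)
  have "mulv (mulv a b) (elt c) = mulv a (mulv b (elt c))" unfolding mulv_def
  proof(induction a b rule: f2_induct2)
  case (elt a b)
  thus ?case using mul_assoc[of a b c] by(cases "mul a b"; cases "mul b c") simp_all
  qed(simp_all add: bil_add_left bil_add_right)
  thus ?thesis unfolding e bar_front_consbv by simp
 qed
qed simp_all

lemma bar_mult_front: "lin bar_mult (bar_front a z) = bar_front a (lin bar_mult z)"
proof(induction z rule: f2_induct)
 case (elt w)
 obtain bs y where w: "w = (bs, y)" by(cases w)
 show ?case unfolding w
 proof(induction bs y rule: bar_induct)
  case (nil y)
  show ?case unfolding elt_pairb bar_front_pairb bar_mult_pairb by simp
 next
  case (cons b bs y)
  show ?case by(simp only: bar_front_consbv bar_mult_consbv bar_add bar_front_mulv)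
 qed
qed(simp_all add: lin_add)

lemma bar_front_rbv: "bar_front b (rbv z a) = rbv (bar_front b z) a"
proof(induction z rule: f2_induct)
 case (elt w)
 obtain bs y where w: "w = (bs, y)" by(cases w)
 show ?case unfolding w
 proof(induction bs y rule: bar_induct)
  case (nil y)
  show ?case unfolding elt_pairb bar_front_pairb rbv_pairb lmv_rmv ..
 next
  case (cons c bs y)
  show ?case by(simp only: rbv_consbv bar_front_consbv)
 qed
qed simp_all

lemma bar_mult_rbv: "lin bar_mult (rbv z a) = rbv (lin bar_mult z) a"
proof(induction z rule: f2_induct)
 case (elt w)
 obtain bs y where w: "w = (bs, y)" by(cases w)
 show ?case unfolding w
 proof(induction bs y rule: bar_induct)
  case (nil y)
  show ?case unfolding elt_pairb rbv_pairb bar_mult_pairb by simp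
 next
  case (cons c bs y)
  show ?case by(simp only: rbv_consbv bar_mult_consbv bar_front_rbv bar_add cons)
 qed
qed(simp_all add: lin_add)

lemma rbv_mulv: "rbv z (mulv a b) = rbv (rbv z a) b"
proof(induction z rule: f2_induct)
 case (elt w)
 obtain bs y where w: "w = (bs, y)" by(cases w)
 show ?case unfolding w
 proof(induction bs y rule: bar_induct)
  case (nil y)
  show ?case unfolding elt_pairb rbv_pairb rmv_mulv ..
 next
  case (cons c bs y)
  show ?case by(simp only: rbv_consbv cons)
 qed
qed simp_all

lemma bar_mult_bar_mult: "lin bar_mult (lin bar_mult z) = 0"
proof(induction z rule: f2_induct)
 case (elt w)
 obtain bs y where w: "w = (bs, y)" by(cases w)
 show ?case unfolding w
 proof(induction bs y rule: bar_induct)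
  case (nil y)
  show ?case unfolding elt_pairb bar_mult_pairb by simp
 next
  case (cons c bs y)
  show ?case by(simp only: bar_mult_consbv lin_add bar_mult_front cons consbv_add add_0_right vec_add_self)
 qed
qed(simp_all add: lin_add)

lemma bar_rot_relation:
 "lin bar_mult (lin bar_rot z) + lin bar_rot (lin bar_mult z) + lin bar_rot (lin bar_rot z) = 0"
proof(induction z rule: f2_induct)
 case (elt w)
 obtain bs y where w: "w = (bs, y)" by(cases w)
 show ?case
 proof(cases bs)
  case Nil
  show ?thesis unfolding w Nil elt_pairb bar_mult_pairb by simp
 next
  case (Cons a cs)
  let ?z = "elt (cs, y)"
  have "lin bar_rot (bar_front (elt a) ?z) = lin bar_rot (rbv ?z (elt a))"
  proof(cases cs)
  case Nil
  show ?thesis unfolding Nil elt_pairb bar_front_pairb rbv_pairb bar_mult_pairb ..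
  next
  case (Cons b ds)
  hence e: "?z = consbv (elt b) (elt (ds, y))" by simp
  show ?thesis unfolding e bar_front_consbv rbv_consbv bar_rot_consbv rbv_mulv ..
  qed
  moreover have e: "elt w = consbv (elt a) ?z" by(simp add: w Cons)
  moreover have "h + (g + h) + g = 0" for g h :: "bar \<Rightarrow>\<^sub>0 bit" by(metis add.commute vec_add_cancel(2) vec_add_self)
  ultimately show ?thesis by(simp only: e bar_rot_consbv bar_mult_consbv lin_add bar_mult_rbv)
 qed
next
 case (add x y)
 have "!!a b c a' b' c' :: bar \<Rightarrow>\<^sub>0 bit. a + b + c = 0 ==> a' + b' + c' = 0 ==> (a + a') + (b + b') + (c + c') = 0"
  by(metis add_swap4 add_0_right)
 from this[OF add] show ?case by(simp add: lin_add)
qed simp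

lemma lin_bar_ext: "lin bar_ext z = lin bar_mult z + lin bar_rot z"
proof -
 have e: "bar_ext = (%z. bar_mult z + bar_rot z)" by(simp add: fun_eq_iff bar_ext_def)
 show ?thesis unfolding e by(rule lin_fun_add)
qed

lemma lin_dbar: "lin (dbar m ls) z = lin (bar_int m ls) z + lin bar_ext z"
proof -
 have e: "dbar m ls = (%z. bar_int m ls z + bar_ext z)" by(simp add: fun_eq_iff dbar_def)
 show ?thesis unfolding e by(rule lin_fun_add)
qed

lemma bar_ext_bar_ext: "lin bar_ext (lin bar_ext z) = 0"
proof -
 have "lin bar_ext (lin bar_ext z) =
  lin bar_mult (lin bar_rot z) + lin bar_rot (lin bar_mult z) + lin bar_rot (lin bar_rot z)"
  unfolding lin_bar_ext lin_add bar_mult_bar_mult by(simp only: add_0_left ac_simps)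
 thus ?thesis using bar_rot_relation[of z] by(rule trans)
qed

lemma bar_int_pairb: "lin (bar_int m ls) (pairb [] y) = pairb [] (lin (dnw m ls) y)"
 by(induction y rule: f2_induct) (simp_all add: lin_add bar_int_def)

lemma bar_int_rbv: "lin (bar_int m ls) (rbv z a) = rbv (lin (bar_int m ls) z) a"
proof(induction z rule: f2_induct)
 case (elt w)
 obtain bs y where w: "w = (bs, y)" by(cases w)
 show ?case unfolding w
 proof(induction bs y rule: bar_induct)
  case (nil y)
  show ?case unfolding elt_pairb rbv_pairb bar_int_pairb dnw_rmv ..
 next
  case (cons c bs y)
  show ?case by(simp only: rbv_consbv lin_bar_int_consbv cons)
 qed
qed(simp_all add: lin_add)

context
 fixes m :: nat and ls :: braid_word
 assumes gd: "ALL l:set ls. good m l"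
begin

lemma bar_int_front:
 assumes "a : vec (KB m)"
 shows "lin (bar_int m ls) (bar_front a z) = bar_front a (lin (bar_int m ls) z)"
proof(induction z rule: f2_induct)
 case (elt w)
 obtain bs y where w: "w = (bs, y)" by(cases w)
 show ?case
 proof(cases bs)
  case Nil
  show ?thesis unfolding w Nil elt_pairb bar_front_pairb bar_int_pairb dnw_lmv[OF gd assms] ..
 next
  case (Cons c cs)
  hence e: "elt w = consbv (elt c) (elt (cs, y))" by(simp add: w)
  show ?thesis unfolding e bar_front_consbv lin_bar_int_consbv bar_front_consbv ..
 qed
qed(simp_all add: lin_add)

lemma bar_int_mult:
 assumes "set bs <= KB m"
 shows "lin (bar_int m ls) (lin bar_mult (elt (bs, y))) = lin bar_mult (lin (bar_int m ls) (elt (bs, y)))" using assms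
proof(induction bs)
 case Nil
 show ?case unfolding elt_pairb bar_int_pairb bar_mult_pairb by simp
next
 case (Cons b bs)
 hence b: "elt b : vec (KB m)" and IH: "lin (bar_int m ls) (lin bar_mult (elt (bs, y))) = lin bar_mult (lin (bar_int m ls) (elt (bs, y)))" by auto
 have e: "elt (b # bs, y) = consbv (elt b) (elt (bs, y))" by simp
 show ?case unfolding e lin_bar_int_consbv bar_mult_consbv lin_add bar_int_front[OF b] lin_bar_int_consbv IH ..
qed

lemma bar_int_rot: "lin (bar_int m ls) (lin bar_rot (elt (bs, y))) = lin bar_rot (lin (bar_int m ls) (elt (bs, y)))"
proof(cases bs)
 case Nil
 show ?thesis unfolding Nil elt_pairb bar_int_pairb bar_mult_pairb by simp
next
 case (Cons b cs)
 hence e: "elt (bs, y) = consbv (elt b) (elt (cs, y))" by simp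
 show ?thesis unfolding e lin_bar_int_consbv bar_rot_consbv bar_int_rbv ..
qed

lemma dbar_dbar: "z : vec (BG m ls) ==> lin (dbar m ls) (lin (dbar m ls) z) = 0"
proof(induction rule: vec_induct)
 case (elt w)
 then obtain bs y where w: "w = (bs, y)" "set bs <= KB m" "okw m ls y" by(auto simp: BG_def NW_def)
 have "lin (bar_int m ls) (lin (bar_int m ls) (elt (bs, y))) = 0"
 proof(induction bs)
  case Nil
  show ?case unfolding elt_pairb bar_int_pairb using dnw_dnw[OF gd w(3)] by simp
 next
  case (Cons c bs)
  have e: "elt (c # bs, y) = consbv (elt c) (elt (bs, y))" by simp
  show ?case unfolding e lin_bar_int_consbv Cons by simp
 qed
 moreover have "lin (bar_int m ls) (lin bar_ext (elt (bs, y))) = lin bar_ext (lin (bar_int m ls) (elt (bs, y)))"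
  by(simp only: lin_bar_ext lin_add bar_int_mult[OF w(2)] bar_int_rot)
 ultimately show ?case by(simp only: lin_dbar lin_add w(1) bar_ext_bar_ext add_0_left add_0_right vec_add_self)
qed(simp_all add: lin_add)

end

lemma dloc_vec:
 assumes "good m l" "okw m (l # ls) (consw u y)"
 shows "dloc m l u (elt y) : vec {z. okw m (l # ls) z & srcw z = srcw (consw u y) &
  wh (l # ls) z = wh (l # ls) (consw u y) + 1 & wq (l # ls) z = wq (l # ls) (consw u y)}"
proof -
 obtain us b where y: "y = (us, b)" by(cases y)
 have ok: "okw m ls y" and len: "length (fst y) = length ls" using assms(2) okw_length[of m ls us b] by(cases u; auto simp: okw_consw y)+
 show ?thesis
 proof(cases u)
  case None
  show ?thesis
  proof(cases "snd l = -1")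
  case True
  hence i: "1 <= fst l" "fst l <= m" using assms(1) by(cases l; auto)+
  have g: "gamv m (fst l) : vec {t : PL m (fst l) \<times> PR m (fst l). src (fst t) = tgt (snd t) & len (fst t) + len (snd t) = 2}"
  unfolding gamv_def using i by(auto simp: PL_def PR_def intro!: vec_add)
  show ?thesis unfolding None dloc_def option.case if_P[OF True]
  proof(rule vec_lin[OF g])
  fix t assume t: "t : {t : PL m (fst l) \<times> PR m (fst l). src (fst t) = tgt (snd t) & len (fst t) + len (snd t) = 2}"
  show "cons1 (Some (fst t)) (lmv (elt (snd t)) (elt y)) : vec {z. okw m (l # ls) z & srcw z = srcw (consw None y) &
  wh (l # ls) z = wh (l # ls) (consw None y) + 1 & wq (l # ls) z = wq (l # ls) (consw None y)}"
  proof(cases "lmw (snd t) y")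
  case (Some z)
  thus ?thesis using t lmw_Some[OF Some] lmw_degrees[OF Some len] okw_lmw[OF ok _ Some] True
  by(cases z) (auto simp: v_elt okw_consw wh_consw uh_def uq_def PR_def y)
  qed(simp add: v_elt)
  qed
  qed(simp add: None dloc_def)
 next
  case (Some p)
  show ?thesis
  proof(cases "snd l = 1")
  case True
  have p: "p : KB m" using assms(2) by(simp add: Some okw_consw PL_def)
  show ?thesis
  proof(cases "lmw p y")
  case z: (Some z)
  thus ?thesis using lmw_Some[OF z] lmw_degrees[OF z len] okw_lmw[OF ok p z]
  by(cases z) (simp add: v_elt okw_consw wh_consw uh_def uq_def y Some True dloc_def)
  qed(simp add: v_elt Some dloc_def)
  qed(simp add: Some dloc_def)
 qed
qed

lemma dnw_vec:
 assumes "ALL l:set ls. good m l" "okw m ls y"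
 shows "dnw m ls y : vec {z. okw m ls z & srcw z = srcw y & wh ls z = wh ls y + 1 & wq ls z = wq ls y}" using assms
proof(induction ls arbitrary: y)
 case (Cons l ls)
 obtain u us b where y: "y = (u # us, b)" using Cons.prems(2) by(cases y; cases "fst y") auto
 have e: "y = consw u (us, b)" by(simp add: y)
 have ok: "okw m ls (us, b)" using Cons.prems(2) by(cases u) (auto simp: y)
 have l: "good m l" and gs: "ALL l:set ls. good m l" using Cons.prems by auto
 have "cons1 u (dnw m ls (us, b)) : vec {z. okw m (l # ls) z & srcw z = srcw y & wh (l # ls) z = wh (l # ls) y + 1 & wq (l # ls) z = wq (l # ls) y}"
  unfolding cons1_def
 proof(rule vec_lin[OF Cons.IH[OF gs ok]])
  fix z assume "z : {z. okw m ls z & srcw z = srcw (us, b) & wh ls z = wh ls (us, b) + 1 & wq ls z = wq ls (us, b)}"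
  thus "elt (consw u z) : vec {z. okw m (l # ls) z & srcw z = srcw y & wh (l # ls) z = wh (l # ls) y + 1 & wq (l # ls) z = wq (l # ls) y}"
  using Cons.prems(2) by(cases u; cases z) (auto simp: y)
 qed
 thus ?case using dloc_vec[OF l, of ls u "(us, b)"] Cons.prems(2) by(auto simp: y intro!: vec_add)
qed simp

definition pat :: "word => bool list" where
 "pat y = map (%u. u = None) (fst y)"

lemma lmw_pat: "lmw a y = Some z ==> pat z = pat y" by(induction a y arbitrary: z rule: lmw.induct) (auto simp: pat_def)

lemma rmw_pat: "rmw y a = Some z ==> fst z = fst y" by(cases y) (auto simp: rmw_def)

definition bar_inv :: "nat => braid_word => nat => bool list => int => bar set" where
 "bar_inv m ls n v q = {(bs, y). set bs <= KB m & okw m ls y & length bs = n & pat y = v &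
  wq ls y - int (sum_list (map len bs)) = q}"

lemma pat_wh: "okw m ls y ==> okw m ls y' ==> pat y = pat y' ==> wh ls y = wh ls y'"
proof(induction ls arbitrary: y y')
 case (Cons l ls)
 obtain u us b u' us' b' where y: "y = (u # us, b)" "y' = (u' # us', b')" using Cons.prems by(cases y; cases "fst y"; cases y'; cases "fst y'") auto
 have "okw m ls (us, b)" "okw m ls (us', b')" using Cons.prems by(cases u; cases u'; auto simp: y)+
 thus ?case using Cons.IH[of "(us, b)" "(us', b')"] Cons.prems(3) by(simp add: y pat_def uh_def)
next
 case Nil
 thus ?case by(cases y; cases y') simp
qed

lemma bar_ext_vec:
 assumes "w : bar_inv m ls (Suc n) v q"
 shows "bar_ext w : vec (bar_inv m ls n v q)"
proof -
 obtain bs y where w: "w = (bs, y)" "set bs <= KB m" "okw m ls y" "length bs = Suc n" "pat y = v"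
  "wq ls y - int (sum_list (map len bs)) = q" using assms by(auto simp: bar_inv_def)
 have len: "length (fst y) = length ls" using okw_length[of m ls "fst y" "snd y"] w by simp
 have "bar_mult (bs, y) : vec (bar_inv m ls n v q)" using w(2,4,6)
 proof(induction bs arbitrary: n q)
  case (Cons b bs)
  have b: "b : KB m" using Cons.prems by simp
  have "front b (bs, y) : vec (bar_inv m ls n v q)"
  proof(cases bs)
  case Nil
  show ?thesis using okw_lmw[OF w(3) b] lmw_pat[of b y] lmw_degrees[OF _ len, of b] Cons.prems w(5) by(cases "lmw b y") (auto simp: Nil bar_inv_def)
  next
  case c: (Cons c cs)
  show ?thesis using mul_KB[OF b, of c] mul_Some(4)[of b c] Cons.prems w(3,5) by(cases "mul b c") (auto simp: c bar_inv_def)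
  qed
  moreover have "consbv (elt b) (bar_mult (bs, y)) : vec (bar_inv m ls n v q)"
  proof(cases bs)
  case (Cons c cs)
  then obtain k where k: "n = Suc k" using Cons.prems by auto
  have IH: "bar_mult (bs, y) : vec (bar_inv m ls k v (q + int (len b)))" using Cons.prems k by(intro Cons.IH) auto
  show ?thesis unfolding consbv_def bil_elt_left using b by(intro vec_lin[OF IH]) (auto simp: bar_inv_def k subset_iff)
  qed simp
  ultimately show ?case by(auto intro: vec_add)
 qed simp
 moreover have "bar_rot (bs, y) : vec (bar_inv m ls n v q)"
 proof(cases bs)
  case (Cons b cs)
  hence b: "b : KB m" using w by simp
  show ?thesis using okw_rmw[OF w(3) b] rmw_pat[of y b] rmw_degrees[OF _ len, of b] w
  by(cases "rmw y b") (auto simp: Cons bar_inv_def rbar_def pat_def)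
 qed simp
 ultimately show ?thesis unfolding w(1) bar_ext_def by(rule vec_add)
qed

lemma bar_ext_Nil: "bar_ext ([], y) = 0" by(simp add: bar_ext_def)

subsection \<open>Vertices of the cube with a cup-cap diagram\<close>

text \<open>
  Here \<open>M\<close> is projective: splitting \<open>p\<close> off the first factor \<open>P\<^sub>i\<close>, as \<open>p \<otimes> (i)\<close>, is a contraction.
\<close>

definition has_cup :: "word => bool" where
 "has_cup y <-> False : set (pat y)"

lemma has_cup_simps [simp]: "~ has_cup ([], b)" "has_cup (None # us, b) <-> has_cup (us, b)" "has_cup (Some p # us, b)"
 by(simp_all add: has_cup_def pat_def)

fun first_path :: "word => kb" where
 "first_path ([], b) = b" | "first_path (None # us, b) = first_path (us, b)" | "first_path (Some p # us, b) = p"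

fun reset :: "word => word" where
 "reset ([], b) = ([], b)" | "reset (None # us, b) = consw None (reset (us, b))"
| "reset (Some p # us, b) = (Some (Vertex (tgt p)) # us, b)"

lemma reset_consw: "reset (consw None y) = consw None (reset y)" "first_path (consw None y) = first_path y"
 "has_cup (consw None y) <-> has_cup y" by(cases y; simp)+

lemma lmw_reset: "has_cup y ==> lmw (first_path y) (reset y) = Some y"
proof(induction y rule: first_path.induct)
 case (2 us b)
 thus ?case by(simp add: lmw_consw)
qed(auto simp: mul_Vertex_right)

lemma lmw_first:
 assumes "has_cup y"
 shows "map_option first_path (lmw a y) = mul a (first_path y)" (is ?g1)
  "lmw a y = Some z ==> reset z = reset y & has_cup z"
proof -
 show ?g1 using assms
 proof(induction a y rule: lmw.induct)
  case (2 a us b)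
  thus ?case by(cases "lmw a (us, b)") auto
 next
  case (3 a p us b)
  thus ?case by(cases "mul a p") auto
 qed simp
 show "reset z = reset y & has_cup z" if "lmw a y = Some z" using assms that
 proof(induction a y arbitrary: z rule: lmw.induct)
  case (2 a us b)
  then obtain z' where "lmw a (us, b) = Some z'" "z = consw None z'" by auto
  with 2 show ?case by(cases z') auto
 qed(auto dest: mul_Some)
qed

lemma rmw_reset: "has_cup y ==> rmw (reset y) c = map_option reset (rmw y c)"
 "has_cup y ==> rmw y c = Some z ==> first_path z = first_path y & has_cup z"
proof -
 show "rmw (reset y) c = map_option reset (rmw y c)" if "has_cup y" using that
 proof(induction y rule: reset.induct)
  case (2 us b)
  have "rmw (us, b) c = map_option (Pair us) (mul b c)" "rmw (None # us, b) c = map_option (Pair (None # us)) (mul b c)" by(simp_all add: rmw_def)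
  with 2 show ?case by(cases "mul b c") (simp_all add: rmw_consw)
 next
  case (3 p us b)
  thus ?case by(cases "mul b c") (simp_all add: rmw_def)
 qed simp
 show "first_path z = first_path y & has_cup z" if "has_cup y" "rmw y c = Some z" using that
 proof(induction y arbitrary: z rule: reset.induct)
  case (2 us b)
  thus ?case by(auto simp: rmw_def)
 qed(auto simp: rmw_def)
qed

lemma okw_reset: "okw m ls y ==> has_cup y ==> okw m ls (reset y) & first_path y : KB m & pat (reset y) = pat y"
proof(induction m ls y rule: okw.induct)
 case (3 m l ls us b)
 thus ?case by(cases "reset (us, b)") (auto simp: pat_def)
next
 case (4 m l ls p us b)
 thus ?case using tgt_KB[of p m] by(auto simp: PL_def pat_def)
qed auto

definition peel :: "bar => bar fvec" where
 "peel = (%(bs, y). elt (bs @ [first_path y], reset y))"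

lemma peel_cons: "lin peel (consbv (elt b) z) = consbv (elt b) (lin peel z)"
proof(induction z rule: f2_induct)
 case (elt w)
 thus ?case by(cases w) (simp add: peel_def)
qed(simp_all add: lin_add)

lemma peel_mult:
 assumes "has_cup y"
 shows "lin bar_mult (peel (bs, y)) + lin peel (bar_mult (bs, y)) = elt (bs, y)"
proof(induction bs)
 case Nil
 show ?case using lmw_reset[OF assms] by(simp add: peel_def)
next
 case (Cons a bs)
 have 1: "peel (a # bs, y) = consbv (elt a) (peel (bs, y))" by(simp add: peel_def)
 have 2: "bar_front (elt a) (peel (bs, y)) = lin peel (front a (bs, y))"
 proof(cases bs)
  case Nil
  show ?thesis
  proof(cases "lmw a y")
  case None
  thus ?thesis using lmw_first(1)[OF assms, of a] by(simp add: Nil peel_def)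
  next
  case (Some z)
  thus ?thesis using lmw_first(1)[OF assms, of a, symmetric] lmw_first(2)[OF assms Some] by(simp add: Nil peel_def)
  qed
 next
  case (Cons c cs)
  thus ?thesis by(cases "mul a c") (simp_all add: peel_def)
 qed
 have "lin bar_mult (peel (a # bs, y)) + lin peel (bar_mult (a # bs, y)) =
  consbv (elt a) (lin bar_mult (peel (bs, y)) + lin peel (bar_mult (bs, y)))"
  by(simp only: 1 bar_mult.simps bar_mult_consbv 2 lin_add peel_cons consbv_add add_cancel4)
 thus ?case using Cons by simp
qed

lemma peel_rot:
 assumes "has_cup y"
 shows "lin bar_rot (peel (bs, y)) + lin peel (bar_rot (bs, y)) =
  (if bs = [] then pairb [] (elto (rmw (reset y) (first_path y))) else 0)"
proof(cases bs)
 case Nil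
 thus ?thesis by(simp add: peel_def rbar_def)
next
 case (Cons a cs)
 have "lin bar_rot (peel (bs, y)) = rbar (cs @ [first_path y], reset y) a" by(simp add: peel_def Cons)
 also have "... = lin peel (rbar (cs, y) a)" using rmw_reset[OF assms, of a] by(cases "rmw y a") (auto simp: rbar_def peel_def)
 finally show ?thesis by(simp add: Cons)
qed

lemma peel_contracts:
 assumes "has_cup y"
 shows "lin bar_ext (peel (bs, y)) + lin peel (bar_ext (bs, y)) =
  elt (bs, y) + (if bs = [] then pairb [] (elto (rmw (reset y) (first_path y))) else 0)" unfolding lin_bar_ext bar_ext_def lin_add
 by(subst add_swap4) (simp only: peel_mult[OF assms] peel_rot[OF assms])

subsection \<open>The vertex without cup-cap diagrams\<close>

text \<open>
  Here \<open>M = A\<close> and the claim is that \<open>HH\<^sub>n(A, A) = 0\<close> for \<open>n > 0\<close>. It rests on the chain of ideals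
  spanned by the basis elements of level at most \<open>t\<close>: the elements of level \<open>t\<close> are the products \<open>u v\<close>
  through the vertex \<open>t\<close>, each in exactly one way. A cyclic word in \<open>A\<close> is contracted by splitting
  its first factor of minimal level. This is a contraction up to words of lower level or with more
  factors of the minimal level; there are only finitely many steps of that kind.
\<close>

fun lev :: "kb => nat" where
 "lev (Vertex i) = i" | "lev (Step i j) = min i j" | "lev (Loop i) = i - 1"

fun spl :: "kb => kb \<times> kb" where
 "spl (Vertex i) = (Vertex i, Vertex i)"
| "spl (Step i j) = (if i < j then (Vertex i, Step i j) else (Step i j, Vertex j))"
| "spl (Loop i) = (Step i (i - 1), Step (i - 1) i)"

lemma spl:
 assumes "b : KB m"
 shows "mul (fst (spl b)) (snd (spl b)) = Some b" "lev (fst (spl b)) = lev b" "lev (snd (spl b)) = lev b"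
  "fst (spl b) : KB m" "snd (spl b) : KB m" "len (fst (spl b)) + len (snd (spl b)) = len b" using assms by(cases b; auto)+

lemma mul_lev: "a : KB m ==> b : KB m ==> mul a b = Some c ==> lev c <= lev a & lev c <= lev b" by(cases a; cases b) (auto split: if_splits)

lemma lev_le: "b : KB m ==> lev b <= m" by(cases b) auto

lemma spl_through: "b : KB m ==> tgt (fst (spl b)) = lev b & src (snd (spl b)) = lev b" by(cases b) auto

lemma spl_unique:
 assumes "u : KB m" "v : KB m" "tgt u = t" "src v = t" "lev u = t" "lev v = t"
 shows "EX d. mul u v = Some d & lev d = t & spl d = (u, v)"
proof -
 have "u = Vertex t | u = Step (Suc t) t" using assms(1,3,5) by(cases u) auto
 moreover have "v = Vertex t | v = Step t (Suc t)" using assms(2,4,6) by(cases v) auto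
 ultimately show ?thesis by auto
qed

lemma spl_mul_right:
 assumes b: "b : KB m" and c: "c : KB m"
 shows "mul (snd (spl b)) c = None ==> mul b c = None"
  "mul (snd (spl b)) c = Some v ==> lev v = lev b ==> EX d. mul b c = Some d & lev d = lev b & spl d = (fst (spl b), v)"
  "mul (snd (spl b)) c = Some v ==> lev v ~= lev b ==> lev v < lev b & (ALL d. mul b c = Some d --> lev d < lev b)"
proof -
 have e: "mul b c = Option.bind (mul (snd (spl b)) c) (mul (fst (spl b)))" using mul_assoc[of "fst (spl b)" "snd (spl b)" c] spl(1)[OF b] by simp
 show "mul (snd (spl b)) c = None ==> mul b c = None" using e by simp
 assume v: "mul (snd (spl b)) c = Some v"
 have vk: "v : KB m" using mul_KB[OF spl(5)[OF b] c v] .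
 { assume "lev v = lev b"
  thus "EX d. mul b c = Some d & lev d = lev b & spl d = (fst (spl b), v)"
  using spl_unique[OF spl(4)[OF b] vk, of "lev b"] spl[OF b] spl_through[OF b] mul_Some(2)[OF v] e v by simp }
 { assume "lev v ~= lev b"
  moreover have "lev v <= lev b" using mul_lev[OF spl(5)[OF b] c v] spl[OF b] by simp
  ultimately show "lev v < lev b & (ALL d. mul b c = Some d --> lev d < lev b)" by(auto simp: e v dest!: mul_lev[OF spl(4)[OF b] vk]) }
qed

lemma spl_mul_left:
 assumes b: "b : KB m" and c: "c : KB m"
 shows "mul c (fst (spl b)) = None ==> mul c b = None"
  "mul c (fst (spl b)) = Some u ==> lev u = lev b ==> EX d. mul c b = Some d & lev d = lev b & spl d = (u, snd (spl b))"
  "mul c (fst (spl b)) = Some u ==> lev u ~= lev b ==> lev u < lev b & (ALL d. mul c b = Some d --> lev d < lev b)"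
proof -
 have e: "mul c b = Option.bind (mul c (fst (spl b))) (%u. mul u (snd (spl b)))"
  using mul_assoc[of c "fst (spl b)" "snd (spl b)"] spl(1)[OF b] by simp
 show "mul c (fst (spl b)) = None ==> mul c b = None" using e by simp
 assume u: "mul c (fst (spl b)) = Some u"
 have uk: "u : KB m" using mul_KB[OF c spl(4)[OF b] u] .
 { assume "lev u = lev b"
  thus "EX d. mul c b = Some d & lev d = lev b & spl d = (u, snd (spl b))"
  using spl_unique[OF uk spl(5)[OF b], of "lev b"] spl[OF b] spl_through[OF b] mul_Some(3)[OF u] e u by simp }
 { assume "lev u ~= lev b"
  moreover have "lev u <= lev b" using mul_lev[OF c spl(4)[OF b] u] spl[OF b] by simp
  ultimately show "lev u < lev b & (ALL d. mul c b = Some d --> lev d < lev b)" by(auto simp: e u dest!: mul_lev[OF uk spl(5)[OF b]]) }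
qed

definition lcons :: "kb => kb list fvec => kb list fvec" where
 "lcons b = lin (%L. elt (b # L))"

lemma lcons_simps [simp]: "lcons b 0 = 0" "lcons b (elt L) = elt (b # L)" "lcons b (x + y) = lcons b x + lcons b y"
 by(simp_all add: lcons_def lin_add)

text \<open>Cyclic words, the module element first; \<open>cyc_rot\<close> multiplies the last factor into it.\<close>

fun mul_head :: "kb => kb list => kb list fvec" where
 "mul_head b [] = 0" | "mul_head b (c # L) = lin (%d. elt (d # L)) (elto (mul b c))"

fun cyc_mult :: "kb list => kb list fvec" where
 "cyc_mult [] = 0" | "cyc_mult (b # L) = mul_head b L + lcons b (cyc_mult L)"

definition cyc_rot :: "kb list => kb list fvec" where
 "cyc_rot L = (if length L < 2 then 0 else lin (%d. elt (d # butlast (tl L))) (elto (mul (last L) (hd L))))"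

definition dcyc :: "kb list => kb list fvec" where
 "dcyc L = cyc_mult L + cyc_rot L"

fun split_at :: "nat => kb list => kb list" where
 "split_at t [] = []"
| "split_at t (b # L) = (if lev b = t then fst (spl b) # snd (spl b) # L else b # split_at t L)"

definition minlev :: "kb list => nat" where
 "minlev L = Min (lev ` set L)"

definition cnt :: "nat => kb list => nat" where
 "cnt t L = length (filter (%b. lev b = t) L)"

lemma cnt_simps [simp]: "cnt t [] = 0" "cnt t (b # L) = (if lev b = t then 1 else 0) + cnt t L" "cnt t (L @ L') = cnt t L + cnt t L'"
 by(simp_all add: cnt_def)

definition split_min :: "kb list => kb list fvec" where
 "split_min L = (if L = [] then 0 else elt (split_at (minlev L) L))"

definition deeper :: "nat => nat => kb list set" where
 "deeper t c = {L. (EX x:set L. lev x < t) \<or> cnt t L > c}"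

lemma cnt_pos: "cnt t L > 0 <-> (EX x:set L. lev x = t)" by(auto simp: cnt_def filter_empty_conv)

lemma cnt_split_at: "set L <= KB m ==> EX x:set L. lev x = t ==> cnt t (split_at t L) = Suc (cnt t L)" by(induction L) (auto simp: spl)

lemma split_at_KB: "set L <= KB m ==> set (split_at t L) <= KB m" by(induction L) (auto simp: spl)

lemma split_at_lower:
 "set L <= KB m ==> x : set L ==> EX x':set (split_at t L). lev x' = lev x" by(induction L) (auto simp: spl intro: bexI)

lemma minlev_eq: "x : set L ==> ALL y:set L. lev x <= lev y ==> minlev L = lev x" unfolding minlev_def by(rule Min_eqI) auto

lemma minlev_attained: "L ~= [] ==> EX x:set L. lev x = minlev L"
proof -
 assume "L ~= []"
 hence "minlev L : lev ` set L" unfolding minlev_def by(intro Min_in) auto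
 thus ?thesis by auto
qed

lemma minlev_le: "x : set L ==> minlev L <= lev x" unfolding minlev_def by(rule Min_le) auto

lemma split_min_deeper:
 assumes "set L <= KB m" "L : deeper t c"
 shows "split_min L : vec (deeper t c)"
proof -
 have L: "L ~= []" using assms(2) by(auto simp: deeper_def)
 show ?thesis
 proof(cases "EX x:set L. lev x < t")
  case True
  then obtain x where x: "x : set L" "lev x < t" by blast
  obtain x' where "x' : set (split_at (minlev L) L)" "lev x' = lev x" using split_at_lower[OF assms(1) x(1), of "minlev L"] by blast
  hence "split_at (minlev L) L : deeper t c" using x(2) unfolding deeper_def by(intro CollectI disjI1 bexI[of _ x']) simp_all
  thus ?thesis using L by(simp add: split_min_def)
 next
  case False
  hence c: "cnt t L > c" using assms(2) by(auto simp: deeper_def)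
  then obtain x where x: "x : set L" "lev x = t" using cnt_pos[of t L] by auto
  hence "minlev L = t" using minlev_eq[of x L] False by(auto simp: not_less)
  thus ?thesis using cnt_split_at[OF assms(1) bexI[of "%x. lev x = t", OF x(2) x(1)]] c L by(auto simp: split_min_def deeper_def)
 qed
qed

lemma split_min_higher:
 assumes "set L <= KB m" "EX x:set L. lev x <= t" "(ALL x:set L. t <= lev x) ==> cnt t L >= c"
 shows "split_min L : vec (deeper t c)"
proof(cases "EX x:set L. lev x < t")
 case True
 thus ?thesis using split_min_deeper[OF assms(1)] by(auto simp: deeper_def)
next
 case False
 then obtain x where x: "x : set L" "lev x = t" using assms(2) by(metis le_neq_implies_less)
 hence "minlev L = t" using minlev_eq[of x L] False by(auto simp: not_less)
 thus ?thesis using cnt_split_at[OF assms(1) bexI[of "%x. lev x = t", OF x(2) x(1)]] x assms(3) False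
  by(auto simp: split_min_def deeper_def not_less)
qed

lemma split_min_eq:
 assumes "x : set L" "lev x = t" "ALL y:set L. t <= lev y"
 shows "split_min L = elt (split_at t L)" using minlev_eq[of x L] assms by(auto simp: split_min_def)

lemma cyc_mult_vec: "set L <= KB m ==> cyc_mult L : vec {W. set W <= KB m & Suc (length W) = length L &
  sum_list (map len W) = sum_list (map len L) & (ALL x:set L. EX x':set W. lev x' <= lev x)}"
proof(induction L)
 case (Cons b L)
 let ?V = "{W. set W <= KB m & Suc (length W) = length (b # L) &
  sum_list (map len W) = sum_list (map len (b # L)) & (ALL x:set (b # L). EX x':set W. lev x' <= lev x)}"
 have "mul_head b L : vec ?V"
 proof(cases L)
  case (Cons c L')
  show ?thesis
  proof(cases "mul b c")
  case (Some d)
  thus ?thesis using Cons.prems mul_KB[of b m c d] mul_lev[of b m c d] mul_Some(4)[OF Some] Cons by auto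
  qed(simp add: Cons)
 qed simp
 moreover have "lcons b (cyc_mult L) : vec ?V" unfolding lcons_def by(rule vec_lin[OF Cons.IH]) (use Cons.prems in auto)
 ultimately show ?case by(auto intro: vec_add)
qed simp

lemma cyc_mult_homotopy:
 assumes "set L <= KB m" "ALL x:set L. t <= lev x" "EX x:set L. lev x = t"
 shows "cyc_mult (split_at t L) + lin split_min (cyc_mult L) + elt L : vec (deeper t (cnt t L))" using assms
proof(induction L)
 case (Cons b L)
 have b: "b : KB m" and L: "set L <= KB m" using Cons.prems by auto
 let ?c = "cnt t (b # L)" and ?u = "fst (spl b)" and ?v = "snd (spl b)"
 have deep_cons: "W : deeper t c ==> x # W : deeper t c" for W x c by(auto simp: deeper_def)
 show ?case
 proof(cases "lev b = t")
  case True
  have s: "split_at t (b # L) = ?u # ?v # L" using True by simp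
  have uv: "mul_head ?u (?v # L) = elt (b # L)" using spl[OF b] by simp
  have 1: "lcons ?u (mul_head ?v L) + lin split_min (mul_head b L) : vec (deeper t ?c)"
  proof(cases L)
  case (Cons c L')
  have c: "c : KB m" using L by(simp add: Cons)
  note sp = spl_mul_right[OF b c]
  show ?thesis
  proof(cases "mul ?v c")
  case None
  thus ?thesis using sp(1) by(simp add: Cons)
  next
  case (Some v)
  show ?thesis
  proof(cases "lev v = lev b")
  case lv: True
  obtain d where d: "mul b c = Some d" "lev d = lev b" "spl d = (?u, v)" using sp(2)[OF Some lv] by blast
  have "split_min (d # L') = elt (split_at t (d # L'))" using Cons.prems d True by(intro split_min_eq[of d]) (auto simp: Cons)
  thus ?thesis using d Some True by(simp add: Cons)
  next
  case False
  note l = sp(3)[OF Some False]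
  have "lin split_min (elto (map_option (%d. d # L') (mul b c))) : vec (deeper t ?c)"
  proof(cases "mul b c")
  case d: (Some d)
  have "split_min (d # L') : vec (deeper t ?c)" using l d True mul_KB[OF b c d] L by(intro split_min_deeper[of _ m]) (auto simp: Cons deeper_def)
  thus ?thesis by(simp add: d)
  qed simp
  moreover have "elt (?u # v # L') : vec (deeper t ?c)" using l True by(auto simp: deeper_def)
  ultimately show ?thesis by(auto simp: Cons Some elto_map intro: vec_add)
  qed
  qed
  qed simp
  have 2: "lcons ?u (lcons ?v (cyc_mult L)) + lin split_min (lcons b (cyc_mult L)) : vec (deeper t ?c)"
  proof -
  have "lin (%W. elt (?u # ?v # W) + split_min (b # W)) (cyc_mult L) : vec (deeper t ?c)"
  proof(rule vec_lin[OF cyc_mult_vec[OF L]])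
  fix W assume "W : {W. set W <= KB m & Suc (length W) = length L &
  sum_list (map len W) = sum_list (map len L) & (ALL x:set L. EX x':set W. lev x' <= lev x)}"
  hence W: "set W <= KB m" by simp
  show "elt (?u # ?v # W) + split_min (b # W) : vec (deeper t ?c)"
  proof(cases "EX x:set W. lev x < t")
  case low: True
  have "split_min (b # W) : vec (deeper t ?c)" using W b low by(intro split_min_deeper[of _ m]) (auto simp: deeper_def)
  thus ?thesis using low by(intro vec_add) (auto simp: deeper_def)
  next
  case False
  hence "split_min (b # W) = elt (split_at t (b # W))" using True by(intro split_min_eq[of b]) (auto simp: not_less)
  thus ?thesis using True by simp
  qed
  qed
  thus ?thesis by(simp add: lcons_def lin_lin lin_fun_add)
  qed
  have "cyc_mult (split_at t (b # L)) + lin split_min (cyc_mult (b # L)) + elt (b # L) =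
  (lcons ?u (mul_head ?v L) + lin split_min (mul_head b L)) +
  (lcons ?u (lcons ?v (cyc_mult L)) + lin split_min (lcons b (cyc_mult L)))"
  proof -
  have r: "(e + (a1 + a2)) + (b1 + b2) + e = (a1 + b1) + (a2 + b2)" for e a1 a2 b1 b2 :: "kb list \<Rightarrow>\<^sub>0 bit"
  proof -
  have "(e + (a1 + a2)) + (b1 + b2) + e = (e + e) + ((a1 + b1) + (a2 + b2))" by(simp only: ac_simps)
  thus ?thesis by simp
  qed
  have 3: "cyc_mult (split_at t (b # L)) = elt (b # L) + (lcons ?u (mul_head ?v L) + lcons ?u (lcons ?v (cyc_mult L)))"
  unfolding s cyc_mult.simps uv lcons_simps ..
  have 4: "lin split_min (cyc_mult (b # L)) = lin split_min (mul_head b L) + lin split_min (lcons b (cyc_mult L))" by(simp add: lin_add)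
  show ?thesis unfolding 3 4 by(rule r)
  qed
  thus ?thesis using vec_add[OF 1 2] by metis
 next
  case False
  hence lb: "t < lev b" using Cons.prems(2) by auto
  have ex: "EX x:set L. lev x = t" using Cons.prems(3) False by auto
  have c: "?c = cnt t L" using False by simp
  have s: "split_at t (b # L) = b # split_at t L" using False by simp
  have IH: "cyc_mult (split_at t L) + lin split_min (cyc_mult L) + elt L : vec (deeper t (cnt t L))" using Cons.IH L Cons.prems(2) ex by simp
  have 1: "mul_head b (split_at t L) : vec (deeper t ?c)"
  proof(cases "split_at t L")
  case k: (Cons k K)
  have kK: "set (k # K) <= KB m" using split_at_KB[OF L, of t] by(simp add: k)
  have n: "cnt t (k # K) = Suc (cnt t L)" using cnt_split_at[OF L ex] by(simp add: k)
  show ?thesis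
  proof(cases "mul b k")
  case (Some d)
  have "lev d <= lev k" using mul_lev[OF b _ Some] kK by simp
  thus ?thesis using n Some False by(auto simp: k deeper_def split: if_splits)
  qed(simp add: k)
  qed simp
  have 2: "lin split_min (mul_head b L) : vec (deeper t ?c)"
  proof(cases L)
  case k: (Cons k K)
  show ?thesis
  proof(cases "mul b k")
  case (Some d)
  have d: "lev d <= lev k" "d : KB m" using mul_lev[OF b _ Some] mul_KB[OF b _ Some] L by(auto simp: k)
  have "split_min (d # K) : vec (deeper t ?c)" using d ex L by(intro split_min_higher[of _ m]) (auto simp: k False)
  thus ?thesis by(simp add: k Some)
  qed(simp add: k)
  qed simp
  have 3: "lin split_min (lcons b (cyc_mult L)) + lcons b (lin split_min (cyc_mult L)) = 0"
  proof -
  have "lin (%W. split_min (b # W)) (cyc_mult L) = lin (%W. lcons b (split_min W)) (cyc_mult L)"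
  proof(rule lin_cong_vec[OF cyc_mult_vec[OF L]])
  fix W assume W: "W : {W. set W <= KB m & Suc (length W) = length L &
  sum_list (map len W) = sum_list (map len L) & (ALL x:set L. EX x':set W. lev x' <= lev x)}"
  then obtain x' where x': "x' : set W" "lev x' <= t" using ex by force
  have "minlev W <= lev x'" unfolding minlev_def using x' by(intro Min_le) auto
  hence m: "minlev W < lev b" using x' lb by simp
  moreover have "minlev (b # W) = min (lev b) (minlev W)"
  unfolding minlev_def using x' by(subst set_simps, subst image_insert, subst Min_insert) auto
  ultimately have "minlev (b # W) = minlev W" by simp
  thus "split_min (b # W) = lcons b (split_min W)" using m x' by(auto simp: split_min_def)
  qed
  thus ?thesis by(simp add: lcons_def lin_lin)
  qed
  have 4: "lcons b (cyc_mult (split_at t L) + lin split_min (cyc_mult L) + elt L) : vec (deeper t ?c)"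
  unfolding lcons_def c using IH by(rule vec_lin) (auto intro: deep_cons)
  have e: "(p + x) + (q + y) + z = p + q + (x + w + z) + (y + w)" for p x q y z w :: "kb list \<Rightarrow>\<^sub>0 bit"
  proof -
  have "p + q + (x + w + z) + (y + w) = (p + x) + (q + y) + z + (w + w)" by(simp only: ac_simps)
  thus ?thesis by simp
  qed
  have "cyc_mult (split_at t (b # L)) + lin split_min (cyc_mult (b # L)) + elt (b # L) =
  mul_head b (split_at t L) + lin split_min (mul_head b L) +
  lcons b (cyc_mult (split_at t L) + lin split_min (cyc_mult L) + elt L) +
  (lin split_min (lcons b (cyc_mult L)) + lcons b (lin split_min (cyc_mult L)))" unfolding s cyc_mult.simps lcons_simps lin_add by(rule e)
  also have "... = mul_head b (split_at t L) + lin split_min (mul_head b L) +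
  lcons b (cyc_mult (split_at t L) + lin split_min (cyc_mult L) + elt L)" unfolding 3 by simp
  finally show ?thesis using vec_add[OF vec_add[OF 1 2] 4] by metis
 qed
qed simp

lemma cyc_rot_homotopy:
 assumes "set L <= KB m" "ALL x:set L. t <= lev x" "EX x:set L. lev x = t" "length L >= 2"
 shows "cyc_rot (split_at t L) + lin split_min (cyc_rot L) : vec (deeper t (cnt t L))"
proof -
 obtain b K z where L: "L = b # K @ [z]" using assms(4) by(cases L; cases "tl L" rule: rev_cases) auto
 have b: "b : KB m" and z: "z : KB m" and K: "set K <= KB m" using assms(1) by(auto simp: L)
 have rL: "cyc_rot L = lin (%d. elt (d # K)) (elto (mul z b))" by(simp add: L cyc_rot_def)
 show ?thesis
 proof(cases "lev b = t")
  case True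
  let ?u = "fst (spl b)" and ?v = "snd (spl b)"
  have rs: "cyc_rot (split_at t L) = lin (%d. elt (d # ?v # K)) (elto (mul z ?u))" using True by(simp add: L cyc_rot_def)
  note sp = spl_mul_left[OF b z]
  show ?thesis
  proof(cases "mul z ?u")
  case None
  thus ?thesis using sp(1) by(simp add: rs rL)
  next
  case (Some u)
  show ?thesis
  proof(cases "lev u = lev b")
  case lu: True
  obtain d where d: "mul z b = Some d" "lev d = lev b" "spl d = (u, ?v)" using sp(2)[OF Some lu] by blast
  have "split_min (d # K) = elt (split_at t (d # K))" using assms(2) d True by(intro split_min_eq[of d]) (auto simp: L)
  thus ?thesis using d Some True by(simp add: rs rL)
  next
  case False
  note l = sp(3)[OF Some False]
  have "lin split_min (elto (map_option (%d. d # K) (mul z b))) : vec (deeper t (cnt t L))"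
  proof(cases "mul z b")
  case d: (Some d)
  have "split_min (d # K) : vec (deeper t (cnt t L))" using l d True mul_KB[OF z b d] K by(intro split_min_deeper[of _ m]) (auto simp: deeper_def)
  thus ?thesis by(simp add: d)
  qed simp
  moreover have "elt (u # ?v # K) : vec (deeper t (cnt t L))" using l True by(auto simp: deeper_def)
  ultimately show ?thesis by(auto simp: rs rL Some elto_map intro: vec_add)
  qed
  qed
 next
  case False
  let ?S = "split_at t (K @ [z])"
  have ex: "EX x:set (K @ [z]). lev x = t" using assms(3) False by(auto simp: L)
  have S: "set ?S <= KB m" using assms(1) by(intro split_at_KB) (simp add: L)
  have c: "cnt t ?S = Suc (cnt t L)" using cnt_split_at[of "K @ [z]" m t] ex assms(1) False by(simp add: L)
  hence "?S ~= []" by auto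
  then obtain S' y where y: "?S = S' @ [y]" by(cases ?S rule: rev_cases) auto
  have rs: "cyc_rot (split_at t L) = lin (%d. elt (d # S')) (elto (mul y b))" using False y by(simp add: L cyc_rot_def)
  have 1: "cyc_rot (split_at t L) : vec (deeper t (cnt t L))"
  proof(cases "mul y b")
  case (Some d)
  have "lev d <= lev y" using mul_lev[OF _ b Some] S by(simp add: y)
  thus ?thesis unfolding rs using c Some by(auto simp: y deeper_def split: if_splits)
  qed(simp add: rs)
  have 2: "lin split_min (cyc_rot L) : vec (deeper t (cnt t L))"
  proof(cases "mul z b")
  case (Some d)
  have d: "lev d <= lev z" "d : KB m" using mul_lev[OF z b Some] mul_KB[OF z b Some] by auto
  have "split_min (d # K) : vec (deeper t (cnt t L))" using d ex K by(intro split_min_higher[of _ m]) (auto simp: L False)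
  thus ?thesis by(simp add: rL Some)
  qed(simp add: rL)
  show ?thesis using vec_add[OF 1 2] .
 qed
qed

definition cyc_words :: "nat => nat => nat => kb list set" where
 "cyc_words m n q = {L. set L <= KB m & length L = n & sum_list (map len L) = q}"

lemma dcyc_vec: "L : cyc_words m (Suc n) q ==> dcyc L : vec (cyc_words m n q)"
proof -
 assume L: "L : cyc_words m (Suc n) q"
 have "cyc_mult L : vec (cyc_words m n q)" by(rule vec_mono[OF cyc_mult_vec[of L m]]) (use L in "auto simp: cyc_words_def")
 moreover have "cyc_rot L : vec (cyc_words m n q)"
 proof(cases "length L < 2")
  case False
  then obtain b K z where K: "L = b # K @ [z]" by(cases L; cases "tl L" rule: rev_cases) auto
  show ?thesis using L mul_KB[of z m b] mul_Some(4)[of z b] by(cases "mul z b") (auto simp: K cyc_rot_def cyc_words_def)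
 qed(simp add: cyc_rot_def)
 ultimately show ?thesis unfolding dcyc_def by(rule vec_add)
qed

lemma split_min_vec: "L : cyc_words m (Suc n) q ==> split_min L : vec (cyc_words m (Suc (Suc n)) q)"
proof -
 assume L: "L : cyc_words m (Suc n) q"
 have "set L <= KB m ==> EX x:set L. lev x = t ==> set (split_at t L) <= KB m & length (split_at t L) = Suc (length L) &
  sum_list (map len (split_at t L)) = sum_list (map len L)" for t
 proof(induction L)
  case (Cons b L)
  thus ?case using spl[of b m] by(cases "lev b = t") auto
 qed simp
 moreover have "L ~= []" using L by(auto simp: cyc_words_def)
 moreover from this have "EX x:set L. lev x = minlev L" by(rule minlev_attained)
 ultimately show ?thesis using L by(auto simp: split_min_def cyc_words_def)
qed

definition depth :: "nat => nat => kb list => nat" where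
 "depth m n L = (m - minlev L) * Suc n + cnt (minlev L) L"

lemma depth_bound: "L : cyc_words m n q ==> depth m n L <= m * Suc n + n"
 unfolding depth_def by(intro add_mono mult_mono) (auto simp: cyc_words_def cnt_def intro: order_trans[OF length_filter_le])

lemma deeper_depth:
 assumes "L : cyc_words m n q" "W : cyc_words m n q" "W : deeper (minlev L) (cnt (minlev L) L)"
 shows "depth m n W > depth m n L"
proof -
 have W: "set W ~= {}" using assms(3) by(auto simp: deeper_def)
 have cL: "cnt (minlev L) L <= n" using assms(1) by(auto simp: cyc_words_def cnt_def intro: order_trans[OF length_filter_le])
 obtain w where w: "w : set W" "lev w = minlev W" using minlev_attained[of W] W by auto
 have wm: "minlev W <= m" using w lev_le assms(2) by(force simp: cyc_words_def)
 have cW: "cnt (minlev W) W > 0" using w cnt_pos by blast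
 have le: "x : set W ==> minlev W <= lev x" for x unfolding minlev_def by(intro Min_le) auto
 show ?thesis
 proof(cases "minlev W < minlev L")
  case True
  show ?thesis
  proof(cases "minlev L <= m")
  case True
  with `minlev W < minlev L` have "m - minlev W >= Suc (m - minlev L)" by simp
  hence "(m - minlev W) * Suc n >= Suc (m - minlev L) * Suc n" by(rule mult_right_mono) simp
  thus ?thesis unfolding depth_def using cL cW by simp
  next
  case False
  have "L ~= []" using assms(1,2) W by(auto simp: cyc_words_def)
  then obtain x where "x : set L" "lev x = minlev L" using minlev_attained by blast
  thus ?thesis using False lev_le assms(1) by(force simp: cyc_words_def)
  qed
 next
  case False
  have "~ (EX x:set W. lev x < minlev L)" using False le by force
  hence c: "cnt (minlev L) W > cnt (minlev L) L" using assms(3) by(auto simp: deeper_def)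
  then obtain x where "x : set W" "lev x = minlev L" using cnt_pos[of "minlev L" W] by auto
  hence "minlev W = minlev L" using le[of x] False by simp
  thus ?thesis unfolding depth_def using c by simp
 qed
qed

lemma cyc_homotopy:
 assumes "L : cyc_words m (Suc (Suc n)) q"
 shows "lin dcyc (split_min L) + lin split_min (dcyc L) + elt L :
  vec {W : cyc_words m (Suc (Suc n)) q. depth m (Suc (Suc n)) W > depth m (Suc (Suc n)) L}"
  (is "?x : _")
proof -
 let ?t = "minlev L"
 have L: "set L <= KB m" "length L >= 2" "L ~= []" using assms by(auto simp: cyc_words_def)
 hence ex: "EX x:set L. lev x = ?t" and le: "ALL x:set L. ?t <= lev x" using minlev_attained minlev_le by auto
 have s: "split_min L = elt (split_at ?t L)" using L by(simp add: split_min_def)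
 have e: "(a1 + a2) + (b1 + b2) + z = (a1 + b1 + z) + (a2 + b2)" for a1 a2 b1 b2 z :: "kb list \<Rightarrow>\<^sub>0 bit" by(simp only: ac_simps)
 have "?x = (cyc_mult (split_at ?t L) + lin split_min (cyc_mult L) + elt L) + (cyc_rot (split_at ?t L) + lin split_min (cyc_rot L))"
  unfolding s lin_elt unfolding dcyc_def lin_add by(rule e)
 hence "?x : vec (deeper ?t (cnt ?t L))" using vec_add[OF cyc_mult_homotopy[OF L(1) le ex] cyc_rot_homotopy[OF L(1) le ex L(2)]] by metis
 moreover have "?x : vec (cyc_words m (Suc (Suc n)) q)"
  using assms vec_lin[OF split_min_vec[OF assms] dcyc_vec] vec_lin[OF dcyc_vec[OF assms] split_min_vec] by(intro vec_add) auto
 ultimately show ?thesis using deeper_depth[OF assms] by(auto simp: vec_def)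
qed

lemma vec_empty: "x : vec {} <-> x = 0" by(simp add: vec_def)

lemma elt_nonzero [simp]: "elt w ~= 0" by(metis keys_elt keys_zero insert_not_empty)

definition kap :: "nat => kb list => bar" where
 "kap k L = (tl L, (replicate k None, hd L))"

definition kapv :: "nat => kb list fvec => bar fvec" where
 "kapv k = lin (%L. elt (kap k L))"

lemma kapv_simps [simp]: "kapv k 0 = 0" "kapv k (elt L) = elt (kap k L)" "kapv k (x + y) = kapv k x + kapv k y" by(simp_all add: kapv_def lin_add)

lemma lmw_None: "lmw a (replicate k None, b) = map_option (Pair (replicate k None)) (mul a b)"
proof(induction k)
 case (Suc k)
 thus ?case by(cases "mul a b") simp_all
qed simp

lemma rmw_None: "rmw (replicate k None, b) a = map_option (Pair (replicate k None)) (mul b a)" by(simp add: rmw_def)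

lemma bar_mult_kap: "bar_mult (bs, (replicate k None, b0)) = kapv k (lcons b0 (cyc_mult bs)) + kapv k (cyc_rot (b0 # bs))"
proof(induction bs)
 case Nil
 show ?case by(simp add: cyc_rot_def)
next
 case (Cons b bs)
 show ?case
 proof(cases bs)
  case Nil
  show ?thesis by(cases "mul b b0") (simp_all add: Nil cyc_rot_def lmw_None kap_def)
 next
  case (Cons c cs)
  have 1: "front b (bs, (replicate k None, b0)) = kapv k (lcons b0 (mul_head b bs))" by(cases "mul b c") (simp_all add: Cons kap_def)
  have 2: "consbv (elt b) (kapv k (lcons b0 x)) = kapv k (lcons b0 (lcons b x))" for x by(induction x rule: f2_induct) (simp_all add: kap_def)
  have 3: "consbv (elt b) (kapv k (cyc_rot (b0 # bs))) = kapv k (cyc_rot (b0 # b # bs))"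
  by(cases "mul (last bs) b0") (simp_all add: Cons cyc_rot_def kap_def)
  show ?thesis unfolding bar_mult.simps Cons.IH 1 consbv_add 2 3 by(simp add: add.assoc)
 qed
qed

lemma bar_ext_kap: "L ~= [] ==> bar_ext (kap k L) = kapv k (dcyc L)"
proof(cases L)
 case (Cons b0 bs)
 have "bar_rot (bs, (replicate k None, b0)) = kapv k (mul_head b0 bs)" by(cases bs; cases "mul b0 (hd bs)") (auto simp: rbar_def rmw_None kap_def)
 thus ?thesis by(simp add: Cons kap_def bar_ext_def bar_mult_kap dcyc_def ac_simps)
qed simp

lemma bar_ext_kapv: "x : vec {L. L ~= []} ==> lin bar_ext (kapv k x) = kapv k (lin dcyc x)"
 by(induction rule: vec_induct) (simp_all add: lin_add bar_ext_kap)

lemma kapv_inject: "x : vec {L. L ~= []} ==> lin (%w. elt (snd (snd w) # fst w)) (kapv k x) = x"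
 by(induction rule: vec_induct) (simp_all add: lin_add kap_def)

lemma cyc_nonempty: "x : vec (cyc_words m (Suc n) q) ==> x : vec {L. L ~= []}" by(erule vec_mono) (auto simp: cyc_words_def)

lemma dcyc_dcyc:
 assumes "x : vec (cyc_words m (Suc (Suc (Suc n))) q)"
 shows "lin dcyc (lin dcyc x) = 0"
proof -
 have 1: "lin dcyc x : vec (cyc_words m (Suc (Suc n)) q)" using assms dcyc_vec by(rule vec_lin)
 hence 2: "lin dcyc (lin dcyc x) : vec (cyc_words m (Suc n) q)" using dcyc_vec by(rule vec_lin)
 have "kapv 0 (lin dcyc (lin dcyc x)) = 0" using bar_ext_bar_ext[of "kapv 0 x"] bar_ext_kapv[OF cyc_nonempty[OF assms], of 0]
  bar_ext_kapv[OF cyc_nonempty[OF 1], of 0] by simp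
 thus ?thesis using kapv_inject[OF cyc_nonempty[OF 2], of 0] by simp
qed

lemma cyc_acyclic:
 assumes "x : vec (cyc_words m (Suc (Suc n)) q)" "lin dcyc x = 0"
 shows "EX z:vec (cyc_words m (Suc (Suc (Suc n))) q). lin dcyc z = x"
proof -
 let ?N = "Suc (Suc n)"
 let ?A = "%k. {W : cyc_words m ?N q. k <= depth m ?N W}"
 have "x : vec (?A k) ==> lin dcyc x = 0 ==> EX z:vec (cyc_words m (Suc ?N) q). lin dcyc z = x" for k x
 proof(induction "Suc (m * Suc ?N + ?N) - k" arbitrary: k x rule: less_induct)
  case less
  show ?case
  proof(cases "k <= m * Suc ?N + ?N")
  case False
  have "depth m ?N W < k" if "W : cyc_words m ?N q" for W using depth_bound[OF that] False by linarith
  hence "?A k = {}" by fastforce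
  hence "x = 0" using less.prems(1) by(simp only: vec_empty)
  thus ?thesis by(intro bexI[of _ 0]) auto
  next
  case True
  have x: "x : vec (cyc_words m ?N q)" using less.prems(1) by(rule vec_mono) auto
  let ?z = "lin split_min x"
  have z: "?z : vec (cyc_words m (Suc ?N) q)" using x split_min_vec by(rule vec_lin)
  define y where "y = lin dcyc ?z + x"
  have "y = lin (%L. lin dcyc (split_min L) + lin split_min (dcyc L) + elt L) x"
  using less.prems(2) by(simp add: y_def lin_fun_add lin_lin[symmetric])
  moreover have "lin (%L. lin dcyc (split_min L) + lin split_min (dcyc L) + elt L) x : vec (?A (Suc k))"
  proof(rule vec_lin[OF less.prems(1)])
  fix L assume L: "L : ?A k"
  thus "lin dcyc (split_min L) + lin split_min (dcyc L) + elt L : vec (?A (Suc k))" using cyc_homotopy[of L m n q] by(auto elim!: vec_mono)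
  qed
  ultimately have "y : vec (?A (Suc k))" by simp
  moreover have "lin dcyc y = 0" using dcyc_dcyc[OF z] less.prems(2) by(simp add: y_def lin_add)
  moreover have "Suc (m * Suc ?N + ?N) - Suc k < Suc (m * Suc ?N + ?N) - k" using True by simp
  ultimately obtain z' where z': "z' : vec (cyc_words m (Suc ?N) q)" "lin dcyc z' = y" using less.hyps[of "Suc k" y] by blast
  have "lin dcyc (?z + z') = x" using z' by(simp add: lin_add y_def add.commute[of _ x])
  thus ?thesis using vec_add[OF z z'(1)] by blast
  qed
 qed
 from this[of x 0] show ?thesis using assms by simp
qed

lemma cyc_trivial:
 assumes "b : KB m" "~ (EX i. b = Vertex i)"
 shows "EX z:vec (cyc_words m 2 (len b)). lin dcyc z = elt [b]"
proof(cases b)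
 case (Step i j)
 thus ?thesis using assms(1) by(intro bexI[of _ "elt [Step i j, Vertex j]"]) (auto simp: dcyc_def cyc_rot_def cyc_words_def)
next
 case (Loop i)
 have "1 <= i ==> i <= m ==> EX z:vec (cyc_words m 2 2). lin dcyc z = elt [Loop i]" for i
 proof(induction i)
  case (Suc i)
  let ?w = "elt [Step (Suc i) i, Step i (Suc i)]"
  have w: "?w : vec (cyc_words m 2 2)" using Suc by(simp add: cyc_words_def)
  have d: "lin dcyc ?w = elt [Loop (Suc i)] + (if i = 0 then 0 else elt [Loop i])" by(simp add: dcyc_def cyc_rot_def)
  show ?case
  proof(cases "i = 0")
  case True
  show ?thesis using d w unfolding if_P[OF True] by(intro bexI[of _ ?w]) simp_all
  next
  case False
  then obtain z where z: "z : vec (cyc_words m 2 2)" "lin dcyc z = elt [Loop i]" using Suc by auto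
  have "lin dcyc (?w + z) = elt [Loop (Suc i)]" unfolding lin_add d z(2) if_not_P[OF False] by simp
  thus ?thesis using vec_add[OF w z(1)] by blast
  qed
 qed simp
 thus ?thesis using assms(1) by(simp add: Loop)
qed(use assms in auto)

section \<open>Comparison of the Hochschild complex with a smaller complex\<close>

definition Bt :: "nat => braid_word => nat => int => int => bool => bar set" where
 "Bt m ls n h q c = {(bs, y). set bs <= KB m & okw m ls y & length bs = n & wh ls y = h &
  wq ls y - int (sum_list (map len bs)) = q & has_cup y = c}"

lemma bar_ext_Bt: "w : Bt m ls (Suc n) h q c ==> bar_ext w : vec (Bt m ls n h q c)"
proof -
 assume w: "w : Bt m ls (Suc n) h q c"
 obtain bs y where y: "w = (bs, y)" by(cases w)
 have "w : bar_inv m ls (Suc n) (pat y) q" using w by(auto simp: y Bt_def bar_inv_def)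
 thus ?thesis by(rule vec_mono[OF bar_ext_vec]) (use w pat_wh[of m ls y] in "auto simp: y Bt_def bar_inv_def has_cup_def")
qed

abbreviation nones :: "braid_word => kb option list" where
 "nones ls == replicate (length ls) None"

lemma okw_has_cup: "okw m ls y ==> ~ has_cup y ==> y = (nones ls, snd y)"
proof(induction m ls y rule: okw.induct)
 case (3 m l ls us b)
 thus ?case by simp
qed auto

lemma okw_None: "okw m ls (nones ls, b) <-> b : KB m" by(induction ls) auto

lemma wq_None: "wq ls (nones ls, b) = wq ls (nones ls, Vertex 0) - int (len b)" by(induction ls) auto

lemma Bt_kap:
 assumes "x : vec (Bt m ls n h q False)"
 shows "EX x':vec (cyc_words m (Suc n) (nat (wq ls (nones ls, Vertex 0) - q))). x = kapv (length ls) x'"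
proof(rule bexI)
 let ?f = "%w :: bar. elt (snd (snd w) # fst w)"
 have *: "w = kap (length ls) (snd (snd w) # fst w) &
  snd (snd w) # fst w : cyc_words m (Suc n) (nat (wq ls (nones ls, Vertex 0) - q))"
  if w: "w : Bt m ls n h q False" for w
 proof -
  obtain bs us b where [simp]: "w = (bs, (us, b))" by(cases w; cases "snd w") auto
  have u: "us = nones ls" "b : KB m" using w okw_has_cup[of m ls "(us, b)"] okw_last[of m ls us b] by(auto simp: Bt_def)
  thus ?thesis using w wq_None[of ls b] by(auto simp: Bt_def kap_def cyc_words_def)
 qed
 show "lin ?f x : vec (cyc_words m (Suc n) (nat (wq ls (nones ls, Vertex 0) - q)))" using assms * by(intro vec_lin[of x]) auto
 show "x = kapv (length ls) (lin ?f x)" using assms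
 proof(induction rule: vec_induct)
  case (elt w)
  thus ?case using *[OF elt] by simp
 qed(simp_all add: lin_add)
qed

lemma kap_Bt:
 assumes "x : vec (cyc_words m (Suc n) p)" "h = wh ls (nones ls, Vertex 0)"
 shows "kapv (length ls) x : vec (Bt m ls n h (wq ls (nones ls, Vertex 0) - int p) False)" unfolding kapv_def
proof(rule vec_lin[OF assms(1)])
 fix L assume L: "L : cyc_words m (Suc n) p"
 then obtain b bs where [simp]: "L = b # bs" by(cases L) (auto simp: cyc_words_def)
 have "wh ls (nones ls, b) = h" unfolding assms(2) by(induction ls) auto
 moreover have "~ has_cup (nones ls, b)" by(simp add: has_cup_def pat_def)
 ultimately show "elt (kap (length ls) L) : vec (Bt m ls n h (wq ls (nones ls, Vertex 0) - int p) False)"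
  using L okw_None wq_None[of ls b] by(auto simp: kap_def Bt_def cyc_words_def)
qed

lemma Bt_h_None:
 assumes "x : vec (Bt m ls n h q False)" "x ~= 0"
 shows "h = wh ls (nones ls, Vertex 0) &
  int (nat (wq ls (nones ls, Vertex 0) - q)) = wq ls (nones ls, Vertex 0) - q"
proof -
 have "Poly_Mapping.keys x ~= {}" using assms(2) by simp
 then obtain w where "w : Poly_Mapping.keys x" by blast
 hence "w : Bt m ls n h q False" using assms(1) by(auto simp: vec_def)
 then obtain bs us b where w: "(bs, (us, b)) : Bt m ls n h q False" by(cases w; cases "snd w") auto
 hence u: "us = nones ls" using okw_has_cup[of m ls "(us, b)"] by(auto simp: Bt_def)
 have "wh ls (nones ls, b) = wh ls (nones ls, Vertex 0)" by(induction ls) auto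
 thus ?thesis using w wq_None[of ls b] by(auto simp: Bt_def u)
qed

lemma peel_Bt: "w : Bt m ls n h q True ==> peel w : vec (Bt m ls (Suc n) h q True)"
proof -
 assume w: "w : Bt m ls n h q True"
 obtain bs y where y: "w = (bs, y)" by(cases w)
 have *: "okw m ls y" "has_cup y" using w by(auto simp: y Bt_def)
 have len: "length (fst (reset y)) = length ls" using okw_reset[OF *] okw_length[of m ls "fst (reset y)" "snd (reset y)"] by simp
 show ?thesis using w okw_reset[OF *] lmw_degrees[OF lmw_reset[OF *(2)] len] by(auto simp: y peel_def Bt_def has_cup_def)
qed

lemma column_exact:
 assumes "x : vec (Bt m ls (Suc n) h q c)" "lin bar_ext x = 0"
 shows "EX z:vec (Bt m ls (Suc (Suc n)) h q c). lin bar_ext z = x"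
proof(cases c)
 case True
 have "lin bar_ext (lin peel x) + lin peel (lin bar_ext x) = x" using assms(1)
 proof(induction rule: vec_induct)
  case (elt w)
  obtain bs y where w: "w = (bs, y)" by(cases w)
  have "has_cup y" "bs ~= []" using elt True by(auto simp: w Bt_def)
  thus ?case using peel_contracts[of y bs] by(simp add: w)
 next
  case (add x y)
  from arg_cong2[OF add(3,4), of "(+)"] show ?case by(simp add: lin_add ac_simps)
 qed simp
 moreover have "lin peel x : vec (Bt m ls (Suc (Suc n)) h q c)" using assms(1) True peel_Bt by(auto intro: vec_lin)
 ultimately show ?thesis using assms(2) by auto
next
 case False
 hence x: "x : vec (Bt m ls (Suc n) h q False)" using assms(1) by simp
 show ?thesis
 proof(cases "x = 0")
  case True
  thus ?thesis by(intro bexI[of _ 0]) auto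
 next
  case nz: False
  let ?p = "nat (wq ls (nones ls, Vertex 0) - q)"
  obtain x' where x': "x' : vec (cyc_words m (Suc (Suc n)) ?p)" "x = kapv (length ls) x'" using Bt_kap[OF x] by blast
  have d: "lin dcyc x' : vec (cyc_words m (Suc n) ?p)" using x'(1) dcyc_vec by(rule vec_lin)
  have "kapv (length ls) (lin dcyc x') = 0" using assms(2) x' bar_ext_kapv[OF cyc_nonempty[OF x'(1)]] by simp
  hence "lin dcyc x' = 0" using kapv_inject[OF cyc_nonempty[OF d], of "length ls"] by simp
  from cyc_acyclic[OF x'(1) this] obtain z' where
  z': "z' : vec (cyc_words m (Suc (Suc (Suc n))) ?p)" "lin dcyc z' = x'" by blast
  have "lin bar_ext (kapv (length ls) z') = x" using bar_ext_kapv[OF cyc_nonempty[OF z'(1)]] z'(2) x'(2) by simp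
  moreover have "kapv (length ls) z' : vec (Bt m ls (Suc (Suc n)) h q c)"
  proof -
  note h = Bt_h_None[OF x nz]
  have e: "wq ls (nones ls, Vertex 0) - int ?p = q" using conjunct2[OF h] by linarith
  show ?thesis using kap_Bt[OF z'(1) conjunct1[OF h]] False unfolding e by simp
  qed
  ultimately show ?thesis by blast
 qed
qed

definition Norm :: "nat => braid_word => word set" where
 "Norm m ls = {y : NW m ls. if has_cup y then reset y = y & tgt (snd y) = src (first_path y) else EX i. snd y = Vertex i}"

lemma reset_reset: "reset (reset y) = reset y" "has_cup y ==> src (first_path (reset y)) = tgt (first_path y)"
 by(induction y rule: reset.induct) (auto simp: reset_consw)

lemma column_end:
 assumes "([], y) : Bt m ls 0 h q c"
 shows "EX t z. t : vec (Norm m ls Int NWd m ls h q) & z : vec (Bt m ls (Suc 0) h q c) &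
  lin bar_ext z = elt ([], y) + pairb [] t"
proof(cases c)
 case True
 have y: "okw m ls y" "has_cup y" "wh ls y = h" "wq ls y = q" using assms True by(auto simp: Bt_def)
 note r = okw_reset[OF y(1,2)]
 have len: "length (fst (reset y)) = length ls" using r okw_length[of m ls "fst (reset y)" "snd (reset y)"] by simp
 let ?t = "elto (rmw (reset y) (first_path y))"
 have cup: "has_cup (reset y)" using r y by(simp add: has_cup_def)
 have "?t : vec (Norm m ls Int NWd m ls h q)"
 proof(cases "rmw (reset y) (first_path y)")
  case (Some z)
  have z: "okw m ls z" "fst z = fst (reset y)" "has_cup z" "first_path z = first_path (reset y)"
  using okw_rmw[of m ls "reset y" "first_path y" z] r rmw_pat[OF Some] rmw_reset(2)[OF cup Some] Some by auto
  have "Some (reset z) = Some z" using rmw_reset(1)[OF cup, of "first_path y"] Some by(simp add: reset_reset)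
  moreover have "tgt (snd z) = src (first_path z)" using Some reset_reset(2)[OF y(2)] z(4) by(cases "reset y") (auto simp: rmw_def dest: mul_Some)
  moreover have "wh ls z = h & wq ls z = q" using rmw_degrees[OF Some len] lmw_degrees[OF lmw_reset[OF y(2)] len] y by simp
  ultimately show ?thesis using z Some by(simp add: Norm_def NWd_def NW_def)
 qed simp
 moreover have "peel ([], y) : vec (Bt m ls (Suc 0) h q c)" using peel_Bt assms True by simp
 moreover have "lin bar_ext (peel ([], y)) = elt ([], y) + pairb [] ?t" using peel_contracts[OF y(2), of "[]"] by(simp add: bar_ext_Nil)
 ultimately show ?thesis by blast
next
 case False
 have y: "okw m ls y" "~ has_cup y" "wh ls y = h" "wq ls y = q" using assms False by(auto simp: Bt_def)
 let ?k = "length ls"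
 obtain b where b: "y = (replicate ?k None, b)" "b : KB m" using okw_has_cup[OF y(1,2)] okw_last[of m ls "fst y" "snd y"] y(1) by(cases y) auto
 show ?thesis
 proof(cases "EX i. b = Vertex i")
  case True
  hence "elt y : vec (Norm m ls Int NWd m ls h q)" using y b by(auto simp: Norm_def NWd_def NW_def)
  thus ?thesis by(intro exI[of _ "elt y"] exI[of _ 0]) simp
 next
  case nv: False
  obtain z where z: "z : vec (cyc_words m 2 (len b))" "lin dcyc z = elt [b]" using cyc_trivial[OF b(2) nv] by blast
  have z2: "z : vec (cyc_words m (Suc (Suc 0)) (len b))" using z(1) by(simp add: numeral_2_eq_2)
  have h: "h = wh ls (replicate ?k None, Vertex 0) & int (len b) = wq ls (replicate ?k None, Vertex 0) - q"
  using Bt_h_None[of "elt ([], y)" m ls 0 h q] assms False wq_None[of ls b] y b by auto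
  hence "kapv ?k z : vec (Bt m ls (Suc 0) h q c)" using kap_Bt[OF z2, of h ls] False by simp
  moreover have "lin bar_ext (kapv ?k z) = elt ([], y)" using bar_ext_kapv[OF cyc_nonempty[OF z2], of ?k] z by(simp add: kap_def b)
  ultimately show ?thesis by(intro exI[of _ 0] exI[of _ "kapv ?k z"]) simp
 qed
qed

lemma vec_disjoint_sum:
 assumes "x : vec A" "y : vec B" "x + y = 0" "A Int B = {}"
 shows "x = 0" "y = 0"
proof -
 have "x = y" using assms(3) by(simp add: vec_add_eq_0_iff)
 hence "Poly_Mapping.keys x <= A Int B" using assms(1,2) by(simp add: vec_def)
 hence "Poly_Mapping.keys x = {}" using assms(4) by blast
 thus "x = 0" by simp
 thus "y = 0" using `x = y` by simp
qed

lemma vec_split: "x : vec A ==> EX u:vec {a : A. P a}. EX v:vec {a : A. ~ P a}. x = u + v"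
proof(induction rule: vec_induct)
 case zero
 show ?case by(intro bexI[of _ 0]) auto
next
 case (elt a)
 show ?case
 proof(cases "P a")
  case True
  thus ?thesis using elt by(intro bexI[of _ "elt a"] bexI[of _ 0]) auto
 next
  case False
  thus ?thesis using elt by(intro bexI[of _ 0] bexI[of _ "elt a"]) auto
 qed
next
 case (add x y)
 then obtain u v u' v' where "u : vec {a : A. P a}" "v : vec {a : A. ~ P a}" "x = u + v"
  "u' : vec {a : A. P a}" "v' : vec {a : A. ~ P a}" "y = u' + v'" by blast
 moreover from this have "x + y = (u + u') + (v + v')" by(simp only: add_swap4)
 ultimately show ?case by(meson vec_add)
qed

text \<open>
  A map of complexes that is onto in every bidegree and has an exact kernel identifies the homologies:
  taking preimages turns cosets of boundaries into cosets of boundaries.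
\<close>

lemma quotient_iso:
 fixes V :: "'v f2_space" and V' :: "'g fvec f2_space"
 assumes V: "coords V H Phi" and Z: "Z <= carrier V" "!!x y. x : Z ==> y : Z ==> x \<oplus>\<^bsub>V\<^esub> y : Z"
  and B: "B <= Z" and V': "add V' = (+)"
  and F: "F ` Z = Z'" "!!x y. x : Z ==> y : Z ==> F (x \<oplus>\<^bsub>V\<^esub> y) = F x + F y"
  and B': "B' <= Z'" "0 : B'" "!!x y. x : B' ==> y : B' ==> x + y : B'"
  and FB: "!!x. x : Z ==> F x : B' <-> x : B"
 shows "f2_iso (quotient_space (V'(|carrier := Z'|)) B') (quotient_space (V(|carrier := Z|)) B)"
proof -
 let ?phi = "%Y. {x : Z. F x : Y}"
 let ?c' = "%y. {b + y | b. b : B'}" and ?c = "%x. {b \<oplus>\<^bsub>V\<^esub> x | b. b : B}"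
 note cl = coords_add_closed[OF V] and ad = coords_add[OF V]
 have c': "B' +>\<^bsub>V'(|carrier := Z'|)\<^esub> y = ?c' y" for y by(auto simp: a_r_coset_def' V')
 have c: "B +>\<^bsub>V(|carrier := Z|)\<^esub> x = ?c x" for x by(auto simp: a_r_coset_def')
 have Q': "a_rcosets\<^bsub>V'(|carrier := Z'|)\<^esub> B' = ?c' ` Z'" by(auto simp: A_RCOSETS_def' c')
 have Q: "a_rcosets\<^bsub>V(|carrier := Z|)\<^esub> B = ?c ` Z" by(auto simp: A_RCOSETS_def' c)
 have canc: "x \<oplus>\<^bsub>V\<^esub> y \<oplus>\<^bsub>V\<^esub> y = x" if "x : Z" "y : Z" for x y
 proof(rule coords_inject[OF V])
  have "x : carrier V" "y : carrier V" using that Z by blast+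
  thus "x \<oplus>\<^bsub>V\<^esub> y \<oplus>\<^bsub>V\<^esub> y : carrier V" "x : carrier V" "Phi (x \<oplus>\<^bsub>V\<^esub> y \<oplus>\<^bsub>V\<^esub> y) = Phi x"
  by(simp_all add: cl ad)
 qed
 have mem': "z : ?c' y <-> z + y : B'" for z y
 proof
  assume "z + y : B'"
  moreover have "z = (z + y) + y" by simp
  ultimately show "z : ?c' y" by blast
 qed auto
 have mem: "z : ?c x <-> z : Z & z \<oplus>\<^bsub>V\<^esub> x : B" if x: "x : Z" for z x
 proof
  assume "z : ?c x"
  then obtain b where "b : B" "z = b \<oplus>\<^bsub>V\<^esub> x" by blast
  thus "z : Z & z \<oplus>\<^bsub>V\<^esub> x : B" using B Z(2)[of b x] x canc[of b x] by auto
 next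
  assume z: "z : Z & z \<oplus>\<^bsub>V\<^esub> x : B"
  hence "z = (z \<oplus>\<^bsub>V\<^esub> x) \<oplus>\<^bsub>V\<^esub> x" using canc x by simp
  thus "z : ?c x" using z by blast
 qed
 have phi: "?phi (?c' (F x)) = ?c x" if x: "x : Z" for x
 proof -
  have "F z : ?c' (F x) <-> z : ?c x" if "z : Z" for z
  unfolding mem' mem[OF x] using that x F(2)[of z x] FB[of "z \<oplus>\<^bsub>V\<^esub> x"] Z(2) by auto
  moreover have "?c x <= Z" using mem[OF x] by blast
  ultimately show ?thesis by blast
 qed
 have Q'': "?c' ` Z' = (%x. ?c' (F x)) ` Z" unfolding F(1)[symmetric] by auto
 have in0: "x : ?c x" if "x : Z" for x
 proof -
  have "F (x \<oplus>\<^bsub>V\<^esub> x) = 0" using F(2)[of x x] that by simp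
  hence "x \<oplus>\<^bsub>V\<^esub> x : B" using FB[of "x \<oplus>\<^bsub>V\<^esub> x"] Z(2) B'(2) that by simp
  thus ?thesis using mem that by simp
 qed
 have inj: "?c' (F x) = ?c' (F y)" if "x : Z" "y : Z" "?c x = ?c y" for x y
 proof -
  have "x \<oplus>\<^bsub>V\<^esub> y : B" using in0[OF that(1)] that(3) mem[OF that(2)] by blast
  hence "F x + F y : B'" using FB[of "x \<oplus>\<^bsub>V\<^esub> y"] F(2) Z(2) that by simp
  moreover have "z + F y = (z + F x) + (F x + F y)" "z + F x = (z + F y) + (F x + F y)" for z by(simp_all add: ac_simps)
  ultimately have "z + F x : B' <-> z + F y : B'" for z using B'(3) by metis
  thus ?thesis unfolding set_eq_iff mem' by blast
 qed
 have bij: "bij_betw ?phi (?c' ` Z') (?c ` Z)" unfolding bij_betw_def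
 proof
  show "inj_on ?phi (?c' ` Z')"
  proof(rule inj_onI)
  fix X Y assume "X : ?c' ` Z'" "Y : ?c' ` Z'" "?phi X = ?phi Y"
  then obtain x y where xy: "x : Z" "X = ?c' (F x)" "y : Z" "Y = ?c' (F y)" unfolding Q'' by blast
  have "?phi (?c' (F x)) = ?phi (?c' (F y))" using `?phi X = ?phi Y` unfolding xy(2,4) .
  hence "?c x = ?c y" unfolding phi[OF xy(1)] phi[OF xy(3)] .
  thus "X = Y" unfolding xy(2,4) by(rule inj[OF xy(1,3)])
  qed
  show "?phi ` ?c' ` Z' = ?c ` Z" unfolding Q'' image_image by(rule image_cong[OF refl phi])
 qed
 have add': "set_add (V'(|carrier := Z'|)) (?c' (F x)) (?c' (F y)) = ?c' (F (x \<oplus>\<^bsub>V\<^esub> y))" if "x : Z" "y : Z" for x y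
 proof -
  have "z : set_add (V'(|carrier := Z'|)) (?c' (F x)) (?c' (F y)) <-> z + (F x + F y) : B'" for z
  proof
  assume "z : set_add (V'(|carrier := Z'|)) (?c' (F x)) (?c' (F y))"
  then obtain b d where bd: "b : B'" "d : B'" "z = (b + F x) + (d + F y)" by(auto simp: set_add_def' V')
  have "z + (F x + F y) = b + d" unfolding bd(3) by(simp only: add_swap4[of b] vec_add_cancel)
  thus "z + (F x + F y) : B'" using B'(3)[OF bd(1,2)] by(simp only:)
  next
  assume z: "z + (F x + F y) : B'"
  have "((z + (F x + F y)) + F x) + (0 + F y) = (z + (F x + F y)) + (F x + F y)" by(simp only: add_0_left add.assoc)
  hence e: "z = ((z + (F x + F y)) + F x) \<oplus>\<^bsub>V'(|carrier := Z'|)\<^esub> (0 + F y)" by(simp add: V')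
  show "z : set_add (V'(|carrier := Z'|)) (?c' (F x)) (?c' (F y))" unfolding set_add_def' using e z B'(2) by blast
  qed
  thus ?thesis unfolding set_eq_iff mem' F(2)[OF that] by blast
 qed
 have add: "set_add (V(|carrier := Z|)) (?c x) (?c y) = ?c (x \<oplus>\<^bsub>V\<^esub> y)" if xy: "x : Z" "y : Z" for x y
 proof -
  have "z : set_add (V(|carrier := Z|)) (?c x) (?c y) <-> z : ?c (x \<oplus>\<^bsub>V\<^esub> y)" for z
  proof
  assume "z : set_add (V(|carrier := Z|)) (?c x) (?c y)"
  then obtain b d where bd: "b : B" "d : B" "z = (b \<oplus>\<^bsub>V\<^esub> x) \<oplus>\<^bsub>V\<^esub> (d \<oplus>\<^bsub>V\<^esub> y)" by(auto simp: set_add_def')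
  have bZ: "b : Z" "d : Z" using bd B by auto
  have "F (b \<oplus>\<^bsub>V\<^esub> d) = F b + F d" "F b : B'" "F d : B'" using bd(1,2) bZ F(2)[OF bZ] FB by auto
  hence "b \<oplus>\<^bsub>V\<^esub> d : B" using FB[OF Z(2)[OF bZ]] B'(3) by simp
  moreover have "z = (b \<oplus>\<^bsub>V\<^esub> d) \<oplus>\<^bsub>V\<^esub> (x \<oplus>\<^bsub>V\<^esub> y)"
  unfolding bd(3) using bd B Z xy cl ad by(intro coords_inject[OF V]) (auto simp: subset_iff ac_simps)
  ultimately show "z : ?c (x \<oplus>\<^bsub>V\<^esub> y)" by blast
  next
  assume "z : ?c (x \<oplus>\<^bsub>V\<^esub> y)"
  then obtain b where b: "b : B" "z = b \<oplus>\<^bsub>V\<^esub> (x \<oplus>\<^bsub>V\<^esub> y)" by blast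
  have "z = (b \<oplus>\<^bsub>V\<^esub> x) \<oplus>\<^bsub>V\<^esub> y"
  unfolding b(2) using b B Z xy cl ad by(intro coords_inject[OF V]) (auto simp: subset_iff ac_simps)
  thus "z : set_add (V(|carrier := Z|)) (?c x) (?c y)" unfolding set_add_def' using b in0[OF xy(2)] by auto
  qed
  thus ?thesis by blast
 qed
 have zero: "?phi B' = B" using FB B by auto
 show ?thesis unfolding f2_iso_def
 proof(intro exI[of _ ?phi] conjI ballI)
  show "bij_betw ?phi (carrier (quotient_space (V'(|carrier := Z'|)) B')) (carrier (quotient_space (V(|carrier := Z|)) B))"
  using bij by(simp add: quotient_space_def Q Q')
  fix X Y
  assume "X : carrier (quotient_space (V'(|carrier := Z'|)) B')" "Y : carrier (quotient_space (V'(|carrier := Z'|)) B')"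
  then obtain x y where "x : Z" "X = ?c' (F x)" "y : Z" "Y = ?c' (F y)" unfolding quotient_space_def f2_space_simps Q' Q'' by blast
  thus "?phi (X \<oplus>\<^bsub>quotient_space (V'(|carrier := Z'|)) B'\<^esub> Y) = ?phi X \<oplus>\<^bsub>quotient_space (V(|carrier := Z|)) B\<^esub> ?phi Y"
  using Z(2) by(simp only: quotient_space_def f2_space_simps add' add phi)
 next
  fix a X
  show "?phi (a \<odot>\<^bsub>quotient_space (V'(|carrier := Z'|)) B'\<^esub> X) = a \<odot>\<^bsub>quotient_space (V(|carrier := Z|)) B\<^esub> ?phi X"
  using zero by(simp add: quotient_space_def f2_space_def)
 qed
qed

lemma homology_iso:
 fixes C :: "('v, 'z) dg_space_scheme" and D :: "('g \<Rightarrow>\<^sub>0 bit, 'y) dg_space_scheme"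
 assumes C: "coords (space C) H Phi"
  and dC: "!!x. x : carrier (space C) ==> diff C x : carrier (space C) & Phi (diff C x) = lin d (Phi x)"
  and pC: "!!i j x. x : piece C i j <-> x : carrier (space C) & Phi x : vec (Hd i j)"
  and Hd: "!!i j. Hd i j <= H" "!!i j h. h : Hd i j ==> d h : vec (Hd (i + 1) j)"
  and dd: "!!x. x : vec H ==> lin d (lin d x) = 0"
  and D: "add (space D) = (+)" "zero (space D) = 0" "!!x. diff D x = lin \<delta> x"
  and pD: "!!i j. piece D (i + a) (j + b) = vec (Kd i j)"
  and \<pi>: "!!i j h. h : Hd i j ==> \<pi> h : vec (Kd i j)" "!!i j g. g : Kd i j ==> EX x:vec (Hd i j). lin \<pi> x = elt g"
  and chain: "!!x. x : vec H ==> lin \<pi> (lin d x) = lin \<delta> (lin \<pi> x)"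
  and exact: "!!i j x. x : vec (Hd i j) ==> lin d x = 0 ==> lin \<pi> x = 0 ==>
  EX z:vec (Hd (i - 1) j). lin d z = x & lin \<pi> z = 0"
 shows "f2_iso (homology D (i + a) (j + b)) (homology C i j)"
proof -
 let ?Z = "{x : piece C i j. diff C x = \<zero>\<^bsub>space C\<^esub>}" and ?B = "diff C ` piece C (i - 1) j"
 let ?Z' = "{x : piece D (i + a) (j + b). diff D x = \<zero>\<^bsub>space D\<^esub>}" and ?B' = "diff D ` piece D (i + a - 1) (j + b)"
 note cl = coords_add_closed[OF C] and ad = coords_add[OF C] and z = coords_zero[OF C]
 have H: "x : vec H" if "x : vec (Hd i j)" for x i j using that Hd(1) by(rule vec_mono)
 have surj: "lin \<pi> ` vec (Hd i j) = vec (Kd i j)" for i j using \<pi> by(rule lin_image_vec)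
 have \<pi>v: "lin \<pi> x : vec (Kd i j)" if "x : vec (Hd i j)" for x i j unfolding surj[symmetric] using that by(rule imageI)
 have lift: "EX v. v : vec (Hd i j) & y = lin \<pi> v" if "y : vec (Kd i j)" for y i j using that unfolding surj[symmetric] by(rule imageE) blast
 have Z: "x : ?Z <-> x : carrier (space C) & Phi x : vec (Hd i j) & lin d (Phi x) = 0" for x
 proof(cases "x : carrier (space C)")
  case True
  have "diff C x = \<zero>\<^bsub>space C\<^esub> <-> lin d (Phi x) = 0"
  proof
  assume "lin d (Phi x) = 0"
  thus "diff C x = \<zero>\<^bsub>space C\<^esub>" using dC[OF True] z by(intro coords_inject[OF C]) simp_all
  next
  assume "diff C x = \<zero>\<^bsub>space C\<^esub>"
  thus "lin d (Phi x) = 0" using dC[OF True] z by simp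
  qed
  thus ?thesis using True pC by simp
 qed(simp add: pC)
 have e: "i + a - 1 = (i - 1) + a" by simp
 have Z': "?Z' = {y : vec (Kd i j). lin \<delta> y = 0}" by(simp add: pD D)
 have B': "?B' = lin \<delta> ` vec (Kd (i - 1) j)" unfolding e pD by(simp add: D)
 have B: "x : ?B <-> x : carrier (space C) & (EX v:vec (Hd (i - 1) j). Phi x = lin d v)" for x
 proof
  assume "x : ?B"
  thus "x : carrier (space C) & (EX v:vec (Hd (i - 1) j). Phi x = lin d v)" using dC by(auto simp: pC)
 next
  assume x: "x : carrier (space C) & (EX v:vec (Hd (i - 1) j). Phi x = lin d v)"
  then obtain v where v: "v : vec (Hd (i - 1) j)" "Phi x = lin d v" by blast
  let ?y = "point (space C) Phi v"
  have y: "?y : carrier (space C)" "Phi ?y = v" using point_closed[OF C H[OF v(1)]] coords_point[OF C H[OF v(1)]] by auto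
  hence "x = diff C ?y" using x v dC[OF y(1)] by(intro coords_inject[OF C]) auto
  thus "x : ?B" using y v by(auto simp: pC)
 qed
 have "f2_iso (quotient_space ((space D)(|carrier := ?Z'|)) ?B') (quotient_space ((space C)(|carrier := ?Z|)) ?B)"
 proof(rule quotient_iso[OF C, where F = "%x. lin \<pi> (Phi x)"])
  show "?Z <= carrier (space C)" using Z by blast
  show "x \<oplus>\<^bsub>space C\<^esub> y : ?Z" if "x : ?Z" "y : ?Z" for x y using that cl ad unfolding Z by(auto simp: lin_add)
  show "?B <= ?Z"
  proof
  fix x assume "x : ?B"
  then obtain v where v: "x : carrier (space C)" "v : vec (Hd (i - 1) j)" "Phi x = lin d v" unfolding B by blast
  have "lin d v : vec (Hd (i - 1 + 1) j)" using v(2) Hd(2) by(rule vec_lin)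
  thus "x : ?Z" unfolding Z using v dd[OF H[OF v(2)]] by simp
  qed
  show "add (space D) = (+)" by(rule D)
  show "lin \<pi> (Phi (x \<oplus>\<^bsub>space C\<^esub> y)) = lin \<pi> (Phi x) + lin \<pi> (Phi y)" if "x : ?Z" "y : ?Z" for x y
  using that ad unfolding Z by(simp add: lin_add)
  show "(%x. lin \<pi> (Phi x)) ` ?Z = ?Z'"
  proof
  show "(%x. lin \<pi> (Phi x)) ` ?Z <= ?Z'"
  proof
  fix y assume "y : (%x. lin \<pi> (Phi x)) ` ?Z"
  then obtain x where x: "x : carrier (space C)" "Phi x : vec (Hd i j)" "lin d (Phi x) = 0" "y = lin \<pi> (Phi x)" using Z by blast
  have "lin \<delta> y = 0" using chain[OF H[OF x(2)]] x by simp
  thus "y : ?Z'" unfolding Z' using x \<pi>v[OF x(2)] by simp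
  qed
  show "?Z' <= (%x. lin \<pi> (Phi x)) ` ?Z"
  proof
  fix y assume "y : ?Z'"
  hence y: "y : vec (Kd i j)" "lin \<delta> y = 0" unfolding Z' by auto
  then obtain v where v: "v : vec (Hd i j)" "y = lin \<pi> v" using lift by blast
  have dv: "lin d v : vec (Hd (i + 1) j)" using v(1) Hd(2) by(rule vec_lin)
  have "lin \<pi> (lin d v) = 0" using chain[OF H[OF v(1)]] v y by simp
  from exact[OF dv dd[OF H[OF v(1)]] this]
  obtain u where u: "u : vec (Hd i j)" "lin d u = lin d v" "lin \<pi> u = 0" by auto
  let ?x = "point (space C) Phi (v + u)"
  have vu: "v + u : vec (Hd i j)" using v u by(intro vec_add)
  have "?x : ?Z" "lin \<pi> (Phi ?x) = y" unfolding Z using vu point_closed[OF C H[OF vu]] coords_point[OF C H[OF vu]] u v by(auto simp: lin_add)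
  thus "y : (%x. lin \<pi> (Phi x)) ` ?Z" by(intro image_eqI[of _ _ ?x]) auto
  qed
  qed
  have \<delta>: "lin \<delta> y : vec (Kd i j) & lin \<delta> (lin \<delta> y) = 0" if "y : vec (Kd (i - 1) j)" for y
  proof -
  obtain v where v: "v : vec (Hd (i - 1) j)" "y = lin \<pi> v" using lift `y : vec (Kd (i - 1) j)` by blast
  have "lin d v : vec (Hd (i - 1 + 1) j)" using v(1) Hd(2) by(rule vec_lin)
  hence dv: "lin d v : vec (Hd i j)" by simp
  have "lin \<delta> y = lin \<pi> (lin d v)" using chain[OF H[OF v(1)]] v by simp
  moreover have "lin \<pi> (lin d v) : vec (Kd i j)" using dv by(rule \<pi>v)
  moreover have "lin \<delta> (lin \<pi> (lin d v)) = 0" using chain[OF H[OF dv]] dd[OF H[OF v(1)]] by simp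
  ultimately show ?thesis by simp
  qed
  thus "?B' <= ?Z'" unfolding B' Z' by auto
  show "0 : ?B'" unfolding B' by(rule image_eqI[of _ _ 0]) auto
  show "x + y : ?B'" if "x : ?B'" "y : ?B'" for x y using that unfolding B' by(auto simp flip: lin_add intro: vec_add)
  show "lin \<pi> (Phi x) : ?B' <-> x : ?B" if "x : ?Z" for x
  proof
  have x: "x : carrier (space C)" "Phi x : vec (Hd i j)" "lin d (Phi x) = 0" using that unfolding Z by auto
  assume "lin \<pi> (Phi x) : ?B'"
  then obtain y where y: "y : vec (Kd (i - 1) j)" "lin \<pi> (Phi x) = lin \<delta> y" unfolding B' by blast
  obtain v where v: "v : vec (Hd (i - 1) j)" "y = lin \<pi> v" using lift[OF y(1)] by blast
  have "lin d v : vec (Hd (i - 1 + 1) j)" using v(1) Hd(2) by(rule vec_lin)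
  hence w: "Phi x + lin d v : vec (Hd i j)" using x(2) by(intro vec_add) simp_all
  have "lin d (Phi x + lin d v) = 0" "lin \<pi> (Phi x + lin d v) = 0"
  using x(3) dd[OF H[OF v(1)]] chain[OF H[OF v(1)]] y v by(simp_all add: lin_add)
  from exact[OF w this] obtain u where u: "u : vec (Hd (i - 1) j)" "lin d u = Phi x + lin d v" by blast
  have "Phi x = lin d (u + v)" using u(2) by(simp add: lin_add)
  thus "x : ?B" unfolding B using x vec_add[OF u(1) v(1)] by blast
  next
  assume "x : ?B"
  then obtain v where v: "v : vec (Hd (i - 1) j)" "Phi x = lin d v" unfolding B by blast
  hence "lin \<pi> (Phi x) = lin \<delta> (lin \<pi> v)" using chain[OF H[OF v(1)]] by simp
  thus "lin \<pi> (Phi x) : ?B'" unfolding B' by(simp only:) (rule imageI[OF \<pi>v[OF v(1)]])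
  qed
 qed
 thus ?thesis by(simp add: homology_def)
qed

text \<open>
  The conditions on a map \<open>\<pi>\<close> from the words to a smaller complex under which it induces an
  isomorphism from Hochschild homology: it is a trace, hence defined on \<open>HH\<^sub>0\<close>, it is injective on the
  words that form a basis of \<open>HH\<^sub>0\<close>, and there it is compatible with the differentials.
\<close>

locale trace_model =
 fixes m :: nat and ls :: braid_word and \<pi> :: "word => 'g fvec" and \<delta> :: "'g => 'g fvec"
  and Kd :: "int => int => 'g set"
 assumes ls: "ls ~= []" "ALL l:set ls. good m l"
  and degrees: "y : NWd m ls h q ==> \<pi> y : vec (Kd h q)"
  and onto: "g : Kd h q ==> EX x:vec (NWd m ls h q). lin \<pi> x = elt g"
  and trace: "okw m ls y ==> c : KB m ==> lin \<pi> (elto (lmw c y)) = lin \<pi> (elto (rmw y c))"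
  and inject: "x : vec (Norm m ls) ==> lin \<pi> x = 0 ==> x = 0"
  and chain: "y : Norm m ls ==> lin \<pi> (dnw m ls y) = lin \<delta> (\<pi> y)"
begin

definition \<pi>b :: "bar => 'g fvec" where
 "\<pi>b = (%(bs, y). if bs = [] then \<pi> y else 0)"

lemma \<pi>b_pairb: "lin \<pi>b (pairb [] y) = lin \<pi> y" by(simp add: lin_pairb \<pi>b_def)

lemma \<pi>b_simps: "\<pi>b ([], y) = \<pi> y" "bs ~= [] ==> \<pi>b (bs, y) = 0" by(simp_all add: \<pi>b_def)

lemma \<pi>b_ext: "w : BG m ls ==> lin \<pi>b (bar_ext w) = 0"
proof -
 assume "w : BG m ls"
 then obtain bs y where w: "w = (bs, y)" "set bs <= KB m" "okw m ls y" by(auto simp: BG_def NW_def)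
 show ?thesis
 proof(cases bs)
  case Nil
  thus ?thesis by(simp add: w bar_ext_Nil)
 next
  case (Cons b cs)
  show ?thesis
  proof(cases cs)
  case Nil
  have "bar_ext w = pairb [] (elto (lmw b y)) + pairb [] (elto (rmw y b))" by(simp add: w Cons Nil bar_ext_def rbar_def)
  thus ?thesis using trace[of y b] w by(simp add: Cons lin_add \<pi>b_pairb)
  next
  case C: (Cons c ds)
  then obtain n where n: "length bs = Suc (Suc n)" using Cons by simp
  have "bar_ext w : vec (bar_inv m ls (Suc n) (pat y) (wq ls y - int (sum_list (map len bs))))"
  by(rule bar_ext_vec) (use w n in "simp add: bar_inv_def")
  moreover have "\<pi>b u = 0" if "u : bar_inv m ls (Suc n) v q" for u v q using that by(auto simp: bar_inv_def \<pi>b_def)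
  ultimately have "lin \<pi>b (bar_ext w) = lin (%_. 0) (bar_ext w)" by(intro lin_cong_vec)
  thus ?thesis by simp
  qed
 qed
qed

lemma dbar_BG: "w : BG m ls ==> bar_ext w : vec (BG m ls) & bar_int m ls w : vec (BG m ls)"
proof -
 assume "w : BG m ls"
 then obtain bs y where w: "w = (bs, y)" "set bs <= KB m" "okw m ls y" by(auto simp: BG_def NW_def)
 have "bar_ext w : vec (BG m ls)"
 proof(cases "length bs")
  case 0
  thus ?thesis by(simp add: w bar_ext_Nil)
 next
  case (Suc n)
  have "bar_ext w : vec (bar_inv m ls n (pat y) (wq ls y - int (sum_list (map len bs))))" by(rule bar_ext_vec) (use w Suc in "simp add: bar_inv_def")
  thus ?thesis by(rule vec_mono) (auto simp: bar_inv_def BG_def NW_def)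
 qed
 moreover have "bar_int m ls w : vec (BG m ls)" unfolding w(1) bar_int_def prod.case pairb_def
  by(rule vec_lin[OF dnw_vec[OF ls(2) w(3)]]) (use w in "auto simp: BG_def NW_def")
 ultimately show ?thesis ..
qed

lemma int_ext: "z : vec (BG m ls) ==> lin (bar_int m ls) (lin bar_ext z) = lin bar_ext (lin (bar_int m ls) z)"
proof(induction rule: vec_induct)
 case (elt w)
 then obtain bs y where w: "w = (bs, y)" "set bs <= KB m" by(auto simp: BG_def)
 show ?case unfolding w(1) by(simp only: lin_bar_ext lin_add bar_int_mult[OF ls(2) w(2)] bar_int_rot[OF ls(2)])
qed(simp_all add: lin_add)

lemma chain_words:
 assumes "okw m ls y"
 shows "lin \<pi> (dnw m ls y) = lin \<delta> (\<pi> y)"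
proof -
 have y: "([], y) : Bt m ls 0 (wh ls y) (wq ls y) (has_cup y)" using assms by(simp add: Bt_def)
 obtain t z where t: "t : vec (Norm m ls Int NWd m ls (wh ls y) (wq ls y))"
  "z : vec (Bt m ls (Suc 0) (wh ls y) (wq ls y) (has_cup y))" "lin bar_ext z = elt ([], y) + pairb [] t" using column_end[OF y] by blast
 have z: "z : vec (BG m ls)" using t(2) by(rule vec_mono) (auto simp: Bt_def BG_def NW_def)
 have ext0: "lin \<pi>b (lin bar_ext x) = 0" if "x : vec (BG m ls)" for x
  using that by(induction rule: vec_induct) (simp_all add: lin_add \<pi>b_ext)
 have iz: "lin (bar_int m ls) z : vec (BG m ls)" using z dbar_BG by(blast intro: vec_lin)
 have "lin \<pi>b (lin (bar_int m ls) (lin bar_ext z)) = 0" unfolding int_ext[OF z] by(rule ext0[OF iz])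
 hence "lin \<pi> (dnw m ls y) = lin \<pi> (lin (dnw m ls) t)" unfolding t(3) lin_add lin_elt bar_int_pairb \<pi>b_pairb
  by(simp add: bar_int_def \<pi>b_pairb vec_add_eq_0_iff)
 also have "... = lin \<delta> (lin \<pi> t)"
 proof -
  have "t : vec (Norm m ls)" using t(1) by(rule vec_mono) auto
  thus ?thesis by(induction rule: vec_induct) (simp_all add: lin_add chain)
 qed
 also have "lin \<pi> t = \<pi> y" using ext0[OF z] unfolding t(3) by(simp add: lin_add \<pi>b_pairb \<pi>b_simps vec_add_eq_0_iff)
 finally show ?thesis .
qed

lemma chain_bar:
 assumes "x : vec (BG m ls)"
 shows "lin \<pi>b (lin (dbar m ls) x) = lin \<delta> (lin \<pi>b x)" using assms
proof(induction rule: vec_induct)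
 case (elt w)
 then obtain bs y where w: "w = (bs, y)" "okw m ls y" by(auto simp: BG_def NW_def)
 show ?case
 proof(cases "bs = []")
  case True
  thus ?thesis using chain_words[OF w(2)] by(simp add: w dbar_def bar_int_def bar_ext_Nil \<pi>b_pairb \<pi>b_simps)
 next
  case False
  have "lin \<pi>b (bar_int m ls w) = 0" using False by(simp add: w bar_int_def lin_pairb \<pi>b_def)
  thus ?thesis using \<pi>b_ext[OF elt] False by(simp add: dbar_def lin_add w \<pi>b_simps)
 qed
qed(simp_all add: lin_add)

lemma dbar_BGd: "w : BGd m ls i j ==> dbar m ls w : vec (BGd m ls (i + 1) j)"
proof -
 assume "w : BGd m ls i j"
 then obtain bs y where w: "w = (bs, y)" "set bs <= KB m" "okw m ls y" "wh ls y - int (length bs) = i"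
  "wq ls y - int (sum_list (map len bs)) = j" by(auto simp: BGd_def NW_def)
 have "bar_ext w : vec (BGd m ls (i + 1) j)"
 proof(cases "length bs")
  case 0
  thus ?thesis by(simp add: w bar_ext_Nil)
 next
  case (Suc n)
  have "bar_ext w : vec (Bt m ls n (wh ls y) j (has_cup y))" by(rule bar_ext_Bt) (use w Suc in "simp add: Bt_def")
  thus ?thesis by(rule vec_mono) (use w Suc in "auto simp: Bt_def BGd_def NW_def")
 qed
 moreover have "bar_int m ls w : vec (BGd m ls (i + 1) j)" unfolding w(1) bar_int_def prod.case pairb_def
  by(rule vec_lin[OF dnw_vec[OF ls(2) w(3)]]) (use w in "auto simp: BGd_def NW_def")
 ultimately show ?thesis unfolding dbar_def by(auto intro: vec_add)
qed

lemma wh_bounds: "okw m ls' y ==> 0 <= wh ls' y & wh ls' y <= int (length ls')"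
proof(induction ls' arbitrary: y)
 case (Cons l ls')
 obtain u us b where y: "y = (u # us, b)" using Cons.prems by(cases y; cases "fst y") auto
 have "okw m ls' (us, b)" using Cons.prems by(cases u) (auto simp: y)
 from Cons.IH[OF this] show ?case by(auto simp: y uh_def)
next
 case Nil
 thus ?case by(cases y) simp
qed

lemma column_kernel:
 assumes x: "x : vec {w : BGd m ls i j. wh ls (snd w) = t}" and d: "lin bar_ext x = 0" and p: "lin \<pi>b x = 0"
 shows "EX z:vec {w : BGd m ls (i - 1) j. wh ls (snd w) = t}. lin bar_ext z = x & lin \<pi>b z = 0"
proof -
 let ?A = "%n c. Bt m ls n t j c"
 have \<pi>0: "lin \<pi>b z = 0" if "z : vec {w : BGd m ls (i - 1) j. wh ls (snd w) = t}" "i <= t" for z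
 proof -
  have "lin \<pi>b z = lin (%_. 0) z" by(rule lin_cong_vec[OF that(1)]) (use that(2) in "auto simp: BGd_def \<pi>b_def")
  thus ?thesis by simp
 qed
 have Bsub: "z : vec {w : BGd m ls (i - 1) j. wh ls (snd w) = t}" if "z : vec (?A n c)" "t - int n = i - 1" for z n c
  using that(1) by(rule vec_mono) (use that(2) in "auto simp: Bt_def BGd_def NW_def")
 show ?thesis
 proof(cases "t < i")
  case True
  hence "{w : BGd m ls i j. wh ls (snd w) = t} = {}" by(auto simp: BGd_def)
  hence "x = 0" using x by(simp only: vec_empty)
  thus ?thesis by(intro bexI[of _ 0]) auto
 next
  case False
  then obtain n where n: "t - int n = i" by(metis diff_diff_eq2 diff_add_cancel add_diff_cancel_left' nonneg_int_cases not_less diff_ge_0_iff_ge)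
  have A: "{w : BGd m ls i j. wh ls (snd w) = t} <= {w. w : ?A n (has_cup (snd w))}" using n by(auto simp: BGd_def Bt_def NW_def)
  show ?thesis
  proof(cases n)
  case (Suc k)
  obtain u v where uv: "u : vec {w : {w : BGd m ls i j. wh ls (snd w) = t}. has_cup (snd w)}"
  "v : vec {w : {w : BGd m ls i j. wh ls (snd w) = t}. ~ has_cup (snd w)}" "x = u + v" using vec_split[OF x, of "%w. has_cup (snd w)"] by blast
  have u: "u : vec (?A (Suc k) True)" using uv(1) by(rule vec_mono) (use A Suc in auto)
  have v: "v : vec (?A (Suc k) False)" using uv(2) by(rule vec_mono) (use A Suc in auto)
  have du: "lin bar_ext u : vec (?A k True)" "lin bar_ext v : vec (?A k False)" using vec_lin[OF u bar_ext_Bt] vec_lin[OF v bar_ext_Bt] by auto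
  have "lin bar_ext u + lin bar_ext v = 0" using d uv(3) by(simp add: lin_add)
  from vec_disjoint_sum[OF du this] have "lin bar_ext u = 0" "lin bar_ext v = 0" by(auto simp: Bt_def)
  then obtain zu zv where z: "zu : vec (?A (Suc (Suc k)) True)" "lin bar_ext zu = u"
  "zv : vec (?A (Suc (Suc k)) False)" "lin bar_ext zv = v" using column_exact[OF u] column_exact[OF v] by blast
  have s: "zu + zv : vec {w : BGd m ls (i - 1) j. wh ls (snd w) = t}" using Bsub[OF z(1)] Bsub[OF z(3)] n Suc by(intro vec_add) auto
  thus ?thesis using z uv(3) \<pi>0[OF s] s False by(intro bexI[of _ "zu + zv"]) (simp_all add: lin_add)
  next
  case 0
  (* At the end of the column x is homologous to normalized words, on which the trace is injective. *)
  have "EX y z. y : vec (Norm m ls) & z : vec {w : BGd m ls (i - 1) j. wh ls (snd w) = t} &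
  lin bar_ext z = x + pairb [] y" using x
  proof(induction rule: vec_induct)
  case zero
  show ?case by(intro exI[of _ 0]) auto
  next
  case (elt w)
  then obtain y where w: "w = ([], y)" using 0 A by(cases w) (auto simp: Bt_def)
  have "([], y) : Bt m ls 0 t j (has_cup y)" using elt A 0 by(auto simp: w)
  from column_end[OF this] obtain s z where s: "s : vec (Norm m ls Int NWd m ls t j)"
  "z : vec (Bt m ls (Suc 0) t j (has_cup y))" "lin bar_ext z = elt ([], y) + pairb [] s" by blast
  have "s : vec (Norm m ls)" using s(1) by(rule vec_mono) auto
  moreover have "z : vec {w : BGd m ls (i - 1) j. wh ls (snd w) = t}" using Bsub[OF s(2)] n 0 by simp
  ultimately show ?case using s(3) w by blast
  next
  case (add x x')
  then obtain y z y' z' where *: "y : vec (Norm m ls)" "z : vec {w : BGd m ls (i - 1) j. wh ls (snd w) = t}"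
  "lin bar_ext z = x + pairb [] y" "y' : vec (Norm m ls)" "z' : vec {w : BGd m ls (i - 1) j. wh ls (snd w) = t}"
  "lin bar_ext z' = x' + pairb [] y'" by blast
  have "lin bar_ext (z + z') = (x + x') + pairb [] (y + y')" by(simp only: lin_add *(3,6) add_swap4 pairb_simps)
  thus ?case using vec_add[OF *(1,4)] vec_add[OF *(2,5)] by blast
  qed
  then obtain y z where yz: "y : vec (Norm m ls)" "z : vec {w : BGd m ls (i - 1) j. wh ls (snd w) = t}"
  "lin bar_ext z = x + pairb [] y" by blast
  have "z : vec (BG m ls)" using yz(2) by(rule vec_mono) (auto simp: BGd_def BG_def)
  hence "lin \<pi>b (lin bar_ext z) = 0" by(induction rule: vec_induct) (simp_all add: lin_add \<pi>b_ext)
  hence "lin \<pi> y = 0" unfolding yz(3) using p by(simp add: lin_add \<pi>b_pairb)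
  hence "y = 0" using inject[OF yz(1)] by simp
  thus ?thesis using yz \<pi>0[OF yz(2)] False by auto
  qed
 qed
qed

text \<open>Exactness of the kernel, by going up through the heights in the cube.\<close>

lemma kernel_exact:
 assumes "x : vec (BGd m ls i j)" "lin (dbar m ls) x = 0" "lin \<pi>b x = 0"
 shows "EX z:vec (BGd m ls (i - 1) j). lin (dbar m ls) z = x & lin \<pi>b z = 0"
proof -
 let ?U = "%i t. {w : BGd m ls i j. t <= wh ls (snd w)}" and ?E = "%i t. {w : BGd m ls i j. wh ls (snd w) = t}"
 have BG: "x : vec (BG m ls)" if "x : vec (BGd m ls i j)" for x i using that by(rule vec_mono) (auto simp: BGd_def BG_def)
 have ext: "bar_ext w : vec {w' : BGd m ls (i + 1) j. wh ls (snd w') = wh ls (snd w)}" if "w : BGd m ls i j" for w i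
 proof -
  obtain bs y where w: "w = (bs, y)" by(cases w)
  show ?thesis
  proof(cases "length bs")
  case 0
  thus ?thesis by(simp add: w bar_ext_Nil)
  next
  case (Suc n)
  have "bar_ext w : vec (Bt m ls n (wh ls y) j (has_cup y))" by(rule bar_ext_Bt) (use that w Suc in "simp add: Bt_def BGd_def NW_def")
  thus ?thesis by(rule vec_mono) (use that w Suc in "auto simp: Bt_def BGd_def NW_def")
  qed
 qed
 have int: "bar_int m ls w : vec {w' : BGd m ls (i + 1) j. wh ls (snd w') = wh ls (snd w) + 1}" if "w : BGd m ls i j" for w i
 proof -
  obtain bs y where wb: "w = (bs, y)" by(cases w)
  hence w: "w = (bs, y)" "okw m ls y" using that by(auto simp: BGd_def NW_def)
  show ?thesis unfolding w(1) bar_int_def prod.case pairb_def by(rule vec_lin[OF dnw_vec[OF ls(2) w(2)]]) (use that w in "auto simp: BGd_def NW_def")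
 qed
 have "x : vec (?U i t) ==> lin (dbar m ls) x = 0 ==> lin \<pi>b x = 0 ==>
  EX z:vec (BGd m ls (i - 1) j). lin (dbar m ls) z = x & lin \<pi>b z = 0" for t x
 proof(induction "nat (int (length ls) + 1 - t)" arbitrary: t x rule: less_induct)
  case less
  show ?case
  proof(cases "t <= int (length ls)")
  case False
  hence "?U i t = {}" using wh_bounds by(fastforce simp: BGd_def NW_def)
  hence "x = 0" using less.prems(1) by(simp only: vec_empty)
  thus ?thesis by(intro bexI[of _ 0]) auto
  next
  case True
  (* The part u of lowest height must be a cycle in the bar direction by itself. *)
  obtain u v where uv: "u : vec {w : ?U i t. wh ls (snd w) = t}" "v : vec {w : ?U i t. wh ls (snd w) ~= t}" "x = u + v"
  using vec_split[OF less.prems(1), of "%w. wh ls (snd w) = t"] by blast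
  have u: "u : vec (?E i t)" using uv(1) by(rule vec_mono) auto
  have v: "v : vec (?U i (t + 1))" using uv(2) by(rule vec_mono) auto
  have eu: "lin bar_ext u : vec (?E (i + 1) t)" by(rule vec_lin[OF u]) (rule vec_mono[OF ext], auto)
  have "lin (bar_int m ls) u : vec (?U (i + 1) (t + 1))" by(rule vec_lin[OF u]) (rule vec_mono[OF int], auto)
  moreover have "lin bar_ext v : vec (?U (i + 1) (t + 1))" by(rule vec_lin[OF v]) (rule vec_mono[OF ext], auto)
  moreover have "lin (bar_int m ls) v : vec (?U (i + 1) (t + 1))" by(rule vec_lin[OF v]) (rule vec_mono[OF int], auto)
  ultimately have r: "lin (bar_int m ls) u + (lin (bar_int m ls) v + lin bar_ext v) : vec (?U (i + 1) (t + 1))" by(intro vec_add)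
  have "lin bar_ext u + (lin (bar_int m ls) u + (lin (bar_int m ls) v + lin bar_ext v)) = lin (dbar m ls) x"
  unfolding uv(3) lin_add lin_dbar by(simp only: ac_simps)
  hence s0: "lin bar_ext u + (lin (bar_int m ls) u + (lin (bar_int m ls) v + lin bar_ext v)) = 0" using less.prems(2) by simp
  have e0: "lin bar_ext u = 0" by(rule vec_disjoint_sum(1)[OF eu r s0]) auto
  have p0: "lin \<pi>b u = 0"
  proof(cases "t = i")
  case True
  have "lin \<pi>b v = lin (%_. 0) v" by(rule lin_cong_vec[OF v]) (use True in "auto simp: BGd_def \<pi>b_def")
  thus ?thesis using less.prems(3) uv(3) by(simp add: lin_add)
  next
  case False
  have "lin \<pi>b u = lin (%_. 0) u" by(rule lin_cong_vec[OF u]) (use False in "auto simp: BGd_def \<pi>b_def")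
  thus ?thesis by simp
  qed
  obtain z where z: "z : vec (?E (i - 1) t)" "lin bar_ext z = u" "lin \<pi>b z = 0" using column_kernel[OF u e0 p0] by blast
  have zB: "z : vec (BGd m ls (i - 1) j)" using z(1) by(rule vec_mono) auto
  have "lin (bar_int m ls) z : vec (?U (i - 1 + 1) (t + 1))" by(rule vec_lin[OF z(1)]) (rule vec_mono[OF int], auto)
  hence y: "v + lin (bar_int m ls) z : vec (?U i (t + 1))" using v by(intro vec_add) simp_all
  have e: "x + lin (dbar m ls) z = v + lin (bar_int m ls) z" unfolding lin_dbar z(2) uv(3) by(simp add: ac_simps)
  have "lin (dbar m ls) (v + lin (bar_int m ls) z) = 0" unfolding e[symmetric] lin_add less.prems(2) dbar_dbar[OF ls(2) BG[OF zB]] by simp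
  moreover have "lin \<pi>b (v + lin (bar_int m ls) z) = 0" unfolding e[symmetric] lin_add less.prems(3) chain_bar[OF BG[OF zB]] z(3) by simp
  moreover have "nat (int (length ls) + 1 - (t + 1)) < nat (int (length ls) + 1 - t)" using True by simp
  ultimately obtain z' where z': "z' : vec (BGd m ls (i - 1) j)" "lin (dbar m ls) z' = v + lin (bar_int m ls) z" "lin \<pi>b z' = 0"
  using less.hyps[OF _ y] by blast
  have "lin (dbar m ls) (z + z') = x" unfolding lin_add z'(2) e[symmetric] by(simp add: ac_simps)
  moreover have "lin \<pi>b (z + z') = 0" using z(3) z'(3) by(simp add: lin_add)
  ultimately show ?thesis using vec_add[OF zB z'(1)] by blast
  qed
 qed
 moreover have "x : vec (?U i 0)" using assms(1) by(rule vec_mono) (use wh_bounds in "auto simp: BGd_def NW_def")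
 ultimately show ?thesis using assms(2,3) by blast
qed

theorem Hochschild_homology_iso:
 fixes D :: "'g fvec dg_space"
 assumes "add (space D) = (+)" "zero (space D) = 0" "!!x. diff D x = lin \<delta> x"
  and "!!i j. piece D (i + a) (j + b) = vec (Kd i j)"
 shows "f2_iso (homology D (i + a) (j + b)) (HH (KS_algebra m) (KS_grading m) (M m ls) i j)" unfolding HH_def
proof(rule homology_iso[OF HC_coords[OF ls]])
 let ?C = "hoch_complex (KS_algebra m) (KS_grading m) (M m ls)"
 show "diff ?C x : carrier (space ?C) & hc m (diff ?C x) = lin (dbar m ls) (hc m x)"
  if "x : carrier (space ?C)" for x using HC_diff[OF ls that] by blast
 show "x : piece ?C i j <-> x : carrier (space ?C) & hc m x : vec (BGd m ls i j)" for i j x by(rule HC_piece[OF ls])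
 show "BGd m ls i j <= BG m ls" for i j by(auto simp: BGd_def BG_def)
 show "lin (dbar m ls) (lin (dbar m ls) x) = 0" if "x : vec (BG m ls)" for x using dbar_dbar[OF ls(2) that] .
 show "\<pi>b w : vec (Kd i j)" if "w : BGd m ls i j" for w i j using that degrees by(auto simp: BGd_def \<pi>b_def NWd_def)
 show "EX x:vec (BGd m ls i j). lin \<pi>b x = elt g" if "g : Kd i j" for g i j
 proof -
  obtain x where x: "x : vec (NWd m ls i j)" "lin \<pi> x = elt g" using onto[OF `g : Kd i j`] by blast
  have "pairb [] x : vec (BGd m ls i j)" unfolding pairb_def by(rule vec_lin[OF x(1)]) (auto simp: NWd_def BGd_def)
  thus ?thesis using x(2) \<pi>b_pairb by metis
 qed
qed(fact assms dbar_BGd chain_bar kernel_exact)+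

end

section \<open>The circles of a resolution\<close>

text \<open>Predecessor and successor are cyclic: the closing arcs join the last slab to the first one.\<close>

definition prv :: "nat set => nat => nat" where
 "prv U l = (if EX j:U. j < l then Max {j : U. j < l} else Max U)"

definition nxt :: "nat set => nat => nat" where
 "nxt U a = (if EX j:U. a < j then Min {j : U. a < j} else Min U)"

lemma prv_eqI: "finite U ==> p : U ==> p < l ==> (!!j. j : U ==> j < l ==> j <= p) ==> prv U l = p"
 and prv_eqI': "finite U ==> p : U ==> (!!j. j : U ==> l <= j) ==> (!!j. j : U ==> j <= p) ==> prv U l = p"
 by(auto simp: prv_def not_less intro!: Max_eqI) (metis leD)

lemma nxt_eqI: "finite U ==> z : U ==> a < z ==> (!!j. j : U ==> a < j ==> z <= j) ==> nxt U a = z"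
 and nxt_eqI': "finite U ==> z : U ==> (!!j. j : U ==> j <= a) ==> (!!j. j : U ==> z <= j) ==> nxt U a = z"
 by(auto simp: nxt_def not_less intro!: Min_eqI) (metis leD)

lemma prv_cases:
 assumes "finite U" "U ~= {}"
 obtains "prv U l : U" "prv U l < l" "!!j. j : U ==> j < l ==> j <= prv U l"
 | "prv U l : U" "!!j. j : U ==> l <= j" "!!j. j : U ==> j <= prv U l"
proof(cases "EX j:U. j < l")
 case True
 hence "Max {j : U. j < l} : {j : U. j < l}" using assms by(intro Max_in) auto
 thus thesis using True assms by(intro that(1)) (auto simp: prv_def)
next
 case False
 thus thesis using assms by(intro that(2)) (auto simp: prv_def not_less)
qed

lemma nxt_cases:
 assumes "finite U" "U ~= {}"
 obtains "nxt U a : U" "a < nxt U a" "!!j. j : U ==> a < j ==> nxt U a <= j"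
 | "nxt U a : U" "!!j. j : U ==> j <= a" "!!j. j : U ==> nxt U a <= j"
proof(cases "EX j:U. a < j")
 case True
 hence "Min {j : U. a < j} : {j : U. a < j}" using assms by(intro Min_in) auto
 thus thesis using True assms by(intro that(1)) (auto simp: nxt_def)
next
 case False
 thus thesis using assms by(intro that(2)) (auto simp: nxt_def not_less)
qed

context
 fixes U :: "nat set"
 assumes U: "finite U"
begin

lemma prv_in: "U ~= {} ==> prv U l : U" using prv_cases[OF U] by blast

lemma nxt_in: "U ~= {} ==> nxt U a : U" using nxt_cases[OF U] by blast

lemma prv_Suc: "j : U ==> prv U (Suc j) = j" by(rule prv_eqI[OF U]) auto

lemma prv_Suc_notin: "j ~: U ==> prv U (Suc j) = prv U j"
proof -
 assume "j ~: U"
 hence "i < Suc j <-> i < j" if "i : U" for i using that by(metis less_Suc_eq)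
 thus ?thesis unfolding prv_def by(metis (mono_tags, lifting) Collect_cong)
qed

lemma nxt_prv: "j : U ==> nxt U (prv U j) = j"
proof -
 assume j: "j : U"
 hence ne: "U ~= {}" by auto
 show ?thesis
 proof(cases rule: prv_cases[OF U ne, of j])
  case 1
  thus ?thesis using j by(intro nxt_eqI[OF U]) (auto simp: not_less[symmetric])
 next
  case 2
  thus ?thesis using j by(intro nxt_eqI'[OF U]) auto
 qed
qed

lemma prv_nxt: "a : U ==> prv U (nxt U a) = a"
proof -
 assume a: "a : U"
 hence ne: "U ~= {}" by auto
 show ?thesis
 proof(cases rule: nxt_cases[OF U ne, of a])
  case 1
  thus ?thesis using a by(intro prv_eqI[OF U]) (auto simp: not_less[symmetric])
 next
  case 2
  thus ?thesis using a by(intro prv_eqI'[OF U]) auto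
 qed
qed

lemma prv_wrap: "U <= {..<k} ==> U ~= {} ==> prv U k = prv U 0"
 by(rule prv_eqI'[OF U, of "prv U k" 0, symmetric]) (auto simp: prv_in intro: prv_cases[OF U, of k])

context
 fixes j
 assumes ne: "U ~= {}" and j: "j ~: U"
begin

lemma nxt_insert_prv: "nxt (insert j U) (prv U j) = j"
proof(cases rule: prv_cases[OF U ne, of j])
 case 1
 thus ?thesis using j by(intro nxt_eqI) (auto simp: U not_less[symmetric])
next
 case 2
 thus ?thesis using j by(intro nxt_eqI') (auto simp: U)
qed

lemma prv_insert: "prv (insert j U) l = prv U l | prv (insert j U) l = j & prv U l = prv U j"
proof -
 have f: "finite (insert j U)" using U by simp
 have "insert j U ~= {}" by simp
 note c = prv_cases[OF f this, of l]
 show ?thesis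
 proof(cases rule: c)
  case 1
  show ?thesis
  proof(cases "prv (insert j U) l = j")
  case True
  have jl: "j < l" using 1(2) unfolding True .
  have "i < j" if "i : U" "i < l" for i using 1(3)[of i] that j unfolding True by(auto simp: le_less)
  hence "{i : U. i < l} = {i : U. i < j}" using jl by auto
  hence "prv U l = prv U j" unfolding prv_def by(metis (mono_tags, lifting) empty_Collect_eq)
  thus ?thesis using True by simp
  next
  case False
  hence "prv U l = prv (insert j U) l" using 1 by(intro prv_eqI[OF U]) auto
  thus ?thesis by simp
  qed
 next
  case 2
  show ?thesis
  proof(cases "prv (insert j U) l = j")
  case True
  have jl: "l <= i & i < j" if "i : U" for i using 2(2,3)[of i] that j unfolding True by(auto simp: le_less)
  have "Max U = prv U j" using jl ne U by(intro prv_eqI[OF U, symmetric]) auto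
  moreover have "prv U l = Max U" using jl by(auto simp: prv_def not_less[symmetric])
  ultimately have "prv U l = prv U j" by simp
  thus ?thesis using True by simp
  next
  case False
  hence "prv U l = prv (insert j U) l" using 2 by(intro prv_eqI'[OF U]) auto
  thus ?thesis by simp
  qed
 qed
qed

lemma nxt_insert_new: "nxt (insert j U) j = nxt U (prv U j)"
proof(cases rule: prv_cases[OF U ne, of j])
 case a: 1
 show ?thesis
 proof(cases rule: nxt_cases[OF U ne, of "prv U j"])
  case 1
  hence "j < nxt U (prv U j)" using a j by(metis leD linorder_neqE_nat)
  thus ?thesis using 1 a by(intro nxt_eqI) (auto simp: U)
 next
  case 2
  thus ?thesis using a by(intro nxt_eqI') (auto simp: U intro: less_imp_le le_less_trans order.trans)
 qed
next
 case a: 2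
 show ?thesis
 proof(cases rule: nxt_cases[OF U ne, of "prv U j"])
  case 1
  thus ?thesis using a(3)[OF 1(1)] by simp
 next
  case 2
  hence "j < nxt U (prv U j)" using a j by(metis le_less)
  thus ?thesis using 2 by(intro nxt_eqI) (auto simp: U)
 qed
qed

lemma nxt_insert_other: "c : U ==> c ~= prv U j ==> nxt (insert j U) c = nxt U c"
proof -
 assume c: "c : U" "c ~= prv U j"
 show ?thesis
 proof(cases rule: nxt_cases[OF U ne, of c])
  case 1
  have "nxt U c <= j" if "c < j"
  proof(rule ccontr)
  assume "~ nxt U c <= j"
  hence "i <= c" if "i : U" "i < j" for i using 1(3)[of i] that by linarith
  hence "prv U j = c" using `c < j` c(1) by(intro prv_eqI[OF U]) auto
  thus False using c by simp
  qed
  thus ?thesis using 1 by(intro nxt_eqI) (auto simp: U)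
 next
  case 2
  have "~ c < j" using prv_eqI[OF U c(1), of j] c(2) 2(2) by blast
  moreover have "nxt U c <= j"
  proof(rule ccontr)
  assume "~ nxt U c <= j"
  hence "j <= i" if "i : U" for i using 2(3)[OF that] by linarith
  hence "prv U j = c" using c(1) 2(2) by(intro prv_eqI'[OF U]) auto
  thus False using c by simp
  qed
  ultimately show ?thesis using 2 by(intro nxt_eqI') (auto simp: U)
 qed
qed

end

end

datatype circle_label = Nt nat | Tr nat

text \<open>
  In a slab from index \<open>x\<close> to index \<open>y\<close> the strands \<open>x - 1\<close>, \<open>x\<close> turn back at one end and \<open>y - 1\<close>, \<open>y\<close> at the
  other. They form the trivial circle \<open>Tr a\<close> if \<open>x = y\<close>; if \<open>x\<close> and \<open>y\<close> are adjacent, three strands make up one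
  piece of a nontrivial circle. The nontrivial circles are counted from strand 0.
\<close>

definition lab :: "nat => nat => nat => nat => circle_label" where
 "lab a x y s = (if Suc s < min x y then Nt s else if max x y < s then Nt (s - 2)
  else if x = y then Tr a else Nt (min x y - 1))"

definition near :: "nat => nat => bool" where
 "near x y <-> x <= Suc y & y <= Suc x"

lemma odd_card_pair:
 assumes "finite S" "a ~= b" "a : S <-> b : S"
 shows "odd (card (S - {a, b})) <-> odd (card S)"
proof(cases "a : S")
 case True
 hence "S = insert a (insert b (S - {a, b}))" using assms(3) by auto
 hence "card S = Suc (Suc (card (S - {a, b})))" using assms(1,2) by(metis (no_types, lifting) DiffE card_insert_disjoint finite_Diff finite_insert insertCI insertE)
 thus ?thesis by simp
next
 case False
 hence "S - {a, b} = S" using assms(3) by auto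
 thus ?thesis by simp
qed

lemma card_pairs:
 assumes "~ near p q" "1 <= p" "1 <= q"
 shows "card ({p - 1, p} Un {q - 1, q}) = 4"
proof -
 have "{p - 1, p} Int {q - 1, q} = {}" "p - 1 ~= p" "q - 1 ~= q" using assms by(auto simp: near_def)
 thus ?thesis by(subst card_Un_disjoint) simp_all
qed

lemma lab_right:
 assumes "near x y" "1 <= x" "1 <= y"
 shows "s ~= y - 1 ==> s ~= y ==> lab a x y s = (if s < y then Nt s else Nt (s - 2))"
  and "lab a x y (y - 1) = lab a x y y"
  and "s ~= x - 1 ==> s ~= x ==> lab a x y s = (if s < x then Nt s else Nt (s - 2))"
  and "lab a x y (x - 1) = lab a x y x" using assms by(auto simp: lab_def near_def min_def max_def)

lemma near_cases:
 assumes "near y z"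
 obtains "z = y" | "z = Suc y" | "y = Suc z" using assms by(fastforce simp: near_def le_Suc_eq)

lemma lab_simps [simp]:
 "lab a y y s = (if Suc s < y then Nt s else if y < s then Nt (s - 2) else Tr a)"
 "lab a y (Suc y) s = (if Suc s < y then Nt s else if Suc y < s then Nt (s - 2) else Nt (y - 1))"
 "lab a (Suc y) y s = (if Suc s < y then Nt s else if Suc y < s then Nt (s - 2) else Nt (y - 1))" by(simp_all add: lab_def)

lemma lab_Tr: "lab a y z s = Tr b ==> a = b & z = y & s : {y - 1, y}" by(auto simp: lab_def split: if_splits)

lemma lab_inject:
 assumes "near y z" "1 <= y" "1 <= z" "lab a y z s = lab a y z s'"
 shows "s = s' \<or> s : {y - 1, y, z - 1, z} & s' : {y - 1, y, z - 1, z}" using assms(1)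
proof(cases rule: near_cases)
 case 1
 thus ?thesis using assms(2-4) by(simp split: if_splits) linarith+
next
 case 2
 thus ?thesis using assms(2-4) by(simp split: if_splits) linarith+
next
 case 3
 thus ?thesis using assms(2-4) by(simp split: if_splits) linarith+
qed

lemma lab_onto:
 assumes "near y z" "1 <= y" "1 <= z" "y <= m" "z <= m" "Suc p < m"
 shows "EX s<=m. lab a y z s = Nt p"
proof -
 let ?s = "if Suc p < min y z then p else if max y z < p + 2 then p + 2 else p"
 have "?s <= m & lab a y z ?s = Nt p" using assms(1) by(cases rule: near_cases) (use assms in auto)
 thus ?thesis by blast
qed

lemma lab_range:
 assumes "near y z" "1 <= y" "1 <= z" "y <= m" "z <= m" "s <= m"
 shows "(EX p. lab a y z s = Nt p & Suc p < m) | lab a y z s = Tr a & y = z" using assms(1) by(cases rule: near_cases) (use assms in auto)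

lemma lab_odd:
 assumes "near y z" "1 <= y" "1 <= z" "y <= m" "z <= m" "Suc p < m"
 shows "odd (card {s. s <= m & lab a y z s = Nt p})"
proof -
 have "{s. s <= m & lab a y z s = Nt p} =
  (if Suc p < min y z then {p} else if max y z < p + 2 then {p + 2} else {p, Suc p, Suc (Suc p)})" using assms(1)
 proof(cases rule: near_cases)
  case 1
  thus ?thesis using assms(2-) by(auto split: if_splits)
 next
  case 2
  thus ?thesis using assms(2-) by(auto split: if_splits)
 next
  case 3
  thus ?thesis using assms(2-) by(auto split: if_splits)
 qed
 thus ?thesis by simp
qed

lemma lab_even:
 assumes "near y z" "1 <= y" "y <= m"
 shows "even (card {s. s <= m & lab a y z s = Tr b})"
proof(cases "y = z & a = b")
 case True
 hence "{s. s <= m & lab a y z s = Tr b} = {y - 1, y}" using assms(2,3) by(auto split: if_splits)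
 moreover have "card {y - 1, y} = 2" using assms(2) by(simp add: card_insert_if)
 ultimately show ?thesis by simp
next
 case False
 have "{s. s <= m & lab a y z s = Tr b} = {}" using assms(1) by(cases rule: near_cases) (use False in "auto split: if_splits")
 thus ?thesis by(simp only: card.empty even_zero)
qed

locale closure =
 fixes m k :: nat and x :: "nat => nat"
 assumes x: "j < k ==> 1 <= x j & x j <= m"
begin

definition arcs :: "nat set => ((nat \<times> nat) \<times> (nat \<times> nat)) set" where
 "arcs U = (UN j<k. if j : U then cup_cap_arcs m (x j) j else id_arcs m j) Un {((k, s), (0, s)) | s. s <= m}"

definition conn :: "nat set => ((nat \<times> nat) \<times> (nat \<times> nat)) set" where
 "conn U = (arcs U Un (arcs U)\<inverse>)\<^sup>*"

definition grid :: "(nat \<times> nat) set" where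
 "grid = {0..k} \<times> {0..m}"

definition circ :: "nat set => circle set" where
 "circ U = grid // conn U"

definition admissible :: "nat set => bool" where
 "admissible U <-> (ALL a:U. near (x a) (x (nxt U a)))"

definition clab :: "nat set => nat \<times> nat => circle_label" where
 "clab U = (%(l, s). if U = {} then Nt s else lab (prv U l) (x (prv U l)) (x (nxt U (prv U l))) s)"

definition fib :: "nat set => circle_label => circle" where
 "fib U c = {p : grid. clab U p = c}"

definition Nts :: "circle_label set" where
 "Nts = Nt ` {p. Suc p < m}"

definition labels :: "nat set => circle_label set" where
 "labels U = (if U = {} then Nt ` {..m} else Nts Un Tr ` {a : U. x a = x (nxt U a)})"

lemma conn_refl [simp]: "(p, p) : conn U" by(simp add: conn_def)

lemma conn_sym: "(p, q) : conn U ==> (q, p) : conn U"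
proof -
 have "sym (conn U)" unfolding conn_def by(rule sym_rtrancl) (auto simp: sym_def)
 thus "(p, q) : conn U ==> (q, p) : conn U" by(rule symD)
qed

lemma conn_trans: "(p, q) : conn U ==> (q, r) : conn U ==> (p, r) : conn U" by(simp add: conn_def)

lemma arcs_conn: "(p, q) : arcs U ==> (p, q) : conn U" by(auto simp: conn_def)

lemma conn_induct: "(p, q) : conn U ==> (!!p q. (p, q) : arcs U ==> F p = F q) ==> F p = F q"
 unfolding conn_def by(induction rule: rtrancl_induct) auto

lemma arcs_grid: "(p, q) : arcs U ==> p : grid & q : grid"
 using x by(fastforce simp: arcs_def grid_def cup_cap_arcs_def id_arcs_def split: if_splits)

lemma conn_grid: "(p, q) : conn U ==> p : grid <-> q : grid" by(rule conn_induct[where F = "%p. p : grid"]) (auto dest: arcs_grid)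

lemma conn_id: "j < k ==> j ~: U ==> s <= m ==> ((j, s), (Suc j, s)) : conn U" by(rule arcs_conn) (auto simp: arcs_def id_arcs_def)

lemma conn_side: "j < k ==> s <= m ==> s ~= x j - 1 ==> s ~= x j ==> ((j, s), (Suc j, s)) : conn U"
 by(rule arcs_conn) (auto simp: arcs_def id_arcs_def cup_cap_arcs_def)

lemma conn_cap: "j < k ==> j : U ==> ((j, x j - 1), (j, x j)) : conn U"
 and conn_cup: "j < k ==> j : U ==> ((Suc j, x j - 1), (Suc j, x j)) : conn U" by(rule arcs_conn; force simp: arcs_def cup_cap_arcs_def)+

lemma conn_close: "s <= m ==> ((k, s), (0, s)) : conn U" by(rule arcs_conn) (auto simp: arcs_def)

lemma conn_walk: "a <= b ==> (!!j. a <= j ==> j < b ==> j ~: U) ==> b <= k ==> s <= m ==> ((a, s), (b, s)) : conn U"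
proof(induction b rule: dec_induct)
 case (step b)
 hence "((a, s), (b, s)) : conn U" "((b, s), (Suc b, s)) : conn U" by(auto intro: conn_id)
 thus ?case by(rule conn_trans)
qed simp

context
 fixes U :: "nat set"
 assumes Uk: "U <= {..<k}"
begin

lemma finU: "finite U" using Uk finite_subset by blast

lemma conn_start:
 assumes "U ~= {}" "l <= k" "s <= m"
 shows "((l, s), (Suc (prv U l), s)) : conn U"
proof(cases rule: prv_cases[OF finU assms(1), of l])
 case 1
 have "j ~: U" if "Suc (prv U l) <= j" "j < l" for j using 1(3)[of j] that by auto
 hence "((Suc (prv U l), s), (l, s)) : conn U" using 1 assms by(intro conn_walk) auto
 thus ?thesis by(rule conn_sym)
next
 case 2
 have a: "((0, s), (l, s)) : conn U" using 2 assms by(intro conn_walk) (auto simp: not_less[symmetric])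
 have "j ~: U" if "Suc (prv U l) <= j" for j using 2(3)[of j] that by auto
 hence b: "((Suc (prv U l), s), (k, s)) : conn U" using 2 assms Uk by(intro conn_walk) auto
 show ?thesis using conn_trans[OF conn_sym[OF a] conn_trans[OF conn_sym[OF conn_close[OF assms(3)]] conn_sym[OF b]]] .
qed

lemma conn_stop:
 assumes "U ~= {}" "a : U" "s <= m"
 shows "((Suc a, s), (nxt U a, s)) : conn U"
proof(cases rule: nxt_cases[OF finU assms(1), of a])
 case 1
 thus ?thesis using assms Uk by(intro conn_walk) (auto simp: not_less[symmetric])
next
 case 2
 have a: "((0, s), (nxt U a, s)) : conn U" using 2 assms Uk by(intro conn_walk) (auto simp: not_less[symmetric])
 have "j ~: U" if "Suc a <= j" for j using 2(2)[of j] that by auto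
 hence b: "((Suc a, s), (k, s)) : conn U" using assms Uk by(intro conn_walk) auto
 show ?thesis using conn_trans[OF b conn_trans[OF conn_close[OF assms(3)] a]] .
qed

lemma xU: "a : U ==> 1 <= x a & x a <= m" using x Uk by auto

text \<open>Where a slab begins, or ends, its two strands there are joined; so they are joined all along the slab.\<close>

lemma conn_slab:
 assumes "l <= k" "U ~= {}"
 shows "((l, x (prv U l) - 1), (l, x (prv U l))) : conn U"
  and "((l, x (nxt U (prv U l)) - 1), (l, x (nxt U (prv U l)))) : conn U"
proof -
 let ?a = "prv U l" and ?z = "nxt U (prv U l)"
 have a: "?a : U" "?a < k" and z: "?z : U" "?z < k" using prv_in[OF finU assms(2)] nxt_in[OF finU assms(2)] Uk by auto
 have s: "x ?a <= m" "x ?a - 1 <= m" "x ?z <= m" "x ?z - 1 <= m" using xU[OF a(1)] xU[OF z(1)] by auto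
 note A = conn_start[OF assms(2,1)]
 show "((l, x ?a - 1), (l, x ?a)) : conn U" by(rule conn_trans[OF A[OF s(2)] conn_trans[OF conn_cup[OF a(2,1)] conn_sym[OF A[OF s(1)]]]])
 have B: "((l, s), (?z, s)) : conn U" if "s <= m" for s by(rule conn_trans[OF A[OF that] conn_stop[OF assms(2) a(1) that]])
 show "((l, x ?z - 1), (l, x ?z)) : conn U" by(rule conn_trans[OF B[OF s(4)] conn_trans[OF conn_cap[OF z(2,1)] conn_sym[OF B[OF s(3)]]]])
qed

lemma class_eq: "(p, q) : conn U ==> conn U `` {p} = conn U `` {q}" by(auto intro: conn_trans conn_sym)

lemma circ_iff: "C : circ U <-> (EX p:grid. C = conn U `` {p})" by(auto simp: circ_def quotient_def)

lemma circ_disjoint: "C : circ U ==> C' : circ U ==> q : C ==> q : C' ==> C = C'"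
 proof -
 assume "C : circ U" "C' : circ U" "q : C" "q : C'"
 then obtain p p' where "C = conn U `` {p}" "C' = conn U `` {p'}" "(p, q) : conn U" "(p', q) : conn U" unfolding circ_iff by blast
 thus "C = C'" using class_eq by metis
qed

lemma circ_closed: "C : circ U ==> (p, q) : conn U ==> p : C <-> q : C" by(auto simp: circ_iff intro: conn_trans conn_sym)

lemma circ_grid: "C : circ U ==> C <= grid" using conn_grid by(auto simp: circ_iff)

subsection \<open>Admissible resolutions\<close>

context
 assumes adm: "admissible U"
begin

lemma clab_arcs: "(p, q) : arcs U ==> clab U p = clab U q"
proof(cases "U = {}")
 case True
 thus "(p, q) : arcs U ==> clab U p = clab U q" by(auto simp: arcs_def id_arcs_def clab_def)
next
 case ne: False
 assume "(p, q) : arcs U"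
 then consider (close) s where "p = (k, s)" "q = (0, s)"
  | (id) j s where "j ~: U" "p = (j, s)" "q = (Suc j, s)"
  | (side) j s where "j : U" "p = (j, s)" "q = (Suc j, s)" "s ~= x j - 1" "s ~= x j"
  | (cap) j where "j : U" "p = (j, x j - 1)" "q = (j, x j)"
  | (cup) j where "j : U" "p = (Suc j, x j - 1)" "q = (Suc j, x j)" by(auto simp: arcs_def id_arcs_def cup_cap_arcs_def split: if_splits)
 thus "clab U p = clab U q"
 proof cases
  case close
  thus ?thesis using prv_wrap[OF finU Uk ne] by(simp add: clab_def)
 next
  case id
  thus ?thesis using prv_Suc_notin[OF finU] by(simp add: clab_def)
 next
  case (side j s)
  let ?a = "prv U j"
  have n: "near (x ?a) (x j)" "near (x j) (x (nxt U j))"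
  using adm prv_in[OF finU ne, of j] nxt_prv[OF finU side(1)] side(1) unfolding admissible_def by force+
  have o: "1 <= x ?a" "1 <= x j" "1 <= x (nxt U j)" using xU prv_in[OF finU ne, of j] nxt_in[OF finU ne, of j] side(1) by auto
  show ?thesis unfolding side(2,3) clab_def prod.case using ne nxt_prv[OF finU side(1)] prv_Suc[OF finU side(1)]
  lab_right(1)[OF n(1) o(1,2) side(4,5)] lab_right(3)[OF n(2) o(2,3) side(4,5)] by simp
 next
  case (cap j)
  let ?a = "prv U j"
  have n: "near (x ?a) (x j)" using adm prv_in[OF finU ne, of j] nxt_prv[OF finU cap(1)] unfolding admissible_def by force
  have o: "1 <= x ?a" "1 <= x j" using xU prv_in[OF finU ne, of j] cap(1) by auto
  show ?thesis unfolding cap(2,3) clab_def prod.case using ne nxt_prv[OF finU cap(1)] lab_right(2)[OF n o] by simp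
 next
  case (cup j)
  have n: "near (x j) (x (nxt U j))" using adm cup(1) unfolding admissible_def by force
  have o: "1 <= x j" "1 <= x (nxt U j)" using xU nxt_in[OF finU ne, of j] cup(1) by auto
  show ?thesis unfolding cup(2,3) clab_def prod.case using ne prv_Suc[OF finU cup(1)] lab_right(4)[OF n o] by simp
 qed
qed

lemma near_slab: "U ~= {} ==> near (x (prv U l)) (x (nxt U (prv U l)))" using adm prv_in[OF finU] by(auto simp: admissible_def)

lemma slab_bounds: "U ~= {} ==> 1 <= x (prv U l) & x (prv U l) <= m & 1 <= x (nxt U (prv U l)) & x (nxt U (prv U l)) <= m"
 using xU prv_in[OF finU] nxt_in[OF finU] by auto

lemma conn_level:
 assumes ne: "U ~= {}" and l: "l <= k" and eq: "clab U (l, s) = clab U (l, s')"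
 shows "((l, s), (l, s')) : conn U"
proof -
 let ?y = "x (prv U l)" and ?z = "x (nxt U (prv U l))"
 note c = conn_slab[OF l ne]
 have "s = s' \<or> (s : {?y - 1, ?y, ?z - 1, ?z} & s' : {?y - 1, ?y, ?z - 1, ?z} & (?y = ?z \<or> ?y = Suc ?z \<or> ?z = Suc ?y))"
 proof -
  note n = near_slab[OF ne, of l] and b = slab_bounds[OF ne, of l]
  have "?y = ?z | ?y = Suc ?z | ?z = Suc ?y" using n by(cases rule: near_cases) simp_all
  moreover have "s = s' \<or> s : {?y - 1, ?y, ?z - 1, ?z} & s' : {?y - 1, ?y, ?z - 1, ?z}"
  using eq ne b by(intro lab_inject[OF n]) (simp_all add: clab_def)
  ultimately show ?thesis by blast
 qed
 moreover have A: "((l, t), (l, ?y)) : conn U"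
  if t: "t : {?y - 1, ?y, ?z - 1, ?z}" "?y = ?z | ?y = Suc ?z | ?z = Suc ?y" for t
 proof -
  have z: "((l, ?z), (l, ?y)) : conn U" using t(2) c conn_sym[OF c(2)] by auto
  have "((l, ?z - 1), (l, ?y)) : conn U" by(rule conn_trans[OF c(2) z])
  thus ?thesis using t(1) z c(1) by auto
 qed
 ultimately consider "s = s'" | "((l, s), (l, ?y)) : conn U" "((l, s'), (l, ?y)) : conn U" by metis
 thus ?thesis
 proof cases
  case 2
  show ?thesis by(rule conn_trans[OF 2(1) conn_sym[OF 2(2)]])
 qed simp
qed

lemma conn_up:
 assumes ne: "U ~= {}" and p: "Suc p < m" and l: "l < k"
 shows "EX s<=m. clab U (l, s) = Nt p & ((l, s), (Suc l, s)) : conn U"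
proof(cases "l : U")
 case False
 let ?y = "x (prv U l)" and ?z = "x (nxt U (prv U l))"
 have "EX s<=m. clab U (l, s) = Nt p" using near_slab[OF ne, of l] slab_bounds[OF ne, of l] ne p lab_onto[of ?y ?z m p] by(simp add: clab_def)
 thus ?thesis using conn_id[OF l False] by blast
next
 case True
 let ?s = "if Suc p < x l then p else p + 2"
 have n: "near (x (prv U l)) (x l)" using near_slab[OF ne, of l] nxt_prv[OF finU True] by simp
 have o: "1 <= x (prv U l)" "1 <= x l" using slab_bounds[OF ne, of l] xU[OF True] by auto
 have s: "?s ~= x l - 1" "?s ~= x l" "?s <= m" using p o by auto
 have "clab U (l, ?s) = Nt p" using ne lab_right(1)[OF n o s(1,2)] nxt_prv[OF finU True] by(auto simp: clab_def)
 thus ?thesis using s conn_side[OF l s(3,1,2)] by blast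
qed

lemma clab_labels: "p : grid ==> clab U p : labels U"
proof -
 assume p: "p : grid"
 obtain l s where ls: "p = (l, s)" "s <= m" using p by(cases p) (auto simp: grid_def)
 show ?thesis
 proof(cases "U = {}")
  case ne: False
  show ?thesis using ne slab_bounds[OF ne, of l] prv_in[OF finU ne, of l] ls lab_range[OF near_slab[OF ne, of l], of m s "prv U l"]
  by(auto simp: clab_def labels_def Nts_def)
 qed(use ls in "auto simp: clab_def labels_def")
qed

lemma conn_Nt:
 assumes ne: "U ~= {}" and p: "Suc p < m"
 shows "l <= k ==> clab U (l, s) = Nt p ==> clab U (0, s') = Nt p ==> ((l, s), (0, s')) : conn U"
proof(induction l arbitrary: s)
 case 0
 thus ?case using conn_level[OF ne, of 0] by simp
next
 case (Suc l)
 hence l: "l < k" by simp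
 obtain t where t: "clab U (l, t) = Nt p" "((l, t), (Suc l, t)) : conn U" using conn_up[OF ne p l] by blast
 have "clab U (Suc l, t) = Nt p" using conn_induct[OF t(2), of "clab U"] clab_arcs t(1) by metis
 hence "((Suc l, s), (Suc l, t)) : conn U" using conn_level[OF ne Suc.prems(1)] Suc.prems(2) by simp
 thus ?case using conn_sym[OF t(2)] Suc.IH[OF _ t(1) Suc.prems(3)] l by(meson conn_trans less_imp_le)
qed

text \<open>
  A trivial circle stays in its slab. Every nontrivial one has on each level a strand that passes on to
  the next level (\<open>conn_up\<close>), so its parts on all levels are connected.
\<close>

lemma conn_iff:
 assumes p: "p : grid" and q: "q : grid"
 shows "(p, q) : conn U <-> clab U p = clab U q"
proof
 show "(p, q) : conn U ==> clab U p = clab U q" using conn_induct[of p q U "clab U"] clab_arcs by metis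
next
 assume eq: "clab U p = clab U q"
 obtain l s l' s' where ls: "p = (l, s)" "l <= k" "s <= m" "q = (l', s')" "l' <= k" "s' <= m" using p q by(cases p; cases q) (auto simp: grid_def)
 show "(p, q) : conn U"
 proof(cases "U = {}")
  case True
  hence "s' = s" using eq ls by(simp add: clab_def)
  moreover have A: "((0, s), (l, s)) : conn U" "((0, s), (l', s)) : conn U" using True ls by(auto intro!: conn_walk)
  ultimately show ?thesis unfolding ls(1,4) using conn_trans[OF conn_sym[OF A(1)] A(2)] by simp
 next
  case ne: False
  show ?thesis
  proof(cases "clab U p")
  case (Nt i)
  hence i: "Suc i < m" using clab_labels[OF p] ne by(auto simp: labels_def Nts_def)
  obtain t where t: "clab U (0, t) = Nt i" using near_slab[OF ne, of 0] slab_bounds[OF ne, of 0] ne i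
  lab_onto[of "x (prv U 0)" "x (nxt U (prv U 0))" m i] by(auto simp: clab_def)
  have "clab U (l, s) = Nt i" "clab U (l', s') = Nt i" using Nt eq ls(1,4) by simp_all
  from conn_trans[OF conn_Nt[OF ne i ls(2) this(1) t] conn_sym[OF conn_Nt[OF ne i ls(5) this(2) t]]]
  show ?thesis unfolding ls(1,4) .
  next
  case (Tr a)
  have "lab (prv U l) (x (prv U l)) (x (nxt U (prv U l))) s = Tr a"
  "lab (prv U l') (x (prv U l')) (x (nxt U (prv U l'))) s' = Tr a" using Tr eq ne ls by(simp_all add: clab_def)
  from lab_Tr[OF this(1)] lab_Tr[OF this(2)]
  have s: "prv U l = a" "prv U l' = a" "s : {x a - 1, x a}" "s' : {x a - 1, x a}" by auto
  have a: "a : U" "a < k" using prv_in[OF finU ne, of l] s Uk by auto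
  have "((Suc a, s), (Suc a, s')) : conn U" using s(3,4) conn_cup[OF a(2,1)] conn_sym by auto
  moreover note A = conn_start[OF ne ls(2,3), unfolded s(1)] conn_start[OF ne ls(5,6), unfolded s(2)]
  ultimately show ?thesis unfolding ls(1,4) using conn_trans[OF A(1) conn_trans[OF _ conn_sym[OF A(2)]]] by simp
  qed
 qed
qed

lemma labels_clab: "c : labels U ==> EX p:grid. clab U p = c"
proof(cases "U = {}")
 case True
 thus "c : labels U ==> EX p:grid. clab U p = c" by(auto simp: labels_def clab_def grid_def)
next
 case ne: False
 assume "c : labels U"
 then consider (Nt) p where "c = Nt p" "Suc p < m" | (Tr) a where "c = Tr a" "a : U" "x a = x (nxt U a)" using ne by(auto simp: labels_def Nts_def)
 thus "EX p:grid. clab U p = c"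
 proof cases
  case Nt
  have k: "0 < k" using Uk ne by auto
  obtain s where "s <= m" "clab U (0, s) = Nt p" using conn_up[OF ne Nt(2) k] by blast
  thus ?thesis using Nt by(intro bexI[of _ "(0, s)"]) (auto simp: grid_def)
 next
  case Tr
  hence "(Suc a, x a) : grid" using Uk xU[of a] by(auto simp: grid_def simp del: Tr(3))
  moreover have "clab U (Suc a, x a) = Tr a" using Tr ne xU[of a] prv_Suc[OF finU Tr(2)] by(auto simp: clab_def lab_def)
  ultimately show ?thesis using Tr by blast
 qed
qed

lemma fib_class: "p : grid ==> conn U `` {p} = fib U (clab U p)" unfolding fib_def by(auto simp: conn_iff dest: conn_grid) (metis conn_iff conn_grid)

lemma circ_fib: "circ U = fib U ` labels U"
proof -
 have "labels U = clab U ` grid" using clab_labels labels_clab by blast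
 thus ?thesis unfolding circ_def quotient_def using fib_class by auto
qed

lemma inj_fib: "inj_on (fib U) (labels U)"
proof(rule inj_onI)
 fix c d assume c: "c : labels U" "fib U c = fib U d"
 obtain p where "p : grid" "clab U p = c" using labels_clab c by blast
 thus "c = d" using c(2) unfolding fib_def by blast
qed

lemma nontrivial_fib: "c : labels U ==> nontrivial (fib U c) <-> (EX p. c = Nt p)"
proof -
 assume c: "c : labels U"
 have *: "{s. (0, s) : fib U c} = {s. s <= m & clab U (0, s) = c}" by(auto simp: fib_def grid_def)
 show ?thesis
 proof(cases "U = {}")
  case True
  then obtain p where "c = Nt p" "p <= m" using c by(auto simp: labels_def)
  hence "{s. (0, s) : fib U c} = {p}" unfolding * using True by(auto simp: clab_def)
  thus ?thesis using `c = Nt p` by(simp add: nontrivial_def)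
 next
  case ne: False
  let ?y = "x (prv U 0)" and ?z = "x (nxt U (prv U 0))"
  note b = near_slab[OF ne, of 0] slab_bounds[OF ne, of 0]
  show ?thesis
  proof(cases c)
  case (Nt p)
  hence p: "Suc p < m" using c ne by(auto simp: labels_def Nts_def)
  thus ?thesis using b ne Nt lab_odd[of ?y ?z m p] unfolding nontrivial_def * by(simp add: clab_def)
  next
  case (Tr a)
  thus ?thesis using b ne lab_even[of ?y ?z m] unfolding nontrivial_def * by(simp add: clab_def)
  qed
 qed
qed

end

text \<open>A cup or cap meets its level in two points of the same circle.\<close>

lemma circ_parity: "C : circ U ==> l <= k ==> odd (card {s. (l, s) : C}) <-> nontrivial C"
proof(induction l)
 case 0
 thus ?case by(simp add: nontrivial_def)
next
 case (Suc l)
 let ?L = "%l. {s. (l, s) : C}"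
 note cl = circ_closed[OF Suc.prems(1)]
 have m: "s <= m" if "(l, s) : C" for l s using circ_grid[OF Suc.prems(1)] that by(auto simp: grid_def)
 have "odd (card (?L (Suc l))) <-> odd (card (?L l))"
 proof(cases "l : U")
  case False
  have "?L (Suc l) = ?L l" using cl[OF conn_id[of l U]] Suc.prems(2) False m by(metis Suc_le_lessD)
  thus ?thesis by simp
 next
  case True
  have l: "l < k" using Suc.prems by simp
  have ne: "x l - 1 ~= x l" using xU[OF True] by linarith
  have "?L (Suc l) - {x l - 1, x l} = ?L l - {x l - 1, x l}" using cl[OF conn_side[OF l]] m by blast
  moreover have "finite (?L l)" for l using m by(intro finite_subset[of "?L l" "{..m}"]) auto
  ultimately show ?thesis using odd_card_pair[OF _ ne, of "?L l"] odd_card_pair[OF _ ne, of "?L (Suc l)"]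
  cl[OF conn_cap[OF l True]] cl[OF conn_cup[OF l True]] by simp
 qed
 thus ?case using Suc by simp
qed

text \<open>
  In a slab whose ends are at distance two or more, two disjoint pairs of strands are joined. A
  nontrivial circle has further strands, so there are too few of them.
\<close>

lemma few_nontrivial:
 assumes "~ admissible U"
 shows "card {C : circ U. nontrivial C} + 3 <= m"
proof -
 obtain a where a: "a : U" "~ near (x a) (x (nxt U a))" using assms by(auto simp: admissible_def)
 hence ne: "U ~= {}" and ak: "Suc a <= k" using Uk by auto
 let ?z = "nxt U a" and ?l = "Suc a"
 let ?K = "{x a - 1, x a} Un {x ?z - 1, x ?z}"
 have b: "1 <= x a" "x a <= m" "1 <= x ?z" "x ?z <= m" using xU a(1) nxt_in[OF finU ne] by auto
 hence nes: "x a - 1 ~= x a" "x ?z - 1 ~= x ?z" by linarith+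
 note c = conn_slab[OF ak ne, unfolded prv_Suc[OF finU a(1)]]
 have K: "?K <= {..m}" "card ?K = 4" using b card_pairs[OF a(2) b(1,3)] by auto
 have "EX s. (?l, s) : C & s ~: ?K" if C: "C : circ U" "nontrivial C" for C
 proof -
  let ?L = "{s. (?l, s) : C}"
  have f: "finite ?L" using circ_grid[OF C(1)] by(intro finite_subset[of ?L "{..m}"]) (auto simp: grid_def)
  have "x ?z - 1 ~: {x a - 1, x a}" "x ?z ~: {x a - 1, x a}" using a(2) b by(auto simp: near_def)
  hence "x a - 1 : ?L <-> x a : ?L" "x ?z - 1 : ?L - {x a - 1, x a} <-> x ?z : ?L - {x a - 1, x a}"
  using circ_closed[OF C(1) c(1)] circ_closed[OF C(1) c(2)] by simp_all
  (* On each level a nontrivial circle has an odd number of strands, and each pair lies in one circle. *)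
  hence "odd (card (?L - {x a - 1, x a} - {x ?z - 1, x ?z}))"
  using circ_parity[OF C(1) ak] C(2) f odd_card_pair[OF _ nes(1), of ?L] odd_card_pair[OF _ nes(2), of "?L - {x a - 1, x a}"] by simp
  hence "?L - {x a - 1, x a} - {x ?z - 1, x ?z} ~= {}" by(metis card.empty even_zero)
  thus ?thesis by blast
 qed
 then obtain f where f: "(?l, f C) : C & f C ~: ?K" if "C : circ U" "nontrivial C" for C by metis
 have "inj_on f {C : circ U. nontrivial C}" using f circ_disjoint by(intro inj_onI) (metis (mono_tags, lifting) mem_Collect_eq)
 moreover have "f ` {C : circ U. nontrivial C} <= {..m} - ?K" using f circ_grid by(fastforce simp: grid_def)
 ultimately have "card {C : circ U. nontrivial C} <= card ({..m} - ?K)" by(intro card_inj_on_le) auto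
 also have "... = Suc m - 4" using K by(subst card_Diff_subset) (auto intro: finite_subset)
 finally show ?thesis using card_mono[OF _ K(1)] K(2) by simp
qed

end

definition plus_sets :: "nat set => circle set set" where
 "plus_sets U = {P. P <= circ U &
  int (card {C : P. nontrivial C}) - int (card {C : circ U - P. nontrivial C}) = int m - 1}"

lemma finite_circ: "finite (circ U)" by(simp add: circ_def quotient_def grid_def)

lemma finite_plus_sets: "finite (plus_sets U)" by(rule finite_subset[of _ "Pow (circ U)"]) (auto simp: plus_sets_def finite_circ)

lemma plus_sets_inadmissible: "U <= {..<k} ==> ~ admissible U ==> plus_sets U = {}"
proof -
 assume U: "U <= {..<k}" "~ admissible U"
 have False if "P : plus_sets U" for P
 proof -
  have P: "P <= circ U" "int m - 1 <= int (card {C : P. nontrivial C})" using that by(auto simp: plus_sets_def)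
  have "card {C : P. nontrivial C} <= card {C : circ U. nontrivial C}" using P(1) finite_circ by(intro card_mono) auto
  thus False using few_nontrivial[OF U] P(2) by linarith
 qed
 thus ?thesis by blast
qed

lemma degree_fib:
 assumes U: "U <= {..<k}" "admissible U" and Q: "Q <= labels U"
 shows "int (card {C : fib U ` Q. nontrivial C}) - int (card {C : circ U - fib U ` Q. nontrivial C}) =
  int (card (labels U Int range Nt)) - 2 * int (card ((labels U - Q) Int range Nt))"
proof -
 note inj = inj_fib[OF U]
 have f: "finite (labels U)" using finite_circ[of U] circ_fib[OF U] inj finite_imageD by metis
 have nt: "{C : fib U ` R. nontrivial C} = fib U ` (R Int range Nt)" if "R <= labels U" for R
 proof -
  have "{C : fib U ` R. nontrivial C} = fib U ` {c : R. nontrivial (fib U c)}" by blast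
  also have "{c : R. nontrivial (fib U c)} = R Int range Nt" using nontrivial_fib[OF U] that by blast
  finally show ?thesis .
 qed
 have "{C : fib U ` Q. nontrivial C} = fib U ` (Q Int range Nt)" using Q by(rule nt)
 moreover have "{C : circ U - fib U ` Q. nontrivial C} = fib U ` ((labels U - Q) Int range Nt)"
  unfolding circ_fib[OF U] inj_on_image_set_diff[OF inj Diff_subset Q, symmetric] by(rule nt) blast
 moreover have "card (fib U ` (Q Int range Nt)) = card (Q Int range Nt)"
  "card (fib U ` ((labels U - Q) Int range Nt)) = card ((labels U - Q) Int range Nt)" using Q by(auto intro!: card_image inj_on_subset[OF inj])
 moreover have "card (labels U Int range Nt) = card (Q Int range Nt) + card ((labels U - Q) Int range Nt)"
  using f Q by(subst card_Un_disjoint[symmetric]) (auto intro: finite_subset intro!: arg_cong[of _ _ card])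
 ultimately show ?thesis by simp
qed

lemma plus_sets_image:
 assumes U: "U <= {..<k}" "admissible U"
 shows "plus_sets U = (%Q. fib U ` Q) ` {Q. Q <= labels U &
  int (card (labels U Int range Nt)) - 2 * int (card ((labels U - Q) Int range Nt)) = int m - 1}"
 unfolding plus_sets_def using degree_fib[OF U] by(auto simp: circ_fib[OF U] subset_image_iff)

lemma card_Nts: "finite Nts" "card Nts = m - 1"
proof -
 have e: "{p. Suc p < m} = {..<m - 1}" by auto
 show "finite Nts" "card Nts = m - 1" unfolding Nts_def e by(simp_all add: card_image inj_on_def)
qed

text \<open>With only \<open>m - 1\<close> nontrivial circles, all of them must be labelled \<open>v\<^sub>+\<close>.\<close>

lemma plus_sets_cup:
 assumes U: "U <= {..<k}" "admissible U" "U ~= {}"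
 shows "plus_sets U = (%Q. fib U ` Q) ` {Q. Nts <= Q & Q <= labels U}"
proof -
 obtain a where "a : U" using U(3) by blast
 hence m: "1 <= m" using xU[OF U(1)] by fastforce
 have N: "labels U Int range Nt = Nts" using U(3) by(auto simp: labels_def Nts_def)
 have "int (card Nts) - 2 * int (card ((labels U - Q) Int range Nt)) = int m - 1 <-> Nts <= Q" if "Q <= labels U" for Q
 proof -
  have "(labels U - Q) Int range Nt = Nts - Q" using N by auto
  moreover have "card (Nts - Q) = 0 <-> Nts <= Q" using card_Nts(1) by auto
  ultimately show ?thesis using m by(simp only: card_Nts) linarith
 qed
 hence "{Q. Q <= labels U & int (card Nts) - 2 * int (card ((labels U - Q) Int range Nt)) = int m - 1} =
  {Q. Nts <= Q & Q <= labels U}" by blast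
 thus ?thesis unfolding plus_sets_image[OF U(1,2)] N by(simp only:)
qed

definition strands :: "nat => circle_label set" where
 "strands t = Nt ` ({..m} - {t})"

lemma admissible_empty: "admissible {}" by(simp add: admissible_def)

text \<open>Here the \<open>m + 1\<close> strands are the circles, and just one is labelled \<open>v\<^sub>-\<close>.\<close>

lemma plus_sets_empty: "plus_sets {} = (%t. fib {} ` strands t) ` {..m}"
proof -
 have N: "labels {} = Nt ` {..m}" by(simp add: labels_def)
 have "Q <= Nt ` {..m} & int (card (Nt ` {..m} Int range Nt)) - 2 * int (card ((Nt ` {..m} - Q) Int range Nt)) = int m - 1
  <-> (EX t<=m. Q = strands t)" for Q
 proof -
  have "Nt ` {..m} Int range Nt = Nt ` {..m}" "(Nt ` {..m} - Q) Int range Nt = Nt ` {..m} - Q" by auto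
  moreover have "card (Nt ` {..m}) = Suc m" by(simp add: card_image inj_on_def)
  moreover have "card (Nt ` {..m} - Q) = 1 <-> (EX t<=m. Q = strands t)" if Q: "Q <= Nt ` {..m}"
  proof
  assume "card (Nt ` {..m} - Q) = 1"
  then obtain c where c: "Nt ` {..m} - Q = {c}" by(auto simp: card_1_singleton_iff)
  then obtain t where t: "c = Nt t" "t <= m" by auto
  have "Q = Nt ` {..m} - (Nt ` {..m} - Q)" using Q by auto
  hence "Q = strands t" unfolding c t by(auto simp: strands_def)
  thus "EX t<=m. Q = strands t" using t by blast
  next
  assume "EX t<=m. Q = strands t"
  then obtain t where t: "t <= m" "Q = strands t" by blast
  hence "Nt ` {..m} - Q = {Nt t}" by(auto simp: strands_def)
  thus "card (Nt ` {..m} - Q) = 1" by simp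
  qed
  moreover have "Q <= Nt ` {..m}" if "EX t<=m. Q = strands t" using that by(auto simp: strands_def)
  ultimately show ?thesis by(cases "Q <= Nt ` {..m}") auto
 qed
 hence "{Q. Q <= labels {} & int (card (labels {} Int range Nt)) - 2 * int (card ((labels {} - Q) Int range Nt)) = int m - 1}
  = strands ` {..m}" unfolding N by auto
 thus ?thesis unfolding plus_sets_image[OF empty_subsetI admissible_empty] by(simp add: image_image)
qed

end

section \<open>Merges and splits\<close>

definition label_in :: "circle_label set => circle_label => label" where
 "label_in Q c = (case c of Nt _ => if c : Q then V_plus else V_minus | Tr _ => if c : Q then W_plus else W_minus)"

lemma merge_terms_sym: "(a, b, c) : merge_terms <-> (b, a, c) : merge_terms"
 and split_terms_sym: "(a, b, c) : split_terms <-> (a, c, b) : split_terms" by(auto simp: merge_terms_def split_terms_def)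

lemma filter_image: "{P : f ` {Q. A Q & B Q}. R P} = f ` {Q. A Q & B Q & R (f Q)}" by blast

context closure
begin

definition step :: "nat set => circle set => nat set => circle set => bool" where
 "step U P U' P' <-> (let S = circ U; S' = circ U' in
  P Int (S Int S') = P' Int (S Int S') &
  ((EX C1 C2 C. C1 ~= C2 & S - S' = {C1, C2} & S' - S = {C} &
  (label_of P C1, label_of P C2, label_of P' C) : merge_terms) \<or>
  (EX C C1 C2. C1 ~= C2 & S - S' = {C} & S' - S = {C1, C2} &
  (label_of P C, label_of P' C1, label_of P' C2) : split_terms)))"

lemma step_mergeI:
 assumes S: "circ U - circ U' = {D1, D2}" "D1 ~= D2" "circ U' - circ U = {D}"
 shows "step U P U' P' <-> P Int (circ U Int circ U') = P' Int (circ U Int circ U') &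
  (label_of P D1, label_of P D2, label_of P' D) : merge_terms" (is ?g1)
  and "step U' P' U P <-> P Int (circ U Int circ U') = P' Int (circ U Int circ U') &
  (label_of P' D, label_of P D1, label_of P D2) : split_terms" (is ?g2)
proof -
 have no: "{C1, C2} ~= {C}" if "C1 ~= C2" for C1 C2 C :: circle using that by auto
 have d: "{D1, D2} = {C1, C2} <-> D1 = C1 & D2 = C2 \<or> D1 = C2 & D2 = C1" for C1 C2 by(rule doubleton_eq_iff)
 show ?g1 unfolding step_def Let_def S(1,3) using S(2) no[OF S(2)]
  merge_terms_sym[of "label_of P D1" "label_of P D2" "label_of P' D"] by(auto simp: d)
 have c: "P' Int (circ U' Int circ U) = P Int (circ U' Int circ U) <-> P Int (circ U Int circ U') = P' Int (circ U Int circ U')" by blast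
 show ?g2 unfolding step_def Let_def S(1,3) c using S(2) no[OF S(2)]
  split_terms_sym[of "label_of P' D" "label_of P D1" "label_of P D2"] by(auto simp: d)
qed

lemma label_of_fib:
 assumes "U <= {..<k}" "admissible U" "Q <= labels U" "c : labels U"
 shows "label_of (fib U ` Q) (fib U c) = label_in Q c"
proof -
 have "fib U c : fib U ` Q <-> c : Q" using inj_fib[OF assms(1,2)] assms(3,4) by(auto dest: inj_onD)
 thus ?thesis using nontrivial_fib[OF assms(1,2,4)] by(cases c) (auto simp: label_of_def label_in_def)
qed

text \<open>
  Two resolutions whose labellings differ by a map that identifies exactly two labels: their circles
  differ by the merging of two circles into one.
\<close>

lemma merge_circles:
 assumes U: "U <= {..<k}" "admissible U" "U' <= {..<k}" "admissible U'"
  and rho: "!!p. clab U' p = rho (clab U p)"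
  and c: "c1 : labels U" "c2 : labels U" "c1 ~= c2" "rho c1 = rho c2"
  and inj: "ALL c:labels U. ALL c':labels U. rho c = rho c' --> c = c' \<or> {c, c'} = {c1, c2}"
 shows "circ U - circ U' = {fib U c1, fib U c2}" "fib U c1 ~= fib U c2" "circ U' - circ U = {fib U' (rho c1)}"
  "labels U' = rho ` labels U"
  "!!Q Q'. Q <= labels U ==> Q' <= labels U' ==>
  (fib U ` Q) Int (circ U Int circ U') = (fib U' ` Q') Int (circ U Int circ U') <->
  (ALL c:labels U - {c1, c2}. c : Q <-> rho c : Q')"
proof -
 have lab_im: "labels V = clab V ` grid" if "V <= {..<k}" "admissible V" for V using clab_labels[OF that] labels_clab[OF that] by blast
 show L: "labels U' = rho ` labels U" unfolding lab_im[OF U(1,2)] lab_im[OF U(3,4)] image_image using rho by(intro image_cong) auto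
 have other: "fib U' (rho c) = fib U c" if "c : labels U" "c ~: {c1, c2}" for c
 proof -
  have "rho (clab U p) = rho c <-> clab U p = c" if "p : grid" for p using inj clab_labels[OF U(1,2) that] `c : labels U` `c ~: {c1, c2}` by blast
  thus ?thesis unfolding fib_def using rho by auto
 qed
 have both: "fib U' (rho c1) = fib U c1 Un fib U c2"
 proof -
  have "rho (clab U p) = rho c1 <-> clab U p = c1 | clab U p = c2" if "p : grid" for p
  proof
  assume "rho (clab U p) = rho c1"
  hence "clab U p = c1 \<or> {clab U p, c1} = {c1, c2}" using inj clab_labels[OF U(1,2) that] c(1) by blast
  thus "clab U p = c1 | clab U p = c2" by blast
  qed(use c(4) in auto)
  thus ?thesis unfolding fib_def using rho by auto
 qed
 have ne: "fib V c ~= {}" if "V <= {..<k}" "admissible V" "c : labels V" for V c using labels_clab[OF that] by(auto simp: fib_def)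
 have dj: "fib U c Int fib U c' = {}" if "c ~= c'" for c c' using that by(auto simp: fib_def)
 show n: "fib U c1 ~= fib U c2" using dj[OF c(3)] ne[OF U(1,2) c(1)] by blast
 have circ': "circ U' = insert (fib U c1 Un fib U c2) (fib U ` (labels U - {c1, c2}))"
 proof -
  have "labels U = insert c1 (insert c2 (labels U - {c1, c2}))" using c by auto
  hence "circ U' = (%c. fib U' (rho c)) ` insert c1 (insert c2 (labels U - {c1, c2}))" unfolding circ_fib[OF U(3,4)] L image_image by simp
  also have "... = insert (fib U c1 Un fib U c2) ((%c. fib U' (rho c)) ` (labels U - {c1, c2}))" using both c(4) by simp
  also have "(%c. fib U' (rho c)) ` (labels U - {c1, c2}) = fib U ` (labels U - {c1, c2})" using other by(intro image_cong) auto
  finally show ?thesis .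
 qed
 have big: "fib U c1 Un fib U c2 ~= fib U c" if "c : labels U" for c using dj[of c c1] dj[of c c2] ne[OF U(1,2) c(1)] ne[OF U(1,2) c(2)] c(3) by blast
 have fib_eq: "fib U c = fib U c' <-> c = c'" if "c : labels U" "c' : labels U" for c c' using inj_fib[OF U(1,2)] that by(auto dest: inj_onD)
 show "circ U - circ U' = {fib U c1, fib U c2}" unfolding circ' circ_fib[OF U(1,2)] using c(1,2) big fib_eq by auto
 show "circ U' - circ U = {fib U' (rho c1)}" unfolding circ' circ_fib[OF U(1,2)] both using big by auto
 have common: "circ U Int circ U' = fib U ` (labels U - {c1, c2})" unfolding circ' circ_fib[OF U(1,2)] using big by auto
 fix Q Q' assume Q: "Q <= labels U" "Q' <= labels U'"
 have 1: "fib U c : fib U ` Q <-> c : Q" if "c : labels U" for c using fib_eq[OF that] Q(1) by blast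
 have 2: "fib U c : fib U' ` Q' <-> rho c : Q'" if "c : labels U" "c ~: {c1, c2}" for c
 proof -
  have "rho c : labels U'" using L that by blast
  hence "fib U' (rho c) : fib U' ` Q' <-> rho c : Q'" using inj_fib[OF U(3,4)] Q(2) by(auto dest: inj_onD)
  thus ?thesis unfolding other[OF that] .
 qed
 show "(fib U ` Q) Int (circ U Int circ U') = (fib U' ` Q') Int (circ U Int circ U') <->
  (ALL c:labels U - {c1, c2}. c : Q <-> rho c : Q')" (is "?A <-> ?B")
 proof
  assume A: ?A
  show ?B
  proof
  fix c assume c: "c : labels U - {c1, c2}"
  hence "fib U c : circ U Int circ U'" unfolding common by blast
  hence "fib U c : fib U ` Q <-> fib U c : fib U' ` Q'" using A by blast
  thus "c : Q <-> rho c : Q'" using 1[of c] 2[of c] c by simp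
  qed
 next
  assume B: ?B
  have "fib U c : fib U ` Q <-> fib U c : fib U' ` Q'" if "c : labels U - {c1, c2}" for c using B 1[of c] 2[of c] that by simp
  hence eq: "C : fib U ` Q <-> C : fib U' ` Q'" if "C : circ U Int circ U'" for C using that unfolding common by(elim imageE) simp
  show ?A
  proof(rule Set.set_eqI)
  fix C
  show "C : (fib U ` Q) Int (circ U Int circ U') <-> C : (fib U' ` Q') Int (circ U Int circ U')"
  using eq[of C] by(cases "C : circ U Int circ U'") auto
  qed
 qed
qed

lemma step_merge_split:
 assumes U: "U <= {..<k}" "admissible U" "U' <= {..<k}" "admissible U'"
  and rho: "!!p. clab U' p = rho (clab U p)"
  and c: "c1 : labels U" "c2 : labels U" "c1 ~= c2" "rho c1 = rho c2"
  and inj: "ALL c:labels U. ALL c':labels U. rho c = rho c' --> c = c' \<or> {c, c'} = {c1, c2}"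
  and Q: "Q <= labels U" "Q' <= labels U'"
 shows "step U (fib U ` Q) U' (fib U' ` Q') <-> (ALL c:labels U - {c1, c2}. c : Q <-> rho c : Q') &
  (label_in Q c1, label_in Q c2, label_in Q' (rho c1)) : merge_terms" (is ?g1)
  and "step U' (fib U' ` Q') U (fib U ` Q) <-> (ALL c:labels U - {c1, c2}. c : Q <-> rho c : Q') &
  (label_in Q' (rho c1), label_in Q c1, label_in Q c2) : split_terms" (is ?g2)
proof -
 note mc = merge_circles[OF U rho c inj]
 have "rho c1 : labels U'" using mc(4) c(1) by blast
 note l = label_of_fib[OF U(1,2) Q(1) c(1)] label_of_fib[OF U(1,2) Q(1) c(2)] label_of_fib[OF U(3,4) Q(2) this]
 show ?g1 unfolding step_mergeI(1)[OF mc(1-3)] mc(5)[OF Q] l ..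
 show ?g2 unfolding step_mergeI(2)[OF mc(1-3)] mc(5)[OF Q] l ..
qed

subsection \<open>Absorbing a trivial circle\<close>

definition plus_steps :: "nat set => circle set => nat set => circle set set" where
 "plus_steps U P U' = {P' : plus_sets U'. step U P U' P'}"

text \<open>
  The trivial circle \<open>Tr c\<close> merges with \<open>d\<close>, or splits off from it. As nontrivial circles are labelled
  \<open>v\<^sub>+\<close>, these are multiplication and comultiplication of \<open>\<int>/2[X]/X\<^sup>2\<close> for trivial \<open>d\<close>, and for nontrivial \<open>d\<close>
  the maps \<open>1 \<mapsto> 1\<close>, \<open>X \<mapsto> 0\<close> and \<open>1 \<mapsto> X\<close>.
\<close>

lemma absorb:
 assumes U: "U <= {..<k}" "admissible U" "U ~= {}" "U' <= {..<k}" "admissible U'" "U' ~= {}"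
  and c: "Tr c : labels U" "d : labels U" "d ~= Tr c"
  and rho: "!!p. clab U' p = (if clab U p = Tr c then d else clab U p)"
 shows "Nts <= Q ==> Q <= labels U ==> plus_steps U (fib U ` Q) U' =
  (if Tr c : Q then {fib U' ` (Q - {Tr c})} else if d : Q & d ~: Nts then {fib U' ` (Q - {d})} else {})"
  and "Nts <= Q' ==> Q' <= labels U' ==> plus_steps U' (fib U' ` Q') U =
  insert (fib U ` Q') (if d : Q' & d ~: Nts then {fib U ` (insert (Tr c) (Q' - {d}))} else {})"
  and "labels U' = labels U - {Tr c}"
proof -
 let ?rho = "%e. if e = Tr c then d else e"
 have inj: "ALL e:labels U. ALL e':labels U. ?rho e = ?rho e' --> e = e' \<or> {e, e'} = {Tr c, d}" by(auto split: if_splits)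
 have r: "?rho (Tr c) = ?rho d" "?rho (Tr c) = d" by simp_all
 show L: "labels U' = labels U - {Tr c}" using merge_circles(4)[OF U(1,2,4,5), of ?rho, OF rho c(1,2) c(3)[symmetric] r(1) inj] c(2,3) by auto
 have N: "Nts <= labels U" "Nts <= labels U'" using U(3,6) by(auto simp: labels_def)
 have Tc: "Tr c ~: Nts" by(auto simp: Nts_def)
 have d: "d : Nts <-> (EX p. d = Nt p)" using c(2) U(3) by(auto simp: labels_def Nts_def)
 have st: "step U (fib U ` Q) U' (fib U' ` Q') <-> (ALL e:labels U - {Tr c, d}. e : Q <-> e : Q') &
  (label_in Q (Tr c), label_in Q d, label_in Q' d) : merge_terms"
  "step U' (fib U' ` Q') U (fib U ` Q) <-> (ALL e:labels U - {Tr c, d}. e : Q <-> e : Q') &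
  (label_in Q' d, label_in Q (Tr c), label_in Q d) : split_terms"
  if "Q <= labels U" "Q' <= labels U'" for Q Q'
  using step_merge_split[OF U(1,2,4,5), of ?rho, OF rho c(1,2) c(3)[symmetric] r(1) inj that] r(2) by auto
 have lt: "label_in Q (Tr c) = (if Tr c : Q then W_plus else W_minus)" for Q by(simp add: label_in_def)
 have ld: "label_in Q d = (if d : Nts then V_plus else if d : Q then W_plus else W_minus)" if "Nts <= Q" for Q
  using that d by(cases d) (auto simp: label_in_def)
 { assume Q: "Nts <= Q" "Q <= labels U"
  have "Nts <= Q' & Q' <= labels U' & step U (fib U ` Q) U' (fib U' ` Q') <->
  (if Tr c : Q then Q' = Q - {Tr c} else d : Q & d ~: Nts & Q' = Q - {d})" for Q'
  proof(cases "Nts <= Q' & Q' <= labels U'")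
  case True
  hence Q': "Nts <= Q'" "Q' <= labels U'" by auto
  show ?thesis
  proof -
  have *: "(label_in Q (Tr c), label_in Q d, label_in Q' d) : merge_terms <->
  (if d : Nts then Tr c : Q else if Tr c : Q then d : Q <-> d : Q' else d : Q & d ~: Q')"
  unfolding lt ld[OF Q(1)] ld[OF Q'(1)] by(simp add: merge_terms_def)
  have TQ': "Tr c ~: Q'" using Q'(2) L by blast
  have dQ: "d : Nts ==> d : Q & d : Q'" using Q Q' by blast
  have "(ALL e:labels U - {Tr c, d}. e : Q <-> e : Q') <-> Q - {Tr c, d} = Q' - {Tr c, d}" using Q(2) Q'(2) L by blast
  also have "... <-> Q - {Tr c, d} = Q' - {d}" using TQ' by blast
  finally have **: "(ALL e:labels U - {Tr c, d}. e : Q <-> e : Q') <-> Q - {Tr c, d} = Q' - {d}" .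
  show ?thesis unfolding st(1)[OF Q(2) Q'(2)] * ** using True dQ TQ' c(3) by(auto split: if_splits)
  qed
  next
  case False
  thus ?thesis using Q L Tc by auto
  qed
  hence "{Q'. Nts <= Q' & Q' <= labels U' & step U (fib U ` Q) U' (fib U' ` Q')} =
  (if Tr c : Q then {Q - {Tr c}} else if d : Q & d ~: Nts then {Q - {d}} else {})" by(cases "Tr c : Q"; cases "d : Q & d ~: Nts") simp_all
  thus "plus_steps U (fib U ` Q) U' =
  (if Tr c : Q then {fib U' ` (Q - {Tr c})} else if d : Q & d ~: Nts then {fib U' ` (Q - {d})} else {})"
  unfolding plus_steps_def plus_sets_cup[OF U(4-6)] filter_image by(simp split: if_split) }
 { assume Q': "Nts <= Q'" "Q' <= labels U'"
  have "Nts <= Q & Q <= labels U & step U' (fib U' ` Q') U (fib U ` Q) <->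
  (Q = Q' \<or> d : Q' & d ~: Nts & Q = insert (Tr c) (Q' - {d}))" for Q
  proof(cases "Nts <= Q & Q <= labels U")
  case True
  hence Q: "Nts <= Q" "Q <= labels U" by auto
  show ?thesis
  proof -
  have *: "(label_in Q' d, label_in Q (Tr c), label_in Q d) : split_terms <->
  (if d : Nts then Tr c ~: Q else if d : Q' then Tr c : Q <-> d ~: Q else Tr c ~: Q & d ~: Q)"
  unfolding lt ld[OF Q(1)] ld[OF Q'(1)] by(auto simp: split_terms_def)
  have TQ': "Tr c ~: Q'" using Q'(2) L by blast
  have dQ: "d : Nts ==> d : Q & d : Q'" using Q Q' by blast
  have "(ALL e:labels U - {Tr c, d}. e : Q <-> e : Q') <-> Q - {Tr c, d} = Q' - {Tr c, d}" using Q(2) Q'(2) L by blast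
  also have "... <-> Q - {Tr c, d} = Q' - {d}" using TQ' by blast
  finally have **: "(ALL e:labels U - {Tr c, d}. e : Q <-> e : Q') <-> Q - {Tr c, d} = Q' - {d}" .
  show ?thesis unfolding st(2)[OF Q(2) Q'(2)] * ** using True dQ TQ' c(3) by(auto split: if_splits)
  qed
  next
  case False
  thus ?thesis using Q' L Tc c by auto
  qed
  hence "{Q. Nts <= Q & Q <= labels U & step U' (fib U' ` Q') U (fib U ` Q)} =
  insert Q' (if d : Q' & d ~: Nts then {insert (Tr c) (Q' - {d})} else {})" by(cases "d : Q' & d ~: Nts") auto
  thus "plus_steps U' (fib U' ` Q') U =
  insert (fib U ` Q') (if d : Q' & d ~: Nts then {fib U ` (insert (Tr c) (Q' - {d}))} else {})"
  unfolding plus_steps_def plus_sets_cup[OF U(1-3)] filter_image by(simp split: if_split) }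
qed

subsection \<open>The first cup\<close>

lemma clab_single: "clab {j} (l, s) = lab j (x j) (x j) s" using prv_in[of "{j}" l] nxt_in[of "{j}" j] by(simp add: clab_def)

lemma admissible_single: "admissible {j}" by(simp add: admissible_def nxt_def near_def)

lemma labels_single: "labels {j} = insert (Tr j) Nts" by(auto simp: labels_def nxt_def)

lemma fib_empty_inj: "t <= m ==> t' <= m ==> fib {} ` strands t = fib {} ` strands t' <-> t = t'"
proof -
 assume t: "t <= m" "t' <= m"
 have l: "labels {} = Nt ` {..m}" by(simp add: labels_def)
 have "fib {} ` strands t = fib {} ` strands t' <-> strands t = strands t'"
  by(rule inj_on_image_eq_iff[OF inj_fib[OF empty_subsetI admissible_empty]]) (auto simp: l strands_def)
 also have "... <-> t = t'" using t by(auto simp: strands_def inj_image_eq_iff inj_on_def)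
 finally show ?thesis .
qed

text \<open>Strands \<open>i - 1\<close> and \<open>i\<close>, both nontrivial, become the trivial circle; one of them must be labelled \<open>v\<^sub>-\<close>.\<close>

lemma first_cup:
 assumes j: "j < k"
 shows "t <= m ==> plus_steps {} (fib {} ` strands t) {j} = (if t : {x j - 1, x j} then {fib {j} ` Nts} else {})"
  and "Q = Nts \<or> Q = insert (Tr j) Nts ==> plus_steps {j} (fib {j} ` Q) {} =
  (if Tr j : Q then {fib {} ` strands (x j - 1), fib {} ` strands (x j)} else {})"
proof -
 let ?i = "x j" and ?rho = "%c. case c of Nt s => lab j (x j) (x j) s | Tr a => Tr a"
 have i: "1 <= ?i" "?i <= m" "?i - 1 <= m" "?i - 1 ~= ?i" using x[OF j] by auto
 have l: "labels {} = Nt ` {..m}" by(simp add: labels_def)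
 have J: "{j} <= {..<k}" using j by simp
 have rho: "clab {j} p = ?rho (clab {} p)" for p by(cases p) (simp add: clab_single, simp add: clab_def)
 have rhoi: "?rho (Nt (?i - 1)) = Tr j" "?rho (Nt ?i) = Tr j" using i by auto
 have "c = c' \<or> {c, c'} = {Nt (?i - 1), Nt ?i}"
  if h: "c : labels {}" "c' : labels {}" "?rho c = ?rho c'" for c c'
 proof -
  obtain s s' where s: "c = Nt s" "c' = Nt s'" using h l by auto
  have "lab j ?i ?i s = lab j ?i ?i s'" using h(3) s by(simp only: circle_label.case)
  from lab_inject[OF _ i(1) i(1) this] have "s = s' \<or> s : {?i - 1, ?i} & s' : {?i - 1, ?i}" by(auto simp: near_def)
  thus ?thesis unfolding s by auto
 qed
 hence inj: "ALL c:labels {}. ALL c':labels {}. ?rho c = ?rho c' --> c = c' \<or> {c, c'} = {Nt (?i - 1), Nt ?i}" by blast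
 have c: "Nt (?i - 1) : labels {}" "Nt ?i : labels {}" "Nt (?i - 1) ~= Nt ?i" "?rho (Nt (?i - 1)) = ?rho (Nt ?i)" using i rhoi l by auto
 note st = step_merge_split[OF empty_subsetI admissible_empty J admissible_single rho c inj, unfolded rhoi(1)]
 have sub: "strands t <= labels {}" for t by(auto simp: l strands_def)
 have N: "?rho c : Nts" if h: "c : labels {} - {Nt (?i - 1), Nt ?i}" for c
 proof -
  obtain s where s: "c = Nt s" "s <= m" "s ~= ?i - 1" "s ~= ?i" using h l by auto
  thus ?thesis using i by(auto simp: Nts_def)
 qed
 have Tj: "Tr j ~: Nts" by(auto simp: Nts_def)
 have ls: "label_in (strands t) (Nt s) = (if s = t then V_minus else V_plus)" if "s <= m" for s t using that by(auto simp: label_in_def strands_def)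
 have main: "(ALL c:labels {} - {Nt (?i - 1), Nt ?i}. c : strands t <-> ?rho c : Q) <-> t : {?i - 1, ?i}"
  if "t <= m" "Nts <= Q" for t Q
 proof -
  have "(ALL c:labels {} - {Nt (?i - 1), Nt ?i}. c : strands t <-> ?rho c : Q) <->
  (ALL c:labels {} - {Nt (?i - 1), Nt ?i}. c : strands t)" using N that(2) by blast
  also have "... <-> t : {?i - 1, ?i}" using that(1) by(auto simp: l strands_def)
  finally show ?thesis .
 qed
 have Q2: "Nts <= Q & Q <= labels {j} <-> Q = Nts \<or> Q = insert (Tr j) Nts" for Q unfolding labels_single using Tj by auto
 have up: "step {} (fib {} ` strands t) {j} (fib {j} ` Q) <-> t : {?i - 1, ?i} & Tr j ~: Q"
  if t: "t <= m" and Q: "Nts <= Q" "Q <= labels {j}" for t Q unfolding st(1)[OF sub Q(2)] main[OF t Q(1)] ls[OF i(3)] ls[OF i(2)]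
  using i(4) by(auto simp: merge_terms_def label_in_def)
 have down: "step {j} (fib {j} ` Q) {} (fib {} ` strands t) <-> t : {?i - 1, ?i} & Tr j : Q"
  if t: "t <= m" and Q: "Nts <= Q" "Q <= labels {j}" for t Q unfolding st(2)[OF sub Q(2)] main[OF t Q(1)] ls[OF i(3)] ls[OF i(2)]
  using i(4) by(auto simp: split_terms_def label_in_def)
 show "plus_steps {} (fib {} ` strands t) {j} = (if t : {?i - 1, ?i} then {fib {j} ` Nts} else {})" if "t <= m"
 proof -
  have "Nts <= Q & Q <= labels {j} & step {} (fib {} ` strands t) {j} (fib {j} ` Q) <-> t : {?i - 1, ?i} & Q = Nts" for Q
  using up[OF that, of Q] Q2[of Q] Tj by auto
  thus ?thesis unfolding plus_steps_def plus_sets_cup[OF J admissible_single insert_not_empty] by auto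
 qed
 show "plus_steps {j} (fib {j} ` Q) {} =
  (if Tr j : Q then {fib {} ` strands (?i - 1), fib {} ` strands ?i} else {})" if "Q = Nts | Q = insert (Tr j) Nts"
 proof -
  have "Nts <= Q & Q <= labels {j}" using that by(simp only: Q2)
  hence Q: "Nts <= Q" "Q <= labels {j}" by blast+
  have "P : plus_steps {j} (fib {j} ` Q) {} <-> (EX t<=m. P = fib {} ` strands t & t : {?i - 1, ?i} & Tr j : Q)" for P
  unfolding plus_steps_def plus_sets_empty using down[OF _ Q] by auto
  thus ?thesis using i by auto
 qed
qed

end

section \<open>Paths in the slabs\<close>

lemma KB_near: "e : KB m ==> near (src e) (tgt e)" by(cases e) (auto simp: near_def)

lemma KB_ends:
 assumes "e : KB m" "src e = y" "tgt e = z"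
 shows "y = z ==> e = Vertex y | e = Loop y" "y ~= z ==> e = Step y z" using assms by(cases e; force)+

definition gamma_sum :: "nat => nat => (kb => kb => 'b fvec) => kb => 'b fvec" where
 "gamma_sum m i F q = lin (%(t1, t2). case mul t2 q of None => 0 | Some e => F t1 e) (gamv m i)"

lemma gamma_sum_eq:
 assumes "1 <= i"
 shows "gamma_sum m i F (Vertex i) = F (Vertex i) (Loop i) + F (Loop i) (Vertex i)"
  and "gamma_sum m i F (Loop i) = F (Loop i) (Loop i)"
  and "near y i ==> y ~= i ==> y <= m ==> gamma_sum m i F (Vertex y) = F (Step y i) (Step i y)"
  and "y ~= i ==> gamma_sum m i F (Loop y) = 0"
  and "y ~= i ==> gamma_sum m i F (Step i y) = F (Loop i) (Step i y)"
  and "near y i ==> y ~= i ==> y <= m ==> gamma_sum m i F (Step y i) = F (Step y i) (Loop i)"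
 using assms by(auto simp: gamma_sum_def gamv_def lin_add near_def le_Suc_eq)

lemma gamv_vec:
 assumes "1 <= i" "i <= m"
 shows "gamv m i : vec {(a, b). a : KB m & b : KB m & tgt a = i & src b = i & src a = tgt b}" unfolding gamv_def using assms by(intro vec_add) auto

lemma near_triple:
 assumes "near p q" "near q r" "near p r"
 shows "p = q & q = r | p = r & p ~= q | p = q & q ~= r | p ~= q & q = r" using assms unfolding near_def by linarith

lemma lab_split:
 assumes n: "near p q" "near q r" and ne: "a ~= j" and pos: "1 <= p" "1 <= q" "1 <= r"
  and L: "L = lab a p r s" and L': "L' = lab a p q s | L' = lab j q r s"
 shows "p = q ==> q = r ==> L = (if L' = Tr j then Tr a else L')"
  and "p = r ==> p ~= q ==> L' = (if L = Tr a then Nt (min p q - 1) else L)"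
  and "p = q ==> q ~= r ==> L = (if L' = Tr a then Nt (min q r - 1) else L')"
  and "p ~= q ==> q = r ==> L = (if L' = Tr j then Nt (min p q - 1) else L')"
proof -
 assume e: "p = q" "q = r"
 show "L = (if L' = Tr j then Tr a else L')" using L L' ne unfolding e by(auto split: if_splits)
next
 assume e: "p = r" "p ~= q"
 have n': "near r q" using n(1) e(1) by simp
 thus "L' = (if L = Tr a then Nt (min p q - 1) else L)"
 proof(cases rule: near_cases)
  case 2
  thus ?thesis using L L' pos unfolding e(1) 2 by(auto split: if_splits)
 next
  case 3
  thus ?thesis using L L' pos unfolding e(1) 3 by(auto split: if_splits)
 qed(use e in simp)
next
 assume e: "p = q" "q ~= r"
 show "L = (if L' = Tr a then Nt (min q r - 1) else L')" using n(2)
 proof(cases rule: near_cases)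
  case 2
  thus ?thesis using L L' pos ne unfolding e(1) 2 by(auto split: if_splits)
 next
  case 3
  thus ?thesis using L L' pos ne unfolding e(1) 3 by(auto split: if_splits)
 qed(use e in simp)
next
 assume e: "p ~= q" "q = r"
 show "L = (if L' = Tr j then Nt (min p q - 1) else L')" using n(1)
 proof(cases rule: near_cases)
  case 2
  thus ?thesis using L L' pos ne unfolding e(2)[symmetric] 2 by(auto split: if_splits)
 next
  case 3
  thus ?thesis using L L' pos ne unfolding e(2)[symmetric] 3 by(auto split: if_splits)
 qed(use e in simp)
qed

context closure
begin

definition plus_of :: "nat set => (nat => kb) => circle_label set" where
 "plus_of U E = Nts Un Tr ` {a : U. len (E a) = 0}"

definition compat :: "nat set => (nat => kb) => bool" where
 "compat U E <-> (ALL a:U. E a : KB m & src (E a) = x a & tgt (E a) = x (nxt U a))"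

lemma Nts_simps [simp]: "Nt p : Nts <-> Suc p < m" "Tr a ~: Nts" by(auto simp: Nts_def)

lemma plus_of_simps [simp]: "Nt p : plus_of U E <-> Suc p < m" "Tr a : plus_of U E <-> a : U & len (E a) = 0" by(auto simp: plus_of_def)

lemma label_set_eqI:
 assumes "!!p. Nt p : Q <-> Nt p : Q'" "!!a. Tr a : Q <-> Tr a : Q'"
 shows "Q = Q'"
proof(rule Set.set_eqI)
 fix c
 show "c : Q <-> c : Q'" using assms by(cases c) auto
qed

lemma compat_admissible: "compat U E ==> admissible U" using KB_near by(auto simp: compat_def admissible_def) metis

lemma compat_plus:
 assumes "compat U E" "U ~= {}"
 shows "Nts <= plus_of U E" "plus_of U E <= labels U"
proof -
 have "src e = tgt e" if "len e = 0" for e using that by(cases e) auto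
 thus "plus_of U E <= labels U" using assms by(auto simp: plus_of_def labels_def compat_def)
qed(auto simp: plus_of_def)

context
 fixes U j
 assumes U: "U <= {..<k}" "U ~= {}" and j: "j < k" "j ~: U"
begin

private abbreviation (input) "a == prv U j"
private abbreviation (input) "z == nxt U (prv U j)"
private abbreviation (input) "U' == insert j U"

lemma slab_split:
 shows "a : U" "a ~= j" "z : U" "U' <= {..<k}" "nxt U' a = j" "nxt U' j = z"
  "b : U ==> b ~= a ==> nxt U' b = nxt U b"
  "1 <= x a" "x a <= m" "1 <= x j" "x j <= m" "1 <= x z" "x z <= m"
proof -
 note f = finU[OF U(1)]
 show "a : U" "z : U" using prv_in[OF f U(2)] nxt_in[OF f U(2)] by auto
 thus "a ~= j" "1 <= x a" "x a <= m" "1 <= x z" "x z <= m" using j xU[OF U(1)] by auto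
 show "U' <= {..<k}" "1 <= x j" "x j <= m" using U j x by auto
 show "nxt U' a = j" "nxt U' j = z" "b : U ==> b ~= a ==> nxt U' b = nxt U b"
  using nxt_insert_prv[OF f U(2) j(2)] nxt_insert_new[OF f U(2) j(2)] nxt_insert_other[OF f U(2) j(2)] by auto
qed

lemma clab_insert:
 "(clab U' p = clab U p & clab U p ~= Tr a & clab U p ~= Tr j) |
 (EX s. clab U p = lab a (x a) (x z) s & (clab U' p = lab a (x a) (x j) s | clab U' p = lab j (x j) (x z) s))"
proof -
 obtain l s where p: "p = (l, s)" by(cases p)
 note f = finU[OF U(1)] and ss = slab_split
 note pr = prv_insert[OF f U(2) j(2), of l]
 show ?thesis
 proof(cases "prv U l = a")
  case True
  thus ?thesis using pr ss(5,6) U(2) by(auto simp: p clab_def)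
 next
  case False
  hence e: "prv U' l = prv U l" using pr by auto
  have b: "prv U l : U" by(rule prv_in[OF f U(2)])
  have "clab U' p = clab U p" using ss(7)[OF b False] U(2) by(simp add: p clab_def e)
  moreover have "clab U p ~= Tr a" "clab U p ~= Tr j" using False b j(2) U(2) by(auto simp: p clab_def dest!: lab_Tr)
  ultimately show ?thesis by blast
 qed
qed

lemma clab_cases:
 assumes "near (x a) (x j)" "near (x j) (x z)" "near (x a) (x z)"
 shows "x a = x j ==> x j = x z ==> clab U p = (if clab U' p = Tr j then Tr a else clab U' p)" (is "?a1 ==> ?b1 ==> ?t1")
  and "x a = x z ==> x a ~= x j ==> clab U' p = (if clab U p = Tr a then Nt (min (x a) (x j) - 1) else clab U p)" (is "?a2 ==> ?b2 ==> ?t2")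
  and "x a = x j ==> x j ~= x z ==> clab U p = (if clab U' p = Tr a then Nt (min (x j) (x z) - 1) else clab U' p)" (is "?a3 ==> ?b3 ==> ?t3")
  and "x a ~= x j ==> x j = x z ==> clab U p = (if clab U' p = Tr j then Nt (min (x a) (x j) - 1) else clab U' p)" (is "?a4 ==> ?b4 ==> ?t4")
proof -
 note b = slab_split(2,8,10,12)
 have "(?a1 --> ?b1 --> ?t1) & (?a2 --> ?b2 --> ?t2) & (?a3 --> ?b3 --> ?t3) & (?a4 --> ?b4 --> ?t4)" using clab_insert[of p]
 proof(elim disjE exE conjE)
  assume "clab U' p = clab U p" "clab U p ~= Tr a" "clab U p ~= Tr j"
  thus ?thesis by simp
 next
  fix s assume e: "clab U p = lab a (x a) (x z) s" "clab U' p = lab a (x a) (x j) s"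
  show ?thesis using lab_split[OF assms(1,2) b e(1) disjI1[OF e(2)]] by blast
 next
  fix s assume e: "clab U p = lab a (x a) (x z) s" "clab U' p = lab j (x j) (x z) s"
  show ?thesis using lab_split[OF assms(1,2) b e(1) disjI2[OF e(2)]] by blast
 qed
 thus "?a1 ==> ?b1 ==> ?t1" "?a2 ==> ?b2 ==> ?t2" "?a3 ==> ?b3 ==> ?t3" "?a4 ==> ?b4 ==> ?t4" by blast+
qed

text \<open>
  Removing a cup-cap diagram joins two slabs, and the labels change as the product of the two paths says.
  The cases are which of the three indices agree. If none do, the product vanishes and the joined
  slab is inadmissible.
\<close>

lemma remove_cup:
 assumes E: "compat U' E"
 shows "plus_steps U' (fib U' ` plus_of U' E) U =
  (case mul (E a) (E j) of None => {} | Some e => {fib U ` plus_of U (E(a := e))})"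
proof -
 note ss = slab_split and A' = compat_admissible[OF E] and Q = compat_plus[OF E insert_not_empty]
 have Ea: "E a : KB m" "src (E a) = x a" "tgt (E a) = x j" and Ej: "E j : KB m" "src (E j) = x j" "tgt (E j) = x z"
  using E ss(1,5,6) by(auto simp: compat_def)
 have n: "near (x a) (x j)" "near (x j) (x z)" using KB_near[OF Ea(1)] KB_near[OF Ej(1)] Ea Ej by auto
 note ka = KB_ends[OF Ea] and kj = KB_ends[OF Ej]
 show ?thesis
 proof(cases "near (x a) (x z)")
  case False
  hence "~ admissible U" using ss(1) by(auto simp: admissible_def)
  moreover have "x a ~= x j" "x j ~= x z" "x a ~= x z" using False n by(auto simp: near_def)
  moreover from this have "E a = Step (x a) (x j)" "E j = Step (x j) (x z)" using ka(2) kj(2) by auto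
  ultimately show ?thesis using plus_sets_inadmissible[OF U(1)] by(simp add: plus_steps_def)
 next
  case True
  note cc = clab_cases[OF n True]
  have A: "admissible U" unfolding admissible_def
  proof
  fix b assume b: "b : U"
  show "near (x b) (x (nxt U b))" using True A' ss(7)[OF b] b by(cases "b = a") (auto simp: admissible_def)
  qed
  note ab = absorb[OF ss(4) A' insert_not_empty U(1) A U(2)] and ab' = absorb[OF U(1) A U(2) ss(4) A' insert_not_empty]
  have L: "Tr b : labels U' <-> b : U' & x b = x (nxt U' b)" "Tr b : labels U <-> b : U & x b = x (nxt U b)"
  "Nt p : labels U' <-> Suc p < m" "Nt p : labels U <-> Suc p < m" for b p using U(2) by(auto simp: labels_def)
  have d: "Suc (min y z' - 1) < m" if "y ~= z'" "1 <= y" "1 <= z'" "y <= m" "z' <= m" for y z' using that by(auto simp: min_def)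
  consider (1) "x a = x j" "x j = x z" | (2) "x a = x z" "x a ~= x j" | (3) "x a = x j" "x j ~= x z" | (4) "x a ~= x j" "x j = x z"
  using near_triple[OF n True] by blast
  thus ?thesis
  proof cases
  case 1
  have "Tr j : labels U'" "Tr a : labels U'" "Tr a ~= Tr j" using 1 ss by(auto simp: L)
  note r = ab(1)[OF this cc(1)[OF 1] Q]
  have "E a = Vertex (x j) | E a = Loop (x j)" "E j = Vertex (x j) | E j = Loop (x j)" using ka(1) kj(1) 1 by auto
  thus ?thesis unfolding r using ss(1,2) j(2) by(elim disjE) (auto intro!: arg_cong[of _ _ "%Q. fib U ` Q"] label_set_eqI split: if_splits)
  next
  case 2
  have "Tr a : labels U" "Nt (min (x a) (x j) - 1) : labels U" "Nt (min (x a) (x j) - 1) ~= Tr a" using 2 ss d by(auto simp: L)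
  note r = ab'(2)[OF this cc(2)[OF 2] Q]
  have "E a = Step (x a) (x j)" "E j = Step (x j) (x a)" using ka(2) kj(2) 2 by auto
  thus ?thesis unfolding r using ss(1,2,8,9,10,11) j(2) 2 d[of "x a" "x j"]
  by(auto intro!: arg_cong[of _ _ "%Q. fib U ` Q"] label_set_eqI split: if_splits)
  next
  case 3
  have "Tr a : labels U'" "Nt (min (x j) (x z) - 1) : labels U'" "Nt (min (x j) (x z) - 1) ~= Tr a" using 3 ss d by(auto simp: L)
  note r = ab(1)[OF this cc(3)[OF 3] Q]
  have "E a = Vertex (x j) | E a = Loop (x j)" "E j = Step (x j) (x z)" using ka(1) kj(2) 3 by auto
  thus ?thesis unfolding r using ss(1,2,10,11,12,13) j(2) 3 d[of "x j" "x z"]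
  by(elim disjE) (auto intro!: arg_cong[of _ _ "%Q. fib U ` Q"] label_set_eqI split: if_splits)
  next
  case 4
  have "Tr j : labels U'" "Nt (min (x a) (x j) - 1) : labels U'" "Nt (min (x a) (x j) - 1) ~= Tr j" using 4 ss d by(auto simp: L)
  note r = ab(1)[OF this cc(4)[OF 4] Q]
  have "E a = Step (x a) (x j)" "E j = Vertex (x j) | E j = Loop (x j)" using ka(2) kj(1) 4 by auto
  thus ?thesis unfolding r using ss(1,2,8,9,10,11) j(2) 4 d[of "x a" "x j"]
  by(elim disjE) (auto intro!: arg_cong[of _ _ "%Q. fib U ` Q"] label_set_eqI split: if_splits)
  qed
 qed
qed

lemma compat_insert:
 assumes E: "compat U E" and t: "t1 : KB m" "t2 : KB m" "tgt t1 = x j" "src t2 = x j" "src t1 = tgt t2" "mul t2 (E a) = Some e"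
 shows "compat U' (E(a := t1, j := e))"
proof -
 note ss = slab_split
 have Ea: "E a : KB m" "src (E a) = x a" "tgt (E a) = x z" using E ss(1) by(auto simp: compat_def)
 note me = mul_Some[OF t(6)] and mk = mul_KB[OF t(2) Ea(1) t(6)]
 show ?thesis unfolding compat_def
 proof
  fix b assume b: "b : U'"
  consider "b = j" | "b = a" | "b : U" "b ~= a" "b ~= j" using b by blast
  thus "(E(a := t1, j := e)) b : KB m & src ((E(a := t1, j := e)) b) = x b &
  tgt ((E(a := t1, j := e)) b) = x (nxt U' b)"
  proof cases
  case 1
  thus ?thesis using me mk t Ea ss(6) by simp
  next
  case 2
  thus ?thesis using me t Ea ss(2,5) by simp
  next
  case 3
  thus ?thesis using E ss(7)[OF 3(1,2)] by(simp add: compat_def)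
  qed
 qed
qed

text \<open>
  The terms of \<open>\<gamma>\<^sub>i(1)\<close> that compose with the path of the slab are those of the split or merge; there is no
  such term if the new resolution is inadmissible (\<open>compat_insert\<close>).
\<close>

lemma insert_cup:
 assumes E: "compat U E" and f: "inj f"
 shows "(SUM P:plus_steps U (fib U ` plus_of U E) U'. elt (f P)) =
  gamma_sum m (x j) (%t e. elt (f (fib U' ` plus_of U' (E(a := t, j := e))))) (E a)"
proof -
 note ss = slab_split and A = compat_admissible[OF E] and Q = compat_plus[OF E U(2)]
 have Ea: "E a : KB m" "src (E a) = x a" "tgt (E a) = x z" using E ss(1) by(auto simp: compat_def)
 have naz: "near (x a) (x z)" using KB_near[OF Ea(1)] Ea by auto
 note ka = KB_ends[OF Ea]
 show ?thesis
 proof(cases "admissible U'")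
  case False
  hence 0: "mul t2 (E a) = None" if "t1 : KB m" "t2 : KB m" "tgt t1 = x j" "src t2 = x j" "src t1 = tgt t2" for t1 t2
  using compat_insert[OF E that] compat_admissible by(cases "mul t2 (E a)") auto
  have "gamma_sum m (x j) F (E a) = lin (%_. 0) (gamv m (x j))" for F :: "kb => kb => 'b fvec"
  unfolding gamma_sum_def by(rule lin_cong_vec[OF gamv_vec[OF ss(10,11)]]) (auto simp: 0)
  thus ?thesis using plus_sets_inadmissible[OF ss(4) False] by(simp add: plus_steps_def)
 next
  case A': True
  have n: "near (x a) (x j)" "near (x j) (x z)" using A' ss(1,5,6) by(auto simp: admissible_def)
  note cc = clab_cases[OF n naz]
  note ab = absorb[OF ss(4) A' insert_not_empty U(1) A U(2)] and ab' = absorb[OF U(1) A U(2) ss(4) A' insert_not_empty]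
  have L: "Tr b : labels U' <-> b : U' & x b = x (nxt U' b)" "Tr b : labels U <-> b : U & x b = x (nxt U b)"
  "Nt p : labels U' <-> Suc p < m" "Nt p : labels U <-> Suc p < m" for b p using U(2) by(auto simp: labels_def)
  have d: "Suc (min y z' - 1) < m" if "y ~= z'" "1 <= y" "1 <= z'" "y <= m" "z' <= m" for y z' using that by(auto simp: min_def)
  have fj: "fib U' ` Q1 = fib U' ` Q2 <-> Q1 = Q2" if "Q1 <= labels U'" "Q2 <= labels U'" for Q1 Q2
  using inj_on_image_eq_iff[OF inj_fib[OF ss(4) A'] that] .
  note gs = gamma_sum_eq[OF ss(10)]
  consider (1) "x a = x j" "x j = x z" | (2) "x a = x z" "x a ~= x j" | (3) "x a = x j" "x j ~= x z" | (4) "x a ~= x j" "x j = x z"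
  using near_triple[OF n naz] by blast
  thus ?thesis
  proof cases
  case 1
  have c: "Tr j : labels U'" "Tr a : labels U'" "Tr a ~= Tr j" using 1 ss by(auto simp: L)
  have L': "labels U = labels U' - {Tr j}" by(rule ab(3)[OF c cc(1)[OF 1]])
  note r = ab(2)[OF c cc(1)[OF 1] Q]
  have "E a = Vertex (x j) | E a = Loop (x j)" using ka(1) 1 by auto
  thus ?thesis
  proof
  assume e: "E a = Vertex (x j)"
  let ?R = "insert (Tr j) (plus_of U E - {Tr a})"
  have "Tr j ~: plus_of U E" using j(2) by simp
  hence ne: "fib U' ` plus_of U E ~= fib U' ` ?R" using fj[of "plus_of U E" ?R] Q(2) L' c(1) by blast
  have "plus_of U' (E(a := Vertex (x j), j := Loop (x j))) = plus_of U E"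
  "plus_of U' (E(a := Loop (x j), j := Vertex (x j))) = ?R" using e ss(1,2) j(2) by(auto intro!: label_set_eqI split: if_splits)
  thus ?thesis unfolding r e gs(1) using e ss(1) ne by simp
  next
  assume e: "E a = Loop (x j)"
  have "plus_of U' (E(a := Loop (x j), j := Loop (x j))) = plus_of U E" using e ss(1,2) j(2) by(auto intro!: label_set_eqI split: if_splits)
  thus ?thesis unfolding r e gs(2) using e by simp
  qed
  next
  case 2
  have c: "Tr a : labels U" "Nt (min (x a) (x j) - 1) : labels U" "Nt (min (x a) (x j) - 1) ~= Tr a" using 2 ss d by(auto simp: L)
  note r = ab'(1)[OF c cc(2)[OF 2] Q]
  have "E a = Vertex (x a) | E a = Loop (x a)" using ka(1) 2 by auto
  thus ?thesis
  proof
  assume e: "E a = Vertex (x a)"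
  have "plus_of U' (E(a := Step (x a) (x j), j := Step (x j) (x a))) = plus_of U E - {Tr a}"
  using ss(1,2) j(2) by(auto intro!: label_set_eqI split: if_splits)
  thus ?thesis unfolding r e gs(3)[OF n(1) 2(2) ss(9)] using e ss(1) by simp
  next
  assume e: "E a = Loop (x a)"
  show ?thesis unfolding r e gs(4)[OF 2(2)] using e 2 ss d[of "x a" "x j"] by simp
  qed
  next
  case 3
  have c: "Tr a : labels U'" "Nt (min (x j) (x z) - 1) : labels U'" "Nt (min (x j) (x z) - 1) ~= Tr a" using 3 ss d by(auto simp: L)
  note r = ab(2)[OF c cc(3)[OF 3] Q]
  have e: "E a = Step (x j) (x z)" using ka(2) 3 by auto
  have "plus_of U' (E(a := Loop (x j), j := Step (x j) (x z))) = plus_of U E" using e ss(1,2) j(2) by(auto intro!: label_set_eqI split: if_splits)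
  thus ?thesis unfolding r e gs(5)[OF 3(2)[symmetric]] using 3 ss d[of "x j" "x z"] by simp
  next
  case 4
  have c: "Tr j : labels U'" "Nt (min (x a) (x j) - 1) : labels U'" "Nt (min (x a) (x j) - 1) ~= Tr j" using 4 ss d by(auto simp: L)
  note r = ab(2)[OF c cc(4)[OF 4] Q]
  have e: "E a = Step (x a) (x j)" using ka(2) 4 by auto
  have "plus_of U' (E(a := Step (x a) (x j), j := Loop (x j))) = plus_of U E" using e ss(1,2) j(2) by(auto intro!: label_set_eqI split: if_splits)
  thus ?thesis unfolding r e gs(6)[OF n(1) 4(1) ss(9)] using 4 ss d[of "x a" "x j"] by simp
  qed
 qed
qed

end

end

section \<open>The trace of a word\<close>

definition cups :: "kb option list => nat set" where
 "cups us = {j. j < length us & us ! j ~= None}"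

lemma cups_finite [simp]: "finite (cups us)" by(simp add: cups_def)

lemma cups_update: "j < length us ==> cups (us[j := None]) = cups us - {j}"
 "j < length us ==> cups (us[j := Some p]) = insert j (cups us)" by(auto simp: cups_def nth_list_update)

lemma first_index:
 assumes "z < length us" "us ! z = Some q" "ALL i<z. us ! i = None"
 shows "lmw p (us, b) = map_option (%e. (us[z := Some e], b)) (mul p q)"
  and "srcw (us, b) = src q" "first_path (us, b) = q" "reset (us, b) = (us[z := Some (Vertex (tgt q))], b)"
proof -
 have "lmw p (us, b) = map_option (%e. (us[z := Some e], b)) (mul p q) & srcw (us, b) = src q &
  first_path (us, b) = q & reset (us, b) = (us[z := Some (Vertex (tgt q))], b)" using assms
 proof(induction us arbitrary: z)
  case (Cons u us)
  show ?case
  proof(cases z)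
  case 0
  thus ?thesis using Cons.prems by simp
  next
  case (Suc y)
  have u: "u = None" using Cons.prems(3) Suc by auto
  have "ALL i<y. us ! i = None" using Cons.prems(3) Suc by auto
  from Cons.IH[OF _ _ this] show ?thesis using Cons.prems Suc u by(cases "mul p q") auto
  qed
 qed simp
 thus "lmw p (us, b) = map_option (%e. (us[z := Some e], b)) (mul p q)" "srcw (us, b) = src q"
  "first_path (us, b) = q" "reset (us, b) = (us[z := Some (Vertex (tgt q))], b)" by auto
qed

lemma no_index:
 assumes "ALL i<length us. us ! i = None"
 shows "lmw p (us, b) = map_option (Pair us) (mul p b)" "srcw (us, b) = src b"
proof -
 have "lmw p (us, b) = map_option (Pair us) (mul p b) & srcw (us, b) = src b" using assms
 proof(induction us)
  case (Cons u us)
  have "u = None" using Cons.prems by(metis length_greater_0_conv list.discI nth_Cons_0)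
  moreover have "ALL i<length us. us ! i = None" using Cons.prems by auto
  ultimately show ?case using Cons.IH by(cases "mul p b") auto
 qed simp
 thus "lmw p (us, b) = map_option (Pair us) (mul p b)" "srcw (us, b) = src b" by auto
qed

lemma first_cup_index:
 assumes "cups us ~= {}"
 shows "Min (cups us) < length us" "us ! Min (cups us) = Some (the (us ! Min (cups us)))" "ALL i<Min (cups us). us ! i = None"
proof -
 have *: "Min (cups us) : cups us" using assms by simp
 thus a: "Min (cups us) < length us" "us ! Min (cups us) = Some (the (us ! Min (cups us)))" by(auto simp: cups_def)
 show "ALL i<Min (cups us). us ! i = None"
 proof(intro allI impI)
  fix i assume i: "i < Min (cups us)"
  hence "i ~: cups us" using Min_le[OF cups_finite, of i us] by(meson leD)
  thus "us ! i = None" using i a(1) by(auto simp: cups_def)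
 qed
qed

lemma nxt_insert_self: "finite U ==> U ~= {} ==> j ~: U ==> nxt (insert j U) j = nxt U j"
proof -
 assume U: "finite U" "U ~= {}" "j ~: U"
 show ?thesis
 proof(cases rule: nxt_cases[OF U(1,2), of j])
  case 1
  thus ?thesis using U by(intro nxt_eqI) auto
 next
  case 2
  thus ?thesis using U by(intro nxt_eqI') auto
 qed
qed

lemma nxt_split:
 assumes f: "finite U" and ne: "U ~= {}" and j: "j ~: U" and a_def: "a = prv U j"
 shows "a : U" "nxt (insert j U) a = j" "nxt (insert j U) j = nxt U j" "nxt U a = nxt U j" "nxt U j ~= j"
  and "!!c. c : U ==> c ~= a ==> nxt (insert j U) c = nxt U c &
  ((EX z:insert j U. c < z) <-> (EX z:U. c < z)) & nxt U c ~= nxt U j & nxt U c ~= j"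
  and "!!i. i : U ==> (a < j --> i < j --> i <= a) & (~ a < j --> j < i & i <= a)"
proof -
 show a: "a : U" using prv_in[OF f ne] by(simp add: a_def)
 show "nxt (insert j U) a = j" using nxt_insert_prv[OF f ne j] by(simp add: a_def)
 show nj: "nxt (insert j U) j = nxt U j" using f ne j by(simp add: nxt_insert_self)
 show njj: "nxt U a = nxt U j" using nxt_insert_new[OF f ne j] nj by(simp add: a_def)
 show "nxt U j ~= j" using nxt_in[OF f ne, of j] j by auto
 fix c assume c: "c : U" "c ~= a"
 have no: "nxt (insert j U) c = nxt U c" using nxt_insert_other[OF f ne j c(1)] c(2) by(simp add: a_def)
 have "EX z:U. c < z" if h: "EX z:insert j U. c < z"
 proof -
  have "c < nxt (insert j U) c" using nxt_cases[of "insert j U" c] h by(metis f finite_insert insert_not_empty leD)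
  thus ?thesis using no nxt_in[OF f ne, of c] by auto
 qed
 thus "nxt (insert j U) c = nxt U c &
  ((EX z:insert j U. c < z) <-> (EX z:U. c < z)) & nxt U c ~= nxt U j & nxt U c ~= j"
  using no prv_nxt[OF f c(1)] prv_nxt[OF f a] c(2) nxt_in[OF f ne, of c] j njj by auto
next
 fix i assume i: "i : U"
 have "(a < j --> i < j --> i <= a) & (~ a < j --> j <= i & i <= a)" using prv_cases[OF f ne, of j] i unfolding a_def[symmetric] by(metis leD)
 thus "(a < j --> i < j --> i <= a) & (~ a < j --> j < i & i <= a)" using i j by(metis le_neq_implies_less)
qed

lemma has_cup_iff: "has_cup (us, b) <-> cups us ~= {}"
 using in_set_conv_nth[of False "map (%u. u = None) us"] by(auto simp: has_cup_def pat_def cups_def simp del: set_map)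

definition follow :: "kb option list => kb => nat => kb" where
 "follow us c j = (if EX z:cups us. j < z then the (us ! nxt (cups us) j) else c)"

lemma next_cup:
 assumes "EX z:cups us. j < z"
 shows "nxt (cups us) j : cups us" "j < nxt (cups us) j" "!!i. j < i ==> i < nxt (cups us) j ==> us ! i = None"
  "nxt (cups us) j < length us" "us ! nxt (cups us) j = Some (the (us ! nxt (cups us) j))"
proof -
 let ?z = "nxt (cups us) j"
 have ne: "cups us ~= {}" using assms by auto
 have *: "?z : cups us & j < ?z & (ALL i:cups us. j < i --> ?z <= i)"
 proof(cases rule: nxt_cases[OF cups_finite ne, of j])
  case 2
  thus ?thesis using assms by(meson leD)
 qed auto
 thus a: "?z : cups us" "j < ?z" "?z < length us" "us ! ?z = Some (the (us ! ?z))" by(auto simp: cups_def)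
 show "us ! i = None" if "j < i" "i < ?z" for i
 proof(rule ccontr)
  assume "us ! i ~= None"
  hence "i : cups us" using that a(3) by(auto simp: cups_def)
  hence "?z <= i" using * that(1) by blast
  thus False using that(2) by simp
 qed
qed

lemma no_cup_after:
 assumes "~ (EX z:cups us. j < z)"
 shows "ALL i<length (drop (Suc j) us). drop (Suc j) us ! i = None"
proof(intro allI impI)
 fix i assume i: "i < length (drop (Suc j) us)"
 hence "Suc j + i ~: cups us" using assms by(meson le_add1 Suc_le_lessD)
 thus "drop (Suc j) us ! i = None" using i by(auto simp: cups_def)
qed

lemma srcw_follow: "j < length us ==> srcw (drop (Suc j) us, b) = src (follow us b j)"
proof(cases "EX z:cups us. j < z")
 case True
 note z = next_cup[OF True]
 have "srcw (drop (Suc j) us, b) = src (the (us ! nxt (cups us) j))" by(rule first_index(2)[of "nxt (cups us) j - Suc j"]) (use z in auto)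
 thus ?thesis using True by(simp add: follow_def)
next
 case False
 thus ?thesis using no_index(2)[OF no_cup_after[OF False]] by(simp add: follow_def)
qed

lemma okw_iff: "okw m ls (us, b) <-> length us = length ls & b : KB m & (ALL j<length ls. us ! j ~= None -->
  snd (ls ! j) ~= 0 & the (us ! j) : PL m (fst (ls ! j)) & srcw (drop (Suc j) us, b) = fst (ls ! j))"
proof(induction m ls "(us, b)" arbitrary: us rule: okw.induct)
 case (3 m l ls us)
 thus ?case by(auto simp: less_Suc_eq_0_disj)
next
 case (4 m l ls p us)
 thus ?case by(auto simp: less_Suc_eq_0_disj)
qed auto

definition slide :: "kb option list => kb => nat => kb option => kb => word fvec" where
 "slide us b j u p = (case mul p (follow us b j) of None => 0
  | Some e => if EX z:cups us. j < z then elt (us[j := u, nxt (cups us) j := Some e], b) else elt (us[j := u], e))"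

lemma foldr_cons1: "foldr cons1 ps (elt (vs, b)) = elt (ps @ vs, b)" "foldr cons1 ps 0 = 0"
 "foldr cons1 ps (lin f x) = lin (%a. foldr cons1 ps (f a)) x"
proof -
 show "foldr cons1 ps (elt (vs, b)) = elt (ps @ vs, b)" by(induction ps) simp_all
 show "foldr cons1 ps 0 = 0" by(induction ps) simp_all
 show "foldr cons1 ps (lin f x) = lin (%a. foldr cons1 ps (f a)) x" by(induction ps) (simp_all add: cons1_lin)
qed

lemma slide_eq:
 assumes j: "j < length us"
 shows "foldr cons1 (take j us) (cons1 u (lmv (elt p) (elt (drop (Suc j) us, b)))) = slide us b j u p"
proof(cases "EX z:cups us. j < z")
 case True
 note z = next_cup[OF True]
 let ?z = "nxt (cups us) j"
 have l: "lmw p (drop (Suc j) us, b) = map_option (%e. ((drop (Suc j) us)[?z - Suc j := Some e], b)) (mul p (the (us ! ?z)))"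
  by(rule first_index(1)) (use z in auto)
 have us: "take j us @ u # (drop (Suc j) us)[?z - Suc j := Some e] = us[j := u, ?z := Some e]" for e
 proof -
  obtain d where "?z = Suc (j + d)" using less_imp_Suc_add[OF z(2)] by blast
  thus ?thesis using j z(4) by(simp add: upd_conv_take_nth_drop[OF j] list_update_append)
 qed
 show ?thesis using us True by(cases "mul p (the (us ! ?z))") (simp_all add: slide_def follow_def v_elt l foldr_cons1)
next
 case False
 from no_index(1)[OF no_cup_after[OF False]] show ?thesis
  using False by(cases "mul p b") (simp_all add: slide_def follow_def v_elt foldr_cons1 upd_conv_take_nth_drop[OF j])
qed

lemma dnw_sum:
 "length us = length ls ==> dnw m ls (us, b) =
  (SUM j<length ls. foldr cons1 (take j us) (dloc m (ls ! j) (us ! j) (elt (drop (Suc j) us, b))))"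
proof(induction ls arbitrary: us)
 case (Cons l ls)
 obtain u vs where us: "us = u # vs" "length vs = length ls" using Cons.prems by(cases us) auto
 have "cons1 u (sum f A) = (SUM a:A. cons1 u (f a))" for f :: "nat => _" and A by(simp add: cons1_def lin_sum)
 thus ?case using Cons.IH[OF us(2)] us by(simp add: sum.lessThan_Suc_shift del: sum.lessThan_Suc)
qed simp

lemma dnw_slide:
 assumes "length us = length ls"
 shows "dnw m ls (us, b) = (SUM j<length ls. case us ! j of
  None => if snd (ls ! j) = -1 then lin (%t. slide us b j (Some (fst t)) (snd t)) (gamv m (fst (ls ! j))) else 0
  | Some p => if snd (ls ! j) = 1 then slide us b j None p else 0)" unfolding dnw_sum[OF assms]
proof(rule sum.cong[OF refl])
 fix j assume "j : {..<length ls}"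
 hence j: "j < length us" using assms by simp
 show "foldr cons1 (take j us) (dloc m (ls ! j) (us ! j) (elt (drop (Suc j) us, b))) = (case us ! j of
  None => if snd (ls ! j) = -1 then lin (%t. slide us b j (Some (fst t)) (snd t)) (gamv m (fst (ls ! j))) else 0
  | Some p => if snd (ls ! j) = 1 then slide us b j None p else 0)" by(cases "us ! j") (simp_all add: dloc_def foldr_cons1 slide_eq[OF j])
qed

locale braid_closure =
 fixes m :: nat and w :: braid_word
 assumes w: "set w <= {1..<Suc m} \<times> {-1, 1}"
begin

abbreviation ix :: "nat => nat" where
 "ix j == fst (w ! j)"

sublocale closure m "length w" ix
proof
 fix j assume "j < length w"
 hence "w ! j : {1..<Suc m} \<times> {-1, 1}" using w nth_mem by blast
 thus "1 <= ix j & ix j <= m" by(auto simp: mem_Times_iff)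
qed

lemma sign: "j < length w ==> snd (w ! j) = 1 | snd (w ! j) = -1" using w nth_mem by fastforce

definition ls :: braid_word where
 "ls = (if w = [] then [(0, 0)] else w)"

definition vtx :: "nat set => int list" where
 "vtx U = map (%j. if (j : U) = (snd (w ! j) = -1) then 1 else -1) [0..<length w]"

definition gen :: "nat set => circle_label set => skh_gen" where
 "gen U Q = (vtx U, fib U ` Q)"

abbreviation word_gen :: "kb option list => kb => skh_gen" where
 "word_gen us c == gen (cups us) (plus_of (cups us) (follow us c))"

text \<open>
  The value at the constant path \<open>(s)\<close> is forced: a cup-cap diagram at \<open>i\<close> takes \<open>(s)\<close> to a loop if \<open>s = i \<plusminus> 1\<close>
  and to 0 otherwise, while it detects the label \<open>v\<^sub>-\<close> on the strands \<open>i - 1\<close> and \<open>i\<close>.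
\<close>

definition tr :: "word => skh_gen fvec" where
 "tr = (%(us, b). if cups us = {}
  then (case b of Vertex s => (if s = 0 then 0 else elt (gen {} (strands (s - 1)))) + elt (gen {} (strands s)) | _ => 0)
  else (case mul b (the (us ! Min (cups us))) of None => 0 | Some c => elt (word_gen us c)))"

lemma plus_of_cong: "(!!a. a : U ==> E a = E' a) ==> plus_of U E = plus_of U E'" by(auto simp: plus_of_def)

lemma cups_bound: "okw m ls (us, b) ==> cups us <= {..<length w}"
proof(cases "w = []")
 case True
 assume "okw m ls (us, b)"
 moreover have l: "ls = [(0, 0)]" unfolding ls_def using True by simp
 ultimately have "length us = Suc 0" "us ! 0 = None" by(auto simp: okw_iff l)
 thus "cups us <= {..<length w}" by(auto simp: cups_def)
next
 case False
 thus "okw m ls (us, b) ==> cups us <= {..<length w}" by(auto simp: okw_iff cups_def ls_def)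
qed

lemma okw_cup:
 assumes "okw m ls (us, b)" "j : cups us"
 shows "j < length w" "the (us ! j) : KB m" "tgt (the (us ! j)) = ix j" "src (follow us b j) = ix j"
proof -
 show j: "j < length w" using assms cups_bound by blast
 hence l: "ls = w" by(auto simp: ls_def)
 have "us ! j ~= None" "length us = length w" using assms by(auto simp: cups_def okw_iff l)
 hence "the (us ! j) : PL m (ix j) & srcw (drop (Suc j) us, b) = ix j" using assms(1) j by(auto simp: okw_iff l)
 thus "the (us ! j) : KB m" "tgt (the (us ! j)) = ix j" "src (follow us b j) = ix j"
  using srcw_follow[of j us b] j `length us = length w` by(auto simp: PL_def)
qed

lemma follow_compat:
 assumes ok: "okw m ls (us, b)" and c: "mul b (the (us ! Min (cups us))) = Some c" and ne: "cups us ~= {}"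
 shows "compat (cups us) (follow us c)" unfolding compat_def
proof
 fix a assume a: "a : cups us"
 have f: "Min (cups us) : cups us" using ne by simp
 note ms = mul_Some[OF c]
 show "follow us c a : KB m & src (follow us c a) = ix a & tgt (follow us c a) = ix (nxt (cups us) a)"
 proof(cases "EX z:cups us. a < z")
  case True
  thus ?thesis using okw_cup[OF ok a] okw_cup[OF ok next_cup(1)[OF True]] by(simp add: follow_def)
 next
  case False
  hence "nxt (cups us) a = Min (cups us)" by(simp add: nxt_def)
  moreover have "b : KB m" using ok by(rule okw_last)
  ultimately show ?thesis using False okw_cup[OF ok a] okw_cup[OF ok f] ms mul_KB[OF _ _ c] by(auto simp: follow_def)
 qed
qed

text \<open>By associativity: both words have the same product of last and first path.\<close>

lemma tr_trace:
 assumes "okw m ls y" "c : KB m"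
 shows "lin tr (elto (lmw c y)) = lin tr (elto (rmw y c))"
proof -
 obtain us b where y: "y = (us, b)" by(cases y)
 show ?thesis
 proof(cases "cups us = {}")
  case True
  hence "ALL i<length us. us ! i = None" by(auto simp: cups_def)
  from no_index(1)[OF this] show ?thesis using True by(cases c; cases b) (auto simp: y rmw_def tr_def)
 next
  case False
  let ?z = "Min (cups us)"
  let ?q = "the (us ! ?z)"
  note f = first_cup_index[OF False]
  have U: "cups (us[?z := Some e]) = cups us" for e using False f(1) by(simp add: cups_update(2) insert_absorb)
  have fo: "follow (us[?z := Some e]) d a = follow us d a" if "a : cups us" for e d a
  proof(cases "EX z:cups us. a < z")
  case True
  have "?z <= a" using that by simp
  hence "nxt (cups us) a ~= ?z" using next_cup(2)[OF True] by simp
  thus ?thesis by(simp add: follow_def U)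
  qed(simp add: follow_def U)
  have 1: "tr (us[?z := Some e], b) = (case mul b e of None => 0 | Some d => elt (word_gen us d))" for e
  proof -
  have "plus_of (cups us) (follow (us[?z := Some e]) d) = plus_of (cups us) (follow us d)" for d by(rule plus_of_cong) (rule fo)
  thus ?thesis using False f(1) by(cases "mul b e") (simp_all add: tr_def U)
  qed
  have 2: "tr (us, b') = (case mul b' ?q of None => 0 | Some d => elt (word_gen us d))" for b' using False by(simp add: tr_def)
  have "lin tr (elto (lmw c y)) = (case Option.bind (mul c ?q) (mul b) of None => 0 | Some d => elt (word_gen us d))"
  unfolding y first_index(1)[OF f] by(cases "mul c ?q") (simp_all add: 1)
  also have "Option.bind (mul c ?q) (mul b) = Option.bind (mul b c) (%x. mul x ?q)" by(rule mul_assoc[symmetric])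
  also have "(case ... of None => 0 | Some d => elt (word_gen us d)) = lin tr (elto (rmw y c))"
  unfolding y rmw_def by(cases "mul b c") (simp_all add: 2)
  finally show ?thesis .
 qed
qed

subsection \<open>The differential on normalized words\<close>

context
 fixes us b
 assumes norm: "(us, b) : Norm m ls" and ne: "cups us ~= {}"
begin

lemma norm_ok: "okw m ls (us, b)" using norm by(simp add: Norm_def NW_def)

lemma norm_first: "us ! Min (cups us) = Some (Vertex (ix (Min (cups us))))" "tgt b = ix (Min (cups us))"
proof -
 note f = first_cup_index[OF ne]
 let ?q = "the (us ! Min (cups us))"
 have r: "reset (us, b) = (us, b)" "tgt b = src (first_path (us, b))" using norm ne by(auto simp: Norm_def has_cup_iff)
 have "us[Min (cups us) := Some (Vertex (tgt ?q))] = us" using r(1) first_index(4)[OF f] by simp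
 hence e: "us ! Min (cups us) = Some (Vertex (tgt ?q))" using f(1) by(metis nth_list_update_eq)
 moreover have "tgt ?q = ix (Min (cups us))" using okw_cup(3)[OF norm_ok] ne by simp
 ultimately show "us ! Min (cups us) = Some (Vertex (ix (Min (cups us))))" by simp
 thus "tgt b = ix (Min (cups us))" using r(2) first_index(3)[OF f] by simp
qed

lemma norm_close: "mul b (the (us ! Min (cups us))) = Some b" using norm_first by(simp add: mul_Vertex_right)

lemma norm_tr: "tr (us, b) = elt (word_gen us b)" using ne norm_close by(simp add: tr_def)

lemma norm_compat: "compat (cups us) (follow us b)" by(rule follow_compat[OF norm_ok norm_close ne])

lemma norm_bound: "cups us <= {..<length w}" "length us = length w"
proof -
 show "cups us <= {..<length w}" by(rule cups_bound[OF norm_ok])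
 hence "w ~= []" using ne by auto
 thus "length us = length w" using okw_length[OF norm_ok] by(simp add: ls_def)
qed

text \<open>Before the first cup-cap diagram the product is formed only on closing up; normalized words start with a constant path.\<close>

lemma slide_remove:
 assumes j: "j : cups us" "us ! j = Some p" and ne': "cups us - {j} ~= {}"
 defines "a == prv (cups us - {j}) j"
 shows "lin tr (slide us b j None p) = (case mul (follow us b a) (follow us b j) of None => 0
  | Some e => elt (gen (cups us - {j}) (plus_of (cups us - {j}) ((follow us b)(a := e)))))"
proof -
 let ?U = "cups us" and ?E = "follow us b"
 let ?U' = "?U - {j}"
 have jl: "j < length us" using j by(simp add: cups_def)
 have jU: "insert j ?U' = ?U" using j by auto
 have f': "finite ?U'" by simp
 have "j ~: ?U'" by simp
 note sp = nxt_split[OF f' ne' this a_def[THEN meta_eq_to_obj_eq], unfolded jU]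
 have a: "a : ?U'" "a ~= j" using sp(1) by auto
 note na = sp(2)
 have nj: "nxt ?U' a = nxt ?U j" using sp(3,4) by simp
 have no: "nxt ?U' c = nxt ?U c" and ext: "(EX z:?U'. c < z) <-> (EX z:?U. c < z)"
  and inj: "nxt ?U c ~= nxt ?U j" "nxt ?U c ~= j" if "c : ?U'" "c ~= a" for c using sp(6)[OF that] sp(3) by auto
 show ?thesis
 proof(cases "mul p (?E j)")
  case None
  have "mul (?E a) (?E j) = None"
  proof(cases "a < j")
  case True
  hence "?E a = p" using na j by(auto simp: follow_def)
  thus ?thesis using None by simp
  next
  case False
  have "j <= i" if "i : ?U'" for i using sp(7)[OF that] False by simp
  hence "Min ?U = j" using j by(intro Min_eqI) auto
  hence "p = Vertex (ix j)" using norm_first(1) j by simp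
  thus ?thesis using None okw_cup(4)[OF norm_ok j(1)] by simp
  qed
  thus ?thesis using None by(simp add: slide_def)
 next
  case (Some e)
  show ?thesis
  proof(cases "a < j")
  case True
  hence Ea: "?E a = p" using na j by(auto simp: follow_def)
  have M: "Min ?U' = Min ?U" "Min ?U < j"
  proof -
  show 1: "Min ?U < j" by(rule le_less_trans[OF Min_le[OF cups_finite] True]) (use a(1) in auto)
  have "Min ?U : ?U'" using 1 ne by auto
  thus "Min ?U' = Min ?U" by(intro Min_eqI) auto
  qed
  have "lin tr (slide us b j None p) = elt (gen ?U' (plus_of ?U' (?E(a := e))))"
  proof(cases "EX z:?U. j < z")
  case z: True
  note nz = next_cup[OF z]
  let ?z = "nxt ?U j"
  let ?v = "us[j := None, ?z := Some e]"
  have U: "cups ?v = ?U'" using jl nz by(auto simp: cups_update)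
  have "mul b (the (?v ! Min ?U)) = Some b" using norm_close M(2) nz(2) by simp
  moreover have "plus_of ?U' (follow ?v b) = plus_of ?U' (?E(a := e))"
  proof(rule plus_of_cong)
  fix c assume c: "c : ?U'"
  show "follow ?v b c = (?E(a := e)) c"
  proof(cases "c = a")
  case True
  have "EX z:?U'. a < z" using nz(1,2) `a < j` by(intro bexI[of _ ?z]) auto
  thus ?thesis using True nz(4) by(simp add: follow_def U nj)
  next
  case False
  thus ?thesis using False ext[OF c False] no[OF c False] inj[OF c False] by(simp add: follow_def U)
  qed
  qed
  ultimately show ?thesis using Some z ne' M by(simp add: slide_def tr_def U)
  next
  case z: False
  let ?v = "us[j := None]"
  have U: "cups ?v = ?U'" using jl by(auto simp: cups_update)
  have "tgt e = tgt b" using mul_Some[OF Some] z by(simp add: follow_def)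
  hence "mul e (the (?v ! Min ?U)) = Some e" using norm_first M(2) by(simp add: mul_Vertex_right)
  moreover have "plus_of ?U' (follow ?v e) = plus_of ?U' (?E(a := e))"
  proof(rule plus_of_cong)
  fix c assume c: "c : ?U'"
  show "follow ?v e c = (?E(a := e)) c"
  proof(cases "c = a")
  case True
  have "~ (EX z:?U'. a < z)"
  proof
  assume "EX z:?U'. a < z"
  then obtain i where i: "i : ?U" "i ~= j" "a < i" by auto
  hence "i < j" using z by(metis linorder_neqE_nat)
  thus False using sp(7)[of i] i `a < j` by simp
  qed
  thus ?thesis using True by(simp add: follow_def U)
  next
  case False
  note inj[OF c False]
  moreover have "EX z:?U. c < z"
  proof -
  have "c < j" using z c by(metis DiffD1 DiffD2 linorder_neqE_nat singletonI)
  thus ?thesis using j by blast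
  qed
  ultimately show ?thesis using False ext[OF c False] no[OF c False] by(simp add: follow_def U)
  qed
  qed
  ultimately show ?thesis using Some z ne' M by(simp add: slide_def tr_def U)
  qed
  thus ?thesis using Some Ea by simp
  next
  case False
  have min: "j <= i & i <= a" if "i : ?U'" for i using sp(7)[OF that] False by simp
  hence Mj: "Min ?U = j" using j by(intro Min_eqI) auto
  hence p: "p = Vertex (ix j)" using norm_first(1) j by simp
  have e: "e = ?E j" using Some p by(simp split: if_splits)
  have aj: "j < a" using min[OF a(1)] a(2) by simp
  have z: "EX z:?U. j < z" using a(1) aj by auto
  note nz = next_cup[OF z]
  let ?z = "nxt ?U j"
  let ?v = "us[j := None, ?z := Some e]"
  have U: "cups ?v = ?U'" using jl nz by(auto simp: cups_update)
  have "~ (EX z:?U. a < z)" using min aj by(metis Diff_iff leD less_asym singletonD)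
  hence Ea: "?E a = b" by(simp add: follow_def)
  have M': "Min ?U' = ?z"
  proof(rule Min_eqI)
  fix i assume i: "i : ?U'"
  hence "j < i" using min[OF i] by auto
  show "?z <= i"
  proof(rule ccontr)
  assume "~ ?z <= i"
  hence "us ! i = None" using nz(3)[of i] `j < i` by simp
  thus False using i by(auto simp: cups_def)
  qed
  qed(use nz in auto)
  have pl: "plus_of ?U' (follow ?v d) = plus_of ?U' (?E(a := d))" for d
  proof(rule plus_of_cong)
  fix c assume c: "c : ?U'"
  show "follow ?v d c = (?E(a := d)) c"
  proof(cases "c = a")
  case True
  have "~ (EX z:?U'. a < z)" using min by(metis leD)
  thus ?thesis using True by(simp add: follow_def U)
  next
  case False
  note inj[OF c False]
  moreover have "EX z:?U. c < z" using min[OF c] False a(1) by(intro bexI[of _ a]) auto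
  ultimately show ?thesis using False ext[OF c False] no[OF c False] by(simp add: follow_def U)
  qed
  qed
  have "tr (?v, b) = (case mul b e of None => 0 | Some d => elt (gen ?U' (plus_of ?U' (?E(a := d)))))"
  using ne' nz(4) by(simp add: tr_def U M' pl split: option.split)
  moreover have "slide us b j None p = elt (?v, b)" using Some z by(simp add: slide_def)
  ultimately show ?thesis using Ea e by simp
  qed
 qed
qed

text \<open>
  Before the first cup-cap diagram the left factor of \<open>\<gamma>\<^sub>i(1)\<close> meets the path at the end of the word
  instead; the sum is the same because \<open>\<gamma>\<^sub>i(1)\<close> is central.
\<close>

lemma slide_insert:
 assumes j: "j < length us" "j ~: cups us"
 defines "a == prv (cups us) j"
 shows "lin (%t. lin tr (slide us b j (Some (fst t)) (snd t))) (gamv m (ix j)) = gamma_sum m (ix j)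
  (%t e. elt (gen (insert j (cups us)) (plus_of (insert j (cups us)) ((follow us b)(a := t, j := e))))) (follow us b a)"
proof -
 let ?U = "cups us" and ?E = "follow us b"
 let ?U' = "insert j ?U"
 let ?F = "%t e. elt (gen ?U' (plus_of ?U' (?E(a := t, j := e))))"
 note f = cups_finite[of us]
 note sp = nxt_split[OF f ne j(2) a_def[THEN meta_eq_to_obj_eq]]
 note na = sp(2) and nj = sp(3) and njj = sp(4) and zj = sp(5)
 have a: "a : ?U" "a ~= j" using sp(1) j by auto
 note no = sp(6)[THEN conjunct1] and ext = sp(6)[THEN conjunct2, THEN conjunct1]
  and inj = sp(6)[THEN conjunct2, THEN conjunct2, THEN conjunct1] sp(6)[THEN conjunct2, THEN conjunct2, THEN conjunct2]
 show ?thesis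
 proof(cases "a < j")
  case True
  have fj: "follow us b j = ?E a"
  proof(cases "EX z:?U. j < z")
  case z: True
  hence "EX z:?U. a < z" using True by(meson less_trans)
  thus ?thesis using z njj by(simp add: follow_def)
  next
  case z: False
  have "~ (EX z:?U. a < z)"
  proof
  assume "EX z:?U. a < z"
  then obtain i where i: "i : ?U" "a < i" by auto
  hence "i < j" using z j(2) by(metis linorder_neqE_nat)
  thus False using sp(7)[OF i(1)] True i(2) by simp
  qed
  thus ?thesis using z by(simp add: follow_def)
  qed
  have M: "Min ?U < j" by(rule le_less_trans[OF Min_le[OF cups_finite] True]) (use a(1) in auto)
  have M': "Min ?U' = Min ?U" using M ne f by simp
  have "lin tr (slide us b j (Some t1) t2) = (case mul t2 (?E a) of None => 0 | Some e => ?F t1 e)" for t1 t2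
  proof(cases "mul t2 (?E a)")
  case None
  thus ?thesis by(simp add: slide_def fj)
  next
  case (Some e)
  show ?thesis
  proof(cases "EX z:?U. j < z")
  case z: True
  note nz = next_cup[OF z]
  let ?v = "us[j := Some t1, nxt ?U j := Some e]"
  have U: "cups ?v = ?U'" using j nz by(auto simp: cups_update)
  have "plus_of ?U' (follow ?v b) = plus_of ?U' (?E(a := t1, j := e))"
  proof(rule plus_of_cong)
  fix c assume "c : ?U'"
  then consider "c = j" | "c = a" | "c : ?U" "c ~= a" "c ~= j" by blast
  thus "follow ?v b c = (?E(a := t1, j := e)) c"
  proof cases
  case 1
  thus ?thesis using z nz(4) by(simp add: follow_def U nj)
  next
  case 2
  thus ?thesis using True j(1) zj a(2) by(simp add: follow_def U na)
  next
  case 3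
  thus ?thesis using ext[OF 3(1,2)] no[OF 3(1,2)] inj[OF 3(1,2)] by(simp add: follow_def U)
  qed
  qed
  moreover have "mul b (the (?v ! Min ?U)) = Some b" using norm_close M nz(2) by simp
  ultimately show ?thesis using Some z ne M' by(simp add: slide_def fj tr_def U)
  next
  case z: False
  let ?v = "us[j := Some t1]"
  have U: "cups ?v = ?U'" using j by(auto simp: cups_update)
  have Eb: "?E a = b" using fj z by(simp add: follow_def)
  have "plus_of ?U' (follow ?v e) = plus_of ?U' (?E(a := t1, j := e))"
  proof(rule plus_of_cong)
  fix c assume "c : ?U'"
  then consider "c = j" | "c = a" | "c : ?U" "c ~= a" "c ~= j" by blast
  thus "follow ?v e c = (?E(a := t1, j := e)) c"
  proof cases
  case 1
  thus ?thesis using z by(simp add: follow_def U)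
  next
  case 2
  thus ?thesis using True j(1) a(2) by(simp add: follow_def U na)
  next
  case 3
  hence "c < j" using z by(metis linorder_neqE_nat)
  hence "EX z:?U'. c < z" by blast
  hence "EX z:?U. c < z" using ext[OF 3(1,2)] by blast
  thus ?thesis using 3 `c < j` no[OF 3(1,2)] inj[OF 3(1,2)] by(simp add: follow_def U)
  qed
  qed
  moreover have "mul e (the (?v ! Min ?U)) = Some e" using norm_first mul_Some[OF Some] Eb M by(simp add: mul_Vertex_right)
  ultimately show ?thesis using Some z ne M' by(simp add: slide_def fj tr_def U)
  qed
  qed
  thus ?thesis unfolding gamma_sum_def by(intro lin_cong) (simp add: case_prod_beta)
 next
  case False
  have min: "j < i & i <= a" if "i : ?U" for i using sp(7)[OF that] False by simp
  have z: "EX z:?U. j < z" using min a by blast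
  note nz = next_cup[OF z]
  let ?z = "nxt ?U j"
  have Mz: "Min ?U = ?z"
  proof(rule Min_eqI[OF f])
  fix i assume i: "i : ?U"
  show "?z <= i"
  proof(rule ccontr)
  assume "~ ?z <= i"
  hence "us ! i = None" using nz(3)[of i] min[OF i] by simp
  thus False using i by(auto simp: cups_def)
  qed
  qed(use nz in auto)
  have M': "Min ?U' = j" using min f by(intro Min_eqI) (auto intro: less_imp_le)
  have last: "~ (EX z:?U. a < z)" using min by(meson leD)
  hence Eb: "?E a = b" by(simp add: follow_def)
  have fj: "follow us b j = Vertex (ix ?z)" using z norm_first(1) Mz by(simp add: follow_def)
  have tb: "tgt b = ix ?z" using norm_first(2) Mz by simp
  have "lin tr (slide us b j (Some t1) t2) = lin (%(t, e). ?F t e) (elto (lpp b (t1, t2)))"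
  if t: "src t1 = tgt t2" for t1 t2
  proof(cases "tgt t2 = ix ?z")
  case F: False
  have "mul b t1 = None"
  proof(cases "mul b t1")
  case (Some d)
  hence "tgt b = src t1" by(rule mul_Some(1))
  thus ?thesis using F t tb by simp
  qed
  thus ?thesis using F by(simp add: slide_def fj mul_Vertex_right lpp_def)
  next
  case T: True
  let ?v = "us[j := Some t1, ?z := Some t2]"
  have U: "cups ?v = ?U'" using j nz by(auto simp: cups_update)
  have pl: "plus_of ?U' (follow ?v d) = plus_of ?U' (?E(a := d, j := t2))" for d
  proof(rule plus_of_cong)
  fix c assume "c : ?U'"
  then consider "c = j" | "c = a" | "c : ?U" "c ~= a" "c ~= j" by blast
  thus "follow ?v d c = (?E(a := d, j := t2)) c"
  proof cases
  case 1
  thus ?thesis using z nz(4) by(simp add: follow_def U nj)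
  next
  case 2
  thus ?thesis using last False a(2) by(simp add: follow_def U)
  next
  case 3
  have "EX z:?U. c < z" using min[OF 3(1)] 3(2) a(1) by(intro bexI[of _ a]) auto
  thus ?thesis using 3 ext[OF 3(1,2)] no[OF 3(1,2)] inj[OF 3(1,2)] by(simp add: follow_def U)
  qed
  qed
  have "slide us b j (Some t1) t2 = elt (?v, b)" using z T by(simp add: slide_def fj mul_Vertex_right)
  moreover have "tr (?v, b) = (case mul b t1 of None => 0 | Some d => ?F d t2)" using nz(2) j(1) by(simp add: tr_def U M' pl split: option.split)
  ultimately show ?thesis by(cases "mul b t1") (simp_all add: lpp_def)
  qed
  hence "lin (%t. lin tr (slide us b j (Some (fst t)) (snd t))) (gamv m (ix j)) =
  lin (%t. lin (%(t, e). ?F t e) (elto (lpp b t))) (gamv m (ix j))" using x[of j] j(1) norm_bound(2) by(intro lin_cong_vec[OF gamv_vec]) auto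
  also have "... = lin (%(t, e). ?F t e) (lin (%t. elto (rpp t b)) (gamv m (ix j)))"
  using gamv_central[OF okw_last[OF norm_ok], of "ix j"] x[of j] j(1) norm_bound(2) by(simp add: lin_lin)
  also have "... = gamma_sum m (ix j) ?F b" unfolding gamma_sum_def lin_lin
  proof(rule lin_cong)
  fix t :: "kb \<times> kb"
  show "lin (%(t, e). ?F t e) (elto (rpp t b)) = (case t of (t1, t2) => case mul t2 b of None => 0 | Some e => ?F t1 e)"
  by(cases t; cases "mul (snd t) b") (simp_all add: rpp_def)
  qed
  finally show ?thesis unfolding Eb .
 qed
qed

end

lemma slide_single:
 assumes norm: "(us, b) : Norm m ls" and U: "cups us = {j}" "us ! j = Some p"
 shows "lin tr (slide us b j None p) =
  (if len b = 0 then elt (gen {} (strands (ix j - 1))) + elt (gen {} (strands (ix j))) else 0)"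
proof -
 have ne: "cups us ~= {}" using U by simp
 note nf = norm_first[OF norm ne] and ok = norm_ok[OF norm]
 have j: "j < length us" "j < length w" using U cups_bound[OF ok] by(auto simp: cups_def)
 have p: "p = Vertex (ix j)" using nf(1) U by simp
 have "follow us b j = b" using U(1) by(simp add: follow_def)
 hence sb: "src b = ix j" using okw_cup(4)[OF ok, of j] U(1) by simp
 have "slide us b j None p = elt (us[j := None], b)" using U(1) sb by(simp add: slide_def follow_def p)
 moreover have "cups (us[j := None]) = {}" using U(1) j(1) by(simp add: cups_update)
 moreover have "b = Vertex (ix j) | b = Loop (ix j)" using KB_ends(1)[OF okw_last[OF ok] sb] nf(2) U(1) by simp
 moreover have "ix j ~= 0" using x[OF j(2)] by simp
 ultimately show ?thesis by(auto simp: tr_def)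
qed

lemma slide_first:
 assumes U: "cups us = {}" and j: "j < length us" "j < length w" and s: "s <= m"
 shows "lin (%t. lin tr (slide us (Vertex s) j (Some (fst t)) (snd t))) (gamv m (ix j)) =
  (if near s (ix j) & s ~= ix j then elt (gen {j} Nts) else 0)"
proof -
 have F: "lin tr (slide us (Vertex s) j (Some t1) t2) =
  (case Option.bind (mul t2 (Vertex s)) (%e. mul e t1) of None => 0 | Some c => elt (gen {j} (plus_of {j} (%_. c))))" for t1 t2
 proof -
  have c: "cups (us[j := Some t1]) = {j}" using U j(1) by(simp add: cups_update)
  have "plus_of {j} (follow (us[j := Some t1]) d) = plus_of {j} (%_. d)" for d by(rule plus_of_cong) (simp add: follow_def c)
  moreover have "follow us (Vertex s) j = Vertex s" using U by(simp add: follow_def)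
  ultimately show ?thesis using U j(1) by(simp add: slide_def tr_def c split: option.split)
 qed
 have L: "plus_of {j} (%_. Loop i) = Nts" for i by(simp add: plus_of_def)
 have i: "1 <= ix j" "ix j <= m" using x[OF j(2)] by auto
 show ?thesis using i s unfolding gamv_def lin_add by(auto simp: F L near_def le_Suc_eq)
qed

end

section \<open>The trace as a map of complexes\<close>

lemma wh_sum: "length us = length ls ==> wh ls (us, b) = (SUM j<length ls. uh (ls ! j) (us ! j))"
proof(induction ls arbitrary: us)
 case (Cons l ls)
 then obtain u vs where "us = u # vs" "length vs = length ls" by(cases us) auto
 thus ?case using Cons.IH[of vs] by(simp add: sum.lessThan_Suc_shift del: sum.lessThan_Suc)
qed simp

lemma wq_sum: "length us = length ls ==> wq ls (us, b) = (SUM j<length ls. uq (ls ! j) (us ! j)) - int (len b)"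
proof(induction ls arbitrary: us)
 case (Cons l ls)
 then obtain u vs where "us = u # vs" "length vs = length ls" by(cases us) auto
 thus ?case using Cons.IH[of vs] by(simp add: sum.lessThan_Suc_shift del: sum.lessThan_Suc)
qed simp

lemma sum_len_follow:
 assumes ne: "cups us ~= {}" and c: "mul b (the (us ! Min (cups us))) = Some c"
 shows "(SUM a:cups us. int (len (follow us c a))) = (SUM j:cups us. int (len (the (us ! j)))) + int (len b)"
proof -
 let ?U = "cups us"
 have M: "Max ?U : ?U" using ne by simp
 have "int (len (follow us c a)) = int (len (the (us ! nxt ?U a))) + (if a = Max ?U then int (len b) else 0)" if a: "a : ?U" for a
 proof(cases "a = Max ?U")
  case True
  hence "~ (EX z:?U. a < z)" by(simp add: not_less)
  thus ?thesis using True mul_Some(4)[OF c] by(simp add: follow_def nxt_def)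
 next
  case False
  hence "EX z:?U. a < z" using M Max_ge[OF cups_finite a] by(intro bexI[of _ "Max ?U"]) auto
  thus ?thesis using False by(simp add: follow_def)
 qed
 hence "(SUM a:?U. int (len (follow us c a))) =
  (SUM a:?U. int (len (the (us ! nxt ?U a))) + (if a = Max ?U then int (len b) else 0))" by(intro sum.cong) auto
 also have "... = (SUM a:?U. int (len (the (us ! nxt ?U a)))) + int (len b)" using M by(simp add: sum.distrib)
 also have "(SUM a:?U. int (len (the (us ! nxt ?U a)))) = (SUM j:?U. int (len (the (us ! j))))"
 proof(rule sum.reindex_bij_betw)
  show "bij_betw (nxt ?U) ?U ?U" by(rule bij_betwI[where g = "prv ?U"]) (use ne in "auto simp: nxt_in prv_in prv_nxt nxt_prv")
 qed
 finally show ?thesis .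
qed

context braid_closure
begin

subsection \<open>The cube of resolutions\<close>

lemma sign_cases: "j < length w ==> (snd (w ! j) = 1 ==> P) ==> (snd (w ! j) = -1 ==> P) ==> P" using sign by blast

lemma mirror_nth: "j < length w ==> mirror w ! j = (ix j, - snd (w ! j))" by(simp add: mirror_def case_prod_beta)

lemma length_mirror [simp]: "length (mirror w) = length w" by(simp add: mirror_def)

definition support :: "int list => nat set" where
 "support v = {j. j < length w & (v ! j = 1) = (snd (w ! j) = -1)}"

lemma vtx_nth: "j < length w ==> vtx U ! j = (if (j : U) = (snd (w ! j) = -1) then 1 else -1)" by(simp add: vtx_def)

lemma length_vtx [simp]: "length (vtx U) = length w" by(simp add: vtx_def)

lemma support_vtx: "U <= {..<length w} ==> support (vtx U) = U"
proof(rule Set.set_eqI)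
 fix j assume U: "U <= {..<length w}"
 show "j : support (vtx U) <-> j : U" using U by(cases "j < length w") (auto simp: support_def vtx_nth split: if_splits)
qed

lemma vtx_cube: "vtx U : cube (length w)" by(auto simp: cube_def vtx_def)

lemma vtx_support: "v : cube (length w) ==> vtx (support v) = v"
proof(rule nth_equalityI)
 assume v: "v : cube (length w)"
 thus "length (vtx (support v)) = length v" by(simp add: cube_def)
 fix j assume "j < length (vtx (support v))"
 hence j: "j < length w" by simp
 have "v ! j : set v" using v j by(intro nth_mem) (simp add: cube_def)
 hence "v ! j : {-1, 1}" using v unfolding cube_def by blast
 thus "vtx (support v) ! j = v ! j" using j by(auto simp: vtx_nth support_def)
qed

lemma support_bound: "support v <= {..<length w}" by(auto simp: support_def)

lemma resolution_arcs_vtx: "resolution_arcs m (mirror w) (vtx U) = arcs U"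
proof -
 have "(case mirror w ! j of (i, \<delta>) => if vtx U ! j * \<delta> = 1 then cup_cap_arcs m i j else id_arcs m j) =
  (if j : U then cup_cap_arcs m (ix j) j else id_arcs m j)" if j: "j < length w" for j
  using j by(rule sign_cases) (simp_all add: j mirror_nth vtx_nth)
 thus ?thesis by(simp add: resolution_arcs_def arcs_def)
qed

lemma circles_vtx: "circles m (mirror w) (vtx U) = circ U" by(simp add: circles_def circ_def conn_def grid_def resolution_arcs_vtx)

abbreviation gens :: "skh_gen set" where
 "gens == skh_gens m (mirror w) (int m - 1)"

lemma gens_vtx: "(vtx U, P) : gens <-> P : plus_sets U" using vtx_cube by(auto simp: skh_gens_def deg_f_def circles_vtx plus_sets_def)

lemma gens_cases:
 assumes "g : gens"
 obtains U P where "g = (vtx U, P)" "U <= {..<length w}" "P : plus_sets U" "support (fst g) = U"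
proof -
 obtain v P where g: "g = (v, P)" by(cases g)
 hence v: "v : cube (length w)" using assms by(auto simp: skh_gens_def)
 have "P : plus_sets (support v)" using assms gens_vtx[of "support v" P] vtx_support[OF v] g by simp
 thus thesis using that[of "support v" P] g vtx_support[OF v] support_bound by simp
qed

definition flip :: "nat set => nat => nat set" where
 "flip U j = (if j : U then U - {j} else insert j U)"

lemma vtx_flip: "j < length w ==> vtx U ! j = -1 ==> (vtx U)[j := 1] = vtx (flip U j)"
 by(rule nth_equalityI) (auto simp: vtx_nth flip_def nth_list_update split: if_splits)

lemma flip_bound: "U <= {..<length w} ==> j < length w ==> flip U j <= {..<length w}" by(auto simp: flip_def)

lemma edge_term_vtx: "edge_term m (mirror w) (vtx U, P) (vtx U', P') <->
  (EX j<length w. vtx U ! j = -1 & vtx U' = (vtx U)[j := 1]) & step U P U' P'"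
 unfolding edge_term_def step_def circles_vtx length_mirror prod.case Let_def ..

definition delta :: "skh_gen => skh_gen fvec" where
 "delta g = (SUM g' | g' : gens & edge_term m (mirror w) g g'. elt g')"

lemma delta_vtx:
 assumes U: "U <= {..<length w}"
 shows "delta (vtx U, P) = (SUM j<length w. if vtx U ! j = -1
  then SUM P':plus_steps U P (flip U j). elt (vtx (flip U j), P') else 0)"
proof -
 let ?J = "{j : {..<length w}. vtx U ! j = -1}"
 let ?A = "%j. (%P'. (vtx (flip U j), P')) ` plus_steps U P (flip U j)"
 have "{g'. g' : gens & edge_term m (mirror w) (vtx U, P) g'} = (UN j:?J. ?A j)" (is "?L = ?R")
 proof
  show "?L <= ?R"
  proof
  fix g' assume g': "g' : ?L"
  then obtain U' P' where g: "g' = (vtx U', P')" "U' <= {..<length w}" "P' : plus_sets U'" by(auto elim: gens_cases)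
  then obtain j where j: "j < length w" "vtx U ! j = -1" "vtx U' = (vtx U)[j := 1]" "step U P U' P'" using g' edge_term_vtx by auto
  have "vtx U' = vtx (flip U j)" using j vtx_flip by simp
  hence "U' = flip U j" using support_vtx[OF g(2)] support_vtx[OF flip_bound[OF U j(1)]] by metis
  thus "g' : ?R" using g j by(auto simp: plus_steps_def)
  qed
  show "?R <= ?L"
  proof
  fix g' assume "g' : ?R"
  then obtain j P' where j: "j < length w" "vtx U ! j = -1" "g' = (vtx (flip U j), P')" "P' : plus_sets (flip U j)"
  "step U P (flip U j) P'" by(auto simp: plus_steps_def)
  thus "g' : ?L" using gens_vtx edge_term_vtx vtx_flip by auto
  qed
 qed
 moreover have fA: "finite (?A j)" for j using finite_plus_sets by(simp add: plus_steps_def)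
 moreover have "?A j Int ?A j' = {}" if j: "j : ?J" "j' : ?J" "j ~= j'" for j j'
 proof -
  have "vtx (flip U j) ! j = 1" "vtx (flip U j') ! j = -1" using j vtx_flip[of j U] vtx_flip[of j' U] by(simp_all flip: vtx_flip)
  thus ?thesis by auto
 qed
 ultimately have "delta (vtx U, P) = (SUM j:?J. SUM g:?A j. elt g)" unfolding delta_def by(simp only:) (rule sum.UNION_disjoint, auto)
 also have "... = (SUM j:?J. SUM P':plus_steps U P (flip U j). elt (vtx (flip U j), P'))"
  by(intro sum.cong refl sum.reindex_cong) (auto simp: inj_on_def)
 also have "... = (SUM j<length w. if vtx U ! j = -1
  then SUM P':plus_steps U P (flip U j). elt (vtx (flip U j), P') else 0)" by(rule sum.inter_filter) simp
 finally show ?thesis .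
qed

subsection \<open>The trace commutes with the differentials\<close>

lemma Norm_cases:
 assumes "y : Norm m ls"
 obtains us b where "y = (us, b)" "(us, b) : Norm m ls" "cups us ~= {}" "ls = w" "length us = length w"
  | us s where "y = (us, Vertex s)" "cups us = {}" "s <= m" "us = nones ls"
proof -
 obtain us b where y: "y = (us, b)" by(cases y)
 have ok: "okw m ls (us, b)" using assms y by(simp add: Norm_def NW_def)
 show thesis
 proof(cases "cups us = {}")
  case False
  hence "w ~= []" using cups_bound[OF ok] by auto
  hence "ls = w" by(simp add: ls_def)
  thus ?thesis using that(1)[OF y] assms y False okw_length[OF ok] by simp
 next
  case True
  then obtain s where "b = Vertex s" using assms y by(auto simp: Norm_def has_cup_iff)
  moreover have "us = nones ls" using True okw_length[OF ok] by(intro nth_equalityI) (auto simp: cups_def)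
  ultimately show ?thesis using that(2)[of us s] y True okw_last[OF ok] by simp
 qed
qed

lemma inj_Pair_vtx: "inj (Pair (vtx U))" by(simp add: inj_on_def)

lemma tr_chain:
 assumes "y : Norm m ls"
 shows "lin tr (dnw m ls y) = lin delta (tr y)" using assms
proof(cases rule: Norm_cases)
 case (1 us b)
 let ?U = "cups us" and ?E = "follow us b"
 note N = 1(2) 1(3)
 have U: "?U <= {..<length w}" by(rule norm_bound(1)[OF N])
 note cp = norm_compat[OF N]
 have "lin delta (tr y) = delta (vtx ?U, fib ?U ` plus_of ?U ?E)" by(simp add: 1(1) norm_tr[OF N] gen_def)
 also have "... = (SUM j<length w. case us ! j of
  None => if snd (w ! j) = -1 then lin (%t. lin tr (slide us b j (Some (fst t)) (snd t))) (gamv m (ix j)) else 0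
  | Some p => if snd (w ! j) = 1 then lin tr (slide us b j None p) else 0)" unfolding delta_vtx[OF U]
 proof(rule sum.cong[OF refl])
  fix j assume "j : {..<length w}"
  hence j: "j < length w" "j < length us" using 1(5) by auto
  show "(if vtx ?U ! j = -1 then SUM P':plus_steps ?U (fib ?U ` plus_of ?U ?E) (flip ?U j). elt (vtx (flip ?U j), P') else 0) =
  (case us ! j of
  None => if snd (w ! j) = -1 then lin (%t. lin tr (slide us b j (Some (fst t)) (snd t))) (gamv m (ix j)) else 0
  | Some p => if snd (w ! j) = 1 then lin tr (slide us b j None p) else 0)"
  proof(cases "us ! j")
  case None
  hence jU: "j ~: ?U" by(simp add: cups_def)
  have v: "vtx ?U ! j = -1 <-> snd (w ! j) = -1" using jU j by(simp add: vtx_nth)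
  have fl: "flip ?U j = insert j ?U" using jU by(simp add: flip_def)
  show ?thesis unfolding v fl None option.case slide_insert[OF N j(2) jU]
  insert_cup[OF U 1(3) j(1) jU cp inj_Pair_vtx] gen_def ..
  next
  case (Some p)
  hence jU: "j : ?U" using j by(simp add: cups_def)
  have v: "vtx ?U ! j = -1 <-> snd (w ! j) = 1" using jU j sign[OF j(1)] by(auto simp: vtx_nth)
  have fl: "flip ?U j = ?U - {j}" using jU by(simp add: flip_def)
  have ji: "insert j (?U - {j}) = ?U" using jU by auto
  have "(SUM P':plus_steps ?U (fib ?U ` plus_of ?U ?E) (?U - {j}). elt (vtx (?U - {j}), P')) = lin tr (slide us b j None p)"
  proof(cases "?U - {j} = {}")
  case False
  have U': "?U - {j} <= {..<length w}" using U by auto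
  have "j ~: ?U - {j}" by simp
  note rc = remove_cup[OF U' False j(1) this, unfolded ji, OF cp]
  show ?thesis unfolding slide_remove[OF N jU Some False] rc by(cases "mul (?E (prv (?U - {j}) j)) (?E j)") (simp_all add: gen_def)
  next
  case True
  hence Uj: "?U = {j}" using jU by auto
  have Eb: "?E j = b" by(simp add: follow_def Uj)
  have Q: "plus_of {j} ?E = (if len b = 0 then insert (Tr j) Nts else Nts)" using Eb by(auto simp: plus_of_def)
  have st: "plus_steps {j} (fib {j} ` plus_of {j} ?E) {} =
  (if len b = 0 then {fib {} ` strands (ix j - 1), fib {} ` strands (ix j)} else {})"
  unfolding Q using first_cup(2)[OF j(1), of "insert (Tr j) Nts"] first_cup(2)[OF j(1), of Nts] by simp
  have "fib {} ` strands (ix j - 1) ~= fib {} ` strands (ix j)"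
  proof -
  have "ix j - 1 ~= ix j" "ix j - 1 <= m" "ix j <= m" using x[OF j(1)] by linarith+
  thus ?thesis using fib_empty_inj by blast
  qed
  thus ?thesis unfolding slide_single[OF 1(2) Uj Some] Uj Diff_cancel st by(simp add: gen_def)
  qed
  thus ?thesis unfolding v fl Some option.case by simp
  qed
 qed
 also have "... = lin tr (dnw m ls y)" unfolding 1(1,4) dnw_slide[OF 1(5)] lin_sum by(intro sum.cong refl) (simp add: lin_lin split: option.split)
 finally show ?thesis ..
next
 case (2 us s)
 have l: "length us = length ls" using 2 by simp
 have none: "us ! j = None" if "j < length ls" for j using 2(4) that by simp
 have tr: "tr y = (if s = 0 then 0 else elt (gen {} (strands (s - 1)))) + elt (gen {} (strands s))" using 2 by(simp add: tr_def)
 let ?D = "%t j. if vtx {} ! j = -1 then SUM P':plus_steps {} (fib {} ` strands t) (flip {} j). elt (vtx (flip {} j), P') else 0"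
 have D: "delta (gen {} (strands t)) = (SUM j<length w. ?D t j)" for t by(simp add: gen_def delta_vtx)
 have "lin delta (tr y) = (SUM j<length w. (if s = 0 then 0 else ?D (s - 1) j) + ?D s j)"
 proof -
  have "lin delta (if s = 0 then 0 else elt (gen {} (strands (s - 1)))) = (SUM j<length w. if s = 0 then 0 else ?D (s - 1) j)"
  proof(cases "s = 0")
  case True
  show ?thesis unfolding if_P[OF True] by simp
  next
  case False
  show ?thesis unfolding if_not_P[OF False] by(simp only: lin_elt D)
  qed
  thus ?thesis unfolding tr lin_add sum.distrib by(simp only: lin_elt D)
 qed
 also have "... = (SUM j<length w. if snd (w ! j) = -1
  then lin (%t. lin tr (slide us (Vertex s) j (Some (fst t)) (snd t))) (gamv m (ix j)) else 0)"
 proof(rule sum.cong[OF refl])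
  fix j assume "j : {..<length w}"
  hence j: "j < length w" "j < length us" using l by(auto simp: ls_def)
  have v: "vtx {} ! j = -1 <-> snd (w ! j) = -1" using j by(simp add: vtx_nth)
  have fl: "flip {} j = {j}" by(simp add: flip_def)
  have d: "(SUM P':plus_steps {} (fib {} ` strands t) {j}. elt (vtx {j}, P')) =
  (if t : {ix j - 1, ix j} then elt (gen {j} Nts) else 0)" if "t <= m" for t unfolding first_cup(1)[OF j(1) that] by(simp add: gen_def)
  show "(if s = 0 then 0 else ?D (s - 1) j) + ?D s j = (if snd (w ! j) = -1
  then lin (%t. lin tr (slide us (Vertex s) j (Some (fst t)) (snd t))) (gamv m (ix j)) else 0)"
  unfolding v fl slide_first[OF 2(2) j(2,1) 2(3)] d[OF 2(3)] using d[of "s - 1"] 2(3) x[OF j(1)] by(auto simp: near_def)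
 qed
 also have "... = lin tr (dnw m ls y)"
 proof(cases "w = []")
  case True
  have "ls = [(0, 0)]" unfolding ls_def using True by simp
  thus ?thesis using none[of 0] l by(simp add: True 2(1) dnw_slide)
 next
  case False
  hence lw: "ls = w" by(simp add: ls_def)
  show ?thesis unfolding 2(1) lw dnw_slide[OF l[unfolded lw]] lin_sum by(intro sum.cong refl) (simp add: none[unfolded lw] lin_lin)
 qed
 finally show ?thesis ..
qed

subsection \<open>Gradings\<close>

definition Kd :: "int => int => skh_gen set" where
 "Kd h q = {g : gens. deg_h (mirror w) g = h - n_minus (mirror w) &
  deg_q m (mirror w) g = q + ((int m - 1) + n_plus (mirror w) - 2 * n_minus (mirror w))}"

lemma Kd_vtx: "(vtx U, P) : Kd h q <-> P : plus_sets U & height (vtx U) = h &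
  height (vtx U) + (int (card P) - int (card (circ U - P))) = q + (int m - 1)" by(auto simp: Kd_def gens_vtx deg_h_def deg_q_def circles_vtx)

lemma sum_ls:
 assumes "w = [] ==> F (0, 0) (us ! 0) = (0 :: int)" "length us = length ls"
 shows "(SUM j<length ls. F (ls ! j) (us ! j)) = (SUM j<length w. F (w ! j) (us ! j))"
proof(cases "w = []")
 case True
 have "ls = [(0, 0)]" unfolding ls_def using True by simp
 thus ?thesis using assms(1)[OF True] True by simp
next
 case False
 thus ?thesis by(simp add: ls_def)
qed

lemma wh_vtx:
 assumes "okw m ls (us, b)"
 shows "wh ls (us, b) = height (vtx (cups us))"
  and "wq ls (us, b) = height (vtx (cups us)) + (SUM j:cups us. 1 - int (len (the (us ! j)))) - int (len b)" (is ?g1)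
proof -
 note l = okw_length[OF assms] and U = cups_bound[OF assms]
 have 0: "us ! 0 = None" if "w = []"
 proof -
  have "ls = [(0, 0)]" unfolding ls_def using that by simp
  hence "0 < length us" "0 ~: cups us" using l U that by auto
  thus ?thesis by(simp add: cups_def)
 qed
 have inU: "j : cups us <-> us ! j ~= None" if "j < length w" for j using that l by(auto simp: cups_def ls_def split: if_splits)
 have "height (vtx (cups us)) = (SUM j<length w. (1 + vtx (cups us) ! j) div 2)" by(simp add: height_def sum_list_sum_nth atLeast0LessThan)
 also have h: "... = (SUM j<length w. uh (w ! j) (us ! j))"
 proof(rule sum.cong[OF refl])
  fix j assume "j : {..<length w}"
  hence j: "j < length w" by simp
  show "(1 + vtx (cups us) ! j) div 2 = uh (w ! j) (us ! j)" using inU[OF j] sign[OF j] by(auto simp: vtx_nth[OF j] uh_def)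
 qed
 finally have h: "height (vtx (cups us)) = (SUM j<length w. uh (w ! j) (us ! j))" .
 have "wh ls (us, b) = (SUM j<length ls. uh (ls ! j) (us ! j))" by(rule wh_sum[OF l])
 also have "... = (SUM j<length w. uh (w ! j) (us ! j))" by(rule sum_ls[OF _ l]) (simp add: 0 uh_def)
 finally show "wh ls (us, b) = height (vtx (cups us))" using h by simp
 have "wq ls (us, b) = (SUM j<length ls. uq (ls ! j) (us ! j)) - int (len b)" by(rule wq_sum[OF l])
 also have "(SUM j<length ls. uq (ls ! j) (us ! j)) = (SUM j<length w. uq (w ! j) (us ! j))" by(rule sum_ls[OF _ l]) (simp add: 0 uq_def)
 also have "... = (SUM j<length w. uh (w ! j) (us ! j) + (if j : cups us then 1 - int (len (the (us ! j))) else 0))"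
 proof(rule sum.cong[OF refl])
  fix j assume "j : {..<length w}"
  hence j: "j < length w" by simp
  show "uq (w ! j) (us ! j) = uh (w ! j) (us ! j) + (if j : cups us then 1 - int (len (the (us ! j))) else 0)"
  using inU[OF j] sign[OF j] by(cases "us ! j") (auto simp: uh_def uq_def)
 qed
 also have "... = height (vtx (cups us)) + (SUM j:cups us. 1 - int (len (the (us ! j))))"
  using U by(simp add: sum.distrib h sum.If_cases Int_absorb1 Collect_mem_eq)
 finally show ?g1 by simp
qed

text \<open>A path of length \<open>l\<close> counts \<open>1 - l\<close>: constant paths are labels \<open>w\<^sub>+\<close>, loops \<open>w\<^sub>-\<close>, and edges belong to no trivial circle.\<close>

lemma card_plus_of:
 assumes U: "U <= {..<length w}" "U ~= {}" and E: "compat U E"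
 shows "fib U ` plus_of U E : plus_sets U"
  and "int (card (fib U ` plus_of U E)) - int (card (circ U - fib U ` plus_of U E)) =
  (int m - 1) + (SUM a:U. 1 - int (len (E a)))"
proof -
 note A = compat_admissible[OF E] and Q = compat_plus[OF E U(2)]
 note inj = inj_fib[OF U(1) A] and f = finU[OF U(1)]
 show "fib U ` plus_of U E : plus_sets U" unfolding plus_sets_cup[OF U(1) A U(2)] using Q by blast
 let ?Z = "{a : U. len (E a) = 0}" and ?L = "{a : U. len (E a) = 2}"
 have len: "len (E a) = 0 | len (E a) = 2 | len (E a) = 1 & ix a ~= ix (nxt U a)"
  "len (E a) = 2 ==> ix a = ix (nxt U a)" if a: "a : U" for a
 proof -
  have e: "E a : KB m" "src (E a) = ix a" "tgt (E a) = ix (nxt U a)" using E a by(auto simp: compat_def)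
  show "len (E a) = 0 | len (E a) = 2 | len (E a) = 1 & ix a ~= ix (nxt U a)" "len (E a) = 2 ==> ix a = ix (nxt U a)" using e by(cases "E a"; force)+
 qed
 have "labels U - plus_of U E = Tr ` ?L"
 proof(rule label_set_eqI)
  show "Nt p : labels U - plus_of U E <-> Nt p : Tr ` ?L" for p using U(2) by(auto simp: labels_def)
  show "Tr a : labels U - plus_of U E <-> Tr a : Tr ` ?L" for a using U(2) len[of a] by(auto simp: labels_def)
 qed
 hence "circ U - fib U ` plus_of U E = fib U ` Tr ` ?L"
  unfolding circ_fib[OF U(1) A] inj_on_image_set_diff[OF inj Diff_subset Q(2), symmetric] by(simp only:)
 moreover have "Tr ` ?L <= labels U" using \<open>labels U - plus_of U E = Tr ` ?L\<close> by blast
 ultimately have c1: "card (circ U - fib U ` plus_of U E) = card ?L"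
  using card_image[OF inj_on_subset[OF inj], of "Tr ` ?L"] by(simp add: card_image inj_on_def)
 have "card (fib U ` plus_of U E) = card (plus_of U E)" using inj_on_subset[OF inj Q(2)] by(rule card_image)
 also have "... = card Nts + card (Tr ` ?Z)" unfolding plus_of_def using f card_Nts(1) by(intro card_Un_disjoint) auto
 also have "card (Tr ` ?Z) = card ?Z" by(simp add: card_image inj_on_def)
 finally have c2: "card (fib U ` plus_of U E) = (m - 1) + card ?Z" using card_Nts(2) by simp
 have "(SUM a:U. 1 - int (len (E a))) = (SUM a:U. (if len (E a) = 0 then 1 else 0) - (if len (E a) = 2 then 1 else 0))"
 proof(rule sum.cong[OF refl])
  fix a assume a: "a : U"
  show "1 - int (len (E a)) = (if len (E a) = 0 then 1 else 0) - (if len (E a) = 2 then 1 else 0)" using len(1)[OF a] by auto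
 qed
 also have "... = int (card ?Z) - int (card ?L)" using f by(simp add: sum_subtractf sum.If_cases Int_def)
 finally have s: "(SUM a:U. 1 - int (len (E a))) = int (card ?Z) - int (card ?L)" .
 obtain a where "a : U" using U(2) by blast
 hence "1 <= m" using xU[OF U(1)] by fastforce
 thus "int (card (fib U ` plus_of U E)) - int (card (circ U - fib U ` plus_of U E)) =
  (int m - 1) + (SUM a:U. 1 - int (len (E a)))" unfolding c1 c2 s by simp
qed

lemma gen_empty_Kd: "t <= m ==> gen {} (strands t) : Kd (height (vtx {})) (height (vtx {}))"
proof -
 assume t: "t <= m"
 have l: "labels {} = Nt ` {..m}" by(simp add: labels_def)
 note inj = inj_fib[OF empty_subsetI admissible_empty]
 have s: "strands t <= labels {}" by(auto simp: l strands_def)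
 have "labels {} - strands t = {Nt t}" using t by(auto simp: l strands_def)
 hence "circ {} - fib {} ` strands t = {fib {} (Nt t)}"
  unfolding circ_fib[OF empty_subsetI admissible_empty] inj_on_image_set_diff[OF inj Diff_subset s, symmetric] by simp
 moreover have "card (fib {} ` strands t) = m" using card_image[OF inj_on_subset[OF inj s]] t by(simp add: strands_def card_image inj_on_def)
 moreover have "fib {} ` strands t : plus_sets {}" unfolding plus_sets_empty using t by blast
 ultimately show ?thesis unfolding gen_def Kd_vtx by simp
qed

lemma tr_degrees:
 assumes "y : NWd m ls h q"
 shows "tr y : vec (Kd h q)"
proof -
 obtain us b where y: "y = (us, b)" by(cases y)
 have ok: "okw m ls (us, b)" and hq: "wh ls (us, b) = h" "wq ls (us, b) = q" using assms by(auto simp: y NWd_def NW_def)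
 show ?thesis
 proof(cases "cups us = {}")
  case True
  have "b : KB m" using okw_last[OF ok] .
  show ?thesis
  proof(cases b)
  case (Vertex s)
  hence s: "s <= m" using okw_last[OF ok] by simp
  have "h = height (vtx {})" "q = height (vtx {})" using hq wh_vtx[OF ok] True Vertex by simp_all
  thus ?thesis using True Vertex s gen_empty_Kd[of s] gen_empty_Kd[of "s - 1"] by(auto simp: y tr_def intro!: vec_add)
  qed(use True in "simp_all add: y tr_def")
 next
  case False
  show ?thesis
  proof(cases "mul b (the (us ! Min (cups us)))")
  case None
  thus ?thesis using False by(simp add: y tr_def)
  next
  case (Some c)
  note cp = follow_compat[OF ok Some False]
  note card = card_plus_of[OF cups_bound[OF ok] False cp]
  have "(SUM a:cups us. 1 - int (len (follow us c a))) = (SUM j:cups us. 1 - int (len (the (us ! j)))) - int (len b)"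
  using sum_len_follow[OF False Some] by(simp add: sum_subtractf)
  hence "word_gen us c : Kd h q" unfolding gen_def Kd_vtx using card hq wh_vtx[OF ok] by simp
  thus ?thesis using False Some by(simp add: y tr_def)
  qed
 qed
qed

subsection \<open>Every generator comes from a word\<close>

definition word_of :: "nat set => (nat => kb) => word" where
 "word_of U E = (map (%j. if j : U then Some (if j = Min U then Vertex (ix j) else E (prv U j)) else None) [0..<length w], E (Max U))"

definition paths_of :: "nat set => circle set => nat => kb" where
 "paths_of U P a = (if ix a ~= ix (nxt U a) then Step (ix a) (ix (nxt U a))
  else if fib U (Tr a) : P then Vertex (ix a) else Loop (ix a))"

definition none_words :: "nat => word fvec" where
 "none_words t = (SUM s<=t. elt (nones ls, Vertex s))"

definition lift_gen :: "skh_gen => word fvec" where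
 "lift_gen = (%(v, P). if support v = {} then none_words (THE t. t <= m & P = fib {} ` strands t)
  else elt (word_of (support v) (paths_of (support v) P)))"

lemma lift_gen_empty: "t <= m ==> lift_gen (gen {} (strands t)) = none_words t"
proof -
 assume t: "t <= m"
 have "(THE t'. t' <= m & fib {} ` strands t = fib {} ` strands t') = t" using t fib_empty_inj by(intro the_equality) auto
 thus ?thesis by(simp add: lift_gen_def gen_def support_vtx)
qed

lemma paths_of_plus:
 assumes U: "U <= {..<length w}" "U ~= {}" and E: "compat U E" and a: "a : U"
 shows "paths_of U (fib U ` plus_of U E) a = E a"
proof -
 note A = compat_admissible[OF E] and Q = compat_plus[OF E U(2)]
 have e: "E a : KB m" "src (E a) = ix a" "tgt (E a) = ix (nxt U a)" using E a by(auto simp: compat_def)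
 note k = KB_ends[OF e]
 show ?thesis
 proof(cases "ix a = ix (nxt U a)")
  case True
  hence "Tr a : labels U" using a U(2) by(simp add: labels_def)
  hence "fib U (Tr a) : fib U ` plus_of U E <-> Tr a : plus_of U E" using inj_fib[OF U(1) A] Q(2) by(auto dest: inj_onD)
  thus ?thesis using True a k(1) by(auto simp: paths_of_def)
 next
  case False
  thus ?thesis using k(2) by(simp add: paths_of_def)
 qed
qed

lemma lift_tr:
 assumes "y : Norm m ls"
 shows "lin lift_gen (tr y) = elt y" using assms
proof(cases rule: Norm_cases)
 case (1 us b)
 let ?U = "cups us" and ?E = "follow us b"
 note N = 1(2) 1(3)
 note U = norm_bound(1)[OF N] and cp = norm_compat[OF N]
 let ?P = "paths_of ?U (fib ?U ` plus_of ?U ?E)"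
 have pp: "?P a = ?E a" if "a : ?U" for a by(rule paths_of_plus[OF U 1(3) cp that])
 have M: "Max ?U : ?U" using 1(3) by simp
 have "~ (EX z:?U. Max ?U < z)" by(simp add: not_less)
 hence Eb: "?E (Max ?U) = b" by(simp add: follow_def)
 have "word_of ?U ?P = (us, b)"
 proof -
  have nth: "(if j : ?U then Some (if j = Min ?U then Vertex (ix j) else ?P (prv ?U j)) else None) = us ! j" if j: "j < length w" for j
  proof(cases "j : ?U")
  case True
  show ?thesis
  proof(cases "j = Min ?U")
  case j0: True
  thus ?thesis using norm_first(1)[OF N] True by simp
  next
  case False
  have "Min ?U < j" using Min_le[OF cups_finite True] False by simp
  hence pr: "prv ?U j : ?U" "prv ?U j < j" using prv_cases[OF cups_finite 1(3), of j] 1(3) Min_in[OF cups_finite 1(3)] by(metis leD)+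
  have "EX z:?U. prv ?U j < z" using pr True by blast
  hence "?E (prv ?U j) = the (us ! j)" using nxt_prv[OF cups_finite True] by(simp add: follow_def)
  thus ?thesis using True False pp[OF pr(1)] by(auto simp: cups_def)
  qed
  next
  case False
  thus ?thesis using j 1(5) by(simp add: cups_def)
  qed
  have "map (%j. if j : ?U then Some (if j = Min ?U then Vertex (ix j) else ?P (prv ?U j)) else None) [0..<length w] = us"
  proof(rule nth_equalityI)
  fix j assume "j < length (map (%j. if j : ?U then Some (if j = Min ?U then Vertex (ix j) else ?P (prv ?U j)) else None) [0..<length w])"
  hence j: "j < length w" by simp
  thus "map (%j. if j : ?U then Some (if j = Min ?U then Vertex (ix j) else ?P (prv ?U j)) else None) [0..<length w] ! j = us ! j"
  using nth[OF j] by(simp only: nth_map_upt diff_zero add_0)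
  qed(simp add: 1(5))
  moreover have "?P (Max ?U) = b" unfolding pp[OF M] by(rule Eb)
  ultimately show ?thesis unfolding word_of_def by(simp only:)
 qed
 thus ?thesis using 1(3) by(simp add: 1(1) norm_tr[OF N] lift_gen_def gen_def support_vtx[OF U])
next
 case (2 us s)
 have "tr y = (if s = 0 then 0 else elt (gen {} (strands (s - 1)))) + elt (gen {} (strands s))" using 2 by(simp add: tr_def)
 hence "lin lift_gen (tr y) = (if s = 0 then 0 else none_words (s - 1)) + none_words s"
  using 2(3) lift_gen_empty[of s] lift_gen_empty[of "s - 1"] by(simp add: lin_add)
 also have "... = elt y" using 2 by(cases s) (simp_all add: none_words_def)
 finally show ?thesis .
qed

lemma tr_inject:
 assumes "x : vec (Norm m ls)" "lin tr x = 0"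
 shows "x = 0"
proof -
 have "lin lift_gen (lin tr x) = x" using assms(1) by(induction rule: vec_induct) (simp_all add: lin_add lift_tr)
 thus ?thesis using assms(2) by simp
qed

lemma tr_none_words: "t <= m ==> lin tr (none_words t) = elt (gen {} (strands t))"
proof(induction t)
 case 0
 have "cups (nones ls) = {}" by(auto simp: cups_def)
 thus ?case by(simp add: none_words_def tr_def)
next
 case (Suc t)
 have "cups (nones ls) = {}" by(auto simp: cups_def)
 moreover have "none_words (Suc t) = none_words t + elt (nones ls, Vertex (Suc t))" by(simp add: none_words_def)
 ultimately show ?case using Suc by(simp add: lin_add tr_def)
qed

lemma word_of_tr:
 assumes U: "U <= {..<length w}" "U ~= {}" and E: "compat U E"
 shows "okw m ls (word_of U E)" "tr (word_of U E) = elt (gen U (plus_of U E))" (is ?g1)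
proof -
 note f = finU[OF U(1)]
 let ?b = "E (Max U)" and ?us = "fst (word_of U E)"
 have y: "word_of U E = (?us, ?b)" by(simp add: word_of_def)
 have l: "ls = w" using U by(auto simp: ls_def)
 have len: "length ?us = length w" by(simp add: word_of_def)
 have nth: "?us ! j = (if j : U then Some (if j = Min U then Vertex (ix j) else E (prv U j)) else None)" if "j < length w" for j
  using that by(simp add: word_of_def)
 have cu: "cups ?us = U" using U(1) nth by(auto simp: cups_def len split: if_splits)
 have Mi: "Min U : U" "Max U : U" using f U(2) by auto
 have e: "E a : KB m" "src (E a) = ix a" "tgt (E a) = ix (nxt U a)" if "a : U" for a using E that by(auto simp: compat_def)
 have fo: "follow ?us ?b a = E a" if a: "a : U" for a
 proof(cases "EX z:U. a < z")
  case True
  have z: "EX z:cups ?us. a < z" using True cu by simp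
  note nz = next_cup[OF z, unfolded cu]
  have "nxt U a ~= Min U" using nz(2) Min_le[OF f a] by auto
  thus ?thesis using True nth[of "nxt U a"] nz(1) U(1) prv_nxt[OF f a] by(auto simp: follow_def cu)
 next
  case False
  hence "a = Max U" using a f by(metis Max_ge Mi(2) le_less)
  thus ?thesis using False by(simp add: follow_def cu)
 qed
 have "okw m ls (?us, ?b)" unfolding okw_iff l
 proof(intro conjI allI impI)
  show "length ?us = length w" by(rule len)
  show "?b : KB m" using e Mi by blast
  fix j assume j: "j < length w" "?us ! j ~= None"
  hence jU: "j : U" using nth[OF j(1)] by(auto split: if_splits)
  show "snd (w ! j) ~= 0" using sign[OF j(1)] by auto
  have p: "prv U j : U" by(rule prv_in[OF f U(2)])
  show "the (?us ! j) : PL m (ix j)" using nth[OF j(1)] jU e[OF p] nxt_prv[OF f jU] x[OF j(1)] by(auto simp: PL_def)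
  show "srcw (drop (Suc j) ?us, ?b) = ix j" using srcw_follow[of j ?us ?b] j(1) len fo[OF jU] e[OF jU] by simp
 qed
 thus "okw m ls (word_of U E)" by(subst y)
 have "nxt U (Max U) = Min U" using Max_ge[OF f] by(simp add: nxt_def leD)
 moreover have "?us ! Min U = Some (Vertex (ix (Min U)))" using nth[of "Min U"] Mi U(1) by auto
 ultimately have "mul ?b (the (?us ! Min U)) = Some ?b" using e(3)[OF Mi(2)] by(simp add: mul_Vertex_right)
 moreover have "plus_of U (follow ?us ?b) = plus_of U E" using fo by(rule plus_of_cong)
 ultimately show ?g1 using U(2) by(subst y) (simp add: tr_def cu)
qed

lemma Kd_unique: "g : Kd h q ==> g : Kd h' q' ==> h' = h & q' = q" by(auto simp: Kd_def)

lemma tr_onto: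
 assumes g: "g : Kd h q"
 shows "EX x:vec (NWd m ls h q). lin tr x = elt g"
proof -
 have "g : gens" using g by(simp add: Kd_def)
 then obtain U P where UP: "g = (vtx U, P)" "U <= {..<length w}" "P : plus_sets U" by(rule gens_cases)
 show ?thesis
 proof(cases "U = {}")
  case True
  then obtain t where t: "t <= m" "g = gen {} (strands t)" using UP by(auto simp: plus_sets_empty gen_def)
  have hq: "h = height (vtx {})" "q = height (vtx {})" using Kd_unique[OF g, of "height (vtx {})" "height (vtx {})"] gen_empty_Kd[OF t(1)] t(2) by auto
  have c: "cups (nones ls) = {}" by(auto simp: cups_def)
  have "(nones ls, Vertex s) : NWd m ls h q" if "s <= t" for s
  proof -
  have ok: "okw m ls (nones ls, Vertex s)" using that t(1) by(simp add: okw_iff)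
  thus ?thesis using wh_vtx[OF ok] hq by(simp add: NWd_def NW_def c)
  qed
  hence "none_words t : vec (NWd m ls h q)" unfolding none_words_def by(intro vec_sum) simp
  thus ?thesis using tr_none_words[OF t(1)] t(2) by blast
 next
  case False
  have A: "admissible U" using plus_sets_inadmissible[OF UP(2)] UP(3) by blast
  then obtain Q where Q: "Nts <= Q" "Q <= labels U" "P = fib U ` Q" using UP(3) plus_sets_cup[OF UP(2) _ False] by blast
  let ?E = "%a. if ix a ~= ix (nxt U a) then Step (ix a) (ix (nxt U a)) else if Tr a : Q then Vertex (ix a) else Loop (ix a)"
  have "compat U ?E" unfolding compat_def
  proof
  fix a assume a: "a : U"
  have b: "1 <= ix a" "ix a <= m" "ix (nxt U a) <= m" "near (ix a) (ix (nxt U a))"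
  using xU[OF UP(2)] a nxt_in[OF finU[OF UP(2)] False] A by(auto simp: admissible_def)
  show "?E a : KB m & src (?E a) = ix a & tgt (?E a) = ix (nxt U a)"
  proof(cases "ix a = ix (nxt U a)")
  case True
  thus ?thesis using b(1,2) by simp
  next
  case False
  hence "ix (nxt U a) = Suc (ix a) | ix a = Suc (ix (nxt U a))" using b(4) False unfolding near_def by linarith
  thus ?thesis using False b(2,3) by simp
  qed
  qed
  note wt = word_of_tr[OF UP(2) False this]
  have "plus_of U ?E = Q"
  proof(rule label_set_eqI)
  show "Nt p : plus_of U ?E <-> Nt p : Q" for p using Q(1,2) False by(auto simp: labels_def)
  show "Tr a : plus_of U ?E <-> Tr a : Q" for a using Q(2) False by(auto simp: labels_def)
  qed
  hence tg: "tr (word_of U ?E) = elt g" using wt(2) Q(3) UP(1) by(simp add: gen_def)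
  let ?y = "word_of U ?E"
  have y: "?y : NWd m ls (wh ls ?y) (wq ls ?y)" using wt(1) by(simp add: NWd_def NW_def)
  (* The trace is homogeneous, so the word has the degrees of its image. *)
  have gk: "g : Kd (wh ls ?y) (wq ls ?y)" using tr_degrees[OF y] unfolding tg by simp
  have "wh ls ?y = h" "wq ls ?y = q" using Kd_unique[OF g gk] by blast+
  hence "?y : NWd m ls h q" using y by(simp only:)
  thus ?thesis using tg by(intro bexI[of _ "elt ?y"]) simp_all
 qed
qed

lemma ls_good: "ls ~= []" "ALL l:set ls. good m l" using w by(auto simp: ls_def split: if_splits)

sublocale trace_model m ls tr delta Kd by unfold_locales (use ls_good tr_degrees tr_onto tr_trace tr_inject tr_chain in auto)

lemma KS_bimodule_eq: "KS_bimodule m w = M m ls"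
proof -
 have "letter m l = KS_letter m l" if "l : set w" for l using that w by(auto simp: letter_def)
 hence "letters m w = map (KS_letter m) w" by(auto simp: letters_def)
 moreover have "letters m [(0, 0)] = [KS_unit m]" by(simp add: letters_def letter_def)
 ultimately show ?thesis by(simp add: KS_bimodule_def ls_def)
qed

end

theorem theorem5p1:
  fixes m :: nat and \<sigma> :: "braid_word set" and w :: braid_word
  assumes "\<sigma> \<in> carrier (braid_group (m + 1))"
    and "w \<in> \<sigma>"
  shows "bigraded_iso
    (SKh m (mirror w) (int m - 1))
    (gshift (n_minus (mirror w))
       ((int m - 1) + n_plus (mirror w) - 2 * n_minus (mirror w))
       (HH (KS_algebra m) (KS_grading m) (KS_bimodule m w)))"
proof -
  obtain x where "\<sigma> = braid_rel (m + 1) `` {x}" using assms(1) by (auto simp: braid_group_def quotient_def)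
  then have "w \<in> braid_words (m + 1)" using assms(2) by (auto simp: braid_rel_def Let_def)
  then interpret braid_closure m w by unfold_locales (simp add: braid_words_def)
  let ?D = "skh_complex m (mirror w) (int m - 1)"
  let ?a = "- n_minus (mirror w)" and ?b = "(int m - 1) + n_plus (mirror w) - 2 * n_minus (mirror w)"
  have piece: "piece ?D (i + ?a) (j + ?b) = vec (Kd i j)" for i j
    by (simp add: skh_complex_def vec_def Kd_def)
  have iso: "f2_iso (homology ?D (i + ?a) (j + ?b)) (HH (KS_algebra m) (KS_grading m) (M m ls) i j)" for i j
    by (rule Hochschild_homology_iso[OF _ _ _ piece])
      (simp_all add: skh_complex_def free_space_simps lin_def delta_def)
  show ?thesis
    unfolding bigraded_iso_def gshift_def SKh_def KS_bimodule_eq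
  proof (intro allI)
    fix i j
    show "f2_iso (homology ?D i j)
        (HH (KS_algebra m) (KS_grading m) (M m ls) (i + n_minus (mirror w)) (j - ?b))"
      using iso[of "i + n_minus (mirror w)" "j - ?b"] by (simp add: algebra_simps)
  qed
qed

end
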